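(* Given a sample $\{(Y_i,\mathbf Z_i)\}_{i=1}^n\subset\mathbb R\times\mathbb R^q$ with $q\ge1$, the estimator $$\hat\sigma^2_{\xi(Y,\mathbf Z)}=36\big\{(1+\mathfrak q_q)\hat T_1+(2-2\mathfrak q_q+\mathfrak o_q)\hat T_2-(2-\mathfrak q_q+\mathfrak o_q)\hat T_3+4\hat T_4-2\hat T_5+\hat T_6-4\hat T_7\big\}$$ can be computed in $O(n\log n)$ time. In particular, the terms $\hat T_4$, $\hat T_5$ and $\hat T_6$ admit $O(n\log n)$ implementations via Algorithm 1, which is given in the context.
   Context: The dimension $q$ does not depend on $n$, and $\mathfrak q_q,\mathfrak o_q$ are regarded as given numerical constants. $a\wedge b=\min\{a,b\}$; $R_i$ is the rank of $Y_i$ among $Y_1,\dots,Y_n$; $N(i),N_2(i),N_3(i)$ are the indices of the first, second and third Euclidean nearest neighbors of $\mathbf Z_i$ among $\{\mathbf Z_j\}_{j\ne i}$. The terms are $\hat T_1=\frac1{n^3}\sum_{i=1}^n(R_i\wedge R_{N(i)})^2$, $\hat T_2=\frac1{n^3}\sum_{i=1}^n(R_i\wedge R_{N(i)})(R_i\wedge R_{N_2(i)})$, $\hat T_3=\frac1{n^3}\sum_{i=1}^n(R_i\wedge R_{N(i)})(R_{N_2(i)}\wedge R_{N_3(i)})$, $\hat T_4=\frac1{n^3}\sum_{1\le i\ne j\le n}\mathbf 1(R_i\le R_j\wedge R_{N(j)})(R_i\wedge R_{N(i)})$, $\hat T_5=\frac1{n^3}\sum_{1\le i\ne j\le n}\mathbf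 1(R_i\le R_j\wedge R_{N(j)})(R_{N(i)}\wedge R_{N_2(i)})$, $\hat T_6=\frac1{n^3}\sum_{1\le i\ne j\le n}R_i\wedge R_{N(i)}\wedge R_j\wedge R_{N(j)}$, $\hat T_7=\big(\frac1{n^2}\sum_{i=1}^nR_i\wedge R_{N(i)}\big)^2$. The constants are $\mathfrak q_d=\{2-I_{3/4}(\frac{d+1}2,\frac12)\}^{-1}$ with $I_x(a,b)$ the regularized incomplete beta function, and $\mathfrak o_d=\int_{\Gamma_{d;2}}\exp[-\lambda\{\mathcal B(\mathbf w_1,\|\mathbf w_1\|)\cup\mathcal B(\mathbf w_2,\|\mathbf w_2\|)\}]d(\mathbf w_1,\mathbf w_2)$, $\Gamma_{d;2}=\{(\mathbf w_1,\mathbf w_2)\in(\mathbb R^d)^2:\max(\|\mathbf w_1\|,\|\mathbf w_2\|)<\|\mathbf w_1-\mathbf w_2\|\}$, $\mathcal B(\mathbf w,r)$ the ball with center $\mathbf w$, radius $r$, $\lambda$ Lebesgue measure. Algorithm 1 (input: sample $\{(\mathbf Z_i,Y_i)\}_{i=1}^n$; output: $\hat T_4,\hat T_5,\hat T_6$). Step 1: perform a $k$-nearest-neighbor search on $\{\mathbf Z_i\}_{i=1}^n$ for $k=1$ and $2$, obtaining $N(i),N_2(i)$ for $i=1,\dots,n$. Step 2: sort $\{Y_i\}_{i=1}^n$, compute the ranks, and obtain $R_i,R_{N(i)},R_{N_2(i)}$ for all $i$. Step 3: for all $i$ compute $U_i=R_i\wedge R_{N(i)}$ and $V_i=R_{N(i)}\wedge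 R_{N_2(i)}$. The remaining objective is to compute $\hat T_4=n^{-3}\sum_iU_i\sum_{j\ne i}\mathbf 1(R_i\le U_j)$, $\hat T_5=n^{-3}\sum_iV_i\sum_{j\ne i}\mathbf 1(R_i\le U_j)$ and $\hat T_6=n^{-3}\sum_{i\ne j}U_i\wedge U_j=2n^{-3}\sum_iU_i\{\sum_{j=1}^n\mathbf 1(U_i\le U_j)-1\}$. Step 4: for each $i$ use binary search to find $R_i^*=\#\{j:R_i>U_j\}$ and $R_i^\#=\#\{j:U_i>U_j\}$. Step 5: compute $\hat T_4=n^{-3}\sum_iU_i\{n-R_i^*-\mathbf 1(R_i\le U_i)\}$, $\hat T_5=n^{-3}\sum_iV_i\{n-R_i^*-\mathbf 1(R_i\le U_i)\}$, $\hat T_6=2n^{-3}\sum_iU_i(n-R_i^\#-1)$.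
   Formalization: The printed formula for T̂_6 in Algorithm 1 counts pairs with U_i=U_j twice (mutual nearest neighbors always give such ties); Step 4 also finds #{j: U_i≥U_j}, and Step 5 uses T̂_6=n^{-3}Σ U_i{(n−R_i^#−1)+(n−#{j: U_i≥U_j})}. *)

theory Defs
  imports "HOL-Analysis.Analysis" "HOL-Library.Landau_Symbols"
begin

section \<open>The estimator\<close>

text \<open>A sample of size \<open>n\<close> is given by \<open>Y :: nat \<Rightarrow> real\<close> and \<open>Z :: nat \<Rightarrow> real ^ 'q\<close>, of which
  only the values at the indices \<open>0, \<dots>, n - 1\<close> matter.  The dimension \<open>q\<close> is \<open>CARD('q)\<close>.\<close>

text \<open>With ties among the \<open>Y i\<close> this is the maximal rank; without ties it is the usual one.
  Ranks start at 1.\<close>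

definition sample_rank :: "nat \<Rightarrow> (nat \<Rightarrow> real) \<Rightarrow> nat \<Rightarrow> nat" where
  "sample_rank n Y i = card {j. j < n \<and> Y j \<le> Y i}"

text \<open>Equal distances are resolved in favour of the smaller index, so that the neighbours are
  well defined for every sample; without ties this clause is void.\<close>

definition closer :: "(nat \<Rightarrow> 'a::metric_space) \<Rightarrow> nat \<Rightarrow> nat \<Rightarrow> nat \<Rightarrow> bool" where
  "closer Z i l j \<longleftrightarrow> dist (Z i) (Z l) < dist (Z i) (Z j) \<or>
     dist (Z i) (Z l) = dist (Z i) (Z j) \<and> l < j"

text \<open>The \<open>k\<close>-th nearest neighbour of \<open>Z i\<close> among the other sample points, for
  \<open>1 \<le> k\<close> and \<open>k < n\<close>.\<close>

definition nbr :: "nat \<Rightarrow> (nat \<Rightarrow> 'a::metric_space) \<Rightarrow> nat \<Rightarrow> nat \<Rightarrow> nat" where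
  "nbr n Z k i = (THE j. j < n \<and> j \<noteq> i \<and>
     Suc (card {l. l < n \<and> l \<noteq> i \<and> closer Z i l j}) = k)"

definition T1_hat :: "nat \<Rightarrow> (nat \<Rightarrow> real) \<Rightarrow> (nat \<Rightarrow> 'a::metric_space) \<Rightarrow> real" where
  "T1_hat n Y Z = (let R = (\<lambda>i. real (sample_rank n Y i)); N = nbr n Z 1 in
     1 / real n ^ 3 * (\<Sum>i<n. (min (R i) (R (N i)))\<^sup>2))"

definition T2_hat :: "nat \<Rightarrow> (nat \<Rightarrow> real) \<Rightarrow> (nat \<Rightarrow> 'a::metric_space) \<Rightarrow> real" where
  "T2_hat n Y Z = (let R = (\<lambda>i. real (sample_rank n Y i)); N = nbr n Z 1; N2 = nbr n Z 2 in
     1 / real n ^ 3 * (\<Sum>i<n. min (R i) (R (N i)) * min (R i) (R (N2 i))))"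

definition T3_hat :: "nat \<Rightarrow> (nat \<Rightarrow> real) \<Rightarrow> (nat \<Rightarrow> 'a::metric_space) \<Rightarrow> real" where
  "T3_hat n Y Z = (let R = (\<lambda>i. real (sample_rank n Y i)); N = nbr n Z 1; N2 = nbr n Z 2;
       N3 = nbr n Z 3 in
     1 / real n ^ 3 * (\<Sum>i<n. min (R i) (R (N i)) * min (R (N2 i)) (R (N3 i))))"

definition T4_hat :: "nat \<Rightarrow> (nat \<Rightarrow> real) \<Rightarrow> (nat \<Rightarrow> 'a::metric_space) \<Rightarrow> real" where
  "T4_hat n Y Z = (let R = (\<lambda>i. real (sample_rank n Y i)); N = nbr n Z 1 in
     1 / real n ^ 3 * (\<Sum>i<n. \<Sum>j\<in>{..<n} - {i}.
       of_bool (R i \<le> min (R j) (R (N j))) * min (R i) (R (N i))))"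

definition T5_hat :: "nat \<Rightarrow> (nat \<Rightarrow> real) \<Rightarrow> (nat \<Rightarrow> 'a::metric_space) \<Rightarrow> real" where
  "T5_hat n Y Z = (let R = (\<lambda>i. real (sample_rank n Y i)); N = nbr n Z 1; N2 = nbr n Z 2 in
     1 / real n ^ 3 * (\<Sum>i<n. \<Sum>j\<in>{..<n} - {i}.
       of_bool (R i \<le> min (R j) (R (N j))) * min (R (N i)) (R (N2 i))))"

definition T6_hat :: "nat \<Rightarrow> (nat \<Rightarrow> real) \<Rightarrow> (nat \<Rightarrow> 'a::metric_space) \<Rightarrow> real" where
  "T6_hat n Y Z = (let R = (\<lambda>i. real (sample_rank n Y i)); N = nbr n Z 1 in
     1 / real n ^ 3 * (\<Sum>i<n. \<Sum>j\<in>{..<n} - {i}.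
       min (min (R i) (R (N i))) (min (R j) (R (N j)))))"

definition T7_hat :: "nat \<Rightarrow> (nat \<Rightarrow> real) \<Rightarrow> (nat \<Rightarrow> 'a::metric_space) \<Rightarrow> real" where
  "T7_hat n Y Z = (let R = (\<lambda>i. real (sample_rank n Y i)); N = nbr n Z 1 in
     (1 / real n ^ 2 * (\<Sum>i<n. min (R i) (R (N i))))\<^sup>2)"

definition reg_inc_beta :: "real \<Rightarrow> real \<Rightarrow> real \<Rightarrow> real" where
  "reg_inc_beta x a b =
     integral {0..x} (\<lambda>t. t powr (a - 1) * (1 - t) powr (b - 1)) / Beta a b"

definition q_const :: "nat \<Rightarrow> real" where
  "q_const d = inverse (2 - reg_inc_beta (3/4) ((real d + 1) / 2) (1/2))"

definition Gamma2 :: "((real ^ 'd::finite) \<times> (real ^ 'd)) set" where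
  "Gamma2 = {(w1, w2). max (norm w1) (norm w2) < norm (w1 - w2)}"

definition o_const :: "'d::finite itself \<Rightarrow> real" where
  "o_const d = (LINT w : (Gamma2 :: ((real ^ 'd) \<times> (real ^ 'd)) set) | lborel.
     exp (- measure lborel (cball (fst w) (norm (fst w)) \<union> cball (snd w) (norm (snd w)))))"

definition sigma2_hat :: "nat \<Rightarrow> (nat \<Rightarrow> real) \<Rightarrow> (nat \<Rightarrow> real ^ 'q::finite) \<Rightarrow> real" where
  "sigma2_hat n Y Z = (let q = q_const CARD('q); \<oo> = o_const TYPE('q) in
     36 * ((1 + q) * T1_hat n Y Z + (2 - 2 * q + \<oo>) * T2_hat n Y Z
       - (2 - q + \<oo>) * T3_hat n Y Z + 4 * T4_hat n Y Z - 2 * T5_hat n Y Z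
       + T6_hat n Y Z - 4 * T7_hat n Y Z))"

section \<open>The model of computation\<close>

text \<open>A real random access machine, programmed in a structured language.  It has variables and
  unbounded arrays (random access memory) holding natural numbers and exact reals; real cells
  support the field operations and comparison, and natural number cells support addition,
  truncated subtraction, halving and comparison.  There is no rounding of reals to integers and no
  multiplication of natural numbers, so the usual ways of packing large computations into few
  operations on a unit-cost machine are absent.  The only numerical literals of a program are
  natural numbers, so a program cannot carry real constants encoding advice.\<close>

type_synonym name = string

datatype nexp =
    NLit nat
  | NVar name
  | NGet name nexp
  | NAdd nexp nexp
  | NSub nexp nexp
  | NHalf nexp

datatype rexp =
    OfNat nexp
  | RVar name
  | RGet name nexp
  | RAdd rexp rexp
  | RSub rexp rexp
  | RMul rexp rexp
  | RDiv rexp rexp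

datatype bexp =
    NLess nexp nexp
  | RLess rexp rexp
  | Neg bexp
  | Conj bexp bexp

datatype com =
    Skip
  | NSet name nexp          (\<open>(_ ::=\<^sub>n _)\<close> [1000, 61] 61)
  | RSet name rexp          (\<open>(_ ::=\<^sub>r _)\<close> [1000, 61] 61)
  | NPut name nexp nexp
  | RPut name nexp rexp
  | Seq com com             (infixr \<open>;;\<close> 60)
  | Cond bexp com com
  | While bexp com

record state =
  nvar :: "name \<Rightarrow> nat"
  narr :: "name \<Rightarrow> nat \<Rightarrow> nat"
  rvar :: "name \<Rightarrow> real"
  rarr :: "name \<Rightarrow> nat \<Rightarrow> real"

primrec nval :: "nexp \<Rightarrow> state \<Rightarrow> nat" where
  "nval (NLit k) s = k"
| "nval (NVar x) s = nvar s x"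
| "nval (NGet a e) s = narr s a (nval e s)"
| "nval (NAdd e f) s = nval e s + nval f s"
| "nval (NSub e f) s = nval e s - nval f s"
| "nval (NHalf e) s = nval e s div 2"

primrec rval :: "rexp \<Rightarrow> state \<Rightarrow> real" where
  "rval (OfNat e) s = real (nval e s)"
| "rval (RVar x) s = rvar s x"
| "rval (RGet a e) s = rarr s a (nval e s)"
| "rval (RAdd e f) s = rval e s + rval f s"
| "rval (RSub e f) s = rval e s - rval f s"
| "rval (RMul e f) s = rval e s * rval f s"
| "rval (RDiv e f) s = rval e s / rval f s"

primrec bval :: "bexp \<Rightarrow> state \<Rightarrow> bool" where
  "bval (NLess e f) s \<longleftrightarrow> nval e s < nval f s"
| "bval (RLess e f) s \<longleftrightarrow> rval e s < rval f s"
| "bval (Neg b) s \<longleftrightarrow> \<not> bval b s"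
| "bval (Conj b c) s \<longleftrightarrow> bval b s \<and> bval c s"

text \<open>Every literal, memory access and operation costs one unit of time.\<close>

primrec ncost :: "nexp \<Rightarrow> nat" where
  "ncost (NLit k) = 1"
| "ncost (NVar x) = 1"
| "ncost (NGet a e) = 1 + ncost e"
| "ncost (NAdd e f) = 1 + ncost e + ncost f"
| "ncost (NSub e f) = 1 + ncost e + ncost f"
| "ncost (NHalf e) = 1 + ncost e"

primrec rcost :: "rexp \<Rightarrow> nat" where
  "rcost (OfNat e) = 1 + ncost e"
| "rcost (RVar x) = 1"
| "rcost (RGet a e) = 1 + ncost e"
| "rcost (RAdd e f) = 1 + rcost e + rcost f"
| "rcost (RSub e f) = 1 + rcost e + rcost f"
| "rcost (RMul e f) = 1 + rcost e + rcost f"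
| "rcost (RDiv e f) = 1 + rcost e + rcost f"

primrec bcost :: "bexp \<Rightarrow> nat" where
  "bcost (NLess e f) = 1 + ncost e + ncost f"
| "bcost (RLess e f) = 1 + rcost e + rcost f"
| "bcost (Neg b) = 1 + bcost b"
| "bcost (Conj b c) = 1 + bcost b + bcost c"

text \<open>\<open>exec c s t s'\<close>: started in \<open>s\<close>, the program \<open>c\<close> terminates in \<open>s'\<close> after time exactly \<open>t\<close>.\<close>

inductive exec :: "com \<Rightarrow> state \<Rightarrow> nat \<Rightarrow> state \<Rightarrow> bool" where
  Skip: "exec Skip s 1 s"
| NSet: "exec (x ::=\<^sub>n e) s (1 + ncost e) (s\<lparr>nvar := (nvar s)(x := nval e s)\<rparr>)"
| RSet: "exec (x ::=\<^sub>r e) s (1 + rcost e) (s\<lparr>rvar := (rvar s)(x := rval e s)\<rparr>)"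
| NPut: "exec (NPut a e f) s (1 + ncost e + ncost f)
    (s\<lparr>narr := (narr s)(a := (narr s a)(nval e s := nval f s))\<rparr>)"
| RPut: "exec (RPut a e f) s (1 + ncost e + rcost f)
    (s\<lparr>rarr := (rarr s)(a := (rarr s a)(nval e s := rval f s))\<rparr>)"
| Seq: "\<lbrakk>exec c s t s'; exec d s' u s''\<rbrakk> \<Longrightarrow> exec (c ;; d) s (t + u) s''"
| IfTrue: "\<lbrakk>bval b s; exec c s t s'\<rbrakk> \<Longrightarrow> exec (Cond b c d) s (1 + bcost b + t) s'"
| IfFalse: "\<lbrakk>\<not> bval b s; exec d s t s'\<rbrakk> \<Longrightarrow> exec (Cond b c d) s (1 + bcost b + t) s'"
| WhileFalse: "\<not> bval b s \<Longrightarrow> exec (While b c) s (1 + bcost b) s"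
| WhileTrue: "\<lbrakk>bval b s; exec c s t s'; exec (While b c) s' u s''\<rbrakk>
    \<Longrightarrow> exec (While b c) s (1 + bcost b + t + u) s''"

text \<open>Input convention: the variable \<open>n\<close> holds the sample size, the array \<open>Y\<close> the first
  components, and the array \<open>Z\<close> the coordinates of the vectors \<open>Z i\<close>, stored row by row, where
  \<open>crd\<close> numbers the coordinates by \<open>0, \<dots>, q - 1\<close>.  The two numerical constants are supplied
  in the variables \<open>q\<close> and \<open>o\<close>.  All other cells are 0.\<close>

definition input :: "(nat \<Rightarrow> 'q::finite) \<Rightarrow> nat \<Rightarrow> (nat \<Rightarrow> real) \<Rightarrow> (nat \<Rightarrow> real ^ 'q) \<Rightarrow> state" where
  "input crd n Y Z =
     \<lparr>nvar = (\<lambda>_. 0)(''n'' := n),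
      narr = (\<lambda>_ _. 0),
      rvar = (\<lambda>_. 0)(''q'' := q_const CARD('q), ''o'' := o_const TYPE('q)),
      rarr = (\<lambda>_ _. 0)
        (''Y'' := (\<lambda>i. if i < n then Y i else 0),
         ''Z'' := (\<lambda>m. if m < n * CARD('q) then Z (m div CARD('q)) $ crd (m mod CARD('q)) else 0))\<rparr>"

section \<open>The algorithm for the fourth, fifth and sixth term\<close>

text \<open>The nearest neighbour search and the sorting routines are parameters of the algorithm;
  the remaining steps are the following programs.  Arrays: \<open>R\<close>, \<open>RN\<close>, \<open>RN2\<close> hold the ranks of
  \<open>i\<close> and of its first and second neighbour, \<open>S\<close> is a sorted copy of \<open>U\<close>.\<close>

definition for_each :: "com \<Rightarrow> com" where
  "for_each c =
     ''i'' ::=\<^sub>n NLit 0 ;;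
     While (NLess (NVar ''i'') (NVar ''n''))
       (c ;; ''i'' ::=\<^sub>n NAdd (NVar ''i'') (NLit 1))"

abbreviation at_i :: "name \<Rightarrow> nexp" where
  "at_i a \<equiv> NGet a (NVar ''i'')"

definition put_min :: "name \<Rightarrow> nexp \<Rightarrow> nexp \<Rightarrow> com" where
  "put_min a e f = Cond (NLess e f) (NPut a (NVar ''i'') e) (NPut a (NVar ''i'') f)"

definition compute_UV :: com where
  "compute_UV = for_each
     (put_min ''U'' (at_i ''R'') (at_i ''RN'') ;;
      put_min ''V'' (at_i ''RN'') (at_i ''RN2''))"

text \<open>Stores at position \<open>i\<close> of \<open>a\<close> the number of entries of the sorted array \<open>S\<close> that are
  less than \<open>key\<close>.\<close>

definition binary_search :: "name \<Rightarrow> nexp \<Rightarrow> com" where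
  "binary_search a key =
     ''lo'' ::=\<^sub>n NLit 0 ;;
     ''hi'' ::=\<^sub>n NVar ''n'' ;;
     While (NLess (NVar ''lo'') (NVar ''hi''))
       (''mid'' ::=\<^sub>n NHalf (NAdd (NVar ''lo'') (NVar ''hi'')) ;;
        Cond (NLess (NGet ''S'' (NVar ''mid'')) key)
          (''lo'' ::=\<^sub>n NAdd (NVar ''mid'') (NLit 1))
          (''hi'' ::=\<^sub>n NVar ''mid'')) ;;
     NPut a (NVar ''i'') (NVar ''lo'')"

text \<open>Besides the numbers of \<open>j\<close> with \<open>R i > U j\<close> (array \<open>Rstar\<close>) and with \<open>U i > U j\<close>
  (array \<open>Rsharp\<close>), the number of \<open>j\<close> with \<open>U i \<ge> U j\<close> is computed (array \<open>Rflat\<close>).  It is needed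
  because the \<open>U i\<close> are in general not distinct: \<open>U i = U j\<close> whenever \<open>i\<close> and \<open>j\<close> are nearest
  neighbours of each other.\<close>

definition count_ranks :: com where
  "count_ranks = for_each
     (binary_search ''Rstar'' (at_i ''R'') ;;
      binary_search ''Rsharp'' (at_i ''U'') ;;
      binary_search ''Rflat'' (NAdd (at_i ''U'') (NLit 1)))"

text \<open>For pairwise distinct \<open>U i\<close> the sum over \<open>i \<noteq> j\<close> of \<open>min (U i) (U j)\<close> is twice the sum over
  \<open>i\<close> of \<open>U i * (n - Rsharp i - 1)\<close>.  This counts a pair with \<open>U i = U j\<close> twice.  The factor
  \<open>2 * (n - Rsharp i - 1)\<close> is therefore replaced by \<open>(n - Rsharp i - 1) + (n - Rflat i)\<close>, which
  is the same when there are no ties and gives the correct sum always.\<close>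

definition compute_T456 :: com where
  "compute_T456 =
     ''T4'' ::=\<^sub>r OfNat (NLit 0) ;;
     ''T5'' ::=\<^sub>r OfNat (NLit 0) ;;
     ''T6'' ::=\<^sub>r OfNat (NLit 0) ;;
     for_each
       (''c'' ::=\<^sub>r RSub (OfNat (NVar ''n'')) (OfNat (at_i ''Rstar'')) ;;
        Cond (NLess (at_i ''U'') (at_i ''R''))
          Skip
          (''c'' ::=\<^sub>r RSub (RVar ''c'') (OfNat (NLit 1))) ;;
        ''T4'' ::=\<^sub>r RAdd (RVar ''T4'') (RMul (OfNat (at_i ''U'')) (RVar ''c'')) ;;
        ''T5'' ::=\<^sub>r RAdd (RVar ''T5'') (RMul (OfNat (at_i ''V'')) (RVar ''c'')) ;;
        ''T6'' ::=\<^sub>r RAdd (RVar ''T6'')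
          (RMul (OfNat (at_i ''U''))
            (RAdd
              (RSub (RSub (OfNat (NVar ''n'')) (OfNat (at_i ''Rsharp''))) (OfNat (NLit 1)))
              (RSub (OfNat (NVar ''n'')) (OfNat (at_i ''Rflat'')))))) ;;
     ''c'' ::=\<^sub>r RMul (OfNat (NVar ''n''))
       (RMul (OfNat (NVar ''n'')) (OfNat (NVar ''n''))) ;;
     ''T4'' ::=\<^sub>r RDiv (RVar ''T4'') (RVar ''c'') ;;
     ''T5'' ::=\<^sub>r RDiv (RVar ''T5'') (RVar ''c'') ;;
     ''T6'' ::=\<^sub>r RDiv (RVar ''T6'') (RVar ''c'')"

definition holds_array :: "state \<Rightarrow> nat \<Rightarrow> name \<Rightarrow> (nat \<Rightarrow> nat) \<Rightarrow> bool" where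
  "holds_array s n a f \<longleftrightarrow> (\<forall>i<n. narr s a i = f i)"

definition entries :: "state \<Rightarrow> nat \<Rightarrow> name \<Rightarrow> nat list" where
  "entries s n a = map (narr s a) [0..<n]"

text \<open>On the given sample, the algorithm with the given search and sorting routines runs through
  all its steps with the specified intermediate results and outputs \<open>T4_hat\<close>, \<open>T5_hat\<close>, \<open>T6_hat\<close>,
  in total time \<open>t\<close>.\<close>

definition algorithm1_runs ::
  "com \<Rightarrow> com \<Rightarrow> com \<Rightarrow> (nat \<Rightarrow> 'q::finite) \<Rightarrow> nat \<Rightarrow> (nat \<Rightarrow> real) \<Rightarrow> (nat \<Rightarrow> real ^ 'q) \<Rightarrow> nat \<Rightarrow> bool"
where
  "algorithm1_runs search ranking sorting crd n Y Z t \<longleftrightarrow>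
     (let R = sample_rank n Y; N = nbr n Z 1; N2 = nbr n Z 2;
          U = (\<lambda>i. min (R i) (R (N i))); V = (\<lambda>i. min (R (N i)) (R (N2 i))) in
      \<exists>t1 s1 t2 s2 t3 s3 t4 s4 t5 s5 t6 s6.
        exec search (input crd n Y Z) t1 s1 \<and>
        holds_array s1 n ''N'' N \<and> holds_array s1 n ''N2'' N2 \<and>
        exec ranking s1 t2 s2 \<and>
        holds_array s2 n ''R'' R \<and> holds_array s2 n ''RN'' (R \<circ> N) \<and>
        holds_array s2 n ''RN2'' (R \<circ> N2) \<and>
        exec compute_UV s2 t3 s3 \<and>
        holds_array s3 n ''U'' U \<and> holds_array s3 n ''V'' V \<and>
        exec sorting s3 t4 s4 \<and>
        sorted (entries s4 n ''S'') \<and> mset (entries s4 n ''S'') = mset (map U [0..<n]) \<and>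
        exec count_ranks s4 t5 s5 \<and>
        holds_array s5 n ''Rstar'' (\<lambda>i. card {j. j < n \<and> R i > U j}) \<and>
        holds_array s5 n ''Rsharp'' (\<lambda>i. card {j. j < n \<and> U i > U j}) \<and>
        holds_array s5 n ''Rflat'' (\<lambda>i. card {j. j < n \<and> U i \<ge> U j}) \<and>
        exec compute_T456 s5 t6 s6 \<and>
        rvar s6 ''T4'' = T4_hat n Y Z \<and>
        rvar s6 ''T5'' = T5_hat n Y Z \<and>
        rvar s6 ''T6'' = T6_hat n Y Z \<and>
        t = t1 + t2 + t3 + t4 + t5 + t6)"

end

theory Submission
  imports Defs
begin

text \<open>The only step that is not sorting, binary search or a summation is the search for three nearest
  neighbours.  It follows Callahan and Kosaraju.  A fair split tree (bounding boxes are halved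
  orthogonally to a longest side) is built in time \<open>O(n log n)\<close> by walking from both ends of
  presorted coordinate lists, so that a split costs as much as its smaller part.  Then the
  tree is traversed from the root, and each node \<open>y\<close> passes two lists to its children: the nodes not
  yet well separated from \<open>y\<close>, and the points \<open>a\<close>, remote from \<open>y\<close>, that may still have one of
  their three nearest neighbours in \<open>y\<close>.  The former list is bounded by a packing argument.  The
  latter is bounded because among many remote points some four lie in a narrow cone with apex in
  \<open>y\<close>, and then the farthest of them has three points closer than all of \<open>y\<close> and can be discarded.
  At a leaf the remaining pairs are tried out.\<close>

section \<open>Reasoning about programs\<close>

text \<open>Flat boxes are the obstacle to packing: disjoint nodes cannot be counted by volume. Each
  node is instead given a point of a grid, of mesh half a side length, on the node's own side of
  every cut above it; nodes of which neither lies below the other are separated by a cut and get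
  different grid points. The order \<open>prec\<close> always refines the larger of two nodes, so
  that the parent of each (unless it is the root) is at least as large as the partner, as the
  packing bound requires.

  Time is amortised. Skipping and relabelling shrink windows of total width \<open>CARD('q)\<close>
  per point, and the redistribution of rows is paid by the binary length of the size of each point's
  leaf, which drops with every expansion.

  Sample points may coincide, so a leaf is a node of width zero with any number of points. Squares
  replace distances because the machine has no roots.\<close>

primrec kc :: "com \<Rightarrow> nat" where
  "kc Skip = 1"
| "kc (x ::=\<^sub>n e) = 1 + ncost e"
| "kc (x ::=\<^sub>r e) = 1 + rcost e"
| "kc (NPut a e f) = 1 + ncost e + ncost f"
| "kc (RPut a e f) = 1 + ncost e + rcost f"
| "kc (c ;; d) = kc c + kc d"
| "kc (Cond b c d) = 1 + bcost b + kc c + kc d"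
| "kc (While b c) = 1 + bcost b + kc c"

text \<open>Time is measured in multiples of \<open>kc c\<close>, which depends on the program only.  The bound
  \<open>f\<close> can then be read as a number of iterations and composes without constants.\<close>

definition runs :: "com \<Rightarrow> state \<Rightarrow> nat \<Rightarrow> (state \<Rightarrow> bool) \<Rightarrow> bool" where
  "runs c s f Q \<longleftrightarrow> (\<exists>t s'. exec c s t s' \<and> t \<le> kc c * f \<and> Q s')"

text \<open>Four separate sets of written names, because the four kinds of cells have separate name
  spaces: for instance \<open>lo\<close> is a variable in a binary search and an array of the
  tree.\<close>

primrec wn :: "com \<Rightarrow> name set" where
  "wn Skip = {}"
| "wn (x ::=\<^sub>n e) = {x}"
| "wn (x ::=\<^sub>r e) = {}"
| "wn (NPut a e f) = {}"
| "wn (RPut a e f) = {}"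
| "wn (c ;; d) = wn c \<union> wn d"
| "wn (Cond b c d) = wn c \<union> wn d"
| "wn (While b c) = wn c"

primrec wr :: "com \<Rightarrow> name set" where
  "wr Skip = {}"
| "wr (x ::=\<^sub>n e) = {}"
| "wr (x ::=\<^sub>r e) = {x}"
| "wr (NPut a e f) = {}"
| "wr (RPut a e f) = {}"
| "wr (c ;; d) = wr c \<union> wr d"
| "wr (Cond b c d) = wr c \<union> wr d"
| "wr (While b c) = wr c"

primrec wna :: "com \<Rightarrow> name set" where
  "wna Skip = {}"
| "wna (x ::=\<^sub>n e) = {}"
| "wna (x ::=\<^sub>r e) = {}"
| "wna (NPut a e f) = {a}"
| "wna (RPut a e f) = {}"
| "wna (c ;; d) = wna c \<union> wna d"
| "wna (Cond b c d) = wna c \<union> wna d"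
| "wna (While b c) = wna c"

primrec wra :: "com \<Rightarrow> name set" where
  "wra Skip = {}"
| "wra (x ::=\<^sub>n e) = {}"
| "wra (x ::=\<^sub>r e) = {}"
| "wra (NPut a e f) = {}"
| "wra (RPut a e f) = {a}"
| "wra (c ;; d) = wra c \<union> wra d"
| "wra (Cond b c d) = wra c \<union> wra d"
| "wra (While b c) = wra c"

text \<open>The frame condition. It is purely syntactic, so specifications only have to mention what
  a program changes, and everything else is recovered by simplification.\<close>

definition same :: "com \<Rightarrow> state \<Rightarrow> state \<Rightarrow> bool" where
  "same c s s' \<longleftrightarrow> (\<forall>x. x \<notin> wn c \<longrightarrow> nvar s' x = nvar s x) \<and> (\<forall>x. x \<notin> wr c \<longrightarrow> rvar s' x = rvar s x) \<and>
     (\<forall>x. x \<notin> wna c \<longrightarrow> narr s' x = narr s x) \<and> (\<forall>x. x \<notin> wra c \<longrightarrow> rarr s' x = rarr s x)"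

lemma same_refl: "same c s s"
  by (simp add: same_def)

lemma same_trans: "same c s s' \<Longrightarrow> same c s' s'' \<Longrightarrow> same c s s''"
  by (simp add: same_def)

lemma sameD:
  assumes "same c s s'"
  shows "x \<notin> wn c \<Longrightarrow> nvar s' x = nvar s x" "x \<notin> wr c \<Longrightarrow> rvar s' x = rvar s x"
    "x \<notin> wna c \<Longrightarrow> narr s' x = narr s x" "x \<notin> wra c \<Longrightarrow> rarr s' x = rarr s x"
  using assms by (auto simp: same_def)

lemma exec_same: "exec c s t s' \<Longrightarrow> same c s s'"
  by (induction rule: exec.induct) (auto simp: same_def)

lemma runs_same: "runs c s f Q \<Longrightarrow> runs c s f (\<lambda>s'. Q s' \<and> same c s s')"
  unfolding runs_def using exec_same by blast

lemma runs_mono: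
  assumes "runs c s f Q" "f \<le> f'" "\<And>s'. Q s' \<Longrightarrow> same c s s' \<Longrightarrow> Q' s'"
  shows "runs c s f' Q'"
proof -
  obtain t s' where *: "exec c s t s'" "t \<le> kc c * f" "Q s'"
    using assms(1) by (auto simp: runs_def)
  moreover have "t \<le> kc c * f'"
    using *(2) assms(2) by (meson le_trans mult_le_mono2)
  ultimately show ?thesis
    using assms(3) exec_same unfolding runs_def by blast
qed

lemma exec_pos: "exec c s t s' \<Longrightarrow> 0 < t"
  by (induction rule: exec.induct) auto

text \<open>Every command takes at least one unit of time. This makes the measure of a loop decrease
  strictly.\<close>

lemma runs_pos: "runs c s f Q \<Longrightarrow> 0 < f"
  unfolding runs_def using exec_pos by (metis gr0I le_zero_eq mult_0_right neq0_conv)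

text \<open>The weights \<open>kc\<close> add up along \<open>;;\<close>, and therefore the bound
  \<open>f\<close> is shared by both parts instead of being added.\<close>

lemma runs_Seq:
  assumes "runs c s f (\<lambda>s'. runs d s' f Q)"
  shows "runs (c ;; d) s f Q"
  using assms unfolding runs_def
  by (metis (mono_tags, lifting) exec.Seq add_mono distrib_right kc.simps(6))

text \<open>For a second part whose bound is only known in the state that the first part
  reaches.\<close>

lemma runs_Seq_ex:
  assumes "runs c s f (\<lambda>s'. \<exists>g. runs d s' g (\<lambda>s''. Q (max f g) s''))"
  shows "\<exists>f. runs (c ;; d) s f (Q f)"
proof -
  obtain t s' g where h: "exec c s t s'" "t \<le> kc c * f" "runs d s' g (\<lambda>s''. Q (max f g) s'')"
    using assms unfolding runs_def[of c] by blast
  have "runs c s (max f g) (\<lambda>s'. runs d s' (max f g) (\<lambda>s''. Q (max f g) s''))"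
  proof -
    have "runs d s' (max f g) (\<lambda>s''. Q (max f g) s'')" by (rule runs_mono[OF h(3)]) auto
    moreover have "t \<le> kc c * max f g" using h(2) by (meson le_trans max.cobounded1 mult_le_mono2)
    ultimately show ?thesis using h(1) unfolding runs_def[of c] by blast
  qed
  then show ?thesis using runs_Seq by blast
qed

lemma runs_Cond:
  assumes "bval b s \<Longrightarrow> runs c s f Q" "\<not> bval b s \<Longrightarrow> runs d s f Q"
  shows "runs (Cond b c d) s f Q"
proof -
  have "0 < f" using assms runs_pos by blast
  then have *: "1 + bcost b \<le> (1 + bcost b) * f" by (metis One_nat_def Suc_leI mult.right_neutral mult_le_mono2)
  show ?thesis
  proof (cases "bval b s")
    case True
    with assms(1) obtain t s' where h: "exec c s t s'" "t \<le> kc c * f" "Q s'" by (auto simp: runs_def)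
    have "1 + bcost b + t \<le> kc (Cond b c d) * f"
      using h(2) * by (simp add: distrib_right)
    with h show ?thesis unfolding runs_def using exec.IfTrue[OF True h(1)] by blast
  next
    case False
    with assms(2) obtain t s' where h: "exec d s t s'" "t \<le> kc d * f" "Q s'" by (auto simp: runs_def)
    have "1 + bcost b + t \<le> kc (Cond b c d) * f"
      using h(2) * by (simp add: distrib_right)
    with h show ?thesis unfolding runs_def using exec.IfFalse[OF False h(1)] by blast
  qed
qed

text \<open>The measure is a potential: a round with bound \<open>j\<close> has to lower it by at
  least \<open>j\<close>. Expensive rounds are thus allowed as long as they are paid for, and one
  unit remains for the last, failing test.\<close>

lemma runs_While:
  fixes \<mu> :: "state \<Rightarrow> nat"
  assumes I0: "I s0"
    and step: "\<And>s. I s \<Longrightarrow> same c s0 s \<Longrightarrow> bval b s \<Longrightarrow> \<exists>j. runs c s j (\<lambda>s'. I s' \<and> \<mu> s' + j \<le> \<mu> s)"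
    and fin: "\<And>s. I s \<Longrightarrow> same c s0 s \<Longrightarrow> \<not> bval b s \<Longrightarrow> Q s"
    and f: "\<mu> s0 < f"
  shows "runs (While b c) s0 f Q"
proof -
  define K where "K = 1 + bcost b + kc c"
  have "\<exists>t s'. exec (While b c) s t s' \<and> t \<le> K * (\<mu> s + 1) \<and> Q s'" if "I s" "same c s0 s" for s
    using that
  proof (induction "\<mu> s" arbitrary: s rule: less_induct)
    case less
    show ?case
    proof (cases "bval b s")
      case False
      then show ?thesis
        using fin[OF less.prems False] exec.WhileFalse[OF False, of c] unfolding K_def by fastforce
    next
      case True
      then obtain j where "runs c s j (\<lambda>s'. I s' \<and> \<mu> s' + j \<le> \<mu> s)"
        using step less.prems by blast
      moreover from this have "0 < j" by (rule runs_pos)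
      ultimately obtain t s' where h: "exec c s t s'" "t \<le> kc c * j" "I s'" "\<mu> s' + j \<le> \<mu> s" "0 < j"
        by (auto simp: runs_def)
      from h(1) have "same c s0 s'" using exec_same less.prems(2) same_trans by blast
      with less.hyps[of s'] h obtain u s'' where
        i: "exec (While b c) s' u s''" "u \<le> K * (\<mu> s' + 1)" "Q s''" by auto
      have "1 + bcost b \<le> (1 + bcost b) * j" using h(5) by (cases j) auto
      then have "1 + bcost b + t \<le> K * j"
        using h(2) unfolding K_def by (simp add: distrib_right)
      then have "1 + bcost b + t + u \<le> K * (\<mu> s' + j + 1)"
        using i(2) by (simp add: algebra_simps)
      also have "\<dots> \<le> K * (\<mu> s + 1)" using h(4) by simp
      finally show ?thesis using exec.WhileTrue[OF True h(1) i(1)] i(3) by blast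
    qed
  qed
  from this[OF I0 same_refl] obtain t s' where
    h: "exec (While b c) s0 t s'" "t \<le> K * (\<mu> s0 + 1)" "Q s'" by blast
  have "t \<le> kc (While b c) * f"
    using h(2) f mult_le_mono2[of "\<mu> s0 + 1" f K] unfolding K_def by simp
  with h show ?thesis unfolding runs_def by blast
qed

text \<open>Programs without loops are executed symbolically by \<open>eff\<close>, so that their
  verification is left to the simplifier.\<close>

primrec line :: "com \<Rightarrow> bool" where
  "line Skip = True"
| "line (x ::=\<^sub>n e) = True"
| "line (x ::=\<^sub>r e) = True"
| "line (NPut a e f) = True"
| "line (RPut a e f) = True"
| "line (c ;; d) = (line c \<and> line d)"
| "line (Cond b c d) = (line c \<and> line d)"
| "line (While b c) = False"

primrec eff :: "com \<Rightarrow> state \<Rightarrow> state" where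
  "eff Skip s = s"
| "eff (x ::=\<^sub>n e) s = s\<lparr>nvar := (nvar s)(x := nval e s)\<rparr>"
| "eff (x ::=\<^sub>r e) s = s\<lparr>rvar := (rvar s)(x := rval e s)\<rparr>"
| "eff (NPut a e f) s = s\<lparr>narr := (narr s)(a := (narr s a)(nval e s := nval f s))\<rparr>"
| "eff (RPut a e f) s = s\<lparr>rarr := (rarr s)(a := (rarr s a)(nval e s := rval f s))\<rparr>"
| "eff (c ;; d) s = eff d (eff c s)"
| "eff (Cond b c d) s = (if bval b s then eff c s else eff d s)"
| "eff (While b c) s = s"

lemma runs_eff: "line c \<Longrightarrow> 0 < f \<Longrightarrow> runs c s f (\<lambda>s'. s' = eff c s)"
proof (induction c arbitrary: s)
  case (Seq c d)
  show ?case
    by (rule runs_Seq, rule runs_mono[OF Seq.IH(1)]) (use Seq in auto)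
next
  case (Cond b c d)
  show ?case
    by (rule runs_Cond; rule runs_mono[OF Cond.IH(1)] runs_mono[OF Cond.IH(2)]) (use Cond in auto)
qed (cases f; fastforce simp: runs_def intro: exec.intros)+

lemma runs_line: "line c \<Longrightarrow> 0 < f \<Longrightarrow> Q (eff c s) \<Longrightarrow> runs c s f Q"
  by (rule runs_mono[OF runs_eff]) auto

definition For :: "name \<Rightarrow> nexp \<Rightarrow> nexp \<Rightarrow> com \<Rightarrow> com" where
  "For i e0 e c = i ::=\<^sub>n e0 ;;
     While (NLess (NVar i) e) (c ;; i ::=\<^sub>n NAdd (NVar i) (NLit 1))"

lemma for_each_For: "for_each c = For ''i'' (NLit 0) (NVar ''n'') c"
  by (simp add: for_each_def For_def)

lemma For_simps [simp]:
  "wn (For i e0 e c) = insert i (wn c)" "wr (For i e0 e c) = wr c"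
  "wna (For i e0 e c) = wna c" "wra (For i e0 e c) = wra c"
  by (auto simp: For_def)

text \<open>The increment of the counter is absorbed into the invariant, which is asked for after
  the counter has been set. The strict inequality on \<open>f\<close> leaves the unit for the
  failing test.\<close>

lemma runs_For:
  fixes g :: "nat \<Rightarrow> nat"
  assumes i: "i \<notin> wn c"
    and N: "\<And>s'. same (For i e0 e c) s s' \<Longrightarrow> nval e s' = N"
    and M: "nval e0 s = M" and MN: "M \<le> N"
    and I0: "I M (s\<lparr>nvar := (nvar s)(i := M)\<rparr>)"
    and step: "\<And>k s'. M \<le> k \<Longrightarrow> k < N \<Longrightarrow> I k s' \<Longrightarrow> nvar s' i = k \<Longrightarrow> same (For i e0 e c) s s' \<Longrightarrow>
       runs c s' (g k) (\<lambda>s''. I (Suc k) (s''\<lparr>nvar := (nvar s'')(i := Suc k)\<rparr>))"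
    and fin: "\<And>s'. I N s' \<Longrightarrow> nvar s' i = N \<Longrightarrow> same (For i e0 e c) s s' \<Longrightarrow> Q s'"
    and f: "(\<Sum>k\<in>{M..<N}. g k) < f"
  shows "runs (For i e0 e c) s f Q"
proof -
  let ?s0 = "s\<lparr>nvar := (nvar s)(i := M)\<rparr>"
  let ?b = "c ;; i ::=\<^sub>n NAdd (NVar i) (NLit 1)"
  define \<mu> where "\<mu> s' = (\<Sum>k\<in>{nvar s' i..<N}. g k)" for s' :: state
  have same0: "same (For i e0 e c) s s'" if "same ?b ?s0 s'" for s'
    using that by (auto simp: same_def)
  have "runs (While (NLess (NVar i) e) ?b) ?s0 f Q"
  proof (rule runs_While[where I = "\<lambda>s'. M \<le> nvar s' i \<and> nvar s' i \<le> N \<and> I (nvar s' i) s'" and \<mu> = \<mu>])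
    show "M \<le> nvar ?s0 i \<and> nvar ?s0 i \<le> N \<and> I (nvar ?s0 i) ?s0" using I0 MN by simp
    show "\<mu> ?s0 < f" using f by (simp add: \<mu>_def)
  next
    fix s' assume h: "M \<le> nvar s' i \<and> nvar s' i \<le> N \<and> I (nvar s' i) s'" "same ?b ?s0 s'" "\<not> bval (NLess (NVar i) e) s'"
    then have "nvar s' i = N" using N[OF same0[OF h(2)]] by simp
    then show "Q s'" using fin h same0 by auto
  next
    fix s' assume h: "M \<le> nvar s' i \<and> nvar s' i \<le> N \<and> I (nvar s' i) s'" "same ?b ?s0 s'" "bval (NLess (NVar i) e) s'"
    let ?k = "nvar s' i"
    have k: "?k < N" using N[OF same0[OF h(2)]] h(3) by simp
    from step[OF _ k] h same0 have r: "runs c s' (g ?k) (\<lambda>s''. I (Suc ?k) (s''\<lparr>nvar := (nvar s'')(i := Suc ?k)\<rparr>))"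
      by blast
    have "runs ?b s' (g ?k) (\<lambda>s''. (M \<le> nvar s'' i \<and> nvar s'' i \<le> N \<and> I (nvar s'' i) s'') \<and> \<mu> s'' + g ?k \<le> \<mu> s')"
    proof (rule runs_Seq, rule runs_mono[OF r order_refl])
      fix s'' assume a: "I (Suc ?k) (s''\<lparr>nvar := (nvar s'')(i := Suc ?k)\<rparr>)" "same c s' s''"
      then have "nvar s'' i = ?k" using i by (auto simp: same_def)
      moreover have "{?k..<N} = insert ?k {Suc ?k..<N}" using k by auto
      ultimately show "runs (i ::=\<^sub>n NAdd (NVar i) (NLit 1)) s'' (g ?k)
          (\<lambda>s''. (M \<le> nvar s'' i \<and> nvar s'' i \<le> N \<and> I (nvar s'' i) s'') \<and> \<mu> s'' + g ?k \<le> \<mu> s')"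
        using a k h(1) runs_pos[OF r] by (intro runs_line) (auto simp: \<mu>_def)
    qed
    then show "\<exists>j. runs ?b s' j (\<lambda>s''. (M \<le> nvar s'' i \<and> nvar s'' i \<le> N \<and> I (nvar s'' i) s'') \<and> \<mu> s'' + j \<le> \<mu> s')"
      by blast
  qed
  then show ?thesis
    unfolding For_def using f M by (auto intro: runs_Seq[OF runs_line])
qed

section \<open>Binary length as a discrete logarithm\<close>

fun blen :: "nat \<Rightarrow> nat" where
  "blen n = (if n = 0 then 0 else Suc (blen (n div 2)))"

declare blen.simps [simp del]

lemma blen_0 [simp]: "blen 0 = 0"
  by (simp add: blen.simps)

lemma blen_mono: "m \<le> n \<Longrightarrow> blen m \<le> blen n"
proof (induction n arbitrary: m rule: blen.induct)
  case (1 n)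
  then show ?case
    by (cases "m = 0") (simp_all add: blen.simps[of m] blen.simps[of n] div_le_mono)
qed

lemma blen_half: "n \<le> m div 2 \<Longrightarrow> 0 < m \<Longrightarrow> blen n < blen m"
  using blen_mono[of n "m div 2"] by (simp add: blen.simps[of m])

lemma blen_pos: "0 < n \<Longrightarrow> 0 < blen n"
  by (simp add: blen.simps)

lemma two_power_blen: "0 < n \<Longrightarrow> 2 ^ blen n \<le> 2 * n"
proof (induction n rule: blen.induct)
  case (1 n)
  show ?case
  proof (cases "n div 2 = 0")
    case True
    with 1 have "n = 1" by auto
    then show ?thesis by (simp add: blen.simps)
  next
    case False
    with 1 have "2 ^ blen (n div 2) \<le> 2 * (n div 2)" by auto
    with 1 show ?thesis by (simp add: blen.simps[of n])
  qed
qed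

lemma blen_ln: "0 < n \<Longrightarrow> real (blen n) * ln 2 \<le> ln 2 + ln (real n)"
proof -
  assume n: "0 < n"
  have "real (2 ^ blen n) \<le> real (2 * n)" using two_power_blen[OF n] by (simp only: of_nat_le_iff)
  then have "ln (2 ^ blen n) \<le> ln (2 * real n)" using n by (subst ln_le_cancel_iff) auto
  then show ?thesis using n by (simp add: ln_realpow ln_mult)
qed

lemma blen_bigo: "(\<lambda>n. real (C * ((n + 1) * (blen n + 1)))) \<in> O(\<lambda>n. real n * ln (real n))"
proof (rule landau_o.bigI[where c = "real C * 2 * (2 + 1 / ln 2) * 2 + 1"])
  show "0 < real C * 2 * (2 + 1 / ln 2) * 2 + 1"
    by (rule add_nonneg_pos) (auto intro!: mult_nonneg_nonneg)
  have "norm (real (C * ((n + 1) * (blen n + 1)))) \<le> (real C * 2 * (2 + 1 / ln 2) * 2 + 1) * norm (real n * ln (real n))"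
    if "3 \<le> n" for n
  proof -
    \<comment> \<open>The bound is claimed from 3 on because 3 exceeds Euler's number; with
      \<open>1 \<le> ln n\<close> all additive constants are absorbed.\<close>
    have l1: "1 \<le> ln (real n)"
      using that exp_le by (subst ln_ge_iff) auto
    have "real (blen n) \<le> 1 + ln (real n) / ln 2"
      using blen_ln[of n] that by (simp add: field_simps)
    then have "real (blen n + 1) \<le> (2 + 1 / ln 2) * ln (real n)"
      using l1 by (simp add: algebra_simps)
    moreover have "real (n + 1) \<le> 2 * real n" using that by simp
    ultimately have "real (n + 1) * real (blen n + 1) \<le> (2 * real n) * ((2 + 1 / ln 2) * ln (real n))"
      by (intro mult_mono) auto
    then have "real C * (real (n + 1) * real (blen n + 1)) \<le> real C * ((2 * real n) * ((2 + 1 / ln 2) * ln (real n)))"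
      by (rule mult_left_mono) auto
    also have "\<dots> \<le> (real C * 2 * (2 + 1 / ln 2) * 2 + 1) * (real n * ln (real n))"
    proof -
      have "real C * ((2 * real n) * ((2 + 1 / ln 2) * ln (real n))) = (real C * 2 * (2 + 1 / ln 2)) * (real n * ln (real n))"
        by (simp add: algebra_simps)
      also have "\<dots> \<le> (real C * 2 * (2 + 1 / ln 2) * 2 + 1) * (real n * ln (real n))"
      proof (rule mult_right_mono)
        have "x \<le> x * 2 + 1" if "0 \<le> x" for x :: real using that by simp
        moreover have "0 \<le> real C * 2 * (2 + 1 / ln 2)" by simp
        ultimately show "real C * 2 * (2 + 1 / ln 2) \<le> real C * 2 * (2 + 1 / ln 2) * 2 + 1" by blast
      qed (use l1 in simp)
      finally show ?thesis .
    qed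
    finally have "real (C * ((n + 1) * (blen n + 1))) \<le> (real C * 2 * (2 + 1 / ln 2) * 2 + 1) * (real n * ln (real n))"
      by (simp only: of_nat_mult)
    moreover have "norm (real n * ln (real n)) = real n * ln (real n)" using l1 by simp
    ultimately show ?thesis by (simp only: real_norm_def abs_of_nat)
  qed
  then show "\<forall>\<^sub>F n in at_top. norm (real (C * ((n + 1) * (blen n + 1)))) \<le> (real C * 2 * (2 + 1 / ln 2) * 2 + 1) * norm (real n * ln (real n))"
    unfolding eventually_at_top_linorder by blast
qed

section \<open>Sorting\<close>

text \<open>Breaking ties by the index turns keys into a strict total order. The same order serves
  for sorting and, with distances as keys, for \<open>closer\<close>.\<close>

definition lexl :: "(nat \<Rightarrow> real) \<Rightarrow> nat \<Rightarrow> nat \<Rightarrow> bool" where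
  "lexl K i j \<longleftrightarrow> K i < K j \<or> K i = K j \<and> i < j"

lemma lexl_irrefl: "\<not> lexl K i i"
  by (simp add: lexl_def)

lemma lexl_trans: "lexl K i j \<Longrightarrow> lexl K j l \<Longrightarrow> lexl K i l"
  by (auto simp: lexl_def)

lemma lexl_total: "i \<noteq> j \<Longrightarrow> lexl K i j \<or> lexl K j i"
  by (auto simp: lexl_def)

text \<open>Conditions offer neither disjunction nor equality; both are expressed by negation,
  conjunction and the strict order.\<close>

definition lex_less :: "rexp \<Rightarrow> rexp \<Rightarrow> nexp \<Rightarrow> nexp \<Rightarrow> bexp" where
  "lex_less d1 d2 e f = Neg (Conj (Neg (RLess d1 d2)) (Neg (Conj (Neg (RLess d2 d1)) (NLess e f))))"

lemma bval_lex_less [simp]: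
  "bval (lex_less d1 d2 e f) s \<longleftrightarrow> rval d1 s < rval d2 s \<or> rval d1 s = rval d2 s \<and> nval e s < nval f s"
  by (auto simp: lex_less_def)

abbreviation set_min :: "name \<Rightarrow> nexp \<Rightarrow> nexp \<Rightarrow> com" where
  "set_min x e f \<equiv> Cond (NLess e f) (x ::=\<^sub>n e) (x ::=\<^sub>n f)"

text \<open>Writes exactly one entry. A new pair of runs is opened whenever the output position
  \<open>o\<close> reaches the end \<open>e\<close> of the previous pair, so a whole pass is a
  single loop with rounds of constant cost.\<close>

definition merge_step :: com where
  "merge_step =
     Cond (NLess (NVar ''o'') (NVar ''e'')) Skip
       (''a'' ::=\<^sub>n NVar ''o'' ;;
        set_min ''m'' (NAdd (NVar ''o'') (NVar ''w'')) (NVar ''n'') ;;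
        ''b'' ::=\<^sub>n NVar ''m'' ;;
        set_min ''e'' (NAdd (NVar ''m'') (NVar ''w'')) (NVar ''n'')) ;;
     Cond (Conj (NLess (NVar ''a'') (NVar ''m''))
           (Neg (Conj (NLess (NVar ''b'') (NVar ''e''))
             (lex_less (RGet ''K'' (NGet ''P'' (NVar ''b''))) (RGet ''K'' (NGet ''P'' (NVar ''a'')))
               (NGet ''P'' (NVar ''b'')) (NGet ''P'' (NVar ''a''))))))
       (NPut ''Q'' (NVar ''o'') (NGet ''P'' (NVar ''a'')) ;; ''a'' ::=\<^sub>n NAdd (NVar ''a'') (NLit 1))
       (NPut ''Q'' (NVar ''o'') (NGet ''P'' (NVar ''b'')) ;; ''b'' ::=\<^sub>n NAdd (NVar ''b'') (NLit 1)) ;;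
     ''o'' ::=\<^sub>n NAdd (NVar ''o'') (NLit 1)"

definition merge_pass :: com where
  "merge_pass =
     ''o'' ::=\<^sub>n NLit 0 ;; ''e'' ::=\<^sub>n NLit 0 ;;
     While (NLess (NVar ''o'') (NVar ''n'')) merge_step ;;
     for_each (NPut ''P'' (NVar ''i'') (at_i ''Q''))"

text \<open>Bottom-up, since the language has no recursion. The keys stay in place and
  \<open>P\<close> is the sorting permutation.\<close>

definition merge_sort :: com where
  "merge_sort =
     for_each (NPut ''P'' (NVar ''i'') (NVar ''i'')) ;;
     ''w'' ::=\<^sub>n NLit 1 ;;
     While (NLess (NVar ''w'') (NVar ''n''))
       (merge_pass ;; ''w'' ::=\<^sub>n NAdd (NVar ''w'') (NVar ''w''))"

text \<open>Equality of the quotients by \<open>w\<close> expresses that two positions belong to the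
  same run; runs have width \<open>w\<close>, except possibly the last.\<close>

locale merging =
  fixes lt :: "nat \<Rightarrow> nat \<Rightarrow> bool" and n w :: nat and P :: "nat \<Rightarrow> nat"
  assumes lt_trans: "lt x y \<Longrightarrow> lt y z \<Longrightarrow> lt x z"
    and lt_total: "x \<noteq> y \<Longrightarrow> lt x y \<or> lt y x"
    and w: "0 < w"
    and P: "inj_on P {..<n}"
    and sorted: "\<And>i j. i < j \<Longrightarrow> j < n \<Longrightarrow> i div w = j div w \<Longrightarrow> lt (P i) (P j)"
begin

definition merged :: "(nat \<Rightarrow> nat) \<Rightarrow> nat \<Rightarrow> bool" where
  "merged Q x \<longleftrightarrow> x \<le> n \<and> (x = n \<or> 2 * w dvd x) \<and> Q ` {..<x} = P ` {..<x} \<and>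
     (\<forall>i j. i < j \<longrightarrow> j < x \<longrightarrow> i div (2 * w) = j div (2 * w) \<longrightarrow> lt (Q i) (Q j))"

text \<open>The state within a block that starts at \<open>s\<close>: \<open>z\<close> is the next
  output position, \<open>a\<close> and \<open>b\<close> are the reading positions in the two runs,
  which meet at \<open>m\<close>. The equation \<open>a + b = z + m\<close> says that as many
  entries were read as written.\<close>

definition in_block :: "(nat \<Rightarrow> nat) \<Rightarrow> nat \<Rightarrow> nat \<Rightarrow> nat \<Rightarrow> nat \<Rightarrow> nat \<Rightarrow> nat \<Rightarrow> bool" where
  "in_block Q s z a b m e \<longleftrightarrow> merged Q s \<and> 2 * w dvd s \<and> s < n \<and> m = min (s + w) n \<and> e = min (m + w) n \<and>
     s \<le> a \<and> a \<le> m \<and> m \<le> b \<and> b \<le> e \<and> a + b = z + m \<and> Q ` {s..<z} = P ` ({s..<a} \<union> {m..<b}) \<and>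
     (\<forall>i j. s \<le> i \<longrightarrow> i < j \<longrightarrow> j < z \<longrightarrow> lt (Q i) (Q j)) \<and>
     (\<forall>i. s \<le> i \<longrightarrow> i < z \<longrightarrow> (a < m \<longrightarrow> lt (Q i) (P a)) \<and> (b < e \<longrightarrow> lt (Q i) (P b)))"

lemma in_block_start:
  "merged Q z \<Longrightarrow> z < n \<Longrightarrow> in_block Q z z z (min (z + w) n) (min (z + w) n) (min (min (z + w) n + w) n)"
  by (auto simp: in_block_def merged_def)

lemma block_div: "2 * w dvd s \<Longrightarrow> s \<le> i \<Longrightarrow> i < s + w \<Longrightarrow> i div w = s div w"
proof -
  assume a: "2 * w dvd s" "s \<le> i" "i < s + w"
  then obtain c where c: "s = w * (2 * c)" by (auto simp: dvd_def)
  have "i = w * (2 * c) + (i - s)" using a c by simp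
  then show ?thesis using a c w by (metis add.right_neutral div_less div_mult_self4 less_diff_conv2 nat_add_left_cancel_less nonzero_mult_div_cancel_left add.commute less_not_refl2)
qed

lemma block_div2: "2 * w dvd s \<Longrightarrow> s + w \<le> i \<Longrightarrow> i < s + w + w \<Longrightarrow> i div w = s div w + 1"
proof -
  assume a: "2 * w dvd s" "s + w \<le> i" "i < s + w + w"
  have "(i - w) div w = s div w" using a by (intro block_div) auto
  moreover have "i div w = Suc ((i - w) div w)" using a w by (intro le_div_geq) auto
  ultimately show ?thesis by simp
qed

lemma same_block:
  assumes "2 * w dvd s" "i < j" "j < s + w + w" "s \<le> j" "i div (2 * w) = j div (2 * w)"
  shows "s \<le> i"
proof -
  obtain c where c: "s = 2 * w * c" using assms by (auto simp: dvd_def)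
  have "c \<le> j div (2 * w)" using c assms w by (simp add: less_eq_div_iff_mult_less_eq mult.commute)
  then have "c \<le> i div (2 * w)" using assms by simp
  then show ?thesis using c w by (simp add: less_eq_div_iff_mult_less_eq mult.commute)
qed

lemma in_block_end:
  assumes "in_block Q s e a b m e"
  shows "merged Q e"
proof -
  have h: "merged Q s" "2 * w dvd s" "s < n" "m = min (s + w) n" "e = min (m + w) n" "s \<le> a" "a \<le> m"
    "m \<le> b" "b \<le> e" "a + b = e + m" "Q ` {s..<e} = P ` ({s..<a} \<union> {m..<b})"
    and srt: "\<And>i j. s \<le> i \<Longrightarrow> i < j \<Longrightarrow> j < e \<Longrightarrow> lt (Q i) (Q j)"
    using assms unfolding in_block_def by auto
  \<comment> \<open>From \<open>a + b = e + m\<close> with \<open>a \<le> m\<close> and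
    \<open>b \<le> e\<close>: a full output means that both runs are exhausted.\<close>
  have ab: "a = m" "b = e" using h(7-10) by linarith+
  have "Q ` {s..<e} = P ` {s..<e}" using h ab by (simp add: ivl_disj_un)
  moreover have "{..<e} = {..<s} \<union> {s..<e}" using h ab by auto
  ultimately have im: "Q ` {..<e} = P ` {..<e}" using h(1) by (simp add: image_Un merged_def)
  have "e = n \<or> 2 * w dvd e"
  proof (cases "e = n")
    case False
    then have "e = s + 2 * w" using h by auto
    then show ?thesis using h(2) by simp
  qed simp
  moreover have "lt (Q i) (Q j)" if "i < j" "j < e" "i div (2 * w) = j div (2 * w)" for i j
  proof (cases "j < s")
    case True
    then show ?thesis using that h(1) by (simp add: merged_def)
  next
    case False
    then have "s \<le> i" using same_block[OF h(2) that(1)] that h by auto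
    then show ?thesis using srt that by blast
  qed
  ultimately show ?thesis using im h(5) by (simp add: merged_def)
qed

lemma merged_cong: "merged Q s \<Longrightarrow> s \<le> z \<Longrightarrow> merged (Q(z := x)) s"
proof -
  assume a: "merged Q s" "s \<le> z"
  then have "(Q(z := x)) ` {..<s} = Q ` {..<s}" by (intro image_cong) auto
  with a show ?thesis by (auto simp: merged_def)
qed

text \<open>The head of the left run precedes its own successor and the head of the other run, so
  all entries written so far still precede both heads.\<close>

lemma in_block_left:
  assumes h: "in_block Q s z a b m e" and a: "a < m" and b: "b < e \<Longrightarrow> \<not> lt (P b) (P a)"
  shows "in_block (Q(z := P a)) s (z + 1) (a + 1) b m e"
proof -
  have h1: "merged Q s" "2 * w dvd s" "s < n" "m = min (s + w) n" "e = min (m + w) n" "s \<le> a" "a \<le> m"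
    "m \<le> b" "b \<le> e" "a + b = z + m" and im: "Q ` {s..<z} = P ` ({s..<a} \<union> {m..<b})"
    and srt: "\<And>i j. s \<le> i \<Longrightarrow> i < j \<Longrightarrow> j < z \<Longrightarrow> lt (Q i) (Q j)"
    and bnd: "\<And>i. s \<le> i \<Longrightarrow> i < z \<Longrightarrow> a < m \<Longrightarrow> lt (Q i) (P a)"
      "\<And>i. s \<le> i \<Longrightarrow> i < z \<Longrightarrow> b < e \<Longrightarrow> lt (Q i) (P b)"
    using h unfolding in_block_def by auto
  have sz: "s \<le> z" using h1 by auto
  have "P a \<noteq> P b" if "b < e" using inj_onD[OF P, of a b] that h1 a by auto
  then have ab: "lt (P a) (P b)" if "b < e" using that b lt_total by blast
  have nxt: "lt (P a) (P (a + 1))" if "a + 1 < m"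
    using that h1 block_div[OF h1(2), of a] block_div[OF h1(2), of "a + 1"] by (intro sorted) auto
  have "(Q(z := P a)) ` {s..<z + 1} = insert (P a) (Q ` {s..<z})"
    using sz by (auto simp: image_iff less_Suc_eq)
  also have "\<dots> = P ` ({s..<a + 1} \<union> {m..<b})"
    using im h1 by (auto simp: image_iff less_Suc_eq)
  finally have E1: "(Q(z := P a)) ` {s..<z + 1} = P ` ({s..<a + 1} \<union> {m..<b})" .
  have E2: "lt ((Q(z := P a)) i) ((Q(z := P a)) j)" if "s \<le> i" "i < j" "j < z + 1" for i j
    using that srt bnd(1) a by (cases "j = z") auto
  have E3: "lt ((Q(z := P a)) i) (P (a + 1))" if "s \<le> i" "i < z + 1" "a + 1 < m" for i
    using that bnd(1)[of i] a nxt lt_trans by (cases "i = z") auto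
  have E4: "lt ((Q(z := P a)) i) (P b)" if "s \<le> i" "i < z + 1" "b < e" for i
    using that bnd(2)[of i] a ab by (cases "i = z") auto
  have E5: "merged (Q(z := P a)) s" "s \<le> a + 1" "a + 1 \<le> m" "a + 1 + b = z + 1 + m"
    using h1 a merged_cong[OF h1(1) sz] by auto
  show ?thesis
    unfolding in_block_def
    by (intro conjI allI impI)
      ((rule h1 E1 E5 | (rule E2, assumption+) | (rule E3, assumption+) | (rule E4, assumption+)))+
qed

lemma in_block_right:
  assumes h: "in_block Q s z a b m e" and z: "z < e" and b: "a < m \<Longrightarrow> b < e \<and> lt (P b) (P a)"
  shows "in_block (Q(z := P b)) s (z + 1) a (b + 1) m e"
proof -
  have h1: "merged Q s" "2 * w dvd s" "s < n" "m = min (s + w) n" "e = min (m + w) n" "s \<le> a" "a \<le> m"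
    "m \<le> b" "b \<le> e" "a + b = z + m" and im: "Q ` {s..<z} = P ` ({s..<a} \<union> {m..<b})"
    and srt: "\<And>i j. s \<le> i \<Longrightarrow> i < j \<Longrightarrow> j < z \<Longrightarrow> lt (Q i) (Q j)"
    and bnd: "\<And>i. s \<le> i \<Longrightarrow> i < z \<Longrightarrow> a < m \<Longrightarrow> lt (Q i) (P a)"
      "\<And>i. s \<le> i \<Longrightarrow> i < z \<Longrightarrow> b < e \<Longrightarrow> lt (Q i) (P b)"
    using h unfolding in_block_def by auto
  have sz: "s \<le> z" using h1 by auto
  \<comment> \<open>If the left run is exhausted, then \<open>a = m\<close> and hence
    \<open>b = z\<close>, which is less than \<open>e\<close>.\<close>
  have be: "b < e" using b h1 z by (cases "a < m") auto
  have nxt: "lt (P b) (P (b + 1))" if "b + 1 < e"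
  proof -
    have "m = s + w" using that h1 by auto
    then show ?thesis
      using that h1 block_div2[OF h1(2), of b] block_div2[OF h1(2), of "b + 1"] by (intro sorted) auto
  qed
  have "(Q(z := P b)) ` {s..<z + 1} = insert (P b) (Q ` {s..<z})"
    using sz by (auto simp: image_iff less_Suc_eq)
  also have "\<dots> = P ` ({s..<a} \<union> {m..<b + 1})"
    using im h1 by (auto simp: image_iff less_Suc_eq)
  finally have E1: "(Q(z := P b)) ` {s..<z + 1} = P ` ({s..<a} \<union> {m..<b + 1})" .
  have E2: "lt ((Q(z := P b)) i) ((Q(z := P b)) j)" if "s \<le> i" "i < j" "j < z + 1" for i j
    using that srt bnd(2) be by (cases "j = z") auto
  have E3: "lt ((Q(z := P b)) i) (P (b + 1))" if "s \<le> i" "i < z + 1" "b + 1 < e" for i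
    using that bnd(2)[of i] be nxt lt_trans by (cases "i = z") auto
  have E4: "lt ((Q(z := P b)) i) (P a)" if "s \<le> i" "i < z + 1" "a < m" for i
    using that bnd(1)[of i] b by (cases "i = z") auto
  have E5: "merged (Q(z := P b)) s" "m \<le> b + 1" "b + 1 \<le> e" "a + (b + 1) = z + 1 + m"
    using h1 be merged_cong[OF h1(1) sz] by auto
  show ?thesis
    unfolding in_block_def
    by (intro conjI allI impI)
      ((rule h1 E1 E5 | (rule E2, assumption+) | (rule E3, assumption+) | (rule E4, assumption+)))+
qed

end

lemma merging_lexl:
  assumes "0 < w" "inj_on P {..<n}"
    "\<And>i j. i < j \<Longrightarrow> j < n \<Longrightarrow> i div w = j div w \<Longrightarrow> lexl K (P i) (P j)"
  shows "merging (lexl K) n w P"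
proof
  show "lexl K x y \<Longrightarrow> lexl K y z \<Longrightarrow> lexl K x z" for x y z by (rule lexl_trans)
  show "x \<noteq> y \<Longrightarrow> lexl K x y \<or> lexl K y x" for x y by (rule lexl_total)
qed (use assms in auto)

text \<open>Between two rounds either a block has just been completed (\<open>o = e\<close>) or one
  is in progress; both shapes occur before and after a round.\<close>

lemma merge_step_runs:
  assumes n: "nvar s ''n'' = n" and M: "merging (lexl (rarr s ''K'')) n (nvar s ''w'') (narr s ''P'')"
    and z: "nvar s ''o'' < n"
    and I: "nvar s ''o'' = nvar s ''e'' \<and> merging.merged (lexl (rarr s ''K'')) n (nvar s ''w'') (narr s ''P'') (narr s ''Q'') (nvar s ''o'') \<or>
       nvar s ''o'' < nvar s ''e'' \<and> (\<exists>k. merging.in_block (lexl (rarr s ''K'')) n (nvar s ''w'') (narr s ''P'') (narr s ''Q'') k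
          (nvar s ''o'') (nvar s ''a'') (nvar s ''b'') (nvar s ''m'') (nvar s ''e''))"
  shows "runs merge_step s 1 (\<lambda>s'. nvar s' ''o'' = nvar s ''o'' + 1 \<and>
      (nvar s' ''o'' = nvar s' ''e'' \<and> merging.merged (lexl (rarr s ''K'')) n (nvar s ''w'') (narr s ''P'') (narr s' ''Q'') (nvar s' ''o'') \<or>
       nvar s' ''o'' < nvar s' ''e'' \<and> (\<exists>k. merging.in_block (lexl (rarr s ''K'')) n (nvar s ''w'') (narr s ''P'') (narr s' ''Q'') k
          (nvar s' ''o'') (nvar s' ''a'') (nvar s' ''b'') (nvar s' ''m'') (nvar s' ''e''))))"
proof -
  interpret merging "lexl (rarr s ''K'')" n "nvar s ''w''" "narr s ''P''" by (rule M)
  define pre where "pre = Cond (NLess (NVar ''o'') (NVar ''e'')) Skip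
       (''a'' ::=\<^sub>n NVar ''o'' ;;
        set_min ''m'' (NAdd (NVar ''o'') (NVar ''w'')) (NVar ''n'') ;;
        ''b'' ::=\<^sub>n NVar ''m'' ;;
        set_min ''e'' (NAdd (NVar ''m'') (NVar ''w'')) (NVar ''n''))"
  have pre: "runs pre s 1 (\<lambda>t. \<exists>k. in_block (narr t ''Q'') k
          (nvar t ''o'') (nvar t ''a'') (nvar t ''b'') (nvar t ''m'') (nvar t ''e'') \<and> nvar t ''o'' < nvar t ''e''
           \<and> nvar t ''o'' = nvar s ''o'' \<and> narr t ''P'' = narr s ''P'')"
  proof (cases "nvar s ''o'' < nvar s ''e''")
    case True
    then show ?thesis using I unfolding pre_def by (intro runs_line) auto
  next
    case False
    then have "nvar s ''o'' = nvar s ''e'' \<and> merged (narr s ''Q'') (nvar s ''o'')" using I by blast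
    then show ?thesis using in_block_start[of "narr s ''Q''" "nvar s ''o''"] z n w unfolding pre_def
      by (intro runs_line) (auto simp: min_def split: if_splits)
  qed
  show ?thesis unfolding merge_step_def pre_def[symmetric]
  proof (rule runs_Seq, rule runs_mono[OF pre order_refl], elim exE conjE)
    fix t k assume t: "same pre s t" and h: "in_block (narr t ''Q'') k
          (nvar t ''o'') (nvar t ''a'') (nvar t ''b'') (nvar t ''m'') (nvar t ''e'')"
      "nvar t ''o'' < nvar t ''e''" "nvar t ''o'' = nvar s ''o''" and P: "narr t ''P'' = narr s ''P''"
    have K: "rarr t ''K'' = rarr s ''K''" using t by (simp add: same_def pre_def)
    let ?a = "nvar t ''a''" and ?b = "nvar t ''b''" and ?m = "nvar t ''m''" and ?e = "nvar t ''e''"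
    let ?c = "?a < ?m \<and> \<not> (?b < ?e \<and> lexl (rarr s ''K'') (narr s ''P'' ?b) (narr s ''P'' ?a))"
    have L: "in_block ((narr t ''Q'')(nvar t ''o'' := narr s ''P'' ?a)) k (nvar t ''o'' + 1) (?a + 1) ?b ?m ?e" if ?c
      using that by (intro in_block_left[OF h(1)]) auto
    have R: "in_block ((narr t ''Q'')(nvar t ''o'' := narr s ''P'' ?b)) k (nvar t ''o'' + 1) ?a (?b + 1) ?m ?e" if "\<not> ?c"
      using that by (intro in_block_right[OF h(1) h(2)]) auto
    show "runs (Cond (Conj (NLess (NVar ''a'') (NVar ''m''))
           (Neg (Conj (NLess (NVar ''b'') (NVar ''e''))
             (lex_less (RGet ''K'' (NGet ''P'' (NVar ''b''))) (RGet ''K'' (NGet ''P'' (NVar ''a'')))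
               (NGet ''P'' (NVar ''b'')) (NGet ''P'' (NVar ''a''))))))
       (NPut ''Q'' (NVar ''o'') (NGet ''P'' (NVar ''a'')) ;; ''a'' ::=\<^sub>n NAdd (NVar ''a'') (NLit 1))
       (NPut ''Q'' (NVar ''o'') (NGet ''P'' (NVar ''b'')) ;; ''b'' ::=\<^sub>n NAdd (NVar ''b'') (NLit 1)) ;;
     ''o'' ::=\<^sub>n NAdd (NVar ''o'') (NLit 1)) t 1 (\<lambda>s'. nvar s' ''o'' = nvar s ''o'' + 1 \<and>
      (nvar s' ''o'' = nvar s' ''e'' \<and> merged (narr s' ''Q'') (nvar s' ''o'') \<or>
       nvar s' ''o'' < nvar s' ''e'' \<and> (\<exists>k. in_block (narr s' ''Q'') k
          (nvar s' ''o'') (nvar s' ''a'') (nvar s' ''b'') (nvar s' ''m'') (nvar s' ''e''))))"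
    proof (cases ?c)
      case True
      have "merged ((narr t ''Q'')(nvar t ''o'' := narr s ''P'' ?a)) (nvar t ''o'' + 1)" if "nvar t ''o'' + 1 = ?e"
        using L[OF True] in_block_end that by metis
      then show ?thesis using True L[OF True] h(2,3) K P
        by (cases "nvar t ''o'' + 1 = ?e"; intro runs_line) (auto simp: lexl_def)
    next
      case False
      have "merged ((narr t ''Q'')(nvar t ''o'' := narr s ''P'' ?b)) (nvar t ''o'' + 1)" if "nvar t ''o'' + 1 = ?e"
        using R[OF False] in_block_end that by metis
      then show ?thesis using False R[OF False] h(2,3) K P
        by (cases "nvar t ''o'' + 1 = ?e"; intro runs_line) (auto simp: lexl_def)
    qed
  qed
qed

lemma merge_pass_runs:
  assumes n: "nvar s ''n'' = n" and M: "merging (lexl (rarr s ''K'')) n (nvar s ''w'') (narr s ''P'')"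
  shows "runs merge_pass s (n + 1) (\<lambda>s'. narr s' ''P'' ` {..<n} = narr s ''P'' ` {..<n} \<and>
     (\<forall>i j. i < j \<longrightarrow> j < n \<longrightarrow> i div (2 * nvar s ''w'') = j div (2 * nvar s ''w'') \<longrightarrow>
        lexl (rarr s ''K'') (narr s' ''P'' i) (narr s' ''P'' j)))"
proof -
  interpret merging "lexl (rarr s ''K'')" n "nvar s ''w''" "narr s ''P''" by (rule M)
  let ?s = "eff (''e'' ::=\<^sub>n NLit 0) (eff (''o'' ::=\<^sub>n NLit 0) s)"
  define J where "J t \<longleftrightarrow> nvar t ''o'' \<le> n \<and> (nvar t ''e'' = nvar t ''o'' \<and> merged (narr t ''Q'') (nvar t ''o'') \<or>
     nvar t ''o'' < nvar t ''e'' \<and> (\<exists>k. in_block (narr t ''Q'') k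
          (nvar t ''o'') (nvar t ''a'') (nvar t ''b'') (nvar t ''m'') (nvar t ''e'')))" for t :: state
  have loop: "runs (While (NLess (NVar ''o'') (NVar ''n'')) merge_step) ?s (n + 1) (\<lambda>t. merged (narr t ''Q'') n)"
  proof (rule runs_While[where I = J and \<mu> = "\<lambda>t. n - nvar t ''o''"])
    show "J ?s" by (simp add: J_def merged_def)
    show "n - nvar ?s ''o'' < n + 1" by simp
  next
    fix t assume a: "J t" "same merge_step ?s t" "\<not> bval (NLess (NVar ''o'') (NVar ''n'')) t"
    have "nvar t ''n'' = n" using a(2) n by (simp add: same_def merge_step_def)
    then have "nvar t ''o'' = n" using a by (simp add: J_def)
    then show "merged (narr t ''Q'') n" using a(1) by (auto simp: J_def in_block_def)
  next
    fix t assume a: "J t" "same merge_step ?s t" "bval (NLess (NVar ''o'') (NVar ''n'')) t"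
    have e: "nvar t ''n'' = n" "rarr t ''K'' = rarr s ''K''" "nvar t ''w'' = nvar s ''w''" "narr t ''P'' = narr s ''P''"
      using a(2) n by (simp_all add: same_def merge_step_def)
    have "runs merge_step t 1 (\<lambda>t'. J t' \<and> n - nvar t' ''o'' + 1 \<le> n - nvar t ''o'')"
      by (rule runs_mono[OF merge_step_runs[of t n]]) (use a M e in \<open>auto simp: J_def\<close>)
    then show "\<exists>j. runs merge_step t j (\<lambda>t'. J t' \<and> n - nvar t' ''o'' + j \<le> n - nvar t ''o'')" by blast
  qed
  have cpy: "runs (for_each (NPut ''P'' (NVar ''i'') (at_i ''Q''))) t (n + 1)
      (\<lambda>t'. \<forall>i<n. narr t' ''P'' i = narr t ''Q'' i)" if "nvar t ''n'' = n" for t :: state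
    unfolding for_each_For
    by (rule runs_For[where M = 0 and N = n and g = "\<lambda>_. 1" and I = "\<lambda>k t'. \<forall>i<k. narr t' ''P'' i = narr t ''Q'' i"])
      (use that in \<open>auto simp: same_def less_Suc_eq intro!: runs_line\<close>)
  show ?thesis unfolding merge_pass_def
  proof (rule runs_Seq, rule runs_line, simp, simp, rule runs_Seq, rule runs_line, simp, simp,
      rule runs_Seq, rule runs_mono[OF loop order_refl], goal_cases)
    case (1 t)
    have e: "nvar t ''n'' = n" using 1(2) n by (simp add: same_def merge_step_def)
    have im: "(\<forall>i<n. f i = g i) \<Longrightarrow> f ` {..<n} = g ` {..<n}" for f g :: "nat \<Rightarrow> nat"
      by (intro image_cong) auto
    show ?case
      by (rule runs_mono[OF cpy[OF e]]) (use 1(1) im in \<open>auto simp: merged_def\<close>)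
  qed
qed

lemma merge_sort_runs:
  assumes n: "nvar s ''n'' = n" and f: "(n + 1) * (blen n + 1) \<le> f"
  shows "runs merge_sort s f (\<lambda>s'. narr s' ''P'' ` {..<n} = {..<n} \<and>
     (\<forall>i j. i < j \<longrightarrow> j < n \<longrightarrow> lexl (rarr s ''K'') (narr s' ''P'' i) (narr s' ''P'' j)))"
proof -
  let ?L = "lexl (rarr s ''K'')"
  define J where "J t \<longleftrightarrow> 0 < nvar t ''w'' \<and> narr t ''P'' ` {..<n} = {..<n} \<and>
     (\<forall>i j. i < j \<longrightarrow> j < n \<longrightarrow> i div nvar t ''w'' = j div nvar t ''w'' \<longrightarrow> ?L (narr t ''P'' i) (narr t ''P'' j))" for t :: state
  let ?B = "merge_pass ;; ''w'' ::=\<^sub>n NAdd (NVar ''w'') (NVar ''w'')"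
  have fn: "n < f" using f by auto
  have ini: "runs (for_each (NPut ''P'' (NVar ''i'') (NVar ''i''))) s f
      (\<lambda>t'. \<forall>i<n. narr t' ''P'' i = i)"
    unfolding for_each_For
    by (rule runs_For[where M = 0 and N = n and g = "\<lambda>_. 1" and I = "\<lambda>k t'. \<forall>i<k. narr t' ''P'' i = i"])
      (use n fn in \<open>auto simp: same_def less_Suc_eq intro!: runs_line\<close>)
  have body: "runs ?B t (n + 1) (\<lambda>t'. J t' \<and> nvar t' ''w'' = 2 * nvar t ''w'')"
    if a: "J t" "nvar t ''n'' = n" "rarr t ''K'' = rarr s ''K''" for t :: state
  proof -
    have "inj_on (narr t ''P'') {..<n}"
      using a(1) by (intro eq_card_imp_inj_on) (auto simp: J_def)
    then have "merging (lexl (rarr t ''K'')) n (nvar t ''w'') (narr t ''P'')"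
      using a by (intro merging_lexl) (auto simp: J_def)
    from merge_pass_runs[OF a(2) this] show ?thesis
    proof (intro runs_Seq, elim runs_mono[OF _ order_refl])
      fix t' assume b: "narr t' ''P'' ` {..<n} = narr t ''P'' ` {..<n} \<and>
     (\<forall>i j. i < j \<longrightarrow> j < n \<longrightarrow> i div (2 * nvar t ''w'') = j div (2 * nvar t ''w'') \<longrightarrow>
        lexl (rarr t ''K'') (narr t' ''P'' i) (narr t' ''P'' j))" "same merge_pass t t'"
      have "nvar t' ''w'' = nvar t ''w''" using b(2) by (simp add: same_def merge_pass_def merge_step_def for_each_def)
      then show "runs (''w'' ::=\<^sub>n NAdd (NVar ''w'') (NVar ''w'')) t' (n + 1) (\<lambda>t'. J t' \<and> nvar t' ''w'' = 2 * nvar t ''w'')"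
        using b(1) a by (intro runs_line) (auto simp: J_def mult_2)
    qed
  qed
  have loop: "runs (While (NLess (NVar ''w'') (NVar ''n'')) ?B) t f
      (\<lambda>s'. narr s' ''P'' ` {..<n} = {..<n} \<and> (\<forall>i j. i < j \<longrightarrow> j < n \<longrightarrow> ?L (narr s' ''P'' i) (narr s' ''P'' j)))"
    if a: "J t" "nvar t ''n'' = n" "rarr t ''K'' = rarr s ''K''" "nvar t ''w'' = 1" for t :: state
  \<comment> \<open>Doubling \<open>w\<close> halves the quotient. The numerator is
    \<open>n - 1\<close> because the quotient then vanishes just when \<open>w\<close> reaches
    \<open>n\<close> and the loop stops.\<close>
  proof (rule runs_While[where I = J and \<mu> = "\<lambda>t. (n + 1) * blen ((n - 1) div nvar t ''w'')"])
    show "J t" by (rule a)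
    have "blen (n - 1) \<le> blen n" by (simp add: blen_mono)
    then have "(n + 1) * blen (n - 1) \<le> (n + 1) * blen n" by (rule mult_le_mono2)
    moreover have "(n + 1) * blen n + n + 1 \<le> f" using f by (simp add: algebra_simps)
    ultimately show "(n + 1) * blen ((n - 1) div nvar t ''w'') < f" using a by simp
  next
    fix t' assume b: "J t'" "same ?B t t'" "\<not> bval (NLess (NVar ''w'') (NVar ''n'')) t'"
    then have "n \<le> nvar t' ''w''" using a
      by (simp add: same_def merge_pass_def merge_step_def for_each_def)
    then show "narr t' ''P'' ` {..<n} = {..<n} \<and> (\<forall>i j. i < j \<longrightarrow> j < n \<longrightarrow> ?L (narr t' ''P'' i) (narr t' ''P'' j))"
      using b(1) by (auto simp: J_def)
  next
    fix t' assume b: "J t'" "same ?B t t'" "bval (NLess (NVar ''w'') (NVar ''n'')) t'"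
    have e: "nvar t' ''n'' = n" "rarr t' ''K'' = rarr s ''K''"
      using b(2) a by (simp_all add: same_def merge_pass_def merge_step_def for_each_def)
    have w: "0 < nvar t' ''w''" "nvar t' ''w'' < n" using b e by (auto simp: J_def)
    have p: "0 < (n - 1) div nvar t' ''w''" using w by (simp add: div_greater_zero_iff)
    have "(n - 1) div (2 * nvar t' ''w'') = (n - 1) div nvar t' ''w'' div 2"
      by (metis div_mult2_eq mult.commute)
    then have "blen ((n - 1) div (2 * nvar t' ''w'')) < blen ((n - 1) div nvar t' ''w'')"
      using p by (intro blen_half) auto
    then have le: "(n + 1) * blen ((n - 1) div (2 * nvar t' ''w'')) + (n + 1) \<le> (n + 1) * blen ((n - 1) div nvar t' ''w'')"
      by (metis Suc_leI mult_Suc_right mult_le_mono2 add.commute)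
    have "runs ?B t' (n + 1) (\<lambda>t''. J t'' \<and> (n + 1) * blen ((n - 1) div nvar t'' ''w'') + (n + 1) \<le> (n + 1) * blen ((n - 1) div nvar t' ''w''))"
      by (rule runs_mono[OF body[OF b(1) e]]) (use le in auto)
    then show "\<exists>j. runs ?B t' j (\<lambda>t''. J t'' \<and> (n + 1) * blen ((n - 1) div nvar t'' ''w'') + j \<le> (n + 1) * blen ((n - 1) div nvar t' ''w''))"
      by blast
  qed
  show ?thesis unfolding merge_sort_def
  proof (rule runs_Seq, rule runs_mono[OF ini order_refl], rule runs_Seq, rule runs_line, simp, use fn in simp, rule loop, goal_cases)
    case (1 t)
    have "narr t ''P'' ` {..<n} = id ` {..<n}" using 1(1) by (intro image_cong) auto
    with 1 show ?case by (auto simp: J_def)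
  qed (use n in \<open>simp_all add: same_def for_each_def\<close>)
qed

section \<open>Fair split trees\<close>

text \<open>If the multiple of \<open>h\<close> below \<open>p\<close> misses the interval, it is
  less than \<open>lo\<close>, and the next multiple is less than
  \<open>lo + h \<le> c\<close>.\<close>

lemma floor_cut:
  fixes p c h lo :: real
  assumes h: "0 < h" and lo: "lo \<le> p" "lo + h \<le> c" and p: "p \<le> c"
  shows "\<exists>z\<in>{\<lfloor>p / h\<rfloor>, \<lfloor>p / h\<rfloor> + 1}. lo \<le> of_int z * h \<and> of_int z * h \<le> c"
proof -
  have 1: "of_int \<lfloor>p / h\<rfloor> * h \<le> p" "p < of_int (\<lfloor>p / h\<rfloor> + 1) * h"
    using h by (simp_all add: pos_le_divide_eq[symmetric] pos_divide_less_eq[symmetric])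
  have 2: "of_int (\<lfloor>p / h\<rfloor> + 1) * h = of_int \<lfloor>p / h\<rfloor> * h + h"
    by (simp add: distrib_right)
  show ?thesis
  proof (cases "lo \<le> of_int \<lfloor>p / h\<rfloor> * h")
    case True
    then show ?thesis using 1 p by (intro bexI[of _ "\<lfloor>p / h\<rfloor>"]) auto
  next
    case False
    then show ?thesis using 1 2 assms by (intro bexI[of _ "\<lfloor>p / h\<rfloor> + 1"]) auto
  qed
qed

text \<open>The counterpart for the upper half of a box, which is open at the cut \<open>c\<close>;
  strictness at \<open>c\<close> has to be preserved.\<close>

lemma floor_cut':
  fixes p c h hi :: real
  assumes h: "0 < h" and hi: "p \<le> hi" "c + h \<le> hi" and p: "c < p"
  shows "\<exists>z\<in>{\<lfloor>p / h\<rfloor>, \<lfloor>p / h\<rfloor> + 1}. c < of_int z * h \<and> of_int z * h \<le> hi"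
proof -
  have 1: "of_int \<lfloor>p / h\<rfloor> * h \<le> p" "p < of_int (\<lfloor>p / h\<rfloor> + 1) * h"
    using h by (simp_all add: pos_le_divide_eq[symmetric] pos_divide_less_eq[symmetric])
  have 2: "of_int (\<lfloor>p / h\<rfloor> + 1) * h = of_int \<lfloor>p / h\<rfloor> * h + h"
    by (simp add: distrib_right)
  show ?thesis
  proof (cases "c < of_int \<lfloor>p / h\<rfloor> * h")
    case True
    then show ?thesis using 1 hi by (intro bexI[of _ "\<lfloor>p / h\<rfloor>"]) auto
  next
    case False
    then show ?thesis using 1 2 assms by (intro bexI[of _ "\<lfloor>p / h\<rfloor> + 1"]) auto
  qed
qed

text \<open>All that the geometric arguments use about the finished tree. A leaf is a node with
  \<open>lmx x = 0\<close>, so its points coincide. The assumption \<open>cut\<close> records that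
  two points attain the longest side and that the cut is halfway between them; it leaves open which
  child is the lower one.\<close>

locale split_tree =
  fixes Z :: "nat \<Rightarrow> real ^ 'q::finite" and n m :: nat and pts :: "nat \<Rightarrow> nat set"
    and ch par rep :: "nat \<Rightarrow> nat" and lmx :: "nat \<Rightarrow> real"
  assumes root: "pts 0 = {..<n}" "0 < m"
    and rep: "x < m \<Longrightarrow> rep x \<in> pts x"
    and lmx0: "x < m \<Longrightarrow> 0 \<le> lmx x"
    and width: "x < m \<Longrightarrow> i \<in> pts x \<Longrightarrow> j \<in> pts x \<Longrightarrow> \<bar>Z i $ k - Z j $ k\<bar> \<le> lmx x"
    and children: "x < m \<Longrightarrow> 0 < lmx x \<Longrightarrow> x < ch x \<and> ch x + 1 < m \<and> par (ch x) = x \<and> par (ch x + 1) = x"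
    and cut: "x < m \<Longrightarrow> 0 < lmx x \<Longrightarrow> \<exists>k c. (\<exists>i\<in>pts x. Z i $ k = c - lmx x / 2) \<and> (\<exists>i\<in>pts x. Z i $ k = c + lmx x / 2) \<and>
       (pts (ch x) = {i \<in> pts x. Z i $ k \<le> c} \<and> pts (ch x + 1) = {i \<in> pts x. c < Z i $ k} \<or>
        pts (ch x) = {i \<in> pts x. c < Z i $ k} \<and> pts (ch x + 1) = {i \<in> pts x. Z i $ k \<le> c})"
    and parent: "0 < x \<Longrightarrow> x < m \<Longrightarrow> par x < m \<and> 0 < lmx (par x) \<and> (x = ch (par x) \<or> x = ch (par x) + 1)"
begin

lemma pts_nonempty: "x < m \<Longrightarrow> pts x \<noteq> {}"
  using rep by blast

lemma pts_children: "x < m \<Longrightarrow> 0 < lmx x \<Longrightarrow> pts (ch x) \<union> pts (ch x + 1) = pts x \<and> pts (ch x) \<inter> pts (ch x + 1) = {}"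
  using cut[of x] by (auto simp: not_le)

lemma par_less: "0 < x \<Longrightarrow> x < m \<Longrightarrow> par x < x"
  using parent[of x] children[of "par x"] by auto

lemma pts_par: "0 < x \<Longrightarrow> x < m \<Longrightarrow> pts x \<subseteq> pts (par x)"
  using parent[of x] pts_children[of "par x"] by auto

lemma pts_root: "x < m \<Longrightarrow> pts x \<subseteq> {..<n}"
proof (induction x rule: less_induct)
  case (less x)
  then show ?case using root pts_par[of x] par_less[of x] by (cases "x = 0") force+
qed

lemma finite_pts: "x < m \<Longrightarrow> finite (pts x)"
  using pts_root finite_subset by blast

text \<open>A positive \<open>lmx x\<close> is a coordinate difference of two points of
  \<open>x\<close>, and these lie in the parent as well.\<close>

lemma lmx_par: "0 < x \<Longrightarrow> x < m \<Longrightarrow> lmx x \<le> lmx (par x)"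
proof (cases "0 < lmx x")
  case True
  assume x: "0 < x" "x < m"
  obtain k c where "\<exists>i\<in>pts x. Z i $ k = c - lmx x / 2" "\<exists>i\<in>pts x. Z i $ k = c + lmx x / 2"
    using cut[OF x(2) True] by blast
  then obtain i j where "i \<in> pts x" "j \<in> pts x" "Z j $ k - Z i $ k = lmx x" by force
  moreover from this have "\<bar>Z j $ k - Z i $ k\<bar> \<le> lmx (par x)"
    using width[of "par x" j i k] parent[OF x] pts_par[OF x] by blast
  ultimately show ?thesis by linarith
next
  case False
  assume x: "0 < x" "x < m"
  then show ?thesis using False parent[OF x] by auto
qed

section \<open>Ancestors and the order of refinement\<close>

inductive anc :: "nat \<Rightarrow> nat \<Rightarrow> bool" where
  refl: "x < m \<Longrightarrow> anc x x"
| step: "anc x (par y) \<Longrightarrow> 0 < y \<Longrightarrow> y < m \<Longrightarrow> anc x y"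

lemma anc_less: "anc x y \<Longrightarrow> x < m \<and> y < m"
  by (induction rule: anc.induct) auto

lemma anc_pts: "anc x y \<Longrightarrow> pts y \<subseteq> pts x"
  by (induction rule: anc.induct) (use pts_par in auto)

lemma anc_child: "anc x y \<Longrightarrow> x \<noteq> y \<Longrightarrow> 0 < lmx x \<and> (anc (ch x) y \<or> anc (ch x + 1) y)"
proof (induction rule: anc.induct)
  case (step x y)
  show ?case
  proof (cases "x = par y")
    case True
    then show ?thesis using parent[OF step(2,3)] anc.refl[OF step(3)] by auto
  next
    case False
    then show ?thesis using step anc.step by blast
  qed
qed simp

text \<open>The node with the larger number is replaced by its parent until the two paths meet; they
  leave the meeting point \<open>z\<close> through different children. This yields the cut that
  separates incomparable nodes.\<close>

lemma anc_cases:
  assumes "x < m" "y < m"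
  shows "anc x y \<or> anc y x \<or> (\<exists>z<m. 0 < lmx z \<and> (anc (ch z) x \<and> anc (ch z + 1) y \<or> anc (ch z + 1) x \<and> anc (ch z) y))"
  using assms
proof (induction "x + y" arbitrary: x y rule: less_induct)
  case less
  have *: "anc x y \<or> anc y x \<or> (\<exists>z<m. 0 < lmx z \<and> (anc (ch z) x \<and> anc (ch z + 1) y \<or> anc (ch z + 1) x \<and> anc (ch z) y))"
    if xy: "x < y" "x < m" "y < m" and
      IH: "anc x (par y) \<or> anc (par y) x \<or> (\<exists>z<m. 0 < lmx z \<and> (anc (ch z) x \<and> anc (ch z + 1) (par y) \<or> anc (ch z + 1) x \<and> anc (ch z) (par y)))"
    for x y
  proof -
    have y0: "0 < y" using xy by simp
    note p = parent[OF y0 xy(3)]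
    consider "anc x (par y)" | "anc (par y) x" "par y \<noteq> x" |
      "\<exists>z<m. 0 < lmx z \<and> (anc (ch z) x \<and> anc (ch z + 1) (par y) \<or> anc (ch z + 1) x \<and> anc (ch z) (par y))"
      using IH anc.refl xy by metis
    then show ?thesis
    proof cases
      case 1
      then show ?thesis using anc.step y0 xy by blast
    next
      case 2
      then show ?thesis using anc_child[OF 2] p anc.refl[OF xy(3)] by metis
    next
      case 3
      then show ?thesis using anc.step y0 xy by blast
    qed
  qed
  consider "x = y" | "x < y" | "y < x" by linarith
  then show ?case
  proof cases
    case 1
    then show ?thesis using anc.refl less by auto
  next
    case 2
    then show ?thesis using *[OF 2 less.prems] less.hyps[of x "par y"] par_less[of y] less.prems by auto
  next
    case 3
    then show ?thesis using *[OF 3 less.prems(2,1)] less.hyps[of y "par x"] par_less[of x] less.prems by auto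
  qed
qed

lemma laminar:
  assumes "x < m" "y < m"
  shows "anc x y \<or> anc y x \<or> pts x \<inter> pts y = {}"
  using anc_cases[OF assms] pts_children anc_pts by blast

lemma leaf_anc: "anc x y \<Longrightarrow> lmx x = 0 \<Longrightarrow> x = y"
  using anc_child by fastforce

text \<open>Larger boxes come first. A child may have the same \<open>lmx\<close> as its parent, and
  then the numbers decide, so that a parent always precedes its children.\<close>

definition prec :: "nat \<Rightarrow> nat \<Rightarrow> bool" where
  "prec x y \<longleftrightarrow> lmx y < lmx x \<or> lmx x = lmx y \<and> x < y"

lemma prec_trans: "prec x y \<Longrightarrow> prec y z \<Longrightarrow> prec x z"
  by (auto simp: prec_def)

lemma prec_par: "0 < y \<Longrightarrow> y < m \<Longrightarrow> prec (par y) y"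
  using lmx_par[of y] par_less[of y] by (auto simp: prec_def)

lemma prec_total: "prec x y \<or> x = y \<or> prec y x"
  by (auto simp: prec_def)

lemma prec_irrefl: "\<not> prec x x"
  by (auto simp: prec_def)

lemma anc_prec: "anc x y \<Longrightarrow> x = y \<or> prec x y"
  by (induction rule: anc.induct) (use prec_par prec_trans in blast)+

section \<open>Packing of nodes by grid points\<close>

definition cut_of :: "nat \<Rightarrow> 'q \<times> real" where
  "cut_of x = (SOME (k, c). (\<exists>i\<in>pts x. Z i $ k = c - lmx x / 2) \<and> (\<exists>i\<in>pts x. Z i $ k = c + lmx x / 2) \<and>
       (pts (ch x) = {i \<in> pts x. Z i $ k \<le> c} \<and> pts (ch x + 1) = {i \<in> pts x. c < Z i $ k} \<or>
        pts (ch x) = {i \<in> pts x. c < Z i $ k} \<and> pts (ch x + 1) = {i \<in> pts x. Z i $ k \<le> c}))"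

definition axis :: "nat \<Rightarrow> 'q" where "axis x = fst (cut_of x)"
definition mid :: "nat \<Rightarrow> real" where "mid x = snd (cut_of x)"
definition below :: "nat \<Rightarrow> bool" where "below y \<longleftrightarrow> pts y = {i \<in> pts (par y). Z i $ axis (par y) \<le> mid (par y)}"

text \<open>The condition that the cut just above \<open>y\<close> imposes, extended from points to
  arbitrary values of the coordinate that is cut.\<close>

definition side :: "nat \<Rightarrow> real \<Rightarrow> bool" where
  "side y t \<longleftrightarrow> (if below y then t \<le> mid (par y) else mid (par y) < t)"

lemma cut_of:
  assumes "x < m" "0 < lmx x"
  shows "\<exists>i\<in>pts x. Z i $ axis x = mid x - lmx x / 2" "\<exists>i\<in>pts x. Z i $ axis x = mid x + lmx x / 2"
    "pts (ch x) = {i \<in> pts x. Z i $ axis x \<le> mid x} \<and> pts (ch x + 1) = {i \<in> pts x. mid x < Z i $ axis x} \<or>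
        pts (ch x) = {i \<in> pts x. mid x < Z i $ axis x} \<and> pts (ch x + 1) = {i \<in> pts x. Z i $ axis x \<le> mid x}"
proof -
  define A where "A = (\<lambda>(k, c). (\<exists>i\<in>pts x. Z i $ k = c - lmx x / 2) \<and> (\<exists>i\<in>pts x. Z i $ k = c + lmx x / 2) \<and>
       (pts (ch x) = {i \<in> pts x. Z i $ k \<le> c} \<and> pts (ch x + 1) = {i \<in> pts x. c < Z i $ k} \<or>
        pts (ch x) = {i \<in> pts x. c < Z i $ k} \<and> pts (ch x + 1) = {i \<in> pts x. Z i $ k \<le> c}))"
  have "\<exists>kc. A kc" using cut[OF assms] unfolding A_def by auto
  then have "A (cut_of x)" unfolding cut_of_def A_def[symmetric] by (rule someI_ex)
  then show "\<exists>i\<in>pts x. Z i $ axis x = mid x - lmx x / 2" "\<exists>i\<in>pts x. Z i $ axis x = mid x + lmx x / 2"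
    "pts (ch x) = {i \<in> pts x. Z i $ axis x \<le> mid x} \<and> pts (ch x + 1) = {i \<in> pts x. mid x < Z i $ axis x} \<or>
        pts (ch x) = {i \<in> pts x. mid x < Z i $ axis x} \<and> pts (ch x + 1) = {i \<in> pts x. Z i $ axis x \<le> mid x}"
    unfolding A_def axis_def mid_def by (simp_all add: case_prod_beta)
qed

lemma below_sibling:
  assumes "x < m" "0 < lmx x"
  shows "below (ch x) \<longleftrightarrow> \<not> below (ch x + 1)"
proof -
  have "par (ch x) = x" "par (ch x + 1) = x" "ch x < m" "ch x + 1 < m" using children[OF assms] by auto
  moreover have "pts (ch x) \<noteq> pts (ch x + 1)"
    using pts_children[OF assms] pts_nonempty[of "ch x"] calculation by auto
  ultimately show ?thesis using cut_of(3)[OF assms] unfolding below_def by auto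
qed

lemma side_pts:
  assumes "0 < y" "y < m" "i \<in> pts y"
  shows "side y (Z i $ axis (par y))"
proof -
  note p = parent[OF assms(1,2)]
  note c = cut_of(3)[of "par y"]
  show ?thesis
  proof (cases "below y")
    case True
    then show ?thesis using assms by (auto simp: side_def below_def)
  next
    case False
    then have "pts y = {i \<in> pts (par y). mid (par y) < Z i $ axis (par y)}"
      using c p unfolding below_def by (metis (no_types, lifting))
    then show ?thesis using assms False by (auto simp: side_def)
  qed
qed

text \<open>A side of a cut is an interval, and the points of \<open>y\<close> are all on the same
  side of a cut above \<open>y\<close>.\<close>

lemma side_between:
  assumes "anc c y" "0 < c" "i \<in> pts y" "j \<in> pts y" "Z i $ axis (par c) \<le> t" "t \<le> Z j $ axis (par c)"
  shows "side c t"
proof -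
  have "side c (Z i $ axis (par c))" "side c (Z j $ axis (par c))"
    using side_pts anc_pts[OF assms(1)] anc_less[OF assms(1)] assms by blast+
  then show ?thesis using assms(5,6) by (auto simp: side_def split: if_splits)
qed

lemma anc_cases_step: "anc c y \<Longrightarrow> c = y \<or> (0 < y \<and> anc c (par y))"
  by (cases rule: anc.cases) auto

text \<open>Along axis \<open>k\<close> only the last cut with this axis matters. The half of the
  box that it leaves has length \<open>lmx / 2\<close>, at least the mesh \<open>h\<close>, and so
  contains a grid value next to the coordinate of \<open>p\<close>. This value lies between two
  points of the box that was cut, whence it satisfies all earlier cuts. Two candidates per axis keep
  the number of grid points bounded.\<close>

lemma grid_point:
  assumes "0 < h" "0 < y" "y < m" "2 * h \<le> lmx (par y)" "p \<in> pts y"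
  shows "\<exists>z\<in>{\<lfloor>Z p $ k / h\<rfloor>, \<lfloor>Z p $ k / h\<rfloor> + 1}. \<forall>c. anc c y \<and> 0 < c \<and> axis (par c) = k \<longrightarrow> side c (of_int z * h)"
  using assms(2-5)
proof (induction y rule: less_induct)
  case (less y)
  note y = less.prems(1,2)
  note p = parent[OF y]
  note cu = cut_of[of "par y"]
  have py: "p \<in> pts (par y)" using less.prems pts_par by blast
  show ?case
  proof (cases "axis (par y) = k")
    case True
    obtain i j where ij: "i \<in> pts (par y)" "Z i $ k = mid (par y) - lmx (par y) / 2"
       "j \<in> pts (par y)" "Z j $ k = mid (par y) + lmx (par y) / 2"
      using cu p True by blast
    have w: "Z i $ k \<le> Z p $ k" "Z p $ k \<le> Z j $ k"
    proof -
      have "\<bar>Z j $ k - Z p $ k\<bar> \<le> lmx (par y)" "\<bar>Z i $ k - Z p $ k\<bar> \<le> lmx (par y)"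
        using width ij p py by blast+
      then show "Z i $ k \<le> Z p $ k" "Z p $ k \<le> Z j $ k" using ij by linarith+
    qed
    have sp: "side y (Z p $ k)" using side_pts[OF y less.prems(4)] True by simp
    \<comment> \<open>The newest cut is satisfied by assumption on \<open>t\<close>, all older ones
      by \<open>side_between\<close> with the extreme points \<open>i\<close> and \<open>j\<close>
      of the parent.\<close>
    have *: "\<forall>c. anc c y \<and> 0 < c \<and> axis (par c) = k \<longrightarrow> side c t"
      if t: "Z i $ k \<le> t" "t \<le> Z j $ k" "side y t" for t
    proof (intro allI impI, elim conjE)
      fix c assume c: "anc c y" "0 < c" "axis (par c) = k"
      from anc_cases_step[OF c(1)] show "side c t"
      proof (elim disjE conjE)
        assume "anc c (par y)"
        from side_between[OF this c(2) ij(1,3)] show ?thesis using c(3) t by simp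
      qed (use t in simp)
    qed
    show ?thesis
    proof (cases "below y")
      case True
      have "\<exists>z\<in>{\<lfloor>Z p $ k / h\<rfloor>, \<lfloor>Z p $ k / h\<rfloor> + 1}. Z i $ k \<le> of_int z * h \<and> of_int z * h \<le> mid (par y)"
        using assms(1) w ij less.prems sp True by (intro floor_cut) (auto simp: side_def)
      then obtain z where z: "z \<in> {\<lfloor>Z p $ k / h\<rfloor>, \<lfloor>Z p $ k / h\<rfloor> + 1}" "Z i $ k \<le> of_int z * h" "of_int z * h \<le> mid (par y)"
        by blast
      have "of_int z * h \<le> Z j $ k" using z(3) ij(4) lmx0[of "par y"] p by simp
      then show ?thesis using *[of "of_int z * h"] z True by (intro bexI[OF _ z(1)]) (simp add: side_def)
    next
      case False
      have "\<exists>z\<in>{\<lfloor>Z p $ k / h\<rfloor>, \<lfloor>Z p $ k / h\<rfloor> + 1}. mid (par y) < of_int z * h \<and> of_int z * h \<le> Z j $ k"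
        using assms(1) w ij less.prems sp False by (intro floor_cut') (auto simp: side_def)
      then obtain z where z: "z \<in> {\<lfloor>Z p $ k / h\<rfloor>, \<lfloor>Z p $ k / h\<rfloor> + 1}" "mid (par y) < of_int z * h" "of_int z * h \<le> Z j $ k"
        by blast
      have "Z i $ k \<le> of_int z * h" using z(2) ij(2) lmx0[of "par y"] p by simp
      then show ?thesis using *[of "of_int z * h"] z False by (intro bexI[OF _ z(1)]) (simp add: side_def)
    qed
  next
    case False
    \<comment> \<open>The cut just above \<open>y\<close> is along another axis, so the conditions
      along \<open>k\<close> are those of the parent.\<close>
    have *: "c \<noteq> y \<and> anc c (par y)" if "anc c y \<and> 0 < c \<and> axis (par c) = k" for c
      using that anc_cases_step[of c y] False by auto
    show ?thesis
    proof (cases "par y = 0")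
      case True
      then have "\<not> (anc c y \<and> 0 < c \<and> axis (par c) = k)" for c
        using * anc_cases_step[of c 0] by auto
      then show ?thesis by blast
    next
      case nz: False
      have "2 * h \<le> lmx (par (par y))" using lmx_par[of "par y"] nz p less.prems by auto
      then have "\<exists>z\<in>{\<lfloor>Z p $ k / h\<rfloor>, \<lfloor>Z p $ k / h\<rfloor> + 1}.
          \<forall>c. anc c (par y) \<and> 0 < c \<and> axis (par c) = k \<longrightarrow> side c (of_int z * h)"
        using nz p py by (intro less.IH par_less[OF y]) auto
      then obtain z where z: "z \<in> {\<lfloor>Z p $ k / h\<rfloor>, \<lfloor>Z p $ k / h\<rfloor> + 1}"
        "\<forall>c. anc c (par y) \<and> 0 < c \<and> axis (par c) = k \<longrightarrow> side c (of_int z * h)"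
        by blast
      show ?thesis by (rule bexI[OF _ z(1)]) (use z(2) * in blast)
    qed
  qed
qed

text \<open>Each node of \<open>S\<close> gets one grid point by \<open>grid_point\<close>, applied
  axis by axis. Two nodes of \<open>S\<close> are separated by a cut, and along its axis their grid
  points lie on different sides. All grid points are near \<open>c\<close>, so there are boundedly
  many.\<close>

lemma packing:
  fixes A :: nat and S :: "nat set"
  assumes S: "S \<subseteq> {0<..<m}" and dj: "\<And>x y. x \<in> S \<Longrightarrow> y \<in> S \<Longrightarrow> x \<noteq> y \<Longrightarrow> \<not> anc x y"
    and l: "0 < l" "\<And>x. x \<in> S \<Longrightarrow> l \<le> lmx (par x)"
    and near: "\<And>x k. x \<in> S \<Longrightarrow> \<bar>Z (rep x) $ k - c $ k\<bar> \<le> real A * l"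
  shows "card S \<le> (4 * A + 2) ^ CARD('q)"
proof -
  \<comment> \<open>Halving a side of length at least \<open>l\<close> leaves at least this mesh on
    either side of the cut.\<close>
  define h where "h = l / 2"
  have h: "0 < h" "2 * h = l" using l by (auto simp: h_def)
  define f where "f x k = (SOME z. z \<in> {\<lfloor>Z (rep x) $ k / h\<rfloor>, \<lfloor>Z (rep x) $ k / h\<rfloor> + 1} \<and>
    (\<forall>c. anc c x \<and> 0 < c \<and> axis (par c) = k \<longrightarrow> side c (of_int z * h)))" for x k
  have f: "f x k \<in> {\<lfloor>Z (rep x) $ k / h\<rfloor>, \<lfloor>Z (rep x) $ k / h\<rfloor> + 1}"
     "\<forall>c. anc c x \<and> 0 < c \<and> axis (par c) = k \<longrightarrow> side c (of_int (f x k) * h)" if "x \<in> S" for x k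
  proof -
    have "x < m" "0 < x" using S that by auto
    then have "\<exists>z. z \<in> {\<lfloor>Z (rep x) $ k / h\<rfloor>, \<lfloor>Z (rep x) $ k / h\<rfloor> + 1} \<and>
      (\<forall>c. anc c x \<and> 0 < c \<and> axis (par c) = k \<longrightarrow> side c (of_int z * h))"
      using grid_point[OF h(1), of x "rep x" k] l(2)[OF that] h(2) rep[of x] by auto
    from someI_ex[OF this] show "f x k \<in> {\<lfloor>Z (rep x) $ k / h\<rfloor>, \<lfloor>Z (rep x) $ k / h\<rfloor> + 1}"
     "\<forall>c. anc c x \<and> 0 < c \<and> axis (par c) = k \<longrightarrow> side c (of_int (f x k) * h)" unfolding f_def by auto
  qed
  have rng: "f x k \<in> {\<lfloor>c $ k / h\<rfloor> - 2 * int A..\<lfloor>c $ k / h\<rfloor> + 2 * int A + 1}" if "x \<in> S" for x k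
  proof -
    have "real A * l = 2 * real A * h" using h by (simp add: h_def)
    then have "\<bar>Z (rep x) $ k - c $ k\<bar> \<le> 2 * real A * h" using near[OF that, of k] by linarith
    then have "\<bar>Z (rep x) $ k / h - c $ k / h\<bar> \<le> 2 * real A"
      using h(1) by (simp add: diff_divide_distrib[symmetric] abs_divide pos_divide_le_eq)
    then have "c $ k / h - of_int (2 * int A) \<le> Z (rep x) $ k / h" "Z (rep x) $ k / h \<le> c $ k / h + of_int (2 * int A)"
      unfolding of_int_mult of_int_of_nat_eq of_int_numeral by linarith+
    then have "\<lfloor>c $ k / h\<rfloor> - 2 * int A \<le> \<lfloor>Z (rep x) $ k / h\<rfloor>" "\<lfloor>Z (rep x) $ k / h\<rfloor> \<le> \<lfloor>c $ k / h\<rfloor> + 2 * int A"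
      by (metis floor_mono floor_diff_of_int, metis floor_mono floor_add_int)
    then show ?thesis using f(1)[OF that, of k] by auto
  qed
  have "inj_on f S"
  proof (rule inj_onI, rule ccontr)
    fix x y assume xy: "x \<in> S" "y \<in> S" "f x = f y" "x \<noteq> y"
    have "x < m" "y < m" using S xy by auto
    then obtain z u v where z: "z < m" "0 < lmx z" "anc u x" "anc v y" and
      uv: "u = ch z \<and> v = ch z + 1 \<or> u = ch z + 1 \<and> v = ch z"
      using anc_cases[of x y] dj[of x y] dj[of y x] xy by blast
    have c: "0 < u" "0 < v" "par u = z" "par v = z" using children[OF z(1,2)] uv by auto
    have "side u (of_int (f x (axis z)) * h)" "side v (of_int (f y (axis z)) * h)"
      using f(2)[OF xy(1), rule_format, of u "axis z"] f(2)[OF xy(2), rule_format, of v "axis z"] z c by simp_all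
    moreover have "below u \<longleftrightarrow> \<not> below v" using below_sibling[OF z(1,2)] uv by blast
    ultimately show False using xy c unfolding side_def by (auto split: if_splits)
  qed
  then have "card S = card (f ` S)" by (simp add: card_image)
  moreover have "f ` S \<subseteq> (\<Pi>\<^sub>E k\<in>UNIV. {\<lfloor>c $ k / h\<rfloor> - 2 * int A..\<lfloor>c $ k / h\<rfloor> + 2 * int A + 1})"
    using rng by auto
  moreover have "finite (\<Pi>\<^sub>E k\<in>(UNIV::'q set). {\<lfloor>c $ k / h\<rfloor> - 2 * int A..\<lfloor>c $ k / h\<rfloor> + 2 * int A + 1})"
    by (intro finite_PiE) auto
  ultimately have "card S \<le> card (\<Pi>\<^sub>E k\<in>(UNIV::'q set). {\<lfloor>c $ k / h\<rfloor> - 2 * int A..\<lfloor>c $ k / h\<rfloor> + 2 * int A + 1})"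
    by (simp only: card_mono)
  \<comment> \<open>The distance \<open>A * l\<close> is \<open>2 * A\<close> meshes in either
    direction, and rounding up adds one more value.\<close>
  also have "\<dots> = (\<Prod>k\<in>(UNIV::'q set). 4 * A + 2)"
    by (subst card_PiE) (auto intro!: prod.cong simp: nat_add_distrib nat_mult_distrib)
  finally show ?thesis by simp
qed

section \<open>Well-separated pairs of nodes\<close>

definition rad :: "nat \<Rightarrow> real" where "rad x = sqrt (real CARD('q)) * lmx x"

lemma rad0: "x < m \<Longrightarrow> 0 \<le> rad x"
  using lmx0 by (simp add: rad_def)

lemma rad_sq: "(rad x)\<^sup>2 = real CARD('q) * (lmx x)\<^sup>2"
  by (simp add: rad_def power_mult_distrib)

lemma dist_pts: "x < m \<Longrightarrow> i \<in> pts x \<Longrightarrow> j \<in> pts x \<Longrightarrow> dist (Z i) (Z j) \<le> rad x"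
proof -
  assume x: "x < m" "i \<in> pts x" "j \<in> pts x"
  have "(\<Sum>k\<in>UNIV. (dist (Z i $ k) (Z j $ k))\<^sup>2) \<le> (\<Sum>k\<in>(UNIV::'q set). (lmx x)\<^sup>2)"
    using width[OF x] lmx0[OF x(1)] by (intro sum_mono) (simp add: dist_real_def abs_le_square_iff[symmetric])
  also have "\<dots> = (rad x)\<^sup>2" by (simp add: rad_sq)
  finally have "sqrt (\<Sum>k\<in>UNIV. (dist (Z i $ k) (Z j $ k))\<^sup>2) \<le> rad x"
    using rad0[OF x(1)] real_le_lsqrt by blast
  then show ?thesis by (simp add: dist_vec_def L2_set_def)
qed

text \<open>A test on representatives only. Its factor 6 leaves a factor 4 for arbitrary points of
  the two nodes, since each is within \<open>rad\<close> of its representative. It is squared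
  because the machine cannot extract roots.\<close>

definition sep :: "nat \<Rightarrow> nat \<Rightarrow> bool" where
  "sep x y \<longleftrightarrow> 36 * (rad x)\<^sup>2 < (dist (Z (rep x)) (Z (rep y)))\<^sup>2 \<and> 36 * (rad y)\<^sup>2 < (dist (Z (rep x)) (Z (rep y)))\<^sup>2"

lemma sep_iff: "x < m \<Longrightarrow> y < m \<Longrightarrow> sep x y \<longleftrightarrow> 6 * rad x < dist (Z (rep x)) (Z (rep y)) \<and> 6 * rad y < dist (Z (rep x)) (Z (rep y))"
proof -
  assume a: "x < m" "y < m"
  have *: "36 * r\<^sup>2 < d\<^sup>2 \<longleftrightarrow> 6 * r < d" if "0 \<le> r" "0 \<le> d" for r d :: real
  proof -
    have "36 * r\<^sup>2 = (6 * r)\<^sup>2" by (simp add: power_mult_distrib)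
    then show ?thesis using that using power_less_imp_less_base[of "6 * r" 2 d] power_strict_mono[of "6 * r" d 2] by auto
  qed
  show ?thesis unfolding sep_def using rad0 a * by simp
qed

lemma sep_dist:
  assumes "x < m" "y < m" "sep x y" "i \<in> pts x" "j \<in> pts y"
  shows "4 * rad x < dist (Z i) (Z j)" "4 * rad y < dist (Z i) (Z j)"
proof -
  have "dist (Z i) (Z (rep x)) \<le> rad x" "dist (Z j) (Z (rep y)) \<le> rad y"
    using dist_pts assms rep by auto
  moreover have "dist (Z (rep x)) (Z (rep y)) \<le> dist (Z i) (Z (rep x)) + dist (Z i) (Z j) + dist (Z j) (Z (rep y))"
    by metric
  ultimately show "4 * rad x < dist (Z i) (Z j)" "4 * rad y < dist (Z i) (Z j)"
    using assms(3) sep_iff[OF assms(1,2)] by linarith+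
qed

text \<open>Bounding the square root of the dimension by the dimension itself gives an integer
  factor, as \<open>packing\<close> demands.\<close>

lemma near_coords:
  assumes "x < m" "y < m" "\<not> sep x y" "lmx x \<le> l" "lmx y \<le> l"
  shows "\<bar>Z (rep x) $ k - Z (rep y) $ k\<bar> \<le> real (6 * CARD('q)) * l"
proof -
  have l: "0 \<le> l" using assms lmx0[of x] by linarith
  have q: "1 \<le> real CARD('q)" using zero_less_card_finite[where 'a='q] by linarith
  have "sqrt (real CARD('q)) \<le> real CARD('q)"
    using q by (intro real_le_lsqrt) (auto simp: power2_eq_square)
  then have r: "rad z \<le> real CARD('q) * l" if "z < m" "lmx z \<le> l" for z
    unfolding rad_def using that lmx0[OF that(1)] q by (intro mult_mono) auto
  have "dist (Z (rep x)) (Z (rep y)) \<le> 6 * (real CARD('q) * l)"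
    using assms r[of x] r[of y] sep_iff[OF assms(1,2)] by linarith
  moreover have "dist (Z (rep x) $ k) (Z (rep y) $ k) \<le> dist (Z (rep x)) (Z (rep y))" by (rule dist_vec_nth_le)
  ultimately show ?thesis by (simp add: dist_real_def)
qed

text \<open>The nodes that are split while the list of nodes not yet separated from \<open>y\<close> is refined.\<close>

definition split_by :: "nat \<Rightarrow> nat set" where
  "split_by y = {x. x < m \<and> 0 < y \<and> y < m \<and> prec x y \<and> \<not> sep x y \<and> (par y = x \<or> prec (par y) x)}"

text \<open>The bound of \<open>packing\<close> with the factor of
  \<open>near_coords\<close>.\<close>

definition pend_max :: nat where "pend_max = (4 * (6 * CARD('q)) + 2) ^ CARD('q)"

text \<open>Leaves have \<open>rad\<close> zero, and some cut separates the representatives of two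
  different leaves. Refinement therefore ends by separating everything except a leaf from
  itself.\<close>

lemma leaf_sep:
  assumes "x < m" "y < m" "lmx x = 0" "lmx y = 0" "x \<noteq> y"
  shows "sep x y"
proof -
  have "\<not> anc x y" "\<not> anc y x" using leaf_anc assms by blast+
  then obtain z u v where z: "z < m" "0 < lmx z" "anc u x" "anc v y" and
    uv: "u = ch z \<and> v = ch z + 1 \<or> u = ch z + 1 \<and> v = ch z"
    using anc_cases[OF assms(1,2)] by blast
  have "rep x \<in> pts u" "rep y \<in> pts v" using z anc_pts rep assms by blast+
  then have "Z (rep x) $ axis z \<noteq> Z (rep y) $ axis z"
    using uv cut_of(3)[OF z(1,2)] by auto
  then have "Z (rep x) \<noteq> Z (rep y)" by auto
  then show ?thesis using assms by (simp add: sep_def rad_def)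
qed

lemma split_pos: "x \<in> split_by y \<Longrightarrow> 0 < lmx x"
proof (rule ccontr)
  assume a: "x \<in> split_by y" "\<not> 0 < lmx x"
  then have "lmx x = 0" "lmx y = 0" "x \<noteq> y" using lmx0[of x] lmx0[of y] by (auto simp: split_by_def prec_def)
  then show False using leaf_sep[of x y] a by (auto simp: split_by_def)
qed

text \<open>The nodes \<open>y\<close> against which \<open>x\<close> is split have parents that are
  at least as large as \<open>x\<close>, they are near \<open>x\<close>, and none is above another:
  if \<open>y\<close> were above \<open>z\<close>, it would be \<open>par z\<close> or precede it,
  hence come no later than \<open>x\<close>, whereas \<open>x\<close> precedes
  \<open>y\<close>.\<close>

lemma card_split:
  assumes "x < m"
  shows "card {y. x \<in> split_by y} \<le> pend_max"
proof (cases "0 < lmx x")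
  case True
  show ?thesis unfolding pend_max_def
  proof (rule packing[where l = "lmx x" and c = "Z (rep x)"])
    show "{y. x \<in> split_by y} \<subseteq> {0<..<m}" by (auto simp: split_by_def)
  next
    fix y z assume a: "y \<in> {y. x \<in> split_by y}" "z \<in> {y. x \<in> split_by y}" "y \<noteq> z"
    show "\<not> anc y z"
    proof
      assume "anc y z"
      then have "anc y (par z)" using a(3) anc_cases_step by blast
      then have "y = par z \<or> prec y (par z)" by (rule anc_prec)
      then have "prec y x \<or> y = x" using a prec_trans by (auto simp: split_by_def)
      then show False using a prec_trans prec_irrefl by (auto simp: split_by_def)
    qed
  next
    fix y assume "y \<in> {y. x \<in> split_by y}"
    then show "lmx x \<le> lmx (par y)" by (auto simp: split_by_def prec_def)
  next
    fix y k assume "y \<in> {y. x \<in> split_by y}"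
    then show "\<bar>Z (rep y) $ k - Z (rep x) $ k\<bar> \<le> real (6 * CARD('q)) * lmx x"
      using near_coords[of x y "lmx x" k] by (auto simp: split_by_def prec_def abs_minus_commute)
  qed (use True in auto)
next
  case False
  then have "{y. x \<in> split_by y} = {}" using split_pos by blast
  then show ?thesis by simp
qed

text \<open>The nodes at which refinement against \<open>y\<close> pauses: \<open>x\<close> no
  longer precedes \<open>y\<close>, but its parent did and so was split.\<close>

definition pend_ok :: "nat \<Rightarrow> nat \<Rightarrow> bool" where
  "pend_ok x y \<longleftrightarrow> x < m \<and> y < m \<and> \<not> sep x y \<and> (x = y \<or> prec y x) \<and> (x = 0 \<or> prec (par x) y)"

text \<open>Packing around \<open>y\<close> with side \<open>lmx y\<close>. The root has no parent
  to which \<open>packing\<close> applies and is counted separately.\<close>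

lemma card_pend:
  assumes y: "0 < lmx y" "finite S" "\<And>x. x \<in> S \<Longrightarrow> pend_ok x y"
  shows "card S \<le> pend_max + 1"
proof -
  have "card (S - {0}) \<le> pend_max" unfolding pend_max_def
  proof (rule packing[where l = "lmx y" and c = "Z (rep y)"])
    show "S - {0} \<subseteq> {0<..<m}" using y(3) by (auto simp: pend_ok_def)
  next
    fix x z assume a: "x \<in> S - {0}" "z \<in> S - {0}" "x \<noteq> z"
    show "\<not> anc x z"
    proof
      assume "anc x z"
      then have "anc x (par z)" using a(3) anc_cases_step by blast
      then have "x = par z \<or> prec x (par z)" by (rule anc_prec)
      moreover have "prec (par z) y" using y(3)[of z] a by (auto simp: pend_ok_def)
      ultimately have "prec x y" using prec_trans by blast
      then show False using y(3)[of x] a prec_trans prec_irrefl by (auto simp: pend_ok_def)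
    qed
  next
    fix x assume "x \<in> S - {0}"
    then show "lmx y \<le> lmx (par x)" using y(3)[of x] by (auto simp: pend_ok_def prec_def)
  next
    fix x k assume "x \<in> S - {0}"
    then show "\<bar>Z (rep x) $ k - Z (rep y) $ k\<bar> \<le> real (6 * CARD('q)) * lmx y"
      using near_coords[of x y "lmx y" k] y(3)[of x] by (auto simp: pend_ok_def prec_def)
  qed (use y in auto)
  moreover have "card S \<le> card (S - {0}) + 1"
    using y(2) by (cases "0 \<in> S") (simp_all add: card_Diff_singleton)
  ultimately show ?thesis by linarith
qed

text \<open>Free of square roots, the condition is \<open>2 r d < d\<^sup>2 - e\<^sup>2\<close> for the distances \<open>d\<close> and \<open>e\<close> of \<open>a\<close> from the
  representative of \<open>y\<close> and from \<open>b\<close>; it implies \<open>e < d - r\<close>.\<close>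

definition screens :: "nat \<Rightarrow> nat \<Rightarrow> nat \<Rightarrow> bool" where
  "screens y a b \<longleftrightarrow> (let D = (dist (Z a) (Z (rep y)))\<^sup>2; E = (dist (Z a) (Z b))\<^sup>2 in
     E < D \<and> 4 * (rad y)\<^sup>2 * D < (D - E)\<^sup>2)"

lemma screens_closer:
  assumes "y < m" "screens y a b" "j \<in> pts y"
  shows "dist (Z a) (Z b) < dist (Z a) (Z j)"
proof -
  define d where "d = dist (Z a) (Z (rep y))"
  define e where "e = dist (Z a) (Z b)"
  have h: "e\<^sup>2 < d\<^sup>2" "4 * (rad y)\<^sup>2 * d\<^sup>2 < (d\<^sup>2 - e\<^sup>2)\<^sup>2"
    using assms(2) by (auto simp: screens_def d_def e_def Let_def)
  have p: "0 \<le> d" "0 \<le> e" by (auto simp: d_def e_def)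
  have ed: "e < d" using h(1) p by (metis power_less_imp_less_base)
  have "(2 * rad y * d)\<^sup>2 < (d\<^sup>2 - e\<^sup>2)\<^sup>2" using h(2) by (simp add: power_mult_distrib)
  then have "2 * rad y * d < d\<^sup>2 - e\<^sup>2"
    using h(1) power_less_imp_less_base[of "2 * rad y * d" 2 "d\<^sup>2 - e\<^sup>2"] by simp
  also have "\<dots> = (d - e) * (d + e)" by (simp add: power2_eq_square algebra_simps)
  \<comment> \<open>Division by \<open>2 * d\<close> turns the test without roots into
    \<open>rad y < d - e\<close>.\<close>
  also have "\<dots> \<le> (d - e) * (2 * d)" using ed p by (intro mult_left_mono) auto
  finally have "rad y * (2 * d) < (d - e) * (2 * d)" by (simp add: algebra_simps)
  then have "rad y < d - e" using p ed by (simp add: mult_less_cancel_right)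
  moreover have "d \<le> dist (Z a) (Z j) + dist (Z j) (Z (rep y))" unfolding d_def by metric
  moreover have "dist (Z j) (Z (rep y)) \<le> rad y" using dist_pts rep assms by auto
  ultimately show ?thesis unfolding e_def[symmetric] by linarith
qed

text \<open>Three points for each cell of the grid of directions used in \<open>cone\<close>, in
  which every coordinate takes \<open>4 * CARD('q) + 1\<close> values.\<close>

definition list_max :: nat where "list_max = 3 * (4 * CARD('q) + 1) ^ CARD('q)"

text \<open>Among four points in a narrow cone with apex at the representative of \<open>y\<close>, the farthest one
  has three points closer than all of \<open>y\<close>.\<close>

lemma cone:
  assumes y: "y < m" and fin: "finite L" and far: "\<And>a. a \<in> L \<Longrightarrow> 4 * rad y < dist (Z a) (Z (rep y))"
    and big: "list_max < card L"
  shows "\<exists>a\<in>L. 3 \<le> card {b \<in> L. b \<noteq> a \<and> screens y a b}"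
proof -
  define q where "q = real CARD('q)"
  have q: "1 \<le> q" unfolding q_def using zero_less_card_finite[where 'a='q] by linarith
  define p where "p = Z (rep y)"
  define r where "r a = dist (Z a) p" for a
  define u where "u a = (1 / r a) *\<^sub>R (Z a - p)" for a
  \<comment> \<open>The cell of the direction \<open>u a\<close>. Side length
    \<open>1 / (2 * q)\<close> is chosen so that the coordinate differences of two directions in one
    cell sum to at most one half.\<close>
  define g where "g a = (\<lambda>k. \<lfloor>2 * q * u a $ k\<rfloor>)" for a
  have r: "0 < r a" "4 * rad y < r a" if "a \<in> L" for a
    using far[OF that] rad0[OF y] by (auto simp: r_def p_def)
  have nu: "norm (u a) = 1" if "a \<in> L" for a
    using r(1)[OF that] by (simp add: u_def r_def dist_norm)
  have Zu: "Z a - p = r a *\<^sub>R u a" if "a \<in> L" for a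
    using r(1)[OF that] by (simp add: u_def)
  have rng: "g a k \<in> {- 2 * int CARD('q)..2 * int CARD('q)}" if "a \<in> L" for a k
  proof -
    have "\<bar>u a $ k\<bar> \<le> 1" using component_le_norm_cart[of "u a" k] nu[OF that] by simp
    then have "\<bar>2 * q * u a $ k\<bar> \<le> 2 * q" using q by (simp add: abs_mult)
    moreover have "of_int (- 2 * int CARD('q)) = - (2 * q)" "of_int (2 * int CARD('q)) = 2 * q"
      by (simp_all add: q_def)
    ultimately have "of_int (- 2 * int CARD('q)) \<le> 2 * q * u a $ k" "2 * q * u a $ k \<le> of_int (2 * int CARD('q))"
      by linarith+
    then have "- 2 * int CARD('q) \<le> g a k" "g a k \<le> 2 * int CARD('q)"
      unfolding g_def by (metis floor_mono floor_of_int)+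
    then show ?thesis by simp
  qed
  let ?G = "\<Pi>\<^sub>E k\<in>(UNIV::'q set). {- 2 * int CARD('q)..2 * int CARD('q)}"
  have gG: "g \<in> L \<rightarrow> ?G" using rng by auto
  have G: "finite ?G" "card ?G = (4 * CARD('q) + 1) ^ CARD('q)"
    by (auto intro!: finite_PiE simp: card_PiE nat_add_distrib nat_mult_distrib)
  have "\<exists>z\<in>?G. 3 < card {a \<in> L. g a = z}"
  proof (rule ccontr)
    assume "\<not> ?thesis"
    then have le: "card {a \<in> L. g a = z} \<le> 3" if "z \<in> ?G" for z using that by (meson not_less)
    have "L = (\<Union>z\<in>?G. {a \<in> L. g a = z})" using gG by auto
    then have "card L \<le> (\<Sum>z\<in>?G. card {a \<in> L. g a = z})"
      using card_UN_le[OF G(1), of "\<lambda>z. {a \<in> L. g a = z}"] by simp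
    also have "\<dots> \<le> (\<Sum>z\<in>?G. 3)" by (rule sum_mono[OF le])
    also have "\<dots> = list_max" using G(2) by (simp add: list_max_def)
    finally show False using big by simp
  qed
  then obtain z where z: "3 < card {a \<in> L. g a = z}" by blast
  let ?C = "{a \<in> L. g a = z}"
  have fC: "finite ?C" using fin by simp
  have "?C \<noteq> {}" using z by force
  then have "Max (r ` ?C) \<in> r ` ?C" using fC by (intro Max_in) auto
  then obtain a where a: "a \<in> ?C" "r a = Max (r ` ?C)" by auto
  have amax: "r b \<le> r a" if "b \<in> ?C" for b
    unfolding a(2) using that fC by (intro Max_ge) auto
  have scr: "screens y a b" if b: "b \<in> ?C" for b
  proof -
    have aL: "a \<in> L" and bL: "b \<in> L" and ge: "g a = g b" using a b by auto
    have rr: "r b \<le> r a" using amax b by blast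
    have "\<bar>(u a - u b) $ k\<bar> < 1 / (2 * q)" for k
    proof -
      have "\<lfloor>2 * q * u a $ k\<rfloor> = \<lfloor>2 * q * u b $ k\<rfloor>" using ge by (metis g_def)
      then have "\<bar>2 * q * u a $ k - 2 * q * u b $ k\<bar> < 1" by linarith
      then have "(2 * q) * \<bar>(u a - u b) $ k\<bar> < 1"
        using q by (simp add: right_diff_distrib[symmetric] abs_mult)
      then show ?thesis using q by (simp add: field_simps)
    qed
    then have "(\<Sum>k\<in>UNIV. \<bar>(u a - u b) $ k\<bar>) \<le> (\<Sum>k\<in>(UNIV::'q set). 1 / (2 * q))"
      by (intro sum_mono) (simp add: less_imp_le)
    also have "\<dots> = 1 / 2" using q by (simp add: q_def)
    finally have uu: "norm (u a - u b) \<le> 1 / 2" using norm_le_l1_cart order_trans by blast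
    \<comment> \<open>The way from \<open>b\<close> to \<open>a\<close> is composed of a radial part
      of length \<open>r a - r b\<close> and a part across the cone of length at most
      \<open>r b / 2\<close>.\<close>
    have "Z a - Z b = (Z a - p) - (Z b - p)" by simp
    also have "\<dots> = (r a - r b) *\<^sub>R u a + r b *\<^sub>R (u a - u b)"
      unfolding Zu[OF aL] Zu[OF bL] by (simp add: algebra_simps)
    finally have "Z a - Z b = (r a - r b) *\<^sub>R u a + r b *\<^sub>R (u a - u b)" .
    then have "norm (Z a - Z b) \<le> \<bar>r a - r b\<bar> * norm (u a) + \<bar>r b\<bar> * norm (u a - u b)"
      by (metis norm_scaleR norm_triangle_ineq)
    also have "\<dots> \<le> (r a - r b) + r b * (1 / 2)"
    proof -
      have "\<bar>r b\<bar> * norm (u a - u b) \<le> r b * (1 / 2)"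
        using r(1)[OF bL] uu by (intro mult_mono) auto
      then show ?thesis using rr nu[OF aL] by simp
    qed
    finally have d: "dist (Z a) (Z b) \<le> r a - r b / 2" by (simp add: dist_norm)
    define e where "e = dist (Z a) (Z b)"
    \<comment> \<open>Here the factor 4 enters: \<open>r a - e\<close> is at least
      \<open>r b / 2\<close>, which exceeds \<open>2 * rad y\<close>.\<close>
    have e: "0 \<le> e" "e < r a" "2 * rad y < r a - e" using d r[OF bL] by (auto simp: e_def)
    have "r a * (2 * rad y) < r a * (r a - e)" using e r(1)[OF aL] by simp
    also have "\<dots> \<le> (r a + e) * (r a - e)" using e by (intro mult_right_mono) auto
    also have "\<dots> = (r a)\<^sup>2 - e\<^sup>2" by (simp add: power2_eq_square algebra_simps)
    finally have "(r a * (2 * rad y))\<^sup>2 < ((r a)\<^sup>2 - e\<^sup>2)\<^sup>2"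
      using r(1)[OF aL] rad0[OF y] by (intro power_strict_mono) auto
    moreover have "e\<^sup>2 < (r a)\<^sup>2" using e by (intro power_strict_mono) auto
    ultimately show ?thesis unfolding screens_def Let_def e_def r_def p_def
      by (simp add: power_mult_distrib mult.commute mult.left_commute)
  qed
  have "card (?C - {a}) \<ge> 3" using z a fC by simp
  moreover have "?C - {a} \<subseteq> {b \<in> L. b \<noteq> a \<and> screens y a b}" using scr by auto
  moreover have "finite {b \<in> L. b \<noteq> a \<and> screens y a b}" using fin by simp
  ultimately have "3 \<le> card {b \<in> L. b \<noteq> a \<and> screens y a b}"
    by (meson card_mono le_trans)
  then show ?thesis using a by blast
qed

end

section \<open>Construction of the tree\<close>

text \<open>The machine does not multiply natural numbers; the factor is the dimension, a constant
  of the program, so repeated addition is an expression of constant size.\<close>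

primrec mulc :: "nat \<Rightarrow> nexp \<Rightarrow> nexp" where
  "mulc 0 e = NLit 0"
| "mulc (Suc k) e = NAdd e (mulc k e)"

lemma nval_mulc [simp]: "nval (mulc k e) s = k * nval e s"
  by (induction k) auto

definition zc :: "nat \<Rightarrow> nexp \<Rightarrow> nexp \<Rightarrow> rexp" where
  "zc q i k = RGet ''Z'' (NAdd (mulc q i) k)"

definition neq :: "nexp \<Rightarrow> nexp \<Rightarrow> bexp" where
  "neq e f = Neg (Conj (Neg (NLess e f)) (Neg (NLess f e)))"

lemma bval_neq [simp]: "bval (neq e f) s \<longleftrightarrow> nval e s \<noteq> nval f s"
  by (auto simp: neq_def)

abbreviation inc :: "name \<Rightarrow> com" where
  "inc x \<equiv> x ::=\<^sub>n NAdd (NVar x) (NLit 1)"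

section \<open>The invariant of the partially built tree\<close>

locale sample =
  fixes crd :: "nat \<Rightarrow> 'q::finite" and n :: nat and Z :: "nat \<Rightarrow> real ^ 'q"
  assumes crd: "bij_betw crd {..<CARD('q)} UNIV" and n0: "0 < n"
begin

definition X :: "nat \<Rightarrow> nat \<Rightarrow> real" where "X k i = Z i $ crd k"

definition Zin :: "nat \<Rightarrow> real" where
  "Zin = (\<lambda>m. if m < n * CARD('q) then Z (m div CARD('q)) $ crd (m mod CARD('q)) else 0)"

lemma q0: "0 < CARD('q)"
  by (rule zero_less_card_finite)

lemma row_index: "i < a \<Longrightarrow> k < b \<Longrightarrow> b * i + k < b * a" for i a k b :: nat
proof -
  assume a: "i < a" "k < b"
  then have "b * i + k < b * (i + 1)" by simp
  also have "\<dots> \<le> b * a" using a by (intro mult_le_mono2) auto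
  finally show ?thesis .
qed

lemma Zin: "i < n \<Longrightarrow> k < CARD('q) \<Longrightarrow> Zin (CARD('q) * i + k) = X k i"
  using row_index[of i n k "CARD('q)"] by (simp add: Zin_def X_def mult.commute)

lemma rval_zc [simp]:
  "rarr s ''Z'' = Zin \<Longrightarrow> nval i s < n \<Longrightarrow> nval k s < CARD('q) \<Longrightarrow> rval (zc CARD('q) i k) s = X (nval k s) (nval i s)"
  by (simp add: zc_def Zin)

text \<open>The leaves of the current tree: nodes not examined yet (\<open>st\<close> is 0) and
  nodes found to consist of coinciding points.\<close>

definition front :: "state \<Rightarrow> nat \<Rightarrow> bool" where
  "front s x \<longleftrightarrow> x < nvar s ''m'' \<and> (narr s ''st'' x = 0 \<or> rarr s ''lmx'' x = 0)"

definition cut_ok :: "nat set \<Rightarrow> real \<Rightarrow> nat set \<Rightarrow> nat set \<Rightarrow> bool" where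
  "cut_ok P w A B \<longleftrightarrow> (\<exists>k c. (\<exists>i\<in>P. Z i $ k = c - w / 2) \<and> (\<exists>i\<in>P. Z i $ k = c + w / 2) \<and>
     (A = {i \<in> P. Z i $ k \<le> c} \<and> B = {i \<in> P. c < Z i $ k} \<or> A = {i \<in> P. c < Z i $ k} \<and> B = {i \<in> P. Z i $ k \<le> c}))"

definition node_ok :: "(nat \<Rightarrow> nat set) \<Rightarrow> state \<Rightarrow> nat \<Rightarrow> bool" where
  "node_ok pts s x \<longleftrightarrow> (let w = rarr s ''lmx'' x; y = narr s ''ch'' x; lo = narr s ''lo''; hi = narr s ''hi'' in
     narr s ''rep'' x \<in> pts x \<and> 0 \<le> w \<and> (\<forall>i\<in>pts x. \<forall>j\<in>pts x. \<forall>k. \<bar>Z i $ k - Z j $ k\<bar> \<le> w) \<and>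
     (0 < w \<longrightarrow> x < y \<and> y + 1 < nvar s ''m'' \<and> narr s ''par'' y = x \<and> narr s ''par'' (y + 1) = x \<and>
        lo y = lo x \<and> hi y = lo (y + 1) \<and> hi (y + 1) = hi x \<and> cut_ok (pts x) w (pts y) (pts (y + 1))))"

text \<open>The point sets are ghost data. The labelling is a parameter because the array
  \<open>lab\<close> is deliberately out of date while a spine is split off. The equation for
  \<open>m\<close> is the leaf count of a full binary tree; it bounds the number of nodes
  linearly.\<close>

definition tree_inv :: "(nat \<Rightarrow> nat set) \<Rightarrow> (nat \<Rightarrow> nat) \<Rightarrow> state \<Rightarrow> bool" where
  "tree_inv pts lab s \<longleftrightarrow> (let m = nvar s ''m''; lo = narr s ''lo''; hi = narr s ''hi''; st = narr s ''st''; par = narr s ''par'' in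
     0 < m \<and> pts 0 = {..<n} \<and>
     (\<forall>x<m. pts x \<noteq> {} \<and> pts x \<subseteq> {..<n} \<and> lo x + card (pts x) = hi x \<and> hi x \<le> n) \<and>
     (\<forall>x<m. st x \<noteq> 0 \<longrightarrow> node_ok pts s x) \<and>
     (\<forall>x. 0 < x \<and> x < m \<longrightarrow> par x < m \<and> st (par x) \<noteq> 0 \<and> 0 < rarr s ''lmx'' (par x) \<and>
        (x = narr s ''ch'' (par x) \<or> x = narr s ''ch'' (par x) + 1)) \<and>
     (\<forall>i<n. front s (lab i)) \<and> (\<forall>x. front s x \<longrightarrow> pts x = {i. i < n \<and> lab i = x}) \<and>
     (\<forall>x y. front s x \<and> front s y \<and> x \<noteq> y \<longrightarrow> hi x \<le> lo y \<or> hi y \<le> lo x) \<and>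
     m + 1 = 2 * card {x. front s x} \<and> (\<forall>x\<ge>m. st x = 0))"

lemma tree_invD:
  assumes "tree_inv pts lab s"
  shows "0 < nvar s ''m''" "pts 0 = {..<n}"
    "x < nvar s ''m'' \<Longrightarrow> pts x \<noteq> {}" "x < nvar s ''m'' \<Longrightarrow> pts x \<subseteq> {..<n}"
    "x < nvar s ''m'' \<Longrightarrow> narr s ''lo'' x + card (pts x) = narr s ''hi'' x"
    "x < nvar s ''m'' \<Longrightarrow> narr s ''hi'' x \<le> n"
    "x < nvar s ''m'' \<Longrightarrow> narr s ''st'' x \<noteq> 0 \<Longrightarrow> node_ok pts s x"
    "0 < x \<Longrightarrow> x < nvar s ''m'' \<Longrightarrow> narr s ''par'' x < nvar s ''m'' \<and> narr s ''st'' (narr s ''par'' x) \<noteq> 0 \<and>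
       0 < rarr s ''lmx'' (narr s ''par'' x) \<and> (x = narr s ''ch'' (narr s ''par'' x) \<or> x = narr s ''ch'' (narr s ''par'' x) + 1)"
    "i < n \<Longrightarrow> front s (lab i)" "front s x \<Longrightarrow> pts x = {i. i < n \<and> lab i = x}"
    "front s x \<Longrightarrow> front s y \<Longrightarrow> x \<noteq> y \<Longrightarrow> narr s ''hi'' x \<le> narr s ''lo'' y \<or> narr s ''hi'' y \<le> narr s ''lo'' x"
    "nvar s ''m'' + 1 = 2 * card {x. front s x}" "nvar s ''m'' \<le> x \<Longrightarrow> narr s ''st'' x = 0"
proof -
  note A1 = assms[unfolded tree_inv_def Let_def]
  note A2 = A1[THEN conjunct2] note A3 = A2[THEN conjunct2] note A4 = A3[THEN conjunct2] note A5 = A4[THEN conjunct2]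
  note A6 = A5[THEN conjunct2] note A7 = A6[THEN conjunct2] note A8 = A7[THEN conjunct2] note A9 = A8[THEN conjunct2]
  show "0 < nvar s ''m''" "pts 0 = {..<n}" "i < n \<Longrightarrow> front s (lab i)"
    "nvar s ''m'' + 1 = 2 * card {x. front s x}" "nvar s ''m'' \<le> x \<Longrightarrow> narr s ''st'' x = 0"
    "front s x \<Longrightarrow> pts x = {i. i < n \<and> lab i = x}"
    using A1[THEN conjunct1] A2[THEN conjunct1] A6[THEN conjunct1] A7[THEN conjunct1] A9 by blast+
  show "x < nvar s ''m'' \<Longrightarrow> pts x \<noteq> {}" "x < nvar s ''m'' \<Longrightarrow> pts x \<subseteq> {..<n}"
    "x < nvar s ''m'' \<Longrightarrow> narr s ''lo'' x + card (pts x) = narr s ''hi'' x"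
    "x < nvar s ''m'' \<Longrightarrow> narr s ''hi'' x \<le> n"
    using A3[THEN conjunct1, rule_format, of x] by simp_all
  show "x < nvar s ''m'' \<Longrightarrow> narr s ''st'' x \<noteq> 0 \<Longrightarrow> node_ok pts s x"
    by (rule A4[THEN conjunct1, rule_format])
  show "0 < x \<Longrightarrow> x < nvar s ''m'' \<Longrightarrow> narr s ''par'' x < nvar s ''m'' \<and> narr s ''st'' (narr s ''par'' x) \<noteq> 0 \<and>
       0 < rarr s ''lmx'' (narr s ''par'' x) \<and> (x = narr s ''ch'' (narr s ''par'' x) \<or> x = narr s ''ch'' (narr s ''par'' x) + 1)"
    by (rule A5[THEN conjunct1, rule_format]) simp
  show "front s x \<Longrightarrow> front s y \<Longrightarrow> x \<noteq> y \<Longrightarrow> narr s ''hi'' x \<le> narr s ''lo'' y \<or> narr s ''hi'' y \<le> narr s ''lo'' x"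
    by (rule A8[THEN conjunct1, rule_format]) simp
qed

lemma tree_inv_leaf:
  assumes T: "tree_inv pts lab s" and y: "front s y" "narr s ''st'' y = 0" and r: "r \<in> pts y"
    and w: "\<And>i j k. i \<in> pts y \<Longrightarrow> j \<in> pts y \<Longrightarrow> Z i $ k = Z j $ k"
    and s': "nvar s' ''m'' = nvar s ''m''" "narr s' ''st'' = (narr s ''st'')(y := 1)"
      "narr s' ''rep'' = (narr s ''rep'')(y := r)" "rarr s' ''lmx'' = (rarr s ''lmx'')(y := 0)"
      "narr s' ''ch'' = narr s ''ch''" "narr s' ''par'' = narr s ''par''" "narr s' ''lo'' = narr s ''lo''" "narr s' ''hi'' = narr s ''hi''"
  shows "tree_inv pts lab s'"
proof -
  note I = tree_invD[OF T]
  have "front s' x = front s x" for x using y s' by (auto simp: front_def)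
  then have fr: "front s' = front s" by blast
  have ym: "y < nvar s ''m''" using y by (simp add: front_def)
  have nd: "node_ok pts s' x" if "x < nvar s ''m''" "narr s' ''st'' x \<noteq> 0" for x
  proof (cases "x = y")
    case True
    have "\<bar>Z i $ k - Z j $ k\<bar> \<le> rarr s' ''lmx'' y" if "i \<in> pts y" "j \<in> pts y" for i j k using w[OF that] s'(4) by simp
    moreover have "narr s' ''rep'' y \<in> pts y" "0 \<le> rarr s' ''lmx'' y" "\<not> 0 < rarr s' ''lmx'' y" using r s'(3,4) by simp_all
    ultimately show ?thesis unfolding True node_ok_def Let_def by blast
  next
    case False
    then have "node_ok pts s x" using I(7) that s' by simp
    then show ?thesis using False s' by (simp add: node_ok_def Let_def)
  qed
  have "narr s ''par'' x \<noteq> y" if "0 < x" "x < nvar s ''m''" for x using I(8)[OF that] y(2) by auto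
  then show ?thesis
    unfolding tree_inv_def Let_def fr using I nd s' ym by auto
qed

text \<open>The part \<open>A\<close> may be the low or the high side of the cut. Whichever is
  peeled off becomes the first child and takes the front of the segment of \<open>y\<close>.\<close>

lemma tree_inv_split:
  assumes T: "tree_inv pts lab s" and y: "front s y" "narr s ''st'' y = 0" and r: "r \<in> pts y" and w0: "0 < w"
    and w: "\<And>i j k. i \<in> pts y \<Longrightarrow> j \<in> pts y \<Longrightarrow> \<bar>Z i $ k - Z j $ k\<bar> \<le> w"
    and A: "A \<subseteq> pts y" "A \<noteq> {}" "pts y - A \<noteq> {}" and c: "cut_ok (pts y) w A (pts y - A)"
    and m: "m = nvar s ''m''" and s': "nvar s' ''m'' = m + 2" "narr s' ''st'' = (narr s ''st'')(y := 1)"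
      "narr s' ''rep'' = (narr s ''rep'')(y := r)" "rarr s' ''lmx'' = (rarr s ''lmx'')(y := w)"
      "narr s' ''ch'' = (narr s ''ch'')(y := m)" "narr s' ''par'' = (narr s ''par'')(m := y, m + 1 := y)"
      "narr s' ''lo'' = (narr s ''lo'')(m := narr s ''lo'' y, m + 1 := narr s ''lo'' y + card A)"
      "narr s' ''hi'' = (narr s ''hi'')(m := narr s ''lo'' y + card A, m + 1 := narr s ''hi'' y)"
    and lab': "\<And>i. i < n \<Longrightarrow> lab' i = (if i \<in> A then m else if i \<in> pts y then m + 1 else lab i)"
  shows "tree_inv (pts(m := A, m + 1 := pts y - A)) lab' s'"
proof -
  note I = tree_invD[OF T]
  let ?p = "pts(m := A, m + 1 := pts y - A)"
  have ym: "y < m" using y m by (simp add: front_def)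
  have fr: "front s' x \<longleftrightarrow> front s x \<and> x \<noteq> y \<or> x = m \<or> x = m + 1" for x
    using y s' w0 m ym I(13)[of x] by (auto simp: front_def)
  have fin: "finite (pts y)" using I(4) ym m finite_subset by blast
  have cA: "card A + card (pts y - A) = card (pts y)"
    using card_Diff_subset[OF finite_subset[OF A(1) fin] A(1)] card_mono[OF fin A(1)] by simp
  have py: "?p y = pts y" "\<And>x. x < m \<Longrightarrow> ?p x = pts x" "?p m = A" "?p (m + 1) = pts y - A" using ym by auto
  have fm: "x < m" if "front s x" for x using that m by (simp add: front_def)
  have chm: "narr s ''ch'' x + 1 < m" if "x < m" "narr s ''st'' x \<noteq> 0" "0 < rarr s ''lmx'' x" for x
    using I(7)[of x] that m by (simp add: node_ok_def Let_def)
  have nd: "node_ok ?p s' x" if "x < m + 2" "narr s' ''st'' x \<noteq> 0" for x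
  proof (cases "x = y")
    case True
    then show ?thesis using ym r w w0 s' c by (auto simp: node_ok_def Let_def)
  next
    case False
    then have x: "x < m" "narr s ''st'' x \<noteq> 0" using that s' I(13)[of x] m not_le by auto
    then have "node_ok pts s x" using I(7) m by simp
    then show ?thesis using False s' x chm[OF x] m by (auto simp: node_ok_def Let_def)
  qed
  have pr: "narr s' ''par'' x < m + 2 \<and> narr s' ''st'' (narr s' ''par'' x) \<noteq> 0 \<and> 0 < rarr s' ''lmx'' (narr s' ''par'' x) \<and>
        (x = narr s' ''ch'' (narr s' ''par'' x) \<or> x = narr s' ''ch'' (narr s' ''par'' x) + 1)" if "0 < x" "x < m + 2" for x
  proof (cases "x < m")
    case True
    then have "narr s ''par'' x \<noteq> y" using I(8)[of x] that y(2) m by auto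
    then show ?thesis using I(8)[of x] that True m s' by auto
  next
    case False
    then have "x = m \<or> x = m + 1" using that by auto
    then show ?thesis using s' ym w0 by auto
  qed
  have ly: "lab i = y \<longleftrightarrow> i \<in> pts y" if "i < n" for i using I(10)[OF y(1)] that by auto
  have p2: "?p x = {i. i < n \<and> lab' i = x}" if fx: "front s' x" for x
  proof -
    consider "front s x" "x \<noteq> y" | "x = m" | "x = m + 1" using fx fr[of x] by blast
    then show ?thesis
    proof cases
      case 1
      have "lab' i = x \<longleftrightarrow> lab i = x" if "i < n" for i
        using 1 lab'[OF that] ly[OF that] fm[OF 1(1)] A(1) by auto
      then have "{i. i < n \<and> lab' i = x} = {i. i < n \<and> lab i = x}" by blast
      then show ?thesis using I(10)[OF 1(1)] fm[OF 1(1)] by simp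
    next
      case 2
      have "lab' i = m \<longleftrightarrow> i \<in> A" if "i < n" for i
        using lab'[OF that] fm[OF I(9)[OF that]] by auto
      moreover have "i < n" if "i \<in> A" for i using that A(1) I(4)[of y] ym m by auto
      ultimately show ?thesis using 2 by auto
    next
      case 3
      have "lab' i = m + 1 \<longleftrightarrow> i \<in> pts y - A" if "i < n" for i
        using lab'[OF that] fm[OF I(9)[OF that]] by auto
      moreover have "i < n" if "i \<in> pts y - A" for i using that I(4)[of y] ym m by auto
      ultimately show ?thesis using 3 by auto
    qed
  qed
  have dj: "narr s' ''hi'' x \<le> narr s' ''lo'' z \<or> narr s' ''hi'' z \<le> narr s' ''lo'' x"
    if "front s' x" "front s' z" "x \<noteq> z" for x z
  proof -
    have hl: "narr s ''hi'' y = narr s ''lo'' y + card A + card (pts y - A)" using I(5)[of y] ym m cA by auto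
    have old: "narr s ''hi'' x \<le> narr s ''lo'' z \<or> narr s ''hi'' z \<le> narr s ''lo'' x"
      if "front s x" "front s z" "x \<noteq> z" for x z using I(11)[OF that] .
    show ?thesis
      using that fr[of x] fr[of z] old[of x z] old[of x y] old[of y z] y(1) fm[of x] fm[of z] s' hl ym by auto
  qed
  \<comment> \<open>One leaf is replaced by two, which matches the two new node numbers in
    \<open>m + 1 = 2 * card\<close>.\<close>
  have "finite {x. front s x}" by (rule finite_subset[of _ "{..<m}"]) (auto dest: fm)
  moreover have "{x. front s' x} = insert m (insert (m + 1) ({x. front s x} - {y}))" using fr by auto
  moreover have "m \<notin> {x. front s x}" "m + 1 \<notin> {x. front s x}" using fm[of m] fm[of "m + 1"] by auto
  ultimately have cd: "m + 2 + 1 = 2 * card {x. front s' x}"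
    using I(12) y(1) m by (simp add: card_Suc_Diff1 card_Diff_singleton)
  have nodes: "?p x \<noteq> {} \<and> ?p x \<subseteq> {..<n} \<and> narr s' ''lo'' x + card (?p x) = narr s' ''hi'' x \<and> narr s' ''hi'' x \<le> n" if "x < m + 2" for x
  proof -
    have "narr s ''lo'' y + card (pts y) = narr s ''hi'' y" "narr s ''hi'' y \<le> n" "pts y \<subseteq> {..<n}"
      using I(4,5,6)[of y] ym m by auto
    then show ?thesis using that s' I(3-6)[of x] ym m A cA by (cases "x < m"; cases "x = m") auto
  qed
  have "\<forall>i<n. front s' (lab' i)" using fr lab' I(9) ly by auto
  moreover have "\<forall>x\<ge>m + 2. narr s' ''st'' x = 0" using s' I(13) m ym by auto
  ultimately show ?thesis
    unfolding tree_inv_def Let_def s'(1) using I(1,2) nodes nd pr p2 dj cd m ym by auto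
qed

end

abbreviation cell :: "name \<Rightarrow> name \<Rightarrow> nexp" where
  "cell a x \<equiv> NGet a (NVar x)"

text \<open>The start of a row is looked up, as the product of two variables cannot be computed
  directly.\<close>

definition ordx :: "nexp \<Rightarrow> nexp \<Rightarrow> nexp" where
  "ordx k p = NGet ''ord'' (NAdd (NGet ''off'' k) p)"

text \<open>Row \<open>k\<close> of \<open>ord\<close>, starting at \<open>off k\<close>, lists the points by their \<open>k\<close>-th coordinate, and \<open>lab i\<close> is
  the current leaf containing point \<open>i\<close>.  Below a node \<open>u\<close> a spine of nodes is split off: the part of
  \<open>cu\<close> whose end is reached first is relabelled, and \<open>cu\<close> becomes the other part, whose points keep the
  label \<open>u\<close> and lie between \<open>a k\<close> and \<open>b k\<close> in row \<open>k\<close>.  This goes on while \<open>cu\<close> has more than half of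
  the points of \<open>u\<close>; then the rows are distributed to the new leaves.\<close>

definition skip_dead :: "nat \<Rightarrow> com" where
  "skip_dead q = For ''k'' (NLit 0) (NLit q)
     (While (neq (NGet ''lab'' (ordx (NVar ''k'') (cell ''a'' ''k''))) (NVar ''u''))
        (NPut ''a'' (NVar ''k'') (NAdd (cell ''a'' ''k'') (NLit 1))) ;;
      While (neq (NGet ''lab'' (ordx (NVar ''k'') (NSub (cell ''b'' ''k'') (NLit 1)))) (NVar ''u''))
        (NPut ''b'' (NVar ''k'') (NSub (cell ''b'' ''k'') (NLit 1))))"

text \<open>After \<open>skip_dead\<close> both ends of a window are live points, and by the order
  of the row they attain the extreme coordinates.\<close>

definition longest_side :: "nat \<Rightarrow> com" where
  "longest_side q =
     ''w'' ::=\<^sub>r OfNat (NLit 0) ;;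
     ''kk'' ::=\<^sub>n NLit 0 ;;
     For ''k'' (NLit 0) (NLit q)
       (''d'' ::=\<^sub>r RSub (zc q (ordx (NVar ''k'') (NSub (cell ''b'' ''k'') (NLit 1))) (NVar ''k''))
          (zc q (ordx (NVar ''k'') (cell ''a'' ''k'')) (NVar ''k'')) ;;
        Cond (RLess (RVar ''w'') (RVar ''d'')) (''w'' ::=\<^sub>r RVar ''d'' ;; ''kk'' ::=\<^sub>n NVar ''k'') Skip)"

definition mark_node :: com where
  "mark_node =
     RPut ''lmx'' (NVar ''cu'') (RVar ''w'') ;;
     NPut ''st'' (NVar ''cu'') (NLit 1) ;;
     NPut ''rep'' (NVar ''cu'') (ordx (NLit 0) (NGet ''a'' (NLit 0)))"

text \<open>Both ends advance in step, so the number of rounds is the length of the shorter side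
  within the window.\<close>

definition walk :: "nat \<Rightarrow> com" where
  "walk q =
     ''c'' ::=\<^sub>r RDiv (RAdd (zc q (ordx (NVar ''kk'') (cell ''a'' ''kk'')) (NVar ''kk''))
         (zc q (ordx (NVar ''kk'') (NSub (cell ''b'' ''kk'') (NLit 1))) (NVar ''kk''))) (OfNat (NLit 2)) ;;
     ''x'' ::=\<^sub>n cell ''a'' ''kk'' ;;
     ''y'' ::=\<^sub>n cell ''b'' ''kk'' ;;
     While (Conj (Neg (RLess (RVar ''c'') (zc q (ordx (NVar ''kk'') (NVar ''x'')) (NVar ''kk''))))
             (RLess (RVar ''c'') (zc q (ordx (NVar ''kk'') (NSub (NVar ''y'') (NLit 1))) (NVar ''kk''))))
       (inc ''x'' ;; ''y'' ::=\<^sub>n NSub (NVar ''y'') (NLit 1))"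

definition new_nodes :: "nat \<Rightarrow> com" where
  "new_nodes q =
     NPut ''ch'' (NVar ''cu'') (NVar ''m'') ;;
     NPut ''par'' (NVar ''m'') (NVar ''cu'') ;;
     NPut ''par'' (NAdd (NVar ''m'') (NLit 1)) (NVar ''cu'') ;;
     NPut ''lo'' (NVar ''m'') (NVar ''sa'') ;;
     Cond (RLess (RVar ''c'') (zc q (ordx (NVar ''kk'') (NVar ''x'')) (NVar ''kk'')))
       (''p'' ::=\<^sub>n cell ''a'' ''kk'' ;; ''en'' ::=\<^sub>n NVar ''x'' ;; NPut ''a'' (NVar ''kk'') (NVar ''x''))
       (''p'' ::=\<^sub>n NVar ''y'' ;; ''en'' ::=\<^sub>n cell ''b'' ''kk'' ;; NPut ''b'' (NVar ''kk'') (NVar ''y''))"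

text \<open>The chunk may contain points that were peeled off along another axis; only those still
  labelled \<open>u\<close> belong to the node.\<close>

definition take_chunk :: com where
  "take_chunk = For ''p'' (NVar ''p'') (NVar ''en'')
     (''i'' ::=\<^sub>n ordx (NVar ''kk'') (NVar ''p'') ;;
      Cond (neq (cell ''lab'' ''i'') (NVar ''u'')) Skip (NPut ''lab'' (NVar ''i'') (NVar ''m'') ;; inc ''sa''))"

definition finish_split :: com where
  "finish_split =
     NPut ''hi'' (NVar ''m'') (NVar ''sa'') ;;
     NPut ''lo'' (NAdd (NVar ''m'') (NLit 1)) (NVar ''sa'') ;;
     NPut ''hi'' (NAdd (NVar ''m'') (NLit 1)) (NVar ''r'') ;;
     ''cu'' ::=\<^sub>n NAdd (NVar ''m'') (NLit 1) ;;
     ''m'' ::=\<^sub>n NAdd (NVar ''m'') (NLit 2) ;;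
     Cond (NLess (NSub (NVar ''r'') (NVar ''l'')) (NAdd (NSub (NVar ''r'') (NVar ''sa'')) (NSub (NVar ''r'') (NVar ''sa''))))
       Skip (''go'' ::=\<^sub>n NLit 0)"

definition spine_step :: "nat \<Rightarrow> com" where
  "spine_step q =
     (skip_dead q ;; longest_side q ;; mark_node) ;;
     Cond (RLess (OfNat (NLit 0)) (RVar ''w''))
       (walk q ;; new_nodes q ;; take_chunk ;; finish_split)
       (''go'' ::=\<^sub>n NLit 0)"

lemmas spine_defs = spine_step_def skip_dead_def longest_side_def mark_node_def walk_def new_nodes_def
  take_chunk_def finish_split_def

section \<open>Amortised cost of a single split\<close>

context sample
begin

definition ctx :: "state \<Rightarrow> bool" where
  "ctx s \<longleftrightarrow> nvar s ''n'' = n \<and> rarr s ''Z'' = Zin \<and> (\<forall>k<CARD('q). narr s ''off'' k = k * n)"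

definition row :: "state \<Rightarrow> nat \<Rightarrow> nat \<Rightarrow> nat" where
  "row s k p = narr s ''ord'' (k * n + p)"

lemma nval_ordx [simp]: "ctx s \<Longrightarrow> nval k s < CARD('q) \<Longrightarrow> nval (ordx k p) s = row s (nval k s) (nval p s)"
  by (simp add: ordx_def ctx_def row_def)

lemma ctx_frame: "same c s s' \<Longrightarrow> ctx s \<Longrightarrow> ''n'' \<notin> wn c \<Longrightarrow> ''off'' \<notin> wna c \<Longrightarrow> ''Z'' \<notin> wra c \<Longrightarrow> ctx s'"
  by (simp add: ctx_def same_def)

lemma row_frame: "same c s s' \<Longrightarrow> ''ord'' \<notin> wna c \<Longrightarrow> row s' = row s"
  by (simp add: row_def same_def fun_eq_iff)

lemma row_eq: "narr s' ''ord'' = narr s ''ord'' \<Longrightarrow> row s' = row s"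
  by (simp add: row_def fun_eq_iff)

text \<open>The windows only shrink; their total width pays for the skipped entries and for the
  walks.\<close>

definition gap :: "state \<Rightarrow> nat" where
  "gap s = (\<Sum>k<CARD('q). narr s ''b'' k - narr s ''a'' k)"

definition pointers :: "state \<Rightarrow> nat \<Rightarrow> nat \<Rightarrow> nat set \<Rightarrow> bool" where
  "pointers s l r P \<longleftrightarrow> (\<forall>k<CARD('q). l \<le> narr s ''a'' k \<and> narr s ''a'' k \<le> narr s ''b'' k \<and> narr s ''b'' k \<le> r \<and>
     P \<subseteq> row s k ` {narr s ''a'' k..<narr s ''b'' k})"

definition tight :: "state \<Rightarrow> nat \<Rightarrow> nat \<Rightarrow> nat set \<Rightarrow> bool" where
  "tight s l r P \<longleftrightarrow> pointers s l r P \<and> (\<forall>k<CARD('q). narr s ''a'' k < narr s ''b'' k \<and>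
     row s k (narr s ''a'' k) \<in> P \<and> row s k (narr s ''b'' k - 1) \<in> P)"

lemma tight_ends:
  assumes "P \<subseteq> f ` {a..<b}" "P \<noteq> {}"
  shows "\<exists>a' b'. a \<le> a' \<and> a' < b' \<and> b' \<le> (b::nat) \<and> f a' \<in> P \<and> f (b' - 1) \<in> P \<and>
    (\<forall>p. a \<le> p \<and> p < a' \<longrightarrow> f p \<notin> P) \<and> (\<forall>p. b' \<le> p \<and> p < b \<longrightarrow> f p \<notin> P)"
proof -
  define S where "S = {p \<in> {a..<b}. f p \<in> P}"
  have fin: "finite S" by (simp add: S_def)
  have ne: "S \<noteq> {}" using assms by (auto simp: S_def)
  have m: "Min S \<in> S" "Max S \<in> S" "Min S \<le> Max S" using fin ne by auto
  have "f p \<notin> P" if "a \<le> p" "p < Min S" for p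
  proof
    assume "f p \<in> P"
    moreover have "p < b" using that m by (auto simp: S_def)
    ultimately have "Min S \<le> p" using that by (intro Min_le[OF fin]) (auto simp: S_def)
    then show False using that by simp
  qed
  moreover have "f p \<notin> P" if "Max S + 1 \<le> p" "p < b" for p
  proof
    assume "f p \<in> P"
    moreover have "a \<le> p" using that m by (auto simp: S_def)
    ultimately have "p \<le> Max S" using that by (intro Max_ge[OF fin]) (auto simp: S_def)
    then show False using that by simp
  qed
  moreover have "a \<le> Min S" "f (Min S) \<in> P" "Max S < b" "f (Max S) \<in> P"
    using m(1,2) unfolding S_def by simp_all
  ultimately have "a \<le> Min S \<and> Min S < Max S + 1 \<and> Max S + 1 \<le> b \<and> f (Min S) \<in> P \<and> f (Max S + 1 - 1) \<in> P \<and>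
    (\<forall>p. a \<le> p \<and> p < Min S \<longrightarrow> f p \<notin> P) \<and> (\<forall>p. Max S + 1 \<le> p \<and> p < b \<longrightarrow> f p \<notin> P)"
    using m(3) by simp
  then show ?thesis by blast
qed

text \<open>Each skipped entry narrows a window by one, so up to the constant
  \<open>CARD('q) + 1\<close> the time equals the loss of \<open>gap\<close>.\<close>

lemma skip_dead_runs:
  assumes c: "ctx s" and ptr: "pointers s l r P" and P: "P \<noteq> {}"
    and lab: "\<And>k p. k < CARD('q) \<Longrightarrow> l \<le> p \<Longrightarrow> p < r \<Longrightarrow> (narr s ''lab'' (row s k p) = nvar s ''u'') = (row s k p \<in> P)"
  shows "\<exists>f>CARD('q). runs (skip_dead CARD('q)) s f (\<lambda>s'. tight s' l r P \<and> gap s' + f \<le> gap s + CARD('q) + 1)"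
proof -
  let ?a = "narr s ''a''" and ?b = "narr s ''b''"
  have "\<forall>k. k < CARD('q) \<longrightarrow> (\<exists>a' b'. ?a k \<le> a' \<and> a' < b' \<and> b' \<le> ?b k \<and> row s k a' \<in> P \<and> row s k (b' - 1) \<in> P \<and>
    (\<forall>p. ?a k \<le> p \<and> p < a' \<longrightarrow> row s k p \<notin> P) \<and> (\<forall>p. b' \<le> p \<and> p < ?b k \<longrightarrow> row s k p \<notin> P))"
    using tight_ends[OF _ P] ptr unfolding pointers_def by blast
  then obtain A B where AB: "\<And>k. k < CARD('q) \<Longrightarrow> ?a k \<le> A k \<and> A k < B k \<and> B k \<le> ?b k \<and> row s k (A k) \<in> P \<and> row s k (B k - 1) \<in> P \<and>
    (\<forall>p. ?a k \<le> p \<and> p < A k \<longrightarrow> row s k p \<notin> P) \<and> (\<forall>p. B k \<le> p \<and> p < ?b k \<longrightarrow> row s k p \<notin> P)"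
    by metis
  have lr: "l \<le> ?a k" "?b k \<le> r" if "k < CARD('q)" for k using ptr that by (auto simp: pointers_def)
  define g where "g k = (A k - ?a k) + (?b k - B k) + 1" for k
  have "runs (skip_dead CARD('q)) s ((\<Sum>k<CARD('q). g k) + 1)
    (\<lambda>s'. (\<forall>k<CARD('q). narr s' ''a'' k = A k \<and> narr s' ''b'' k = B k) \<and> narr s' ''ord'' = narr s ''ord'')"
    unfolding skip_dead_def
  proof (rule runs_For[where M = 0 and N = "CARD('q)" and g = g and I = "\<lambda>k s'. (\<forall>j<k. narr s' ''a'' j = A j \<and> narr s' ''b'' j = B j) \<and>
       (\<forall>j\<ge>k. narr s' ''a'' j = ?a j \<and> narr s' ''b'' j = ?b j)"])
    fix k s' assume k: "k < CARD('q)" and I: "(\<forall>j<k. narr s' ''a'' j = A j \<and> narr s' ''b'' j = B j) \<and>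
       (\<forall>j\<ge>k. narr s' ''a'' j = ?a j \<and> narr s' ''b'' j = ?b j)" and ks: "nvar s' ''k'' = k"
      and sm: "same (For ''k'' (NLit 0) (NLit CARD('q))
          (While (neq (NGet ''lab'' (ordx (NVar ''k'') (cell ''a'' ''k''))) (NVar ''u''))
            (NPut ''a'' (NVar ''k'') (NAdd (cell ''a'' ''k'') (NLit 1))) ;;
           While (neq (NGet ''lab'' (ordx (NVar ''k'') (NSub (cell ''b'' ''k'') (NLit 1)))) (NVar ''u''))
            (NPut ''b'' (NVar ''k'') (NSub (cell ''b'' ''k'') (NLit 1))))) s s'"
    have e: "ctx s'" "row s' = row s" "narr s' ''lab'' = narr s ''lab''" "nvar s' ''u'' = nvar s ''u''"
      using ctx_frame[OF sm c] row_frame[OF sm] sameD[OF sm] by simp_all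
    note ABk = AB[OF k] and lrk = lr[OF k]
    have AB1: "?a k \<le> A k" "A k < B k" "B k \<le> ?b k" using ABk by blast+
    let ?ca = "While (neq (NGet ''lab'' (ordx (NVar ''k'') (cell ''a'' ''k''))) (NVar ''u''))
            (NPut ''a'' (NVar ''k'') (NAdd (cell ''a'' ''k'') (NLit 1)))"
    let ?cb = "While (neq (NGet ''lab'' (ordx (NVar ''k'') (NSub (cell ''b'' ''k'') (NLit 1)))) (NVar ''u''))
            (NPut ''b'' (NVar ''k'') (NSub (cell ''b'' ''k'') (NLit 1)))"
    have 1: "runs ?ca s' (g k) (\<lambda>t. narr t ''a'' = (narr s' ''a'')(k := A k))"
    proof (rule runs_While[where I = "\<lambda>t. ?a k \<le> narr t ''a'' k \<and> narr t ''a'' k \<le> A k \<and> (\<forall>j. j \<noteq> k \<longrightarrow> narr t ''a'' j = narr s' ''a'' j)"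
          and \<mu> = "\<lambda>t. A k - narr t ''a'' k"])
      fix t assume a: "?a k \<le> narr t ''a'' k \<and> narr t ''a'' k \<le> A k \<and> (\<forall>j. j \<noteq> k \<longrightarrow> narr t ''a'' j = narr s' ''a'' j)"
        "same (NPut ''a'' (NVar ''k'') (NAdd (cell ''a'' ''k'') (NLit 1))) s' t"
      have f: "ctx t" "row t = row s" "narr t ''lab'' = narr s ''lab''" "nvar t ''u'' = nvar s ''u''" "nvar t ''k'' = k"
        using ctx_frame[OF a(2) e(1)] row_frame[OF a(2)] sameD[OF a(2)] e ks by simp_all
      have v: "bval (neq (NGet ''lab'' (ordx (NVar ''k'') (cell ''a'' ''k''))) (NVar ''u'')) t \<longleftrightarrow> narr t ''a'' k \<noteq> A k"
      proof -
        have "l \<le> narr t ''a'' k" "narr t ''a'' k < r" using a(1) AB1 lrk by linarith+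
        moreover have "row s k (narr t ''a'' k) \<in> P \<longleftrightarrow> narr t ''a'' k = A k"
        proof
          assume "row s k (narr t ''a'' k) \<in> P"
          then have "\<not> narr t ''a'' k < A k" using ABk a(1) by blast
          then show "narr t ''a'' k = A k" using a(1) by linarith
        qed (use ABk in simp)
        ultimately show ?thesis using lab[OF k] f k by simp
      qed
      {
        assume "\<not> bval (neq (NGet ''lab'' (ordx (NVar ''k'') (cell ''a'' ''k''))) (NVar ''u'')) t"
        then show "narr t ''a'' = (narr s' ''a'')(k := A k)" using v a(1) by auto
      next
        assume "bval (neq (NGet ''lab'' (ordx (NVar ''k'') (cell ''a'' ''k''))) (NVar ''u'')) t"
        then have "narr t ''a'' k < A k" using v a(1) by auto
        then show "\<exists>j. runs (NPut ''a'' (NVar ''k'') (NAdd (cell ''a'' ''k'') (NLit 1))) t j (\<lambda>t'. (?a k \<le> narr t' ''a'' k \<and>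
            narr t' ''a'' k \<le> A k \<and> (\<forall>j. j \<noteq> k \<longrightarrow> narr t' ''a'' j = narr s' ''a'' j)) \<and> A k - narr t' ''a'' k + j \<le> A k - narr t ''a'' k)"
          using a(1) f by (intro exI[of _ 1] runs_line) auto
      }
    qed (use I ABk in \<open>auto simp: g_def\<close>)
    have 2: "runs ?cb t (g k) (\<lambda>t'. narr t' ''b'' = (narr s' ''b'')(k := B k))" if sa: "same ?ca s' t" for t
    proof -
      have te: "ctx t" "row t = row s" "narr t ''lab'' = narr s ''lab''" "nvar t ''u'' = nvar s ''u''" "nvar t ''k'' = k" "narr t ''b'' = narr s' ''b''"
        using ctx_frame[OF sa e(1)] row_frame[OF sa] sameD[OF sa] e ks by simp_all
      show ?thesis
      proof (rule runs_While[where I = "\<lambda>t. B k \<le> narr t ''b'' k \<and> narr t ''b'' k \<le> ?b k \<and> (\<forall>j. j \<noteq> k \<longrightarrow> narr t ''b'' j = narr s' ''b'' j)"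
          and \<mu> = "\<lambda>t. narr t ''b'' k - B k"])
      fix t' assume a: "B k \<le> narr t' ''b'' k \<and> narr t' ''b'' k \<le> ?b k \<and> (\<forall>j. j \<noteq> k \<longrightarrow> narr t' ''b'' j = narr s' ''b'' j)"
        "same (NPut ''b'' (NVar ''k'') (NSub (cell ''b'' ''k'') (NLit 1))) t t'"
      have f: "ctx t'" "row t' = row s" "narr t' ''lab'' = narr s ''lab''" "nvar t' ''u'' = nvar s ''u''" "nvar t' ''k'' = k"
        using ctx_frame[OF a(2) te(1)] row_frame[OF a(2)] sameD[OF a(2)] te by simp_all
      have v: "bval (neq (NGet ''lab'' (ordx (NVar ''k'') (NSub (cell ''b'' ''k'') (NLit 1)))) (NVar ''u'')) t' \<longleftrightarrow> narr t' ''b'' k \<noteq> B k"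
      proof -
        have b: "l \<le> narr t' ''b'' k - 1" "narr t' ''b'' k - 1 < r" using a(1) AB1 lrk by linarith+
        have "row s k (narr t' ''b'' k - 1) \<in> P \<longleftrightarrow> narr t' ''b'' k = B k"
        proof
          assume p: "row s k (narr t' ''b'' k - 1) \<in> P"
          have "narr t' ''b'' k - 1 < ?b k" using a(1) AB1 by linarith
          then have "\<not> B k \<le> narr t' ''b'' k - 1" using ABk p by blast
          then show "narr t' ''b'' k = B k" using a(1) AB1 by linarith
        qed (use ABk in simp)
        then show ?thesis using lab[OF k b] f k by simp
      qed
      {
        assume "\<not> bval (neq (NGet ''lab'' (ordx (NVar ''k'') (NSub (cell ''b'' ''k'') (NLit 1)))) (NVar ''u'')) t'"
        then show "narr t' ''b'' = (narr s' ''b'')(k := B k)" using v a(1) by auto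
      next
        assume "bval (neq (NGet ''lab'' (ordx (NVar ''k'') (NSub (cell ''b'' ''k'') (NLit 1)))) (NVar ''u'')) t'"
        then have "B k < narr t' ''b'' k" using v a(1) by auto
        then show "\<exists>j. runs (NPut ''b'' (NVar ''k'') (NSub (cell ''b'' ''k'') (NLit 1))) t' j (\<lambda>t''. (B k \<le> narr t'' ''b'' k \<and>
            narr t'' ''b'' k \<le> ?b k \<and> (\<forall>j. j \<noteq> k \<longrightarrow> narr t'' ''b'' j = narr s' ''b'' j)) \<and> narr t'' ''b'' k - B k + j \<le> narr t' ''b'' k - B k)"
          using a(1) f by (intro exI[of _ 1] runs_line) auto
      }
      qed (use I ABk te in \<open>auto simp: g_def\<close>)
    qed
    show "runs (?ca ;; ?cb) s' (g k) (\<lambda>s''. (\<forall>j<Suc k. narr (s''\<lparr>nvar := (nvar s'')(''k'' := Suc k)\<rparr>) ''a'' j = A j \<and> narr (s''\<lparr>nvar := (nvar s'')(''k'' := Suc k)\<rparr>) ''b'' j = B j) \<and>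
       (\<forall>j\<ge>Suc k. narr (s''\<lparr>nvar := (nvar s'')(''k'' := Suc k)\<rparr>) ''a'' j = ?a j \<and> narr (s''\<lparr>nvar := (nvar s'')(''k'' := Suc k)\<rparr>) ''b'' j = ?b j))"
    proof (rule runs_Seq, rule runs_mono[OF 1 order_refl], rule runs_mono[OF 2 order_refl])
      fix t t' assume h: "narr t ''a'' = (narr s' ''a'')(k := A k)" "same ?ca s' t" "narr t' ''b'' = (narr s' ''b'')(k := B k)" "same ?cb t t'"
      have "narr t' ''a'' = (narr s' ''a'')(k := A k)" using h(1,4) by (simp add: same_def)
      then show "(\<forall>j<Suc k. narr (t'\<lparr>nvar := (nvar t')(''k'' := Suc k)\<rparr>) ''a'' j = A j \<and> narr (t'\<lparr>nvar := (nvar t')(''k'' := Suc k)\<rparr>) ''b'' j = B j) \<and>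
       (\<forall>j\<ge>Suc k. narr (t'\<lparr>nvar := (nvar t')(''k'' := Suc k)\<rparr>) ''a'' j = ?a j \<and> narr (t'\<lparr>nvar := (nvar t')(''k'' := Suc k)\<rparr>) ''b'' j = ?b j)"
        using h(3) I by auto
    qed
  qed (auto simp: same_def lessThan_atLeast0)
  moreover have "gap s = (\<Sum>k<CARD('q). (B k - A k)) + (\<Sum>k<CARD('q). (A k - ?a k) + (?b k - B k))"
    unfolding gap_def sum.distrib[symmetric]
  proof (rule sum.cong[OF refl])
    fix k assume "k \<in> {..<CARD('q)}"
    then have "?a k \<le> A k" "A k < B k" "B k \<le> ?b k" using AB by auto
    then show "?b k - ?a k = B k - A k + (A k - ?a k + (?b k - B k))" by linarith
  qed
  moreover have "(\<Sum>k<CARD('q). g k) = (\<Sum>k<CARD('q). (A k - ?a k) + (?b k - B k)) + CARD('q)"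
    unfolding g_def sum.distrib by simp
  ultimately have "runs (skip_dead CARD('q)) s ((\<Sum>k<CARD('q). g k) + 1)
     (\<lambda>s'. tight s' l r P \<and> gap s' + ((\<Sum>k<CARD('q). g k) + 1) \<le> gap s + CARD('q) + 1)"
  proof (elim runs_mono[OF _ order_refl], elim conjE)
    fix s' :: state assume h: "\<forall>k<CARD('q). narr s' ''a'' k = A k \<and> narr s' ''b'' k = B k" "narr s' ''ord'' = narr s ''ord''"
      and gs: "gap s = (\<Sum>k<CARD('q). B k - A k) + (\<Sum>k<CARD('q). A k - narr s ''a'' k + (narr s ''b'' k - B k))"
      "sum g {..<CARD('q)} = (\<Sum>k<CARD('q). A k - narr s ''a'' k + (narr s ''b'' k - B k)) + CARD('q)"
    have rw: "row s' = row s" by (rule row_eq[OF h(2)])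
    have im: "P \<subseteq> row s k ` {A k..<B k}" if k: "k < CARD('q)" for k
    proof
      fix i assume i: "i \<in> P"
      then obtain p where p: "?a k \<le> p" "p < ?b k" "i = row s k p" using ptr k unfolding pointers_def by fastforce
      have "\<not> p < A k" "\<not> B k \<le> p" using AB[OF k] i p by blast+
      then show "i \<in> row s k ` {A k..<B k}" using p by auto
    qed
    have "tight s' l r P"
      unfolding tight_def pointers_def rw
    proof (intro conjI allI impI)
      fix k assume k: "k < CARD('q)"
      have AB1: "?a k \<le> A k" "A k < B k" "B k \<le> ?b k" "row s k (A k) \<in> P" "row s k (B k - 1) \<in> P" using AB[OF k] by blast+
      have e: "narr s' ''a'' k = A k" "narr s' ''b'' k = B k" using h(1) k by auto
      show "l \<le> narr s' ''a'' k" "narr s' ''a'' k \<le> narr s' ''b'' k" "narr s' ''b'' k \<le> r"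
        "narr s' ''a'' k < narr s' ''b'' k"
        unfolding e using AB1 lr[OF k] by linarith+
      show "P \<subseteq> row s k ` {narr s' ''a'' k..<narr s' ''b'' k}" unfolding e by (rule im[OF k])
      show "row s k (narr s' ''a'' k) \<in> P" "row s k (narr s' ''b'' k - 1) \<in> P" unfolding e by (rule AB1)+
    qed
    moreover have "gap s' = (\<Sum>k<CARD('q). B k - A k)" unfolding gap_def using h(1) by (intro sum.cong) auto
    ultimately show "tight s' l r P \<and> gap s' + (sum g {..<CARD('q)} + 1) \<le> gap s + CARD('q) + 1"
      using gs by simp
  qed
  moreover have "CARD('q) < (\<Sum>k<CARD('q). g k) + 1" unfolding g_def sum.distrib by simp
  ultimately show ?thesis by blast
qed

definition extent :: "state \<Rightarrow> nat \<Rightarrow> real" where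
  "extent s k = X k (row s k (narr s ''b'' k - 1)) - X k (row s k (narr s ''a'' k))"

lemma longest_side_runs:
  assumes c: "ctx s" and t: "tight s l r P" and P: "P \<subseteq> {..<n}" and f: "CARD('q) < f"
  shows "runs (longest_side CARD('q)) s f (\<lambda>s'. 0 \<le> rvar s' ''w'' \<and> (\<forall>k<CARD('q). extent s k \<le> rvar s' ''w'') \<and>
     (0 < rvar s' ''w'' \<longrightarrow> nvar s' ''kk'' < CARD('q) \<and> rvar s' ''w'' = extent s (nvar s' ''kk'')))"
  unfolding longest_side_def
proof (rule runs_Seq, rule runs_line, simp, use f in simp, rule runs_Seq, rule runs_line, simp, use f in simp,
    rule runs_For[where M = 0 and N = "CARD('q)" and g = "\<lambda>_. 1" and
      I = "\<lambda>k s'. 0 \<le> rvar s' ''w'' \<and> (\<forall>j<k. extent s j \<le> rvar s' ''w'') \<and>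
     (0 < rvar s' ''w'' \<longrightarrow> nvar s' ''kk'' < CARD('q) \<and> rvar s' ''w'' = extent s (nvar s' ''kk''))"], goal_cases)
  case (6 k s')
  have e: "ctx s'" "row s' = row s" "narr s' ''a'' = narr s ''a''" "narr s' ''b'' = narr s ''b''"
    using 6(5) c by (auto simp: same_def ctx_def row_def fun_eq_iff zc_def)
  have m: "row s k (narr s ''a'' k) < n" "row s k (narr s ''b'' k - 1) < n"
    using t P 6(2) by (auto simp: tight_def)
  have z: "rarr s' ''Z'' = Zin" using e(1) by (simp add: ctx_def)
  have v: "rval (RSub (zc CARD('q) (ordx (NVar ''k'') (NSub (cell ''b'' ''k'') (NLit 1))) (NVar ''k''))
          (zc CARD('q) (ordx (NVar ''k'') (cell ''a'' ''k'')) (NVar ''k''))) s' = extent s k"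
    using e m 6(2,4) z by (simp add: extent_def)
  show ?case
    by (rule runs_line) (use 6(2-4) v in \<open>auto simp: less_Suc_eq\<close>)
qed (use f in \<open>auto simp: same_def\<close>)

text \<open>The lower bound on \<open>f\<close>, together with the inequality for
  \<open>gap\<close>, guarantees that \<open>gap\<close> has not grown.\<close>

lemma part1_runs:
  assumes c: "ctx s" and ptr: "pointers s l r P" and P: "P \<noteq> {}" "P \<subseteq> {..<n}"
    and lab: "\<And>k p. k < CARD('q) \<Longrightarrow> l \<le> p \<Longrightarrow> p < r \<Longrightarrow> (narr s ''lab'' (row s k p) = nvar s ''u'') = (row s k p \<in> P)"
  shows "\<exists>f\<ge>2 * CARD('q) + 3. runs (skip_dead CARD('q) ;; longest_side CARD('q) ;; mark_node) s f (\<lambda>s'. tight s' l r P \<and>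
     gap s' + f \<le> gap s + 2 * CARD('q) + 3 \<and> 0 \<le> rvar s' ''w'' \<and> (\<forall>k<CARD('q). extent s' k \<le> rvar s' ''w'') \<and>
     (0 < rvar s' ''w'' \<longrightarrow> nvar s' ''kk'' < CARD('q) \<and> rvar s' ''w'' = extent s' (nvar s' ''kk'')) \<and>
     rarr s' ''lmx'' = (rarr s ''lmx'')(nvar s ''cu'' := rvar s' ''w'') \<and> narr s' ''st'' = (narr s ''st'')(nvar s ''cu'' := 1) \<and>
     narr s' ''rep'' = (narr s ''rep'')(nvar s ''cu'' := row s' 0 (narr s' ''a'' 0)))"
proof -
  obtain f0 where f1: "CARD('q) < f0" and f0: "runs (skip_dead CARD('q)) s f0 (\<lambda>s'. tight s' l r P \<and> gap s' + f0 \<le> gap s + CARD('q) + 1)"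
    using skip_dead_runs[OF c ptr P(1) lab] by blast
  define f where "f = f0 + CARD('q) + 2"
  show ?thesis
  proof (intro exI[of _ f] conjI runs_Seq, use f1 in \<open>simp add: f_def\<close>, rule runs_mono[OF f0], goal_cases)
    case (2 s1)
    have c1: "ctx s1" "nvar s1 ''cu'' = nvar s ''cu''" "rarr s1 ''lmx'' = rarr s ''lmx''" "narr s1 ''st'' = narr s ''st''" "narr s1 ''rep'' = narr s ''rep''"
      using c 2(2) by (auto simp: same_def ctx_def skip_dead_def)
    have t1: "tight s1 l r P" and g1: "gap s1 + f0 \<le> gap s + CARD('q) + 1" using 2(1) by auto
    have "CARD('q) < f" by (simp add: f_def)
    show ?case
    proof (rule runs_Seq, rule runs_mono[OF longest_side_runs[OF c1(1) t1 P(2) \<open>CARD('q) < f\<close>] order_refl], goal_cases)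
      case (1 s2)
      have e: "ctx s2" "narr s2 = narr s1" "nvar s2 ''cu'' = nvar s ''cu''" "rarr s2 = rarr s1"
        using c1 1(2) by (auto simp: same_def longest_side_def ctx_def fun_eq_iff)
      have ro: "nval (ordx (NLit 0) (NGet ''a'' (NLit 0))) (s2\<lparr>rarr := R, narr := A\<rparr>) = row s2 0 (narr s2 ''a'' 0)"
        if "A ''ord'' = narr s2 ''ord''" "A ''off'' = narr s2 ''off''" "A ''a'' = narr s2 ''a''" for R A
        using that e(1) q0 by (simp add: ordx_def row_def ctx_def)
      show ?case unfolding mark_node_def
      proof (rule runs_line)
        let ?s = "eff (RPut ''lmx'' (NVar ''cu'') (RVar ''w'') ;;
           NPut ''st'' (NVar ''cu'') (NLit 1) ;; NPut ''rep'' (NVar ''cu'') (ordx (NLit 0) (NGet ''a'' (NLit 0)))) s2"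
        have "narr ?s ''ord'' = narr s1 ''ord''" "narr ?s ''a'' = narr s1 ''a''" "narr ?s ''b'' = narr s1 ''b''"
          using e by simp_all
        then have "row ?s = row s1" "gap ?s = gap s1" "extent ?s = extent s1" "tight ?s l r P = tight s1 l r P"
          by (simp_all add: row_def gap_def extent_def tight_def pointers_def fun_eq_iff)
        moreover have "row s2 = row s1" using e(2) by (simp add: row_def fun_eq_iff)
        moreover have "gap s1 + f \<le> gap s + 2 * CARD('q) + 3" using g1 by (simp add: f_def)
        ultimately show "tight ?s l r P \<and> gap ?s + f \<le> gap s + 2 * CARD('q) + 3 \<and> 0 \<le> rvar ?s ''w'' \<and> (\<forall>k<CARD('q). extent ?s k \<le> rvar ?s ''w'') \<and>
     (0 < rvar ?s ''w'' \<longrightarrow> nvar ?s ''kk'' < CARD('q) \<and> rvar ?s ''w'' = extent ?s (nvar ?s ''kk'')) \<and>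
     rarr ?s ''lmx'' = (rarr s ''lmx'')(nvar s ''cu'' := rvar ?s ''w'') \<and> narr ?s ''st'' = (narr s ''st'')(nvar s ''cu'' := 1) \<and>
     narr ?s ''rep'' = (narr s ''rep'')(nvar s ''cu'' := row ?s 0 (narr ?s ''a'' 0))"
          using 1(1) t1 e c1 q0 by (simp add: ordx_def ctx_def row_def)
      qed (simp_all add: f_def)
    qed
  qed (simp add: f_def)
qed

text \<open>\<open>T\<close> is the first round in which the loop test fails. It is positive because
  the two ends lie on different sides of \<open>c\<close>.\<close>

lemma walk_exists:
  fixes f :: "nat \<Rightarrow> real"
  assumes AB: "A < B" and mono: "\<And>p p'. A \<le> p \<Longrightarrow> p \<le> p' \<Longrightarrow> p' < B \<Longrightarrow> f p \<le> f p'" and c: "f A \<le> c" "c < f (B - 1)"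
  obtains T where "0 < T" "A + 2 * T \<le> B" "\<And>t. t < T \<Longrightarrow> f (A + t) \<le> c \<and> c < f (B - t - 1)"
    "\<not> (f (A + T) \<le> c \<and> c < f (B - T - 1))"
proof -
  define T where "T = (LEAST t. \<not> (f (A + t) \<le> c \<and> c < f (B - t - 1)))"
  have ex: "\<not> (f (A + (B - 1 - A)) \<le> c \<and> c < f (B - (B - 1 - A) - 1))" using AB c(2) by simp
  have T: "\<not> (f (A + T) \<le> c \<and> c < f (B - T - 1))" unfolding T_def by (rule LeastI[of "\<lambda>t. \<not> (f (A + t) \<le> c \<and> c < f (B - t - 1))", OF ex])
  have less: "f (A + t) \<le> c \<and> c < f (B - t - 1)" if "t < T" for t
    using not_less_Least[OF that[unfolded T_def]] by blast
  have Tle: "T \<le> B - 1 - A" unfolding T_def by (rule Least_le[of "\<lambda>t. \<not> (f (A + t) \<le> c \<and> c < f (B - t - 1))", OF ex])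
  have T0: "0 < T" using T c by (cases T) auto
  \<comment> \<open>Otherwise the pointers would have crossed: position \<open>B - T\<close> has a
    value above \<open>c\<close>, but comes no later than \<open>A + (T - 1)\<close>, whose value is
    at most \<open>c\<close>.\<close>
  have "A + 2 * T \<le> B"
  proof (rule ccontr)
    assume "\<not> A + 2 * T \<le> B"
    then have "A \<le> B - T" "B - T \<le> A + (T - 1)" "A + (T - 1) < B" using Tle T0 AB by linarith+
    then have "f (B - T) \<le> f (A + (T - 1))" by (rule mono)
    moreover have "B - (T - 1) - 1 = B - T" using T0 by simp
    ultimately show False using less[of "T - 1"] T0 by auto
  qed
  then show thesis using that T0 less T by blast
qed

lemma walk_runs:
  assumes c: "ctx s" and k: "nvar s ''kk'' = k" "k < CARD('q)" and A: "A = narr s ''a'' k" and B: "B = narr s ''b'' k"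
    and AB: "A < B" and n: "\<And>p. A \<le> p \<Longrightarrow> p < B \<Longrightarrow> row s k p < n" and F: "F = (\<lambda>p. X k (row s k p))"
    and mono: "\<And>p p'. A \<le> p \<Longrightarrow> p \<le> p' \<Longrightarrow> p' < B \<Longrightarrow> F p \<le> F p'" and lt: "F A < F (B - 1)"
  shows "\<exists>T. 0 < T \<and> A + 2 * T \<le> B \<and> (\<forall>t<T. F (A + t) \<le> (F A + F (B - 1)) / 2 \<and> (F A + F (B - 1)) / 2 < F (B - t - 1)) \<and>
     \<not> (F (A + T) \<le> (F A + F (B - 1)) / 2 \<and> (F A + F (B - 1)) / 2 < F (B - T - 1)) \<and>
     runs (walk CARD('q)) s (T + 1) (\<lambda>s'. nvar s' ''x'' = A + T \<and> nvar s' ''y'' = B - T \<and> rvar s' ''c'' = (F A + F (B - 1)) / 2)"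
proof -
  define m where m: "m = (F A + F (B - 1)) / 2"
  obtain T where T: "0 < T" "A + 2 * T \<le> B" "\<And>t. t < T \<Longrightarrow> F (A + t) \<le> m \<and> m < F (B - t - 1)"
    "\<not> (F (A + T) \<le> m \<and> m < F (B - T - 1))"
    by (rule walk_exists[where f = F and c = m, OF AB mono]) (use lt m in auto)
  let ?w = "While (Conj (Neg (RLess (RVar ''c'') (zc CARD('q) (ordx (NVar ''kk'') (NVar ''x'')) (NVar ''kk''))))
             (RLess (RVar ''c'') (zc CARD('q) (ordx (NVar ''kk'') (NSub (NVar ''y'') (NLit 1))) (NVar ''kk''))))
       (inc ''x'' ;; ''y'' ::=\<^sub>n NSub (NVar ''y'') (NLit 1))"
  have loop: "runs ?w t (T + 1) (\<lambda>s'. nvar s' ''x'' = A + T \<and> nvar s' ''y'' = B - T \<and> rvar s' ''c'' = m)"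
    if t: "ctx t" "row t = row s" "nvar t ''kk'' = k" "nvar t ''x'' = A" "nvar t ''y'' = B" "rvar t ''c'' = m" for t :: state
  proof (rule runs_While[where I = "\<lambda>t. \<exists>d\<le>T. nvar t ''x'' = A + d \<and> nvar t ''y'' = B - d" and \<mu> = "\<lambda>t. T - (nvar t ''x'' - A)"])
    show "\<exists>d\<le>T. nvar t ''x'' = A + d \<and> nvar t ''y'' = B - d" using t by (intro exI[of _ 0]) auto
    show "T - (nvar t ''x'' - A) < T + 1" by simp
  next
    fix t' assume "\<exists>d\<le>T. nvar t' ''x'' = A + d \<and> nvar t' ''y'' = B - d" and sm: "same (inc ''x'' ;; ''y'' ::=\<^sub>n NSub (NVar ''y'') (NLit 1)) t t'"
    then obtain d where d: "d \<le> T" "nvar t' ''x'' = A + d" "nvar t' ''y'' = B - d" by blast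
    have e: "ctx t'" "row t' = row s" "nvar t' ''kk'' = k" "rvar t' ''c'' = m" "rarr t' ''Z'' = Zin"
      using ctx_frame[OF sm t(1)] row_frame[OF sm] sameD[OF sm] t by (simp_all add: ctx_def)
    have nn: "row s k (A + d) < n" "row s k (B - d - 1) < n" using n T(1,2) d(1) AB by auto
    have v: "bval (Conj (Neg (RLess (RVar ''c'') (zc CARD('q) (ordx (NVar ''kk'') (NVar ''x'')) (NVar ''kk''))))
             (RLess (RVar ''c'') (zc CARD('q) (ordx (NVar ''kk'') (NSub (NVar ''y'') (NLit 1))) (NVar ''kk'')))) t' \<longleftrightarrow>
         F (A + d) \<le> m \<and> m < F (B - d - 1)"
      using e nn d k(2) by (simp add: F not_less)
    {
      assume "\<not> bval (Conj (Neg (RLess (RVar ''c'') (zc CARD('q) (ordx (NVar ''kk'') (NVar ''x'')) (NVar ''kk''))))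
             (RLess (RVar ''c'') (zc CARD('q) (ordx (NVar ''kk'') (NSub (NVar ''y'') (NLit 1))) (NVar ''kk'')))) t'"
      then have "d = T" using v T(3)[of d] d(1) by (cases "d = T") auto
      then show "nvar t' ''x'' = A + T \<and> nvar t' ''y'' = B - T \<and> rvar t' ''c'' = m" using d e by simp
    next
      assume "bval (Conj (Neg (RLess (RVar ''c'') (zc CARD('q) (ordx (NVar ''kk'') (NVar ''x'')) (NVar ''kk''))))
             (RLess (RVar ''c'') (zc CARD('q) (ordx (NVar ''kk'') (NSub (NVar ''y'') (NLit 1))) (NVar ''kk'')))) t'"
      then have "d \<noteq> T" using v T(4) by blast
      then have "d < T" using d(1) by simp
      then show "\<exists>j. runs (inc ''x'' ;; ''y'' ::=\<^sub>n NSub (NVar ''y'') (NLit 1)) t' j (\<lambda>t''. (\<exists>d\<le>T. nvar t'' ''x'' = A + d \<and> nvar t'' ''y'' = B - d) \<and>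
          T - (nvar t'' ''x'' - A) + j \<le> T - (nvar t' ''x'' - A))"
        using d by (intro exI[of _ 1] runs_line) (auto intro!: exI[of _ "Suc d"])
    }
  qed
  have nn: "row s k A < n" "row s k (B - 1) < n" using n AB by auto
  have z: "rarr s ''Z'' = Zin" using c by (simp add: ctx_def)
  have "runs (walk CARD('q)) s (T + 1) (\<lambda>s'. nvar s' ''x'' = A + T \<and> nvar s' ''y'' = B - T \<and> rvar s' ''c'' = m)"
    unfolding walk_def
  proof (rule runs_Seq, rule runs_line, simp, simp, rule runs_Seq, rule runs_line, simp, simp, rule runs_Seq, rule runs_line, simp, simp, rule loop)
  qed (use c k A B nn z in \<open>simp_all add: F m ctx_def row_def ordx_def fun_eq_iff add_divide_distrib\<close>)
  then show ?thesis using T unfolding m by blast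
qed

lemma take_chunk_runs:
  assumes c: "ctx s" and k: "nvar s ''kk'' = k" "k < CARD('q)" and p: "nvar s ''p'' = p0" "nvar s ''en'' = p1" "p0 \<le> p1"
    and u: "nvar s ''m'' \<noteq> nvar s ''u''"
    and inj: "inj_on (row s k) {p0..<p1}"
    and lab: "\<And>p. p0 \<le> p \<Longrightarrow> p < p1 \<Longrightarrow> (narr s ''lab'' (row s k p) = nvar s ''u'') = (row s k p \<in> P)"
    and C: "C = P \<inter> row s k ` {p0..<p1}" and f: "p1 - p0 < f"
  shows "runs take_chunk s f (\<lambda>s'. narr s' ''lab'' = (\<lambda>i. if i \<in> C then nvar s ''m'' else narr s ''lab'' i) \<and>
     nvar s' ''sa'' = nvar s ''sa'' + card C)"
proof -
  define D where "D p = P \<inter> row s k ` {p0..<p}" for p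
  show ?thesis unfolding take_chunk_def
  proof (rule runs_For[where M = p0 and N = p1 and g = "\<lambda>_. 1" and
      I = "\<lambda>p s'. narr s' ''lab'' = (\<lambda>i. if i \<in> D p then nvar s ''m'' else narr s ''lab'' i) \<and>
     nvar s' ''sa'' = nvar s ''sa'' + card (D p)"], goal_cases)
    case (6 pp s')
    have e: "ctx s'" "row s' = row s" "nvar s' ''kk'' = k" "nvar s' ''u'' = nvar s ''u''" "nvar s' ''m'' = nvar s ''m''"
      using ctx_frame[OF 6(5) c] row_frame[OF 6(5)] sameD[OF 6(5)] k by simp_all
    let ?i = "row s k pp"
    have "?i \<notin> row s k ` {p0..<pp}"
    proof
      assume "?i \<in> row s k ` {p0..<pp}"
      then obtain p' where p': "p0 \<le> p'" "p' < pp" "row s k pp = row s k p'" by auto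
      have "pp = p'" using p' 6(1,2) by (intro inj_onD[OF inj p'(3)]) auto
      then show False using p' by simp
    qed
    then have iD: "?i \<notin> D pp" by (simp add: D_def)
    have fin: "finite (D pp)" by (simp add: D_def)
    have DS: "D (Suc pp) = (if ?i \<in> P then insert ?i (D pp) else D pp)"
    proof -
      have "{p0..<Suc pp} = insert pp {p0..<pp}" using 6(1) by auto
      then show ?thesis by (auto simp: D_def)
    qed
    have iv: "(narr s' ''lab'' ?i = nvar s ''u'') = (?i \<in> P)" using lab[OF 6(1,2)] 6(3) iD by simp
    have card: "card (D (Suc pp)) = card (D pp) + (if ?i \<in> P then 1 else 0)" using DS iD fin by simp
    show ?case
      by (rule runs_line) (use 6(3,4) e iv k card in \<open>auto simp: DS fun_eq_iff\<close>)
  qed (use p f in \<open>auto simp: D_def C same_def\<close>)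
qed

end

context sample
begin

lemma tight_width:
  assumes t: "tight s l r P" and k: "k < CARD('q)"
    and mono: "\<And>p p'. l \<le> p \<Longrightarrow> p \<le> p' \<Longrightarrow> p' < r \<Longrightarrow> X k (row s k p) \<le> X k (row s k p')"
    and ij: "i \<in> P" "j \<in> P"
  shows "\<bar>X k i - X k j\<bar> \<le> extent s k"
proof -
  let ?A = "narr s ''a'' k" and ?B = "narr s ''b'' k"
  have t': "l \<le> ?A" "?A < ?B" "?B \<le> r" "P \<subseteq> row s k ` {?A..<?B}"
    using t k by (auto simp: tight_def pointers_def)
  have b: "X k (row s k ?A) \<le> X k z \<and> X k z \<le> X k (row s k (?B - 1))" if z: "z \<in> P" for z
  proof -
    obtain p where p: "?A \<le> p" "p < ?B" "z = row s k p" using subsetD[OF t'(4) z] by auto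
    show ?thesis unfolding p(3) using mono[of ?A p] mono[of p "?B - 1"] p t' by auto
  qed
  show ?thesis using b[OF ij(1)] b[OF ij(2)] unfolding extent_def by linarith
qed

text \<open>The chunk of \<open>T\<close> positions leaves its window, so \<open>gap\<close> falls
  by \<open>T\<close>, which pays for the walk and the relabelling. It is at most half of the
  window, whence the peeled part has at most half of the points of \<open>u\<close>.\<close>

lemma split_runs:
  fixes s :: state
  assumes c: "ctx s" and k: "nvar s ''kk'' = k" "k < CARD('q)" and t: "tight s l r P" and P: "P \<subseteq> {..<n}"
    and inj: "inj_on (row s k) {l..<r}" and rn: "\<And>p. l \<le> p \<Longrightarrow> p < r \<Longrightarrow> row s k p < n"
    and mono: "\<And>p p'. l \<le> p \<Longrightarrow> p \<le> p' \<Longrightarrow> p' < r \<Longrightarrow> X k (row s k p) \<le> X k (row s k p')"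
    and lab: "\<And>p. l \<le> p \<Longrightarrow> p < r \<Longrightarrow> (narr s ''lab'' (row s k p) = nvar s ''u'') = (row s k p \<in> P)"
    and u: "nvar s ''m'' \<noteq> nvar s ''u''" and w: "0 < extent s k" and rl: "nvar s ''r'' = r" "nvar s ''l'' = l"
  shows "\<exists>T C. 0 < T \<and> cut_ok P (extent s k) C (P - C) \<and> C \<subseteq> P \<and> C \<noteq> {} \<and> P - C \<noteq> {} \<and> 2 * card C \<le> r - l \<and>
    runs (walk CARD('q) ;; new_nodes CARD('q) ;; take_chunk ;; finish_split) s (T + 1) (\<lambda>s'.
      pointers s' l r (P - C) \<and> gap s' + T = gap s \<and>
      narr s' ''lab'' = (\<lambda>i. if i \<in> C then nvar s ''m'' else narr s ''lab'' i) \<and>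
      nvar s' ''m'' = nvar s ''m'' + 2 \<and> nvar s' ''cu'' = nvar s ''m'' + 1 \<and> nvar s' ''sa'' = nvar s ''sa'' + card C \<and>
      narr s' ''ch'' = (narr s ''ch'')(nvar s ''cu'' := nvar s ''m'') \<and>
      narr s' ''par'' = (narr s ''par'')(nvar s ''m'' := nvar s ''cu'', nvar s ''m'' + 1 := nvar s ''cu'') \<and>
      narr s' ''lo'' = (narr s ''lo'')(nvar s ''m'' := nvar s ''sa'', nvar s ''m'' + 1 := nvar s ''sa'' + card C) \<and>
      narr s' ''hi'' = (narr s ''hi'')(nvar s ''m'' := nvar s ''sa'' + card C, nvar s ''m'' + 1 := r) \<and>
      nvar s' ''go'' = (if 2 * (r - nvar s' ''sa'') \<le> r - l then 0 else nvar s ''go''))"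
proof -
  define A where "A = narr s ''a'' k"
  define B where "B = narr s ''b'' k"
  define F where "F = (\<lambda>p. X k (row s k p))"
  have t': "l \<le> A" "A < B" "B \<le> r" "P \<subseteq> row s k ` {A..<B}" "row s k A \<in> P" "row s k (B - 1) \<in> P"
    using t k by (auto simp: tight_def pointers_def A_def B_def)
  have Fm: "F p \<le> F p'" if "A \<le> p" "p \<le> p'" "p' < B" for p p' unfolding F_def using mono[of p p'] that t' by auto
  have rnAB: "row s k p < n" if "A \<le> p" "p < B" for p using rn that t' by auto
  define e where "e = (F A + F (B - 1)) / 2"
  have sd: "extent s k = F (B - 1) - F A" by (simp add: extent_def F_def A_def B_def)
  then have lt: "F A < F (B - 1)" using w by simp
  obtain T where T: "0 < T" "A + 2 * T \<le> B" "\<And>t. t < T \<Longrightarrow> F (A + t) \<le> e \<and> e < F (B - t - 1)"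
     "\<not> (F (A + T) \<le> e \<and> e < F (B - T - 1))"
    and R: "runs (walk CARD('q)) s (T + 1) (\<lambda>s'. nvar s' ''x'' = A + T \<and> nvar s' ''y'' = B - T \<and> rvar s' ''c'' = e)"
    using walk_runs[OF c k A_def B_def t'(2) rnAB F_def Fm lt] unfolding e_def by blast
  \<comment> \<open>Tells which pointer has met the cut. If the left one has, the positions before
    it are the complete low side; otherwise the positions from \<open>B - T\<close> on are the
    complete high side.\<close>
  define low where "low \<longleftrightarrow> e < F (A + T)"
  define p0 where "p0 = (if low then A else B - T)"
  define p1 where "p1 = (if low then A + T else B)"
  have p01: "l \<le> p0" "p0 \<le> p1" "p1 \<le> r" "p1 - p0 = T" using T(1,2) t' by (auto simp: p0_def p1_def)
  define C where "C = P \<inter> row s k ` {p0..<p1}"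
  have pos: "\<exists>p. A \<le> p \<and> p < B \<and> i = row s k p" if "i \<in> P" for i using subsetD[OF t'(4) that] by auto
  have inC: "row s k p \<in> C \<longleftrightarrow> p0 \<le> p \<and> p < p1" if "row s k p \<in> P" "A \<le> p" "p < B" for p
  proof
    assume "row s k p \<in> C"
    then obtain p' where p': "p0 \<le> p'" "p' < p1" "row s k p = row s k p'" by (auto simp: C_def)
    have "p = p'" by (rule inj_onD[OF inj p'(3)]) (use that p' p01 t' in auto)
    then show "p0 \<le> p \<and> p < p1" using p' by simp
  qed (use that in \<open>auto simp: C_def\<close>)
  have left: "F p \<le> e" if "A \<le> p" "p < A + T" for p using T(3)[of "p - A"] that by simp
  have right: "e < F p" if "B - T \<le> p" "p < B" for p
  proof -
    have "B - (B - 1 - p) - 1 = p" "B - 1 - p < T" using that T(1,2) by linarith+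
    then show ?thesis using T(3)[of "B - 1 - p"] by metis
  qed
  have Ceq: "if low then C = {i \<in> P. X k i \<le> e} else C = {i \<in> P. e < X k i}"
  proof (cases low)
    case True
    have "i \<in> C \<longleftrightarrow> X k i \<le> e" if iP: "i \<in> P" for i
    proof -
      obtain p where p: "A \<le> p" "p < B" "i = row s k p" using pos[OF iP] by blast
      have "X k i \<le> e \<longleftrightarrow> p < A + T"
        using left[of p] Fm[of "A + T" p] True p unfolding low_def F_def by force
      then show ?thesis using inC[of p] iP p True by (simp add: p0_def p1_def)
    qed
    then show ?thesis using True by (auto simp: C_def)
  next
    case False
    then have FT: "F (B - T - 1) \<le> e" using T(4) by (auto simp: low_def)
    have "i \<in> C \<longleftrightarrow> e < X k i" if iP: "i \<in> P" for i
    proof -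
      obtain p where p: "A \<le> p" "p < B" "i = row s k p" using pos[OF iP] by blast
      have "e < X k i \<longleftrightarrow> B - T \<le> p"
      proof
        assume "e < X k i"
        then have "\<not> F p \<le> F (B - T - 1)" using FT p(3) unfolding F_def by simp
        then have "\<not> p \<le> B - T - 1" using Fm[of p "B - T - 1"] p T(1) t' by auto
        then show "B - T \<le> p" by linarith
      qed (use right p in \<open>simp add: F_def\<close>)
      then show ?thesis using inC[of p] iP p False by (simp add: p0_def p1_def)
    qed
    then show ?thesis using False by (auto simp: C_def)
  qed
  \<comment> \<open>The cut is the midpoint of the two extreme coordinates, which provides the
    witnesses for \<open>cut_ok\<close> and shows that both sides are nonempty.\<close>
  have ends: "X k (row s k A) = e - extent s k / 2" "X k (row s k (B - 1)) = e + extent s k / 2"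
    unfolding e_def sd F_def by (simp_all add: field_simps)
  have cut: "cut_ok P (extent s k) C (P - C)"
    unfolding cut_ok_def
  proof (intro exI[of _ "crd k"] exI[of _ e] conjI)
    show "\<exists>i\<in>P. Z i $ crd k = e - extent s k / 2" "\<exists>i\<in>P. Z i $ crd k = e + extent s k / 2"
      using ends t'(5,6) unfolding X_def by blast+
    show "C = {i \<in> P. Z i $ crd k \<le> e} \<and> P - C = {i \<in> P. e < Z i $ crd k} \<or>
      C = {i \<in> P. e < Z i $ crd k} \<and> P - C = {i \<in> P. Z i $ crd k \<le> e}"
      using Ceq unfolding X_def by (cases low) auto
  qed
  have ne: "C \<noteq> {}" "P - C \<noteq> {}"
    using Ceq ends w t'(5,6) by (cases low; force)+
  have CP: "C \<subseteq> P" by (simp add: C_def)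
  have cC: "card C \<le> T"
  proof -
    have "card C \<le> card (row s k ` {p0..<p1})" unfolding C_def by (intro card_mono) auto
    also have "\<dots> \<le> T" using card_image_le[of "{p0..<p1}" "row s k"] p01 by simp
    finally show ?thesis .
  qed
  have c2: "2 * card C \<le> r - l" using cC T(2) t' by linarith
  have injp: "inj_on (row s k) {p0..<p1}" by (rule inj_on_subset[OF inj]) (use p01 in auto)
  have R': "runs (walk CARD('q) ;; new_nodes CARD('q) ;; take_chunk ;; finish_split) s (T + 1) (\<lambda>s'.
      pointers s' l r (P - C) \<and> gap s' + T = gap s \<and>
      narr s' ''lab'' = (\<lambda>i. if i \<in> C then nvar s ''m'' else narr s ''lab'' i) \<and>
      nvar s' ''m'' = nvar s ''m'' + 2 \<and> nvar s' ''cu'' = nvar s ''m'' + 1 \<and> nvar s' ''sa'' = nvar s ''sa'' + card C \<and>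
      narr s' ''ch'' = (narr s ''ch'')(nvar s ''cu'' := nvar s ''m'') \<and>
      narr s' ''par'' = (narr s ''par'')(nvar s ''m'' := nvar s ''cu'', nvar s ''m'' + 1 := nvar s ''cu'') \<and>
      narr s' ''lo'' = (narr s ''lo'')(nvar s ''m'' := nvar s ''sa'', nvar s ''m'' + 1 := nvar s ''sa'' + card C) \<and>
      narr s' ''hi'' = (narr s ''hi'')(nvar s ''m'' := nvar s ''sa'' + card C, nvar s ''m'' + 1 := r) \<and>
      nvar s' ''go'' = (if 2 * (r - nvar s' ''sa'') \<le> r - l then 0 else nvar s ''go''))"
  proof (rule runs_Seq, rule runs_mono[OF R order_refl], elim conjE)
    fix s1 :: state assume x: "nvar s1 ''x'' = A + T" "nvar s1 ''y'' = B - T" "rvar s1 ''c'' = e" and sm1: "same (walk CARD('q)) s s1"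
    have e1: "ctx s1" "row s1 = row s" "narr s1 = narr s" "nvar s1 ''kk'' = k" "nvar s1 ''m'' = nvar s ''m''" "nvar s1 ''cu'' = nvar s ''cu''"
       "nvar s1 ''sa'' = nvar s ''sa''" "nvar s1 ''u'' = nvar s ''u''" "nvar s1 ''r'' = r" "nvar s1 ''l'' = l" "nvar s1 ''go'' = nvar s ''go''"
      using ctx_frame[OF sm1 c] row_frame[OF sm1] sameD[OF sm1] k rl by (auto simp: walk_def fun_eq_iff)
    have bv: "bval (RLess (RVar ''c'') (zc CARD('q) (ordx (NVar ''kk'') (NVar ''x'')) (NVar ''kk''))) s1' \<longleftrightarrow> low"
      if "ctx s1'" "row s1' = row s" "nvar s1' ''kk'' = k" "nvar s1' ''x'' = A + T" "rvar s1' ''c'' = e" for s1'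
      using that rnAB[of "A + T"] T(1,2) k(2) by (simp add: low_def F_def ctx_def row_def ordx_def fun_eq_iff)
    define s2 where "s2 = eff (new_nodes CARD('q)) s1"
    have s2: "ctx s2" "row s2 = row s" "nvar s2 ''p'' = p0" "nvar s2 ''en'' = p1"
      "narr s2 ''a'' = (if low then (narr s ''a'')(k := A + T) else narr s ''a'')"
      "narr s2 ''b'' = (if low then narr s ''b'' else (narr s ''b'')(k := B - T))"
      "narr s2 ''lab'' = narr s ''lab''" "nvar s2 ''kk'' = k" "nvar s2 ''m'' = nvar s ''m''" "nvar s2 ''u'' = nvar s ''u''" "nvar s2 ''sa'' = nvar s ''sa''"
      "narr s2 ''ch'' = (narr s ''ch'')(nvar s ''cu'' := nvar s ''m'')"
      "narr s2 ''par'' = (narr s ''par'')(nvar s ''m'' := nvar s ''cu'', nvar s ''m'' + 1 := nvar s ''cu'')"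
      "narr s2 ''lo'' = (narr s ''lo'')(nvar s ''m'' := nvar s ''sa'')" "narr s2 ''hi'' = narr s ''hi''"
      "nvar s2 ''r'' = r" "nvar s2 ''l'' = l" "nvar s2 ''go'' = nvar s ''go''"
    proof -
      define s1' where "s1' = s1\<lparr>narr := (narr s1)(''ch'' := (narr s ''ch'')(nvar s ''cu'' := nvar s ''m''),
         ''par'' := (narr s ''par'')(nvar s ''m'' := nvar s ''cu'', nvar s ''m'' + 1 := nvar s ''cu''), ''lo'' := (narr s ''lo'')(nvar s ''m'' := nvar s ''sa''))\<rparr>"
      have "bval (RLess (RVar ''c'') (zc CARD('q) (ordx (NVar ''kk'') (NVar ''x'')) (NVar ''kk''))) s1' \<longleftrightarrow> low"
        by (rule bv) (use e1 x in \<open>simp_all add: s1'_def ctx_def row_def fun_eq_iff\<close>)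
      moreover have "eff (NPut ''ch'' (NVar ''cu'') (NVar ''m'') ;; NPut ''par'' (NVar ''m'') (NVar ''cu'') ;;
          NPut ''par'' (NAdd (NVar ''m'') (NLit 1)) (NVar ''cu'') ;; NPut ''lo'' (NVar ''m'') (NVar ''sa'')) s1 = s1'"
        using e1 by (simp add: s1'_def)
      ultimately have "s2 = (if low then s1'\<lparr>nvar := (nvar s1')(''p'' := A, ''en'' := A + T), narr := (narr s1')(''a'' := (narr s ''a'')(k := A + T))\<rparr>
        else s1'\<lparr>nvar := (nvar s1')(''p'' := B - T, ''en'' := B), narr := (narr s1')(''b'' := (narr s ''b'')(k := B - T))\<rparr>)"
        unfolding s2_def new_nodes_def using e1 x by (simp add: s1'_def A_def B_def)
      then have b: "nvar s2 = (if low then (nvar s1)(''p'' := A, ''en'' := A + T) else (nvar s1)(''p'' := B - T, ''en'' := B))"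
        "rarr s2 = rarr s1" "narr s2 = (if low then (narr s1')(''a'' := (narr s ''a'')(k := A + T)) else (narr s1')(''b'' := (narr s ''b'')(k := B - T)))"
        by (simp_all add: s1'_def)
      show "ctx s2" using e1(1) unfolding ctx_def b by (cases low; simp add: s1'_def e1(3))
      show "row s2 = row s" by (rule row_eq) (cases low; simp add: b s1'_def e1(3))
      show "nvar s2 ''p'' = p0" "nvar s2 ''en'' = p1"
      "narr s2 ''a'' = (if low then (narr s ''a'')(k := A + T) else narr s ''a'')"
      "narr s2 ''b'' = (if low then narr s ''b'' else (narr s ''b'')(k := B - T))"
      "narr s2 ''lab'' = narr s ''lab''" "nvar s2 ''kk'' = k" "nvar s2 ''m'' = nvar s ''m''" "nvar s2 ''u'' = nvar s ''u''" "nvar s2 ''sa'' = nvar s ''sa''"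
      "narr s2 ''ch'' = (narr s ''ch'')(nvar s ''cu'' := nvar s ''m'')"
      "narr s2 ''par'' = (narr s ''par'')(nvar s ''m'' := nvar s ''cu'', nvar s ''m'' + 1 := nvar s ''cu'')"
      "narr s2 ''lo'' = (narr s ''lo'')(nvar s ''m'' := nvar s ''sa'')" "narr s2 ''hi'' = narr s ''hi''"
      "nvar s2 ''r'' = r" "nvar s2 ''l'' = l" "nvar s2 ''go'' = nvar s ''go''"
        by (cases low; simp add: b s1'_def e1(3-11) p0_def p1_def)+
    qed
    have ptr2: "pointers s2 l r (P - C)"
      unfolding pointers_def s2
    proof (intro allI impI)
      fix j assume j: "j < CARD('q)"
      have old: "l \<le> narr s ''a'' j" "narr s ''a'' j \<le> narr s ''b'' j" "narr s ''b'' j \<le> r" "P \<subseteq> row s j ` {narr s ''a'' j..<narr s ''b'' j}"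
        using t j by (auto simp: tight_def pointers_def)
      show "l \<le> (if low then (narr s ''a'')(k := A + T) else narr s ''a'') j \<and>
         (if low then (narr s ''a'')(k := A + T) else narr s ''a'') j \<le> (if low then narr s ''b'' else (narr s ''b'')(k := B - T)) j \<and>
         (if low then narr s ''b'' else (narr s ''b'')(k := B - T)) j \<le> r \<and>
         P - C \<subseteq> row s j ` {(if low then (narr s ''a'')(k := A + T) else narr s ''a'') j..<(if low then narr s ''b'' else (narr s ''b'')(k := B - T)) j}"
      proof (cases "j = k")
        case False
        then show ?thesis using old by auto
      next
        case True
        have "P - C \<subseteq> row s k ` {if low then A + T else A..<if low then B else B - T}"
        proof
          fix i assume i: "i \<in> P - C"
          then obtain p where p: "A \<le> p" "p < B" "i = row s k p" using pos[of i] by blast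
          then have "\<not> (p0 \<le> p \<and> p < p1)" using inC[of p] i by blast
          then have "(if low then A + T else A) \<le> p" "p < (if low then B else B - T)"
            using p by (auto simp: p0_def p1_def split: if_splits)
          then show "i \<in> row s k ` {if low then A + T else A..<if low then B else B - T}" using p(3) by simp
        qed
        then show ?thesis using True T(1,2) t' by (auto simp: A_def[symmetric] B_def[symmetric])
      qed
    qed
    have gap2: "gap s2 + T = gap s"
    proof -
      have "gap s2 = (\<Sum>j\<in>{..<CARD('q)} - {k}. narr s ''b'' j - narr s ''a'' j) + (B - A - T)"
        unfolding gap_def s2 by (subst sum.remove[of _ k]) (use k(2) in \<open>auto intro!: sum.cong simp: A_def B_def add.commute\<close>)
      moreover have "gap s = (\<Sum>j\<in>{..<CARD('q)} - {k}. narr s ''b'' j - narr s ''a'' j) + (B - A)"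
        unfolding gap_def by (subst sum.remove[of _ k]) (use k(2) in \<open>auto simp: A_def B_def add.commute\<close>)
      ultimately show ?thesis using T(2) by linarith
    qed
    have lab2: "(narr s2 ''lab'' (row s2 k p) = nvar s2 ''u'') = (row s2 k p \<in> P)" if "p0 \<le> p" "p < p1" for p
      unfolding s2 using lab that p01 by auto
    show "runs (new_nodes CARD('q) ;; take_chunk ;; finish_split) s1 (T + 1) (\<lambda>s'.
      pointers s' l r (P - C) \<and> gap s' + T = gap s \<and>
      narr s' ''lab'' = (\<lambda>i. if i \<in> C then nvar s ''m'' else narr s ''lab'' i) \<and>
      nvar s' ''m'' = nvar s ''m'' + 2 \<and> nvar s' ''cu'' = nvar s ''m'' + 1 \<and> nvar s' ''sa'' = nvar s ''sa'' + card C \<and>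
      narr s' ''ch'' = (narr s ''ch'')(nvar s ''cu'' := nvar s ''m'') \<and>
      narr s' ''par'' = (narr s ''par'')(nvar s ''m'' := nvar s ''cu'', nvar s ''m'' + 1 := nvar s ''cu'') \<and>
      narr s' ''lo'' = (narr s ''lo'')(nvar s ''m'' := nvar s ''sa'', nvar s ''m'' + 1 := nvar s ''sa'' + card C) \<and>
      narr s' ''hi'' = (narr s ''hi'')(nvar s ''m'' := nvar s ''sa'' + card C, nvar s ''m'' + 1 := r) \<and>
      nvar s' ''go'' = (if 2 * (r - nvar s' ''sa'') \<le> r - l then 0 else nvar s ''go''))"
    proof (rule runs_Seq, rule runs_line)
      show "runs (take_chunk ;; finish_split) (eff (new_nodes CARD('q)) s1) (T + 1) (\<lambda>s'.
      pointers s' l r (P - C) \<and> gap s' + T = gap s \<and>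
      narr s' ''lab'' = (\<lambda>i. if i \<in> C then nvar s ''m'' else narr s ''lab'' i) \<and>
      nvar s' ''m'' = nvar s ''m'' + 2 \<and> nvar s' ''cu'' = nvar s ''m'' + 1 \<and> nvar s' ''sa'' = nvar s ''sa'' + card C \<and>
      narr s' ''ch'' = (narr s ''ch'')(nvar s ''cu'' := nvar s ''m'') \<and>
      narr s' ''par'' = (narr s ''par'')(nvar s ''m'' := nvar s ''cu'', nvar s ''m'' + 1 := nvar s ''cu'') \<and>
      narr s' ''lo'' = (narr s ''lo'')(nvar s ''m'' := nvar s ''sa'', nvar s ''m'' + 1 := nvar s ''sa'' + card C) \<and>
      narr s' ''hi'' = (narr s ''hi'')(nvar s ''m'' := nvar s ''sa'' + card C, nvar s ''m'' + 1 := r) \<and>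
      nvar s' ''go'' = (if 2 * (r - nvar s' ''sa'') \<le> r - l then 0 else nvar s ''go''))"
        unfolding s2_def[symmetric]
      proof (rule runs_Seq, rule runs_mono[OF take_chunk_runs[OF s2(1,8) k(2) s2(3,4) p01(2), where P = P and C = C and f = "T + 1"] order_refl])
        show "nvar s2 ''m'' \<noteq> nvar s2 ''u''" using u s2 by simp
        show "inj_on (row s2 k) {p0..<p1}" using injp s2 by simp
        show "C = P \<inter> row s2 k ` {p0..<p1}" using s2 by (simp add: C_def)
        show "p1 - p0 < T + 1" using p01 by simp
        fix s3 :: state assume h: "narr s3 ''lab'' = (\<lambda>i. if i \<in> C then nvar s2 ''m'' else narr s2 ''lab'' i) \<and> nvar s3 ''sa'' = nvar s2 ''sa'' + card C"
          and sm: "same take_chunk s2 s3"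
        have e3: "narr s3 ''a'' = narr s2 ''a''" "narr s3 ''b'' = narr s2 ''b''" "narr s3 ''ord'' = narr s2 ''ord''" "narr s3 ''ch'' = narr s2 ''ch''"
          "narr s3 ''par'' = narr s2 ''par''" "narr s3 ''lo'' = narr s2 ''lo''" "narr s3 ''hi'' = narr s2 ''hi''" "nvar s3 ''m'' = nvar s2 ''m''"
          "nvar s3 ''r'' = r" "nvar s3 ''l'' = l" "nvar s3 ''go'' = nvar s2 ''go''"
          using sm s2 by (simp_all add: same_def take_chunk_def)
        let ?s = "eff finish_split s3"
        have "narr ?s ''a'' = narr s2 ''a''" "narr ?s ''b'' = narr s2 ''b''" "narr ?s ''ord'' = narr s2 ''ord''"
          using e3 by (simp_all add: finish_split_def)
        then have pg: "pointers ?s l r (P - C) = pointers s2 l r (P - C)" "gap ?s = gap s2"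
          by (simp_all add: pointers_def gap_def row_def fun_eq_iff)
        have fs: "narr ?s ''lab'' = narr s3 ''lab''" "nvar ?s ''m'' = nvar s3 ''m'' + 2" "nvar ?s ''cu'' = nvar s3 ''m'' + 1"
          "nvar ?s ''sa'' = nvar s3 ''sa''" "narr ?s ''ch'' = narr s3 ''ch''" "narr ?s ''par'' = narr s3 ''par''"
          "narr ?s ''lo'' = (narr s3 ''lo'')(nvar s3 ''m'' + 1 := nvar s3 ''sa'')"
          "narr ?s ''hi'' = (narr s3 ''hi'')(nvar s3 ''m'' := nvar s3 ''sa'', nvar s3 ''m'' + 1 := r)"
          "nvar ?s ''go'' = (if 2 * (r - nvar s3 ''sa'') \<le> r - l then 0 else nvar s3 ''go'')"
          using e3(9,10) by (simp_all add: finish_split_def) linarith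
        show "runs finish_split s3 (T + 1) (\<lambda>s'.
      pointers s' l r (P - C) \<and> gap s' + T = gap s \<and>
      narr s' ''lab'' = (\<lambda>i. if i \<in> C then nvar s ''m'' else narr s ''lab'' i) \<and>
      nvar s' ''m'' = nvar s ''m'' + 2 \<and> nvar s' ''cu'' = nvar s ''m'' + 1 \<and> nvar s' ''sa'' = nvar s ''sa'' + card C \<and>
      narr s' ''ch'' = (narr s ''ch'')(nvar s ''cu'' := nvar s ''m'') \<and>
      narr s' ''par'' = (narr s ''par'')(nvar s ''m'' := nvar s ''cu'', nvar s ''m'' + 1 := nvar s ''cu'') \<and>
      narr s' ''lo'' = (narr s ''lo'')(nvar s ''m'' := nvar s ''sa'', nvar s ''m'' + 1 := nvar s ''sa'' + card C) \<and>
      narr s' ''hi'' = (narr s ''hi'')(nvar s ''m'' := nvar s ''sa'' + card C, nvar s ''m'' + 1 := r) \<and>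
      nvar s' ''go'' = (if 2 * (r - nvar s' ''sa'') \<le> r - l then 0 else nvar s ''go''))"
          by (rule runs_line, simp add: finish_split_def, simp, intro conjI)
            (simp_all only: pg ptr2 gap2 fs e3 s2 conjunct1[OF h] conjunct2[OF h] simp_thms if_cancel)
      qed (use lab2 in simp)
    qed (simp_all add: new_nodes_def)
  qed
  show ?thesis using T(1) cut CP ne c2 R' by blast
qed

end

text \<open>The expansion of one leaf \<open>u\<close>. The state \<open>s0\<close> and the sets
  \<open>pts0\<close> describe the tree before it, and \<open>m0\<close> separates old node numbers
  from new ones.\<close>

locale phase = sample crd n Z for crd :: "nat \<Rightarrow> 'q::finite" and n Z +
  fixes pts0 :: "nat \<Rightarrow> nat set" and s0 :: state and u l r m0 :: nat
  assumes T0: "tree_inv pts0 (narr s0 ''lab'') s0" and uf: "front s0 u" and su: "narr s0 ''st'' u = 0"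
    and l: "l = narr s0 ''lo'' u" and r: "r = narr s0 ''hi'' u" and m0: "m0 = nvar s0 ''m''"
    and rows: "k < CARD('q) \<Longrightarrow> row s0 k ` {l..<r} = pts0 u"
    and rsort: "k < CARD('q) \<Longrightarrow> l \<le> p \<Longrightarrow> p < p' \<Longrightarrow> p' < r \<Longrightarrow> lexl (X k) (row s0 k p) (row s0 k p')"
begin

lemma u_facts: "u < m0" "pts0 u \<subseteq> {..<n}" "pts0 u \<noteq> {}" "l + card (pts0 u) = r" "r \<le> n" "l < r"
proof -
  show um: "u < m0" using uf m0 by (simp add: front_def)
  note I = tree_invD[OF T0]
  show "pts0 u \<subseteq> {..<n}" "pts0 u \<noteq> {}" "l + card (pts0 u) = r" "r \<le> n"
    using I(3-6)[of u] um unfolding l r m0 by auto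
  moreover from this have "0 < card (pts0 u)" using finite_subset by (auto simp: card_gt_0_iff)
  ultimately show "l < r" by linarith
qed

lemma row_inj: "k < CARD('q) \<Longrightarrow> inj_on (row s0 k) {l..<r}"
proof (rule inj_onI)
  fix p p' assume k: "k < CARD('q)" and p: "p \<in> {l..<r}" "p' \<in> {l..<r}" and e: "row s0 k p = row s0 k p'"
  show "p = p'"
  proof (rule ccontr)
    assume "p \<noteq> p'"
    then have "lexl (X k) (row s0 k p) (row s0 k p') \<or> lexl (X k) (row s0 k p') (row s0 k p)"
      using rsort[OF k, of p p'] rsort[OF k, of p' p] p by (cases "p < p'") auto
    then show False using e lexl_irrefl by auto
  qed
qed

lemma row_n: "k < CARD('q) \<Longrightarrow> l \<le> p \<Longrightarrow> p < r \<Longrightarrow> row s0 k p < n"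
proof -
  assume a: "k < CARD('q)" "l \<le> p" "p < r"
  then have "row s0 k p \<in> row s0 k ` {l..<r}" by simp
  then show ?thesis using rows[OF a(1)] u_facts(2) by auto
qed

lemma row_mono: "k < CARD('q) \<Longrightarrow> l \<le> p \<Longrightarrow> p \<le> p' \<Longrightarrow> p' < r \<Longrightarrow> X k (row s0 k p) \<le> X k (row s0 k p')"
  using rsort[of k p p'] by (cases "p = p'") (auto simp: lexl_def)

definition fixd :: "state \<Rightarrow> bool" where
  "fixd s \<longleftrightarrow> ctx s \<and> nvar s ''u'' = u \<and> nvar s ''l'' = l \<and> nvar s ''r'' = r \<and> row s = row s0"

text \<open>In memory the larger part keeps the label \<open>u\<close>, for relabelling it at every
  split would be too expensive. This is the labelling for which the tree invariant holds.\<close>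

definition vlab :: "state \<Rightarrow> nat \<Rightarrow> nat" where
  "vlab s = (\<lambda>i. if narr s ''lab'' i = u then nvar s ''cu'' else narr s ''lab'' i)"

definition spine_cur :: "(nat \<Rightarrow> nat set) \<Rightarrow> state \<Rightarrow> bool" where
  "spine_cur pts s \<longleftrightarrow> (let y = nvar s ''cu'' in front s y \<and> (nvar s ''go'' \<noteq> 0 \<longrightarrow> narr s ''st'' y = 0) \<and> (y = u \<or> m0 \<le> y) \<and>
     nvar s ''sa'' = narr s ''lo'' y \<and> narr s ''hi'' y = r \<and> l \<le> nvar s ''sa'' \<and> pts y \<subseteq> pts0 u \<and>
     (\<forall>i<n. narr s ''lab'' i = u \<longleftrightarrow> i \<in> pts y) \<and> pointers s l r (pts y))"

definition spine_old :: "(nat \<Rightarrow> nat set) \<Rightarrow> state \<Rightarrow> bool" where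
  "spine_old pts s \<longleftrightarrow> (\<forall>x<m0. pts x = pts0 x \<and> (x \<noteq> u \<longrightarrow> narr s ''st'' x = narr s0 ''st'' x \<and> rarr s ''lmx'' x = rarr s0 ''lmx'' x) \<and>
       narr s ''lo'' x = narr s0 ''lo'' x \<and> narr s ''hi'' x = narr s0 ''hi'' x) \<and>
     (\<forall>i. i \<notin> pts0 u \<longrightarrow> narr s ''lab'' i = narr s0 ''lab'' i) \<and> (\<forall>i\<in>pts0 u. narr s ''lab'' i = u \<or> m0 \<le> narr s ''lab'' i)"

text \<open>Unexamined new nodes, apart from the one still being peeled, have at most half of the
  points of \<open>u\<close>: this is what makes \<open>lab_pot\<close> fall.\<close>

definition spine_new :: "state \<Rightarrow> bool" where
  "spine_new s \<longleftrightarrow> m0 \<le> nvar s ''m'' \<and> (\<forall>x. m0 \<le> x \<and> x < nvar s ''m'' \<longrightarrow> l \<le> narr s ''lo'' x \<and> narr s ''hi'' x \<le> r) \<and>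
     (\<forall>x. m0 \<le> x \<and> x < nvar s ''m'' \<and> narr s ''st'' x = 0 \<and> (x \<noteq> nvar s ''cu'' \<or> nvar s ''go'' = 0) \<longrightarrow>
        2 * (narr s ''hi'' x - narr s ''lo'' x) \<le> r - l) \<and>
     (nvar s ''go'' = 0 \<or> nvar s ''cu'' \<noteq> u \<longrightarrow> narr s ''st'' u \<noteq> 0)"

definition spine_inv :: "(nat \<Rightarrow> nat set) \<Rightarrow> state \<Rightarrow> bool" where
  "spine_inv pts s \<longleftrightarrow> tree_inv pts (vlab s) s \<and> spine_cur pts s \<and> spine_old pts s \<and> spine_new s"

text \<open>Every split consumes at least one unit of \<open>gap\<close>, and the last step without
  a split consumes the unit of \<open>go\<close>; either is worth the fixed cost of a step, which is
  linear in the dimension.\<close>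

definition spine_pot :: "state \<Rightarrow> nat" where
  "spine_pot s = (3 * CARD('q) + 8) * (gap s + (if nvar s ''go'' = 0 then 0 else 1))"

lemma spine_leaf:
  assumes I: "spine_inv pts s" and g: "nvar s ''go'' \<noteq> 0" and rp: "rp \<in> pts (nvar s ''cu'')"
    and w: "\<And>i j k. i \<in> pts (nvar s ''cu'') \<Longrightarrow> j \<in> pts (nvar s ''cu'') \<Longrightarrow> Z i $ k = Z j $ k"
    and s': "nvar s' ''m'' = nvar s ''m''" "nvar s' ''cu'' = nvar s ''cu''" "nvar s' ''sa'' = nvar s ''sa''" "nvar s' ''go'' = 0"
      "narr s' ''st'' = (narr s ''st'')(nvar s ''cu'' := 1)"
      "narr s' ''rep'' = (narr s ''rep'')(nvar s ''cu'' := rp)" "rarr s' ''lmx'' = (rarr s ''lmx'')(nvar s ''cu'' := 0)"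
      "narr s' ''ch'' = narr s ''ch''" "narr s' ''par'' = narr s ''par''" "narr s' ''lo'' = narr s ''lo''" "narr s' ''hi'' = narr s ''hi''"
      "narr s' ''lab'' = narr s ''lab''" and ptr: "pointers s' l r (pts (nvar s ''cu''))"
  shows "spine_inv pts s'"
proof -
  have J: "tree_inv pts (vlab s) s" "spine_cur pts s" "spine_old pts s" "spine_new s" using I by (simp_all add: spine_inv_def)
  have cf: "front s (nvar s ''cu'')" "narr s ''st'' (nvar s ''cu'') = 0" "nvar s ''cu'' = u \<or> m0 \<le> nvar s ''cu''"
    using J(2) g by (auto simp: spine_cur_def Let_def)
  have "vlab s' = vlab s" unfolding vlab_def s'(2,12) ..
  then have "tree_inv pts (vlab s') s'"
    using tree_inv_leaf[OF J(1) cf(1,2) rp w s'(1,5-11)] by simp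
  moreover have "spine_cur pts s'"
    using J(2) cf(1) ptr s' unfolding spine_cur_def Let_def front_def by simp
  moreover have "spine_old pts s'"
    using J(3) cf(3) s' unfolding spine_old_def by auto
  moreover have "spine_new s'"
    using J(4) cf(3) s' unfolding spine_new_def by auto
  ultimately show ?thesis by (simp add: spine_inv_def)
qed

lemma spine_split:
  assumes I: "spine_inv pts s" and g: "nvar s ''go'' \<noteq> 0" and y: "y = nvar s ''cu''" and m: "m = nvar s ''m''" and rp: "rp \<in> pts y" and w0: "0 < w"
    and w: "\<And>i j k. i \<in> pts y \<Longrightarrow> j \<in> pts y \<Longrightarrow> \<bar>Z i $ k - Z j $ k\<bar> \<le> w"
    and C: "C \<subseteq> pts y" "C \<noteq> {}" "pts y - C \<noteq> {}" "cut_ok (pts y) w C (pts y - C)" "2 * card C \<le> r - l"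
    and s': "nvar s' ''m'' = m + 2" "nvar s' ''cu'' = m + 1" "nvar s' ''sa'' = nvar s ''sa'' + card C"
      "nvar s' ''go'' = (if 2 * (r - nvar s' ''sa'') \<le> r - l then 0 else nvar s ''go'')"
      "narr s' ''st'' = (narr s ''st'')(y := 1)"
      "narr s' ''rep'' = (narr s ''rep'')(y := rp)" "rarr s' ''lmx'' = (rarr s ''lmx'')(y := w)"
      "narr s' ''ch'' = (narr s ''ch'')(y := m)" "narr s' ''par'' = (narr s ''par'')(m := y, m + 1 := y)"
      "narr s' ''lo'' = (narr s ''lo'')(m := nvar s ''sa'', m + 1 := nvar s ''sa'' + card C)"
      "narr s' ''hi'' = (narr s ''hi'')(m := nvar s ''sa'' + card C, m + 1 := r)"
      "narr s' ''lab'' = (\<lambda>i. if i \<in> C then m else narr s ''lab'' i)" and ptr: "pointers s' l r (pts y - C)"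
  shows "spine_inv (pts(m := C, m + 1 := pts y - C)) s'"
proof -
  have J: "tree_inv pts (vlab s) s" "spine_cur pts s" "spine_old pts s" "spine_new s" using I by (simp_all add: spine_inv_def)
  note TI = tree_invD[OF J(1)]
  have cf: "front s y" "narr s ''st'' y = 0" "y = u \<or> m0 \<le> y" "nvar s ''sa'' = narr s ''lo'' y" "narr s ''hi'' y = r"
    "l \<le> nvar s ''sa''" "pts y \<subseteq> pts0 u" "\<And>i. i < n \<Longrightarrow> narr s ''lab'' i = u \<longleftrightarrow> i \<in> pts y"
    using J(2) g unfolding spine_cur_def Let_def y by blast+
  have ym: "y < m" using cf(1) m by (simp add: front_def)
  have um: "u < m" "m0 \<le> m" using u_facts(1) J(4) m by (auto simp: spine_new_def)
  have Pn: "i < n" if "i \<in> pts y" for i using cf(7) u_facts(2) that by auto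
  have lab': "vlab s' i = (if i \<in> C then m else if i \<in> pts y then m + 1 else vlab s i)" if "i < n" for i
    using cf(8)[OF that] um s'(2,12) C(1) by (auto simp: vlab_def)
  have "tree_inv (pts(m := C, m + 1 := pts y - C)) (vlab s') s'"
    by (rule tree_inv_split[OF J(1) cf(1,2) rp w0 w C(1-4) m s'(1,5-9) _ _ lab'])
      (use s'(10,11) cf(4,5) in simp_all)
  moreover have fr: "front s' (m + 1)"
    using s' TI(13)[of "m + 1"] m ym by (simp add: front_def)
  have "spine_cur (pts(m := C, m + 1 := pts y - C)) s'"
    unfolding spine_cur_def Let_def s'(2)
  proof (intro conjI allI impI)
    show "front s' (m + 1)" by (rule fr)
    show "narr s' ''st'' (m + 1) = 0" using s'(5) TI(13)[of "m + 1"] m ym by simp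
    show "(narr s' ''lab'' i = u) = (i \<in> (pts(m := C, m + 1 := pts y - C)) (m + 1))" if "i < n" for i
      using cf(8)[OF that] s'(12) C(1) um by auto
  qed (use s' cf um ptr in auto)
  moreover have "spine_old (pts(m := C, m + 1 := pts y - C)) s'"
    unfolding spine_old_def
  proof (intro conjI allI impI ballI)
    fix x assume x: "x < m0"
    then have "x \<noteq> m" "x \<noteq> m + 1" "x \<noteq> u \<Longrightarrow> x \<noteq> y" using um cf(3) by auto
    moreover note J(3)[unfolded spine_old_def, THEN conjunct1, rule_format, OF x]
    ultimately show "(pts(m := C, m + 1 := pts y - C)) x = pts0 x" "x \<noteq> u \<Longrightarrow> narr s' ''st'' x = narr s0 ''st'' x"
      "x \<noteq> u \<Longrightarrow> rarr s' ''lmx'' x = rarr s0 ''lmx'' x" "narr s' ''lo'' x = narr s0 ''lo'' x" "narr s' ''hi'' x = narr s0 ''hi'' x"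
      using s' by simp_all
  next
    fix i assume "i \<notin> pts0 u"
    then show "narr s' ''lab'' i = narr s0 ''lab'' i" using J(3) s'(12) C(1) cf(7) unfolding spine_old_def by auto
  next
    fix i assume "i \<in> pts0 u"
    then show "narr s' ''lab'' i = u \<or> m0 \<le> narr s' ''lab'' i" using J(3) s'(12) um unfolding spine_old_def by auto
  qed
  moreover have "spine_new s'"
  proof -
    have fin: "finite (pts y)" by (rule finite_subset[of _ "{..<n}"]) (use Pn in auto)
    have cC: "card C \<le> card (pts y)" by (rule card_mono[OF fin C(1)])
    have hl: "nvar s ''sa'' + card (pts y) = r" using TI(5)[of y] ym m cf(4,5) by simp
    have N: "\<And>x. m0 \<le> x \<Longrightarrow> x < m \<Longrightarrow> l \<le> narr s ''lo'' x \<and> narr s ''hi'' x \<le> r"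
      "\<And>x. m0 \<le> x \<Longrightarrow> x < m \<Longrightarrow> narr s ''st'' x = 0 \<Longrightarrow> x \<noteq> y \<Longrightarrow> 2 * (narr s ''hi'' x - narr s ''lo'' x) \<le> r - l"
      "y \<noteq> u \<Longrightarrow> narr s ''st'' u \<noteq> 0"
      using J(4) unfolding spine_new_def m y by blast+
    show ?thesis unfolding spine_new_def
    proof (intro conjI allI impI)
      show "m0 \<le> nvar s' ''m''" using s' um by simp
      show "narr s' ''st'' u \<noteq> 0" using s'(5) N(3) by auto
    next
      fix x assume "m0 \<le> x \<and> x < nvar s' ''m''"
      then have x: "m0 \<le> x" "x < m + 2" using s'(1) by auto
      show "l \<le> narr s' ''lo'' x" "narr s' ''hi'' x \<le> r"
        using N(1)[of x] x s'(10,11) cf(6) hl cC by (cases "x < m"; cases "x = m"; simp)+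
    next
      fix x assume "m0 \<le> x \<and> x < nvar s' ''m'' \<and> narr s' ''st'' x = 0 \<and> (x \<noteq> nvar s' ''cu'' \<or> nvar s' ''go'' = 0)"
      then have x: "m0 \<le> x" "x < m + 2" "narr s' ''st'' x = 0" "x \<noteq> m + 1 \<or> nvar s' ''go'' = 0" using s'(1,2) by auto
      consider "x < m" | "x = m" | "x = m + 1" using x by linarith
      then show "2 * (narr s' ''hi'' x - narr s' ''lo'' x) \<le> r - l"
      proof cases
        case 1
        then have "x \<noteq> y" using x(3) s'(5) by auto
        then show ?thesis using N(2)[of x] 1 x s'(5,10,11) by simp
      next
        case 2
        then show ?thesis using s'(10,11) C(5) by simp
      next
        case 3
        then have "nvar s' ''go'' = 0" using x by simp
        then have "2 * (r - nvar s' ''sa'') \<le> r - l" using s'(4) g by (simp split: if_splits)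
        then show ?thesis using 3 s'(3,10,11) by simp
      qed
    qed
  qed
  ultimately show ?thesis by (simp add: spine_inv_def)
qed

text \<open>\<open>g\<close> and \<open>c\<close> are the values of \<open>gap\<close> before and
  after skipping, \<open>f\<close> is the cost of that part, and \<open>T\<close> is the length of
  the chunk. One of the \<open>T\<close> units pays for the constant part, the loss
  \<open>g - c\<close> for the rest of \<open>f\<close>.\<close>

lemma pot_arith:
  fixes c d f g T :: nat
  assumes "c + f \<le> g + 2 * b + 3" "2 * b + 3 \<le> f" "0 < T"
  shows "(3 * b + 8) * (c - T + 1) + max f (T + 1) \<le> (3 * b + 8) * (g + 1) \<or> c < T"
    "(3 * b + 8) * c + max f 1 \<le> (3 * b + 8) * (g + 1)"
proof -
  have "c \<le> g" using assms by linarith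
  then obtain d where d: "g = c + d" using le_Suc_ex by blast
  have f: "f \<le> d + 2 * b + 3" using assms d by simp
  have dd: "d \<le> (3 * b + 8) * d" by simp
  show "(3 * b + 8) * c + max f 1 \<le> (3 * b + 8) * (g + 1)"
  proof -
    have "(3 * b + 8) * (g + 1) = (3 * b + 8) * c + (3 * b + 8) * d + (3 * b + 8)" by (simp add: d distrib_left)
    then show ?thesis using f dd by linarith
  qed
  show "(3 * b + 8) * (c - T + 1) + max f (T + 1) \<le> (3 * b + 8) * (g + 1) \<or> c < T"
  proof (cases "c < T")
    case False
    then obtain e where e: "c = e + T" by (metis le_Suc_ex add.commute not_less)
    obtain T' where T': "T = Suc T'" using assms(3) by (cases T) auto
    have tt: "T' \<le> (3 * b + 8) * T'" by simp
    have "(3 * b + 8) * (g + 1) = (3 * b + 8) * (e + 1) + (3 * b + 8) * d + (3 * b + 8) * T' + (3 * b + 8)"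
      by (simp add: d e T' distrib_left)
    moreover have "c - T = e" by (simp add: e)
    moreover have "f \<le> (3 * b + 8) * d + (3 * b + 8) * T' + (3 * b + 8)" "T + 1 \<le> (3 * b + 8) * d + (3 * b + 8) * T' + (3 * b + 8)"
      using f dd tt T' by linarith+
    ultimately show ?thesis by simp
  qed simp
qed

lemma spine_step_runs:
  assumes F: "fixd s" and I: "spine_inv pts s" and g: "nvar s ''go'' \<noteq> 0"
  shows "\<exists>f. runs (spine_step CARD('q)) s f (\<lambda>s'. fixd s' \<and> (\<exists>pts'. spine_inv pts' s') \<and> spine_pot s' + f \<le> spine_pot s)"
proof -
  define y where "y = nvar s ''cu''"
  define P where "P = pts y"
  have J: "tree_inv pts (vlab s) s" "spine_cur pts s" "spine_old pts s" "spine_new s" using I by (simp_all add: spine_inv_def)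
  have cf: "front s y" "pts y \<subseteq> pts0 u" "\<And>i. i < n \<Longrightarrow> narr s ''lab'' i = u \<longleftrightarrow> i \<in> P" "pointers s l r P"
    using J(2) unfolding spine_cur_def Let_def P_def y_def by blast+
  have Pn: "P \<subseteq> {..<n}" using cf(2) u_facts(2) by (auto simp: P_def)
  have Pne: "P \<noteq> {}" using tree_invD(3)[OF J(1), of y] cf(1) by (simp add: front_def P_def)
  have fx: "ctx s" "row s = row s0" "nvar s ''u'' = u" "nvar s ''l'' = l" "nvar s ''r'' = r" using F by (auto simp: fixd_def)
  have lab: "(narr s ''lab'' (row s k p) = nvar s ''u'') = (row s k p \<in> P)" if "k < CARD('q)" "l \<le> p" "p < r" for k p
    using cf(3)[OF row_n[OF that]] fx by simp
  have um: "nvar s ''m'' \<noteq> u" using u_facts(1) J(4) by (simp add: spine_new_def)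
  obtain f1 where f1: "2 * CARD('q) + 3 \<le> f1" and R1: "runs (skip_dead CARD('q) ;; longest_side CARD('q) ;; mark_node) s f1 (\<lambda>s'. tight s' l r P \<and>
     gap s' + f1 \<le> gap s + 2 * CARD('q) + 3 \<and> 0 \<le> rvar s' ''w'' \<and> (\<forall>k<CARD('q). extent s' k \<le> rvar s' ''w'') \<and>
     (0 < rvar s' ''w'' \<longrightarrow> nvar s' ''kk'' < CARD('q) \<and> rvar s' ''w'' = extent s' (nvar s' ''kk'')) \<and>
     rarr s' ''lmx'' = (rarr s ''lmx'')(nvar s ''cu'' := rvar s' ''w'') \<and> narr s' ''st'' = (narr s ''st'')(nvar s ''cu'' := 1) \<and>
     narr s' ''rep'' = (narr s ''rep'')(nvar s ''cu'' := row s' 0 (narr s' ''a'' 0)))"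
    using part1_runs[OF fx(1) cf(4) Pne Pn lab] by blast
  let ?Q = "\<lambda>f s'. fixd s' \<and> (\<exists>pts'. spine_inv pts' s') \<and> spine_pot s' + f \<le> spine_pot s"
  show ?thesis unfolding spine_step_def
  proof (rule runs_Seq_ex[where Q = ?Q], rule runs_mono[OF R1 order_refl], elim conjE)
    fix s1 :: state
    assume t: "tight s1 l r P" and gp: "gap s1 + f1 \<le> gap s + 2 * CARD('q) + 3" and w0: "0 \<le> rvar s1 ''w''"
      and ws: "\<forall>k<CARD('q). extent s1 k \<le> rvar s1 ''w''"
      and wk: "0 < rvar s1 ''w'' \<longrightarrow> nvar s1 ''kk'' < CARD('q) \<and> rvar s1 ''w'' = extent s1 (nvar s1 ''kk'')"
      and mk: "rarr s1 ''lmx'' = (rarr s ''lmx'')(nvar s ''cu'' := rvar s1 ''w'')" "narr s1 ''st'' = (narr s ''st'')(nvar s ''cu'' := 1)"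
        "narr s1 ''rep'' = (narr s ''rep'')(nvar s ''cu'' := row s1 0 (narr s1 ''a'' 0))"
      and sm: "same (skip_dead CARD('q) ;; longest_side CARD('q) ;; mark_node) s s1"
    have e: "ctx s1" "row s1 = row s0" "nvar s1 ''u'' = u" "nvar s1 ''l'' = l" "nvar s1 ''r'' = r"
      "nvar s1 ''cu'' = nvar s ''cu''" "nvar s1 ''m'' = nvar s ''m''" "nvar s1 ''sa'' = nvar s ''sa''" "nvar s1 ''go'' = nvar s ''go''"
      "narr s1 ''ch'' = narr s ''ch''" "narr s1 ''par'' = narr s ''par''" "narr s1 ''lo'' = narr s ''lo''" "narr s1 ''hi'' = narr s ''hi''"
      "narr s1 ''lab'' = narr s ''lab''"
      using sm fx by (auto simp: same_def spine_defs ctx_def row_def fun_eq_iff)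
    have rp: "row s1 0 (narr s1 ''a'' 0) \<in> P" using t q0 by (simp add: tight_def)
    have wid: "\<bar>Z i $ k - Z j $ k\<bar> \<le> rvar s1 ''w''" if "i \<in> P" "j \<in> P" for i j k
    proof -
      obtain k' where k': "k' < CARD('q)" "crd k' = k" using crd by (metis UNIV_I bij_betw_imp_surj_on imageE lessThan_iff)
      have "\<bar>X k' i - X k' j\<bar> \<le> extent s1 k'"
        by (rule tight_width[OF t k'(1) _ that]) (use row_mono[OF k'(1)] e(2) in simp)
      also have "\<dots> \<le> rvar s1 ''w''" using ws k'(1) by blast
      finally show ?thesis by (simp add: X_def k'(2))
    qed
    have sp: "spine_pot s = (3 * CARD('q) + 8) * (gap s + 1)" using g by (simp add: spine_pot_def)
    show "\<exists>f2. runs (Cond (RLess (OfNat (NLit 0)) (RVar ''w''))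
       (walk CARD('q) ;; new_nodes CARD('q) ;; take_chunk ;; finish_split) (''go'' ::=\<^sub>n NLit 0)) s1 f2 (?Q (max f1 f2))"
    proof (cases "0 < rvar s1 ''w''")
      case False
      then have w: "rvar s1 ''w'' = 0" using w0 by simp
      let ?s = "eff (''go'' ::=\<^sub>n NLit 0) s1"
      have eq: "Z i $ k = Z j $ k" if "i \<in> pts (nvar s ''cu'')" "j \<in> pts (nvar s ''cu'')" for i j k
        using wid[of i j k] that w by (simp add: P_def y_def)
      have "pointers ?s l r (pts (nvar s ''cu''))"
        using t by (simp add: tight_def pointers_def row_def P_def y_def)
      then have "spine_inv pts ?s"
        by (intro spine_leaf[OF I g rp[unfolded P_def y_def] eq]) (use e mk w in simp_all)
      moreover have "fixd ?s" using e by (simp add: fixd_def ctx_def row_def fun_eq_iff)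
      moreover have "spine_pot ?s + max f1 1 \<le> spine_pot s"
      proof -
        have "spine_pot ?s = (3 * CARD('q) + 8) * gap s1" by (simp add: spine_pot_def gap_def)
        then show ?thesis using pot_arith(2)[OF gp f1, of 1] unfolding sp by simp
      qed
      ultimately show ?thesis using False
        by (intro exI[of _ 1] runs_Cond runs_line) auto
    next
      case True
      define k where "k = nvar s1 ''kk''"
      have k: "k < CARD('q)" "rvar s1 ''w'' = extent s1 k" using wk True by (auto simp: k_def)
      have a1: "inj_on (row s1 k) {l..<r}" using row_inj[OF k(1)] e(2) by simp
      have a2: "row s1 k p < n" if "l \<le> p" "p < r" for p using row_n[OF k(1) that] e(2) by simp
      have a3: "X k (row s1 k p) \<le> X k (row s1 k p')" if "l \<le> p" "p \<le> p'" "p' < r" for p p' using row_mono[OF k(1) that] e(2) by simp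
      have a4: "(narr s1 ''lab'' (row s1 k p) = nvar s1 ''u'') = (row s1 k p \<in> P)" if "l \<le> p" "p < r" for p
        using lab[OF k(1) that] e fx by simp
      have a5: "nvar s1 ''m'' \<noteq> nvar s1 ''u''" using um e by simp
      have a6: "0 < extent s1 k" using True k by simp
      obtain T C where TC: "0 < T" "cut_ok P (extent s1 k) C (P - C)" "C \<subseteq> P" "C \<noteq> {}" "P - C \<noteq> {}" "2 * card C \<le> r - l"
        and R2: "runs (walk CARD('q) ;; new_nodes CARD('q) ;; take_chunk ;; finish_split) s1 (T + 1) (\<lambda>s'.
      pointers s' l r (P - C) \<and> gap s' + T = gap s1 \<and>
      narr s' ''lab'' = (\<lambda>i. if i \<in> C then nvar s1 ''m'' else narr s1 ''lab'' i) \<and>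
      nvar s' ''m'' = nvar s1 ''m'' + 2 \<and> nvar s' ''cu'' = nvar s1 ''m'' + 1 \<and> nvar s' ''sa'' = nvar s1 ''sa'' + card C \<and>
      narr s' ''ch'' = (narr s1 ''ch'')(nvar s1 ''cu'' := nvar s1 ''m'') \<and>
      narr s' ''par'' = (narr s1 ''par'')(nvar s1 ''m'' := nvar s1 ''cu'', nvar s1 ''m'' + 1 := nvar s1 ''cu'') \<and>
      narr s' ''lo'' = (narr s1 ''lo'')(nvar s1 ''m'' := nvar s1 ''sa'', nvar s1 ''m'' + 1 := nvar s1 ''sa'' + card C) \<and>
      narr s' ''hi'' = (narr s1 ''hi'')(nvar s1 ''m'' := nvar s1 ''sa'' + card C, nvar s1 ''m'' + 1 := r) \<and>
      nvar s' ''go'' = (if 2 * (r - nvar s' ''sa'') \<le> r - l then 0 else nvar s1 ''go''))"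
        using split_runs[OF e(1) k_def[symmetric] k(1) t Pn a1 a2 a3 a4 a5 a6 e(5,4)] by blast
      have "runs (walk CARD('q) ;; new_nodes CARD('q) ;; take_chunk ;; finish_split) s1 (T + 1) (?Q (max f1 (T + 1)))"
      proof (rule runs_mono[OF R2 order_refl], elim conjE)
        fix s' :: state
        assume h: "pointers s' l r (P - C)" "gap s' + T = gap s1"
          "narr s' ''lab'' = (\<lambda>i. if i \<in> C then nvar s1 ''m'' else narr s1 ''lab'' i)"
          "nvar s' ''m'' = nvar s1 ''m'' + 2" "nvar s' ''cu'' = nvar s1 ''m'' + 1" "nvar s' ''sa'' = nvar s1 ''sa'' + card C"
          "narr s' ''ch'' = (narr s1 ''ch'')(nvar s1 ''cu'' := nvar s1 ''m'')"
          "narr s' ''par'' = (narr s1 ''par'')(nvar s1 ''m'' := nvar s1 ''cu'', nvar s1 ''m'' + 1 := nvar s1 ''cu'')"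
          "narr s' ''lo'' = (narr s1 ''lo'')(nvar s1 ''m'' := nvar s1 ''sa'', nvar s1 ''m'' + 1 := nvar s1 ''sa'' + card C)"
          "narr s' ''hi'' = (narr s1 ''hi'')(nvar s1 ''m'' := nvar s1 ''sa'' + card C, nvar s1 ''m'' + 1 := r)"
          "nvar s' ''go'' = (if 2 * (r - nvar s' ''sa'') \<le> r - l then 0 else nvar s1 ''go'')"
          and sm': "same (walk CARD('q) ;; new_nodes CARD('q) ;; take_chunk ;; finish_split) s1 s'"
        have e': "ctx s'" "row s' = row s0" "nvar s' ''u'' = u" "nvar s' ''l'' = l" "nvar s' ''r'' = r"
          "narr s' ''st'' = narr s1 ''st''" "narr s' ''rep'' = narr s1 ''rep''" "rarr s' ''lmx'' = rarr s1 ''lmx''"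
          using sm' e(1-5) by (auto simp: same_def spine_defs ctx_def row_def fun_eq_iff)
        have "spine_inv (pts(nvar s ''m'' := C, nvar s ''m'' + 1 := pts y - C)) s'"
        proof (rule spine_split[OF I g y_def refl rp[unfolded P_def] True wid[unfolded P_def] TC(3-5)[unfolded P_def] _ TC(6)])
          show "cut_ok (pts y) (rvar s1 ''w'') C (pts y - C)" using TC(2) k(2) by (simp add: P_def)
          show "pointers s' l r (pts y - C)" using h(1) by (simp add: P_def)
          show "nvar s' ''go'' = (if 2 * (r - nvar s' ''sa'') \<le> r - l then 0 else nvar s ''go'')" using h(11) e(9) by simp
        qed (simp_all only: h(3-10) e e' mk y_def)
        moreover have "fixd s'" using e' by (simp add: fixd_def)
        moreover have "spine_pot s' + max f1 (T + 1) \<le> spine_pot s"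
        proof -
          have "gap s1 - T = gap s'" "\<not> gap s1 < T" using h(2) by simp_all
          then have "(3 * CARD('q) + 8) * (gap s' + 1) + max f1 (T + 1) \<le> spine_pot s"
            using pot_arith(1)[OF gp f1 TC(1)] unfolding sp by simp
          moreover have "spine_pot s' \<le> (3 * CARD('q) + 8) * (gap s' + 1)" unfolding spine_pot_def by (intro mult_le_mono2) simp
          ultimately show ?thesis by linarith
        qed
        ultimately show "?Q (max f1 (T + 1)) s'" by blast
      qed
      then show ?thesis using True by (intro exI[of _ "T + 1"] runs_Cond) auto
    qed
  qed
qed

end

section \<open>Distribution of the sorted rows to the new leaves\<close>

definition relabel :: com where
  "relabel = For ''p'' (NVar ''l'') (NVar ''r'')
     (''i'' ::=\<^sub>n ordx (NLit 0) (NVar ''p'') ;;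
      Cond (neq (cell ''lab'' ''i'') (NVar ''u'')) Skip (NPut ''lab'' (NVar ''i'') (NVar ''cu'')))"

text \<open>The writing position of a leaf is reset once for each of its points. This stays within
  the cost of a pass and avoids a list of the new leaves.\<close>

definition reset_wp :: com where
  "reset_wp = For ''p'' (NVar ''l'') (NVar ''r'')
     (''i'' ::=\<^sub>n ordx (NVar ''k'') (NVar ''p'') ;; NPut ''wp'' (cell ''lab'' ''i'') (NGet ''lo'' (cell ''lab'' ''i'')))"

text \<open>Points are handed out in increasing order, so each leaf receives its part of the row
  sorted. Hence the coordinates are sorted only once, at the root.\<close>

definition scatter :: com where
  "scatter = For ''p'' (NVar ''l'') (NVar ''r'')
     (''i'' ::=\<^sub>n ordx (NVar ''k'') (NVar ''p'') ;;
      NPut ''Q'' (NGet ''wp'' (cell ''lab'' ''i'')) (NVar ''i'') ;;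
      NPut ''wp'' (cell ''lab'' ''i'') (NAdd (NGet ''wp'' (cell ''lab'' ''i'')) (NLit 1)))"

definition copy_back :: com where
  "copy_back = For ''p'' (NVar ''l'') (NVar ''r'')
     (NPut ''ord'' (NAdd (cell ''off'' ''k'') (NVar ''p'')) (cell ''Q'' ''p''))"

definition distribute :: "nat \<Rightarrow> com" where
  "distribute q = For ''k'' (NLit 0) (NLit q) (reset_wp ;; scatter ;; copy_back)"

definition expand :: "nat \<Rightarrow> com" where
  "expand q =
     (''l'' ::=\<^sub>n cell ''lo'' ''u'' ;; ''r'' ::=\<^sub>n cell ''hi'' ''u'' ;; ''sa'' ::=\<^sub>n NVar ''l'' ;;
      ''cu'' ::=\<^sub>n NVar ''u'' ;; ''go'' ::=\<^sub>n NLit 1) ;;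
     For ''k'' (NLit 0) (NLit q) (NPut ''a'' (NVar ''k'') (NVar ''l'') ;; NPut ''b'' (NVar ''k'') (NVar ''r'')) ;;
     While (NLess (NLit 0) (NVar ''go'')) (spine_step q) ;;
     relabel ;;
     distribute q"

lemmas expand_defs = expand_def relabel_def distribute_def reset_wp_def scatter_def copy_back_def spine_defs

locale distribution =
  fixes g :: "nat \<Rightarrow> nat" and L lo hi :: "nat \<Rightarrow> nat" and \<Lambda> :: "nat set" and lt :: "nat \<Rightarrow> nat \<Rightarrow> bool" and l r :: nat
  assumes dj: "x \<in> \<Lambda> \<Longrightarrow> y \<in> \<Lambda> \<Longrightarrow> x \<noteq> y \<Longrightarrow> hi x \<le> lo y \<or> hi y \<le> lo x"
    and cap: "x \<in> \<Lambda> \<Longrightarrow> lo x + card {p \<in> {l..<r}. L (g p) = x} = hi x"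
    and srt: "l \<le> p \<Longrightarrow> p < p' \<Longrightarrow> p' < r \<Longrightarrow> lt (g p) (g p')"
    and lab: "l \<le> p \<Longrightarrow> p < r \<Longrightarrow> L (g p) \<in> \<Lambda>"
begin

definition part :: "nat \<Rightarrow> nat \<Rightarrow> nat set" where "part p x = {p' \<in> {l..<p}. L (g p') = x}"

definition dist_inv :: "nat \<Rightarrow> (nat \<Rightarrow> nat) \<Rightarrow> (nat \<Rightarrow> nat) \<Rightarrow> bool" where
  "dist_inv p wp Q \<longleftrightarrow> (\<forall>x\<in>\<Lambda>. wp x = lo x + card (part p x) \<and> Q ` {lo x..<wp x} = g ` part p x \<and>
     (\<forall>a b. lo x \<le> a \<longrightarrow> a < b \<longrightarrow> b < wp x \<longrightarrow> lt (Q a) (Q b)))"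

lemma part_mono: "p \<le> r \<Longrightarrow> x \<in> \<Lambda> \<Longrightarrow> lo x + card (part p x) \<le> hi x"
proof -
  assume a: "p \<le> r" "x \<in> \<Lambda>"
  have "card (part p x) \<le> card {p \<in> {l..<r}. L (g p) = x}" unfolding part_def using a by (intro card_mono) auto
  then show ?thesis using cap[OF a(2)] by linarith
qed

lemma part_Suc: "l \<le> p \<Longrightarrow> part (Suc p) x = (if L (g p) = x then insert p (part p x) else part p x)"
  by (auto simp: part_def less_Suc_eq)

text \<open>Segments of different leaves are disjoint and have exactly the right length, so writing
  for one leaf disturbs no other. Within a leaf the new entry is the largest, being read
  last.\<close>

lemma dist_step:
  assumes D: "dist_inv p wp Q" and p: "l \<le> p" "p < r" and x: "x = L (g p)"
  shows "dist_inv (Suc p) (wp(x := wp x + 1)) (Q(wp x := g p))"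
proof -
  have xL: "x \<in> \<Lambda>" using lab[OF p] x by simp
  have Dx: "wp y = lo y + card (part p y)" "Q ` {lo y..<wp y} = g ` part p y"
    "\<And>a b. lo y \<le> a \<Longrightarrow> a < b \<Longrightarrow> b < wp y \<Longrightarrow> lt (Q a) (Q b)" if "y \<in> \<Lambda>" for y
    using D that unfolding dist_inv_def by blast+
  have fp: "finite (part p x)" "p \<notin> part p x" by (auto simp: part_def)
  have cS: "card (part (Suc p) x) = card (part p x) + 1" using part_Suc[OF p(1), of x] x fp by simp
  have wx: "wp x < hi x" using part_mono[of "Suc p" x] p xL cS Dx(1)[OF xL] by simp
  show ?thesis unfolding dist_inv_def
  proof (intro ballI conjI allI impI)
    fix y assume y: "y \<in> \<Lambda>"
    show "(wp(x := wp x + 1)) y = lo y + card (part (Suc p) y)"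
      using Dx(1)[OF y] part_Suc[OF p(1), of y] cS x by auto
    have ne: "wp x \<notin> {lo y..<wp y}" if "y \<noteq> x"
    proof -
      have "wp y \<le> hi y" using part_mono[of p y] p y Dx(1)[OF y] by simp
      moreover have "lo x \<le> wp x" using Dx(1)[OF xL] by simp
      ultimately show ?thesis using dj[OF xL y] that wx by auto
    qed
    show "(Q(wp x := g p)) ` {lo y..<(wp(x := wp x + 1)) y} = g ` part (Suc p) y"
    proof (cases "y = x")
      case True
      have "{lo x..<wp x + 1} = insert (wp x) {lo x..<wp x}" using Dx(1)[OF xL] by auto
      moreover have "(Q(wp x := g p)) ` {lo x..<wp x} = Q ` {lo x..<wp x}" by (intro image_cong) auto
      ultimately have "(Q(wp x := g p)) ` {lo x..<wp x + 1} = insert (g p) (g ` part p x)"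
        using Dx(2)[OF xL] by (simp only: image_insert fun_upd_same)
      then show ?thesis using True part_Suc[OF p(1), of x] x by simp
    next
      case False
      have "(Q(wp x := g p)) ` {lo y..<wp y} = Q ` {lo y..<wp y}" using ne[OF False] by (intro image_cong) auto
      then show ?thesis using False Dx(2)[OF y] part_Suc[OF p(1), of y] x by simp
    qed
    fix a b assume ab: "lo y \<le> a" "a < b" "b < (wp(x := wp x + 1)) y"
    show "lt ((Q(wp x := g p)) a) ((Q(wp x := g p)) b)"
    proof (cases "y = x")
      case True
      show ?thesis
      proof (cases "b = wp x")
        case bw: True
        have "Q a \<in> g ` part p x" using Dx(2)[OF xL] ab True bw by auto
        then obtain p' where "l \<le> p'" "p' < p" "Q a = g p'" by (auto simp: part_def)
        then show ?thesis using srt[of p' p] p bw ab by simp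
      next
        case False
        then show ?thesis using Dx(3)[OF xL, of a b] ab True by simp
      qed
    next
      case False
      then have "a \<noteq> wp x" "b \<noteq> wp x" using ne[OF False] ab by auto
      then show ?thesis using Dx(3)[OF y, of a b] ab False by simp
    qed
  qed
qed

end

context sample
begin

lemma tree_inv_cong:
  assumes T: "tree_inv pts lab s" and lab: "\<And>i. i < n \<Longrightarrow> lab' i = lab i"
    and s': "nvar s' ''m'' = nvar s ''m''" "narr s' ''st'' = narr s ''st''" "narr s' ''rep'' = narr s ''rep''" "rarr s' ''lmx'' = rarr s ''lmx''"
      "narr s' ''ch'' = narr s ''ch''" "narr s' ''par'' = narr s ''par''" "narr s' ''lo'' = narr s ''lo''" "narr s' ''hi'' = narr s ''hi''"
  shows "tree_inv pts lab' s'"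
proof -
  have fr: "front s' = front s" using s' by (simp add: front_def fun_eq_iff)
  have nd: "node_ok pts s' = node_ok pts s" unfolding node_ok_def s' by simp
  have "{i. i < n \<and> lab' i = x} = {i. i < n \<and> lab i = x}" for x using lab by auto
  moreover have "(\<forall>i<n. front s (lab' i)) = (\<forall>i<n. front s (lab i))" using lab by auto
  ultimately show ?thesis using T unfolding tree_inv_def Let_def fr nd s' by simp
qed

definition rows_at :: "state \<Rightarrow> nat \<Rightarrow> nat \<Rightarrow> nat \<Rightarrow> nat set \<Rightarrow> bool" where
  "rows_at s k a b P \<longleftrightarrow> row s k ` {a..<b} = P \<and> (\<forall>p p'. a \<le> p \<longrightarrow> p < p' \<longrightarrow> p' < b \<longrightarrow> lexl (X k) (row s k p) (row s k p'))"

lemma rows_at_cong: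
  assumes "rows_at s k a b P" "\<And>p. a \<le> p \<Longrightarrow> p < b \<Longrightarrow> row s' k p = row s k p"
  shows "rows_at s' k a b P"
proof -
  have "row s' k ` {a..<b} = row s k ` {a..<b}" using assms(2) by (intro image_cong) auto
  then show ?thesis using assms unfolding rows_at_def by simp
qed

text \<open>The invariant between two expansions, when the stored labels are up to date and every
  leaf owns a sorted segment in each row.\<close>

definition tree_full :: "(nat \<Rightarrow> nat set) \<Rightarrow> state \<Rightarrow> bool" where
  "tree_full pts s \<longleftrightarrow> ctx s \<and> tree_inv pts (narr s ''lab'') s \<and>
     (\<forall>x k. front s x \<longrightarrow> k < CARD('q) \<longrightarrow> rows_at s k (narr s ''lo'' x) (narr s ''hi'' x) (pts x))"

text \<open>A new leaf has at most half of the points of \<open>u\<close>, which pays for the passes over the rows of \<open>u\<close>.\<close>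

definition lab_pot :: "state \<Rightarrow> nat" where
  "lab_pot s = (\<Sum>i<n. if narr s ''st'' (narr s ''lab'' i) = 0 then blen (narr s ''hi'' (narr s ''lab'' i) - narr s ''lo'' (narr s ''lab'' i)) else 0)"

lemma row_nvar [simp]: "row (s\<lparr>nvar := f\<rparr>) = row s"
  by (simp add: row_def fun_eq_iff)

lemma row_upd: "k < CARD('q) \<Longrightarrow> p < n \<Longrightarrow> p' < n \<Longrightarrow> k * n + p = j * n + p' \<longleftrightarrow> k = j \<and> p = p'" for k j p p' :: nat
proof
  assume a: "k < CARD('q)" "p < n" "p' < n" "k * n + p = j * n + p'"
  have "k = (k * n + p) div n" "j = (j * n + p') div n" using a(2,3) by simp_all
  then have "k = j" using a(4) by metis
  then show "k = j \<and> p = p'" using a(4) by simp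
qed simp

end

context phase
begin

lemma relabel_runs:
  assumes F: "fixd s" and I: "spine_inv pts s" and f: "r - l < f"
  shows "runs relabel s f (\<lambda>s'. (\<forall>i<n. narr s' ''lab'' i = vlab s i))"
proof -
  have J: "tree_inv pts (vlab s) s" "spine_cur pts s" using I by (simp_all add: spine_inv_def)
  have fx: "ctx s" "row s = row s0" "nvar s ''u'' = u" "nvar s ''l'' = l" "nvar s ''r'' = r" using F by (auto simp: fixd_def)
  have cf: "pts (nvar s ''cu'') \<subseteq> pts0 u" "\<And>i. i < n \<Longrightarrow> narr s ''lab'' i = u \<longleftrightarrow> i \<in> pts (nvar s ''cu'')"
    using J(2) unfolding spine_cur_def Let_def by blast+
  show ?thesis unfolding relabel_def
  proof (rule runs_For[where M = l and N = r and g = "\<lambda>_. 1" and I = "\<lambda>p t. \<forall>i. narr t ''lab'' i =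
      (if narr s ''lab'' i = u \<and> i \<in> row s0 0 ` {l..<p} then nvar s ''cu'' else narr s ''lab'' i)"], goal_cases)
    case (6 p t)
    have e: "ctx t" "row t = row s0" "nvar t ''u'' = u" "nvar t ''cu'' = nvar s ''cu''"
      using ctx_frame[OF 6(5) fx(1)] row_frame[OF 6(5)] sameD[OF 6(5)] fx by simp_all
    let ?i = "row s0 0 p"
    have "?i \<notin> row s0 0 ` {l..<p}"
    proof
      assume "?i \<in> row s0 0 ` {l..<p}"
      then obtain p' where p': "l \<le> p'" "p' < p" "row s0 0 p = row s0 0 p'" by auto
      have "p = p'" by (rule inj_onD[OF row_inj[OF q0] p'(3)]) (use p' 6(1,2) in auto)
      then show False using p' by simp
    qed
    then have li: "narr t ''lab'' ?i = narr s ''lab'' ?i" using 6(3) by simp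
    have S: "{l..<Suc p} = insert p {l..<p}" using 6(1) by auto
    show ?case
      by (rule runs_line) (use 6(3,4) e li q0 in \<open>auto simp: S\<close>)
  next
    case (7 t)
    show ?case
    proof (intro allI impI)
      fix i assume i: "i < n"
      have "i \<in> row s0 0 ` {l..<r}" if "narr s ''lab'' i = u" using that cf i rows[OF q0] by auto
      then show "narr t ''lab'' i = vlab s i" using 7(1) by (auto simp: vlab_def)
    qed
  qed (use fx u_facts f in \<open>auto simp: same_def\<close>)
qed

lemma copy_back_runs:
  fixes s :: state
  assumes c: "ctx s" and lr: "nvar s ''l'' = l" "nvar s ''r'' = r" "nvar s ''k'' = k" "k < CARD('q)" and f: "r - l < f"
  shows "runs copy_back s f (\<lambda>t. \<forall>j<CARD('q). \<forall>p<n. row t j p = (if j = k \<and> l \<le> p \<and> p < r then narr s ''Q'' p else row s j p))"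
  unfolding copy_back_def
proof (rule runs_For[where M = l and N = r and g = "\<lambda>_. 1" and
    I = "\<lambda>p t. \<forall>j<CARD('q). \<forall>p'<n. row t j p' = (if j = k \<and> l \<le> p' \<and> p' < p then narr s ''Q'' p' else row s j p')"], goal_cases)
  case (6 p t)
  have e: "ctx t" "nvar t ''k'' = k" "narr t ''Q'' = narr s ''Q''"
    using sameD[OF 6(5)] c lr by (simp_all add: ctx_def)
  have pn: "p < n" using 6(2) u_facts by simp
  let ?t = "eff (NPut ''ord'' (NAdd (cell ''off'' ''k'') (NVar ''p'')) (cell ''Q'' ''p'')) t"
  have "row (?t\<lparr>nvar := (nvar ?t)(''p'' := Suc p)\<rparr>) j p' = (if j = k \<and> p' = p then narr s ''Q'' p else row t j p')"
    if "j < CARD('q)" "p' < n" for j p'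
    using e 6(4) lr(4) row_upd[OF that(1,2) pn, of k] by (simp add: row_def ctx_def)
  then show ?case
    by (intro runs_line) (use 6(1,3) in \<open>auto simp: less_Suc_eq\<close>)
qed (use lr u_facts f in \<open>auto simp: same_def row_def\<close>)

lemma dist_row_runs:
  fixes s :: state
  assumes c: "ctx s" and lr: "nvar s ''l'' = l" "nvar s ''r'' = r" "nvar s ''k'' = k" "k < CARD('q)"
    and row: "\<And>p. p < n \<Longrightarrow> row s k p = row s0 k p" and D: "distribution (row s0 k) (narr s ''lab'') (narr s ''lo'') hi \<Lambda> (lexl (X k)) l r"
    and wi: "\<And>x. x \<in> \<Lambda> \<Longrightarrow> l \<le> narr s ''lo'' x \<and> narr s ''lo'' x < hi x \<and> hi x \<le> r"
    and f: "r - l < f"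
  shows "runs (reset_wp ;; scatter ;; copy_back) s f (\<lambda>s'. (\<forall>x\<in>\<Lambda>. rows_at s' k (narr s ''lo'' x) (hi x) {i \<in> pts0 u. narr s ''lab'' i = x}) \<and>
     (\<forall>j<CARD('q). \<forall>p<n. j \<noteq> k \<or> p < l \<or> r \<le> p \<longrightarrow> row s' j p = row s j p))"
proof -
  interpret distribution "row s0 k" "narr s ''lab''" "narr s ''lo''" hi \<Lambda> "lexl (X k)" l r by (rule D)
  have rn: "r \<le> n" "l < r" using u_facts by auto
  \<comment> \<open>A leaf has a nonempty segment, hence at least one point in the row, and so its
    writing position is really reset.\<close>
  have emp: "x \<in> narr s ''lab'' ` row s0 k ` {l..<r}" if "x \<in> \<Lambda>" for x
  proof -
    have "card {p \<in> {l..<r}. narr s ''lab'' (row s0 k p) = x} \<noteq> 0" using cap[OF that] wi[OF that] by linarith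
    then have "{p \<in> {l..<r}. narr s ''lab'' (row s0 k p) = x} \<noteq> {}" by (metis card.empty)
    then show ?thesis by auto
  qed
  have 1: "runs reset_wp s f (\<lambda>t. \<forall>x\<in>\<Lambda>. narr t ''wp'' x = narr s ''lo'' x)"
    unfolding reset_wp_def
  proof (rule runs_For[where M = l and N = r and g = "\<lambda>_. 1" and I = "\<lambda>p t. \<forall>x\<in>narr s ''lab'' ` row s0 k ` {l..<p}. narr t ''wp'' x = narr s ''lo'' x"], goal_cases)
    case (6 p t)
    have e: "ctx t" "row t = row s" "nvar t ''k'' = k" "narr t ''lab'' = narr s ''lab''" "narr t ''lo'' = narr s ''lo''"
      using ctx_frame[OF 6(5) c] row_frame[OF 6(5)] sameD[OF 6(5)] lr by simp_all
    have rp: "row s k p = row s0 k p" using row 6(2) rn by simp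
    have S: "{l..<Suc p} = insert p {l..<p}" using 6(1) by auto
    show ?case
      by (rule runs_line) (use 6(3,4) e rp lr in \<open>auto simp: S\<close>)
  next
    case (7 t)
    then show ?case using emp by blast
  qed (use lr rn f in \<open>auto simp: same_def\<close>)
  have 2: "runs scatter t f (\<lambda>t'. dist_inv r (narr t' ''wp'') (narr t' ''Q''))"
    if h: "\<forall>x\<in>\<Lambda>. narr t ''wp'' x = narr s ''lo'' x" "same reset_wp s t" for t
  proof -
    have te: "ctx t" "row t = row s" "nvar t ''k'' = k" "narr t ''lab'' = narr s ''lab''" "nvar t ''l'' = l" "nvar t ''r'' = r"
      using ctx_frame[OF h(2) c] row_frame[OF h(2)] sameD[OF h(2)] lr by (simp_all add: reset_wp_def)
    show ?thesis unfolding scatter_def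
    proof (rule runs_For[where M = l and N = r and g = "\<lambda>_. 1" and I = "\<lambda>p t'. dist_inv p (narr t' ''wp'') (narr t' ''Q'')"], goal_cases)
      case 5
      show ?case using h(1) by (simp add: dist_inv_def part_def)
    next
      case (6 p t')
      have e: "ctx t'" "row t' = row s" "nvar t' ''k'' = k" "narr t' ''lab'' = narr s ''lab''"
        using ctx_frame[OF 6(5) te(1)] row_frame[OF 6(5)] sameD[OF 6(5)] te by simp_all
      have rp: "row s k p = row s0 k p" using row 6(2) rn by simp
      show ?case
        by (rule runs_line) (use dist_step[OF 6(3,1,2) refl] e lr(4) 6(4) rp in \<open>simp_all\<close>)
    qed (use te rn f in \<open>auto simp: same_def\<close>)
  qed
  show ?thesis
  proof (rule runs_Seq, rule runs_mono[OF 1 order_refl], rule runs_Seq, rule runs_mono[OF 2 order_refl])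
    fix t t' assume D': "dist_inv r (narr t' ''wp'') (narr t' ''Q'')" and sm: "same reset_wp s t" "same scatter t t'"
    have te: "ctx t'" "nvar t' ''l'' = l" "nvar t' ''r'' = r" "nvar t' ''k'' = k" "row t' = row s"
      using ctx_frame[OF sm(2) ctx_frame[OF sm(1) c]] row_frame[OF sm(1)] row_frame[OF sm(2)] sameD[OF sm(1)] sameD[OF sm(2)] lr
      by (simp_all add: reset_wp_def scatter_def)
    show "runs copy_back t' f (\<lambda>s'. (\<forall>x\<in>\<Lambda>. rows_at s' k (narr s ''lo'' x) (hi x) {i \<in> pts0 u. narr s ''lab'' i = x}) \<and>
     (\<forall>j<CARD('q). \<forall>p<n. j \<noteq> k \<or> p < l \<or> r \<le> p \<longrightarrow> row s' j p = row s j p))"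
    proof (rule runs_mono[OF copy_back_runs[OF te(1-4) lr(4) f] order_refl], intro conjI ballI allI impI)
      fix s' :: state and x
      assume h: "\<forall>j<CARD('q). \<forall>p<n. row s' j p = (if j = k \<and> l \<le> p \<and> p < r then narr t' ''Q'' p else row t' j p)" and x: "x \<in> \<Lambda>"
      have wx: "narr t' ''wp'' x = hi x" "narr t' ''Q'' ` {narr s ''lo'' x..<hi x} = row s0 k ` part r x"
        "\<And>a b. narr s ''lo'' x \<le> a \<Longrightarrow> a < b \<Longrightarrow> b < hi x \<Longrightarrow> lexl (X k) (narr t' ''Q'' a) (narr t' ''Q'' b)"
      proof -
        have d: "narr t' ''wp'' x = narr s ''lo'' x + card (part r x)" "narr t' ''Q'' ` {narr s ''lo'' x..<narr t' ''wp'' x} = row s0 k ` part r x"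
          "\<forall>a b. narr s ''lo'' x \<le> a \<longrightarrow> a < b \<longrightarrow> b < narr t' ''wp'' x \<longrightarrow> lexl (X k) (narr t' ''Q'' a) (narr t' ''Q'' b)"
          using D' x unfolding dist_inv_def by blast+
        show w: "narr t' ''wp'' x = hi x" using d(1) cap[OF x] unfolding part_def by simp
        show "narr t' ''Q'' ` {narr s ''lo'' x..<hi x} = row s0 k ` part r x" using d(2) unfolding w .
        show "lexl (X k) (narr t' ''Q'' a) (narr t' ''Q'' b)" if "narr s ''lo'' x \<le> a" "a < b" "b < hi x" for a b
          using d(3) that unfolding w by blast
      qed
      have rq: "row s' k p = narr t' ''Q'' p" if "narr s ''lo'' x \<le> p" "p < hi x" for p
        using h lr(4) that wi[OF x] rn by auto
      then have "row s' k ` {narr s ''lo'' x..<hi x} = narr t' ''Q'' ` {narr s ''lo'' x..<hi x}" by (intro image_cong) auto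
      also have "\<dots> = {i \<in> pts0 u. narr s ''lab'' i = x}" unfolding wx(2) part_def rows[OF lr(4), symmetric] by auto
      finally show "rows_at s' k (narr s ''lo'' x) (hi x) {i \<in> pts0 u. narr s ''lab'' i = x}"
        unfolding rows_at_def using wx(3) rq by auto
    next
      fix s' :: state and j p
      assume h: "\<forall>j<CARD('q). \<forall>p<n. row s' j p = (if j = k \<and> l \<le> p \<and> p < r then narr t' ''Q'' p else row t' j p)"
        and j: "j < CARD('q)" "p < n" "j \<noteq> k \<or> p < l \<or> r \<le> p"
      then show "row s' j p = row s j p" using te(5) by auto
    qed
  qed
qed

lemma distribute_runs:
  fixes s :: state
  assumes c: "ctx s" and lr: "nvar s ''l'' = l" "nvar s ''r'' = r"
    and row: "row s = row s0" and D: "\<And>k. k < CARD('q) \<Longrightarrow> distribution (row s0 k) (narr s ''lab'') (narr s ''lo'') hi \<Lambda> (lexl (X k)) l r"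
    and wi: "\<And>x. x \<in> \<Lambda> \<Longrightarrow> l \<le> narr s ''lo'' x \<and> narr s ''lo'' x < hi x \<and> hi x \<le> r"
    and f: "CARD('q) * (r - l + 1) < f"
  shows "runs (distribute CARD('q)) s f (\<lambda>s'. \<forall>k<CARD('q). (\<forall>x\<in>\<Lambda>. rows_at s' k (narr s ''lo'' x) (hi x) {i \<in> pts0 u. narr s ''lab'' i = x}) \<and>
     (\<forall>p<n. p < l \<or> r \<le> p \<longrightarrow> row s' k p = row s0 k p))"
  unfolding distribute_def
proof (rule runs_For[where M = 0 and N = "CARD('q)" and g = "\<lambda>_. r - l + 1" and
    I = "\<lambda>k t. (\<forall>j<CARD('q). (j < k \<longrightarrow> (\<forall>x\<in>\<Lambda>. rows_at t j (narr s ''lo'' x) (hi x) {i \<in> pts0 u. narr s ''lab'' i = x})) \<and>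
     (\<forall>p<n. k \<le> j \<or> p < l \<or> r \<le> p \<longrightarrow> row t j p = row s0 j p))"], goal_cases)
  case (6 k t)
  have e: "ctx t" "nvar t ''l'' = l" "nvar t ''r'' = r" "narr t ''lab'' = narr s ''lab''" "narr t ''lo'' = narr s ''lo''"
    using ctx_frame[OF 6(5) c] sameD[OF 6(5)] lr by (simp_all add: reset_wp_def scatter_def copy_back_def)
  have rk: "row t k p = row s0 k p" if "p < n" for p using 6(2,3) that by auto
  have Dk: "distribution (row s0 k) (narr t ''lab'') (narr t ''lo'') hi \<Lambda> (lexl (X k)) l r" using D[OF 6(2)] e by simp
  have wk: "x \<in> \<Lambda> \<Longrightarrow> l \<le> narr t ''lo'' x \<and> narr t ''lo'' x < hi x \<and> hi x \<le> r" for x using wi e by simp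
  show ?case
  proof (rule runs_mono[OF dist_row_runs[OF e(1-3) 6(4,2) rk Dk wk, where f = "r - l + 1"]])
    fix t' :: state
    assume h: "(\<forall>x\<in>\<Lambda>. rows_at t' k (narr t ''lo'' x) (hi x) {i \<in> pts0 u. narr t ''lab'' i = x}) \<and>
     (\<forall>j<CARD('q). \<forall>p<n. j \<noteq> k \<or> p < l \<or> r \<le> p \<longrightarrow> row t' j p = row t j p)"
    let ?t = "t'\<lparr>nvar := (nvar t')(''k'' := Suc k)\<rparr>"
    have rt: "row ?t = row t'" by (rule row_eq) simp
    have at: "rows_at ?t = rows_at t'" unfolding rows_at_def rt by simp
    show "\<forall>j<CARD('q). (j < Suc k \<longrightarrow> (\<forall>x\<in>\<Lambda>. rows_at ?t j (narr s ''lo'' x) (hi x) {i \<in> pts0 u. narr s ''lab'' i = x})) \<and>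
     (\<forall>p<n. Suc k \<le> j \<or> p < l \<or> r \<le> p \<longrightarrow> row ?t j p = row s0 j p)"
    proof (intro allI impI conjI ballI)
      fix j x assume j: "j < CARD('q)" "j < Suc k" "x \<in> \<Lambda>"
      show "rows_at ?t j (narr s ''lo'' x) (hi x) {i \<in> pts0 u. narr s ''lab'' i = x}"
      proof (cases "j = k")
        case True
        then show ?thesis using h j e unfolding at by simp
      next
        case False
        have o: "rows_at t j (narr s ''lo'' x) (hi x) {i \<in> pts0 u. narr s ''lab'' i = x}" using 6(3) j False by simp
        show ?thesis unfolding at
          by (rule rows_at_cong[OF o]) (use h j False wi[OF j(3)] u_facts(5) in auto)
      qed
    next
      fix j p assume j: "j < CARD('q)" "p < n" "Suc k \<le> j \<or> p < l \<or> r \<le> p"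
      have "row t' j p = row t j p" using h j by auto
      then show "row ?t j p = row s0 j p" using 6(3) j unfolding rt by auto
    qed
  qed simp_all
qed (use row f in \<open>auto simp: reset_wp_def scatter_def copy_back_def\<close>)

lemma loop_runs:
  assumes F: "fixd s" and I: "spine_inv pts s" and f: "spine_pot s < f"
  shows "runs (While (NLess (NLit 0) (NVar ''go'')) (spine_step CARD('q))) s f (\<lambda>s'. fixd s' \<and> nvar s' ''go'' = 0 \<and> (\<exists>pts'. spine_inv pts' s'))"
proof (rule runs_While[where I = "\<lambda>t. fixd t \<and> (\<exists>pts'. spine_inv pts' t)" and \<mu> = spine_pot])
  fix t assume a: "fixd t \<and> (\<exists>pts'. spine_inv pts' t)" and b: "bval (NLess (NLit 0) (NVar ''go'')) t"
  then obtain pts' where "fixd t" "spine_inv pts' t" by blast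
  then show "\<exists>j. runs (spine_step CARD('q)) t j (\<lambda>s'. (fixd s' \<and> (\<exists>pts'. spine_inv pts' s')) \<and> spine_pot s' + j \<le> spine_pot t)"
    using spine_step_runs[of t pts'] b by simp
qed (use F I f in auto)

text \<open>A point of \<open>u\<close> ends up in an examined node and then counts 0, or in an
  unexamined leaf of at most half the size, whose binary length is smaller. So each of the
  \<open>r - l\<close> points lowers \<open>lab_pot\<close> by at least one.\<close>

lemma finish_runs:
  assumes F: "fixd s" and I: "spine_inv pts s" and g: "nvar s ''go'' = 0" and f: "CARD('q) * (r - l + 1) < f" "r - l < f"
    and R0: "\<And>x k. front s0 x \<Longrightarrow> k < CARD('q) \<Longrightarrow> rows_at s0 k (narr s0 ''lo'' x) (narr s0 ''hi'' x) (pts0 x)"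
  shows "runs (relabel ;; distribute CARD('q)) s f (\<lambda>s'. tree_full pts s' \<and> narr s' ''st'' u \<noteq> 0 \<and> lab_pot s' + (r - l) \<le> lab_pot s0 \<and>
     m0 \<le> nvar s' ''m'' \<and> (\<forall>x<m0. x \<noteq> u \<longrightarrow> narr s' ''st'' x = narr s0 ''st'' x))"
proof (rule runs_Seq, rule runs_mono[OF relabel_runs[OF F I f(2)] order_refl])
  fix t :: state assume lt: "\<forall>i<n. narr t ''lab'' i = vlab s i" and sm: "same relabel s t"
  have J: "tree_inv pts (vlab s) s" "spine_cur pts s" "spine_old pts s" "spine_new s" using I by (simp_all add: spine_inv_def)
  have fx: "ctx s" "row s = row s0" "nvar s ''u'' = u" "nvar s ''l'' = l" "nvar s ''r'' = r" using F by (auto simp: fixd_def)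
  have e: "ctx t" "row t = row s0" "nvar t ''l'' = l" "nvar t ''r'' = r" "nvar t ''m'' = nvar s ''m''" "narr t ''st'' = narr s ''st''"
    "narr t ''rep'' = narr s ''rep''" "rarr t ''lmx'' = rarr s ''lmx''" "narr t ''ch'' = narr s ''ch''" "narr t ''par'' = narr s ''par''"
    "narr t ''lo'' = narr s ''lo''" "narr t ''hi'' = narr s ''hi''"
    using ctx_frame[OF sm fx(1)] row_frame[OF sm] sameD[OF sm] fx by (simp_all add: relabel_def)
  let ?L = "narr t ''lab''" and ?lo = "narr t ''lo''" and ?hi = "narr t ''hi''"
  have T: "tree_inv pts ?L t"
    by (rule tree_inv_cong[OF J(1)]) (use lt e in auto)
  note TI = tree_invD[OF T] and TI0 = tree_invD[OF T0]
  \<comment> \<open>The leaves below \<open>u\<close>. The node \<open>u\<close> itself is among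
    them if all its points coincide.\<close>
  define \<Lambda> where "\<Lambda> = {x. front t x \<and> (x = u \<or> m0 \<le> x)}"
  have cu: "nvar s ''cu'' = u \<or> m0 \<le> nvar s ''cu''" using J(2) unfolding spine_cur_def Let_def by blast
  have old: "\<And>i. i \<notin> pts0 u \<Longrightarrow> narr s ''lab'' i = narr s0 ''lab'' i" "\<And>i. i \<in> pts0 u \<Longrightarrow> narr s ''lab'' i = u \<or> m0 \<le> narr s ''lab'' i"
    "\<And>x. x < m0 \<Longrightarrow> pts x = pts0 x \<and> (x \<noteq> u \<longrightarrow> narr s ''st'' x = narr s0 ''st'' x \<and> rarr s ''lmx'' x = rarr s0 ''lmx'' x) \<and>
       narr s ''lo'' x = narr s0 ''lo'' x \<and> narr s ''hi'' x = narr s0 ''hi'' x"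
    using J(3) unfolding spine_old_def by blast+
  have new: "m0 \<le> nvar s ''m''" "\<And>x. m0 \<le> x \<Longrightarrow> x < nvar s ''m'' \<Longrightarrow> l \<le> narr s ''lo'' x \<and> narr s ''hi'' x \<le> r"
    "\<And>x. m0 \<le> x \<Longrightarrow> x < nvar s ''m'' \<Longrightarrow> narr s ''st'' x = 0 \<Longrightarrow> 2 * (narr s ''hi'' x - narr s ''lo'' x) \<le> r - l" "narr s ''st'' u \<noteq> 0"
    using J(4) g unfolding spine_new_def by blast+
  have um: "u < m0" and Pu: "pts0 u \<subseteq> {..<n}" using u_facts by auto
  have Lout: "?L i = narr s0 ''lab'' i" "?L i < m0" "?L i \<noteq> u" if "i < n" "i \<notin> pts0 u" for i
  proof -
    have "narr s0 ''lab'' i \<noteq> u" using TI0(10)[OF uf] that by auto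
    then show "?L i = narr s0 ''lab'' i" "?L i \<noteq> u" using lt that old(1)[OF that(2)] by (auto simp: vlab_def)
    then show "?L i < m0" using TI0(9)[OF that(1)] by (simp add: front_def m0)
  qed
  have Lin: "?L i \<in> \<Lambda>" if "i \<in> pts0 u" for i
  proof -
    have i: "i < n" using that Pu by auto
    then have "?L i = u \<or> m0 \<le> ?L i" using lt old(2)[OF that] cu by (auto simp: vlab_def)
    then show ?thesis using TI(9)[OF i] by (simp add: \<Lambda>_def)
  qed
  have ptsL: "pts x = {i \<in> pts0 u. ?L i = x}" if x: "x \<in> \<Lambda>" for x
  proof -
    have "pts x = {i. i < n \<and> ?L i = x}" using TI(10)[of x] x by (simp add: \<Lambda>_def)
    moreover have "i \<in> pts0 u" if i: "i < n" "?L i = x" for i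
    proof (rule ccontr)
      assume "i \<notin> pts0 u"
      from Lout(2,3)[OF i(1) this] show False using i(2) x by (simp add: \<Lambda>_def)
    qed
    ultimately show ?thesis using Pu by auto
  qed
  have xm: "x < nvar t ''m''" if "x \<in> \<Lambda>" for x using that by (simp add: \<Lambda>_def front_def)
  have wi: "l \<le> ?lo x \<and> ?lo x < ?hi x \<and> ?hi x \<le> r" if x: "x \<in> \<Lambda>" for x
  proof -
    have "pts x \<noteq> {}" "finite (pts x)" using TI(3,4)[OF xm[OF x]] finite_subset by auto
    then have "0 < card (pts x)" by (simp add: card_gt_0_iff)
    then have 1: "?lo x < ?hi x" using TI(5)[OF xm[OF x]] by linarith
    show ?thesis
    proof (cases "x = u")
      case True
      then show ?thesis using 1 old(3)[OF um] l r e by simp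
    next
      case False
      then have "m0 \<le> x" using x by (simp add: \<Lambda>_def)
      then show ?thesis using new(2)[of x] xm[OF x] e 1 by simp
    qed
  qed
  have D: "distribution (row s0 k) ?L ?lo ?hi \<Lambda> (lexl (X k)) l r" if k: "k < CARD('q)" for k
  proof
    show "?hi x \<le> ?lo y \<or> ?hi y \<le> ?lo x" if "x \<in> \<Lambda>" "y \<in> \<Lambda>" "x \<noteq> y" for x y
      using TI(11)[of x y] that by (simp add: \<Lambda>_def)
    show "?L (row s0 k p) \<in> \<Lambda>" if "l \<le> p" "p < r" for p
    proof (rule Lin)
      have "row s0 k p \<in> row s0 k ` {l..<r}" using that by simp
      then show "row s0 k p \<in> pts0 u" using rows[OF k] by simp
    qed
    show "lexl (X k) (row s0 k p) (row s0 k p')" if "l \<le> p" "p < p'" "p' < r" for p p' by (rule rsort[OF k that])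
    show "?lo x + card {p \<in> {l..<r}. ?L (row s0 k p) = x} = ?hi x" if x: "x \<in> \<Lambda>" for x
    proof -
      have "pts x = row s0 k ` {p \<in> {l..<r}. ?L (row s0 k p) = x}"
        unfolding ptsL[OF x] rows[OF k, symmetric] by auto
      moreover have "inj_on (row s0 k) {p \<in> {l..<r}. ?L (row s0 k p) = x}"
        by (rule inj_on_subset[OF row_inj[OF k]]) auto
      ultimately have "card (pts x) = card {p \<in> {l..<r}. ?L (row s0 k p) = x}" by (simp add: card_image)
      then show ?thesis using TI(5)[OF xm[OF x]] by simp
    qed
  qed
  show "runs (distribute CARD('q)) t f (\<lambda>s'. tree_full pts s' \<and> narr s' ''st'' u \<noteq> 0 \<and> lab_pot s' + (r - l) \<le> lab_pot s0 \<and>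
     m0 \<le> nvar s' ''m'' \<and> (\<forall>x<m0. x \<noteq> u \<longrightarrow> narr s' ''st'' x = narr s0 ''st'' x))"
  proof (rule runs_mono[OF distribute_runs[OF e(1,3,4,2) D wi f(1)] order_refl])
    fix s' :: state
    assume h: "\<forall>k<CARD('q). (\<forall>x\<in>\<Lambda>. rows_at s' k (?lo x) (?hi x) {i \<in> pts0 u. ?L i = x}) \<and> (\<forall>p<n. p < l \<or> r \<le> p \<longrightarrow> row s' k p = row s0 k p)"
      and sm': "same (distribute CARD('q)) t s'"
    have e': "ctx s'" "nvar s' ''m'' = nvar t ''m''" "narr s' ''st'' = narr t ''st''"
    "narr s' ''rep'' = narr t ''rep''" "rarr s' ''lmx'' = rarr t ''lmx''" "narr s' ''ch'' = narr t ''ch''" "narr s' ''par'' = narr t ''par''"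
    "narr s' ''lo'' = narr t ''lo''" "narr s' ''hi'' = narr t ''hi''" "narr s' ''lab'' = narr t ''lab''"
      using ctx_frame[OF sm' e(1)] sameD[OF sm'] by (simp_all add: distribute_def reset_wp_def scatter_def copy_back_def)
    have T': "tree_inv pts (narr s' ''lab'') s'"
      by (rule tree_inv_cong[OF T]) (use e' in simp_all)
    have fr: "front s' x = front t x" for x using e' by (simp add: front_def)
    have "rows_at s' k (narr s' ''lo'' x) (narr s' ''hi'' x) (pts x)" if x: "front s' x" and k: "k < CARD('q)" for x k
    proof (cases "x \<in> \<Lambda>")
      case True
      then show ?thesis using h k ptsL[OF True] e' by simp
    next
      case False
      then have xo: "x < m0" "x \<noteq> u" using x fr by (auto simp: \<Lambda>_def)
      note o = old(3)[OF xo(1)]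
      \<comment> \<open>This leaf existed before, and its segment is disjoint from the positions
        between \<open>l\<close> and \<open>r\<close>, the only ones rewritten.\<close>
      have f0: "front s0 x" using x fr xo o e by (simp add: front_def m0)
      have "rows_at s0 k (narr s0 ''lo'' x) (narr s0 ''hi'' x) (pts0 x)" by (rule R0[OF f0 k])
      moreover have "narr s0 ''hi'' x \<le> l \<or> r \<le> narr s0 ''lo'' x"
        using TI0(11)[OF f0 uf xo(2)] l r by simp
      moreover have "narr s0 ''hi'' x \<le> n" using TI0(6)[of x] xo(1) m0 by simp
      ultimately have "rows_at s' k (narr s0 ''lo'' x) (narr s0 ''hi'' x) (pts0 x)"
        by (elim rows_at_cong) (use h k in auto)
      then show ?thesis using o e e' by simp
    qed
    then have "tree_full pts s'" using e'(1) T' by (simp add: tree_full_def)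
    moreover have "narr s' ''st'' u \<noteq> 0" using new(4) e e' by simp
    moreover have "lab_pot s' + (r - l) \<le> lab_pot s0"
    proof -
      let ?b = "\<lambda>s i. if narr s ''st'' (narr s ''lab'' i) = 0 then blen (narr s ''hi'' (narr s ''lab'' i) - narr s ''lo'' (narr s ''lab'' i)) else 0"
      have "?b s' i + (if i \<in> pts0 u then 1 else 0) \<le> ?b s0 i" if i: "i < n" for i
      proof (cases "i \<in> pts0 u")
        case False
        then show ?thesis using Lout[OF i False] old(3)[of "?L i"] e e' by simp
      next
        case True
        have l0: "narr s0 ''lab'' i = u" using TI0(10)[OF uf] True by auto
        have rl: "0 < r - l" using u_facts by simp
        have "?b s0 i = blen (r - l)" using l0 su l r by simp
        moreover have "?b s' i < blen (r - l)"
        proof (cases "narr s ''st'' (?L i) = 0")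
          case False
          then show ?thesis using e e' blen_pos[OF rl] by simp
        next
          case z: True
          then have "?L i \<noteq> u" using new(4) by auto
          then have "m0 \<le> ?L i" "?L i < nvar s ''m''" using Lin[OF True] xm[OF Lin[OF True]] e by (auto simp: \<Lambda>_def)
          then have "2 * (narr s ''hi'' (?L i) - narr s ''lo'' (?L i)) \<le> r - l" using new(3) z by blast
          then have "blen (narr s ''hi'' (?L i) - narr s ''lo'' (?L i)) < blen (r - l)" using rl by (intro blen_half) auto
          then show ?thesis using z e e' by simp
        qed
        ultimately show ?thesis using True by simp
      qed
      then have "(\<Sum>i<n. ?b s' i + (if i \<in> pts0 u then 1 else 0)) \<le> (\<Sum>i<n. ?b s0 i)" by (intro sum_mono) auto
      moreover have "(\<Sum>i<n. (if i \<in> pts0 u then 1 else 0::nat)) = card (pts0 u)"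
        using Pu by (simp add: sum.If_cases Int_absorb1)
      ultimately show ?thesis using u_facts(4) unfolding lab_pot_def sum.distrib by simp
    qed
    moreover have "m0 \<le> nvar s' ''m''" "\<forall>x<m0. x \<noteq> u \<longrightarrow> narr s' ''st'' x = narr s0 ''st'' x"
      using new(1) old(3) e e' by auto
    ultimately show "tree_full pts s' \<and> narr s' ''st'' u \<noteq> 0 \<and> lab_pot s' + (r - l) \<le> lab_pot s0 \<and>
     m0 \<le> nvar s' ''m'' \<and> (\<forall>x<m0. x \<noteq> u \<longrightarrow> narr s' ''st'' x = narr s0 ''st'' x)" by blast
  qed
qed

end

section \<open>Presorting and the complete construction\<close>

definition init_rows :: "nat \<Rightarrow> com" where
  "init_rows q =
     ''f'' ::=\<^sub>n NLit 0 ;;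
     For ''k'' (NLit 0) (NLit q)
       (for_each (RPut ''K'' (NVar ''i'') (zc q (NVar ''i'') (NVar ''k''))) ;;
        merge_sort ;;
        for_each (NPut ''ord'' (NAdd (NVar ''f'') (NVar ''i'')) (cell ''P'' ''i'')) ;;
        (NPut ''off'' (NVar ''k'') (NVar ''f'') ;; ''f'' ::=\<^sub>n NAdd (NVar ''f'') (NVar ''n''))) ;;
     NPut ''hi'' (NLit 0) (NVar ''n'') ;;
     ''m'' ::=\<^sub>n NLit 1"

text \<open>Children have larger numbers than their parents, so a scan by number reaches every node.
  Nodes on a spine that were examined during an earlier expansion are passed over.\<close>

definition build_tree :: "nat \<Rightarrow> com" where
  "build_tree q =
     init_rows q ;;
     ''u'' ::=\<^sub>n NLit 0 ;;
     While (NLess (NVar ''u'') (NVar ''m''))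
       (Cond (NLess (NLit 0) (cell ''st'' ''u'')) Skip (expand q) ;; inc ''u'')"

context sample
begin

text \<open>Per point of the expanded leaf: the windows start with total width
  \<open>CARD('q)\<close> for each point, which is multiplied by the factor of
  \<open>spine_pot\<close>; the surplus covers the fixed parts and the passes over the rows.\<close>

definition expand_cost :: nat where "expand_cost = (3 * CARD('q) + 8) * (CARD('q) + 2)"

lemma expand_runs:
  fixes s :: state
  assumes T: "tree_full pts s" and u: "front s u" "narr s ''st'' u = 0" "nvar s ''u'' = u"
    and d: "d = narr s ''hi'' u - narr s ''lo'' u"
  shows "runs (expand CARD('q)) s (expand_cost * d) (\<lambda>s'. (\<exists>pts'. tree_full pts' s') \<and> narr s' ''st'' u \<noteq> 0 \<and> lab_pot s' + d \<le> lab_pot s \<and>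
     nvar s ''m'' \<le> nvar s' ''m'' \<and> (\<forall>x<nvar s ''m''. x \<noteq> u \<longrightarrow> narr s' ''st'' x = narr s ''st'' x))"
proof -
  define l where "l = narr s ''lo'' u"
  define r where "r = narr s ''hi'' u"
  define m0 where "m0 = nvar s ''m''"
  have c: "ctx s" and TI: "tree_inv pts (narr s ''lab'') s" and
    R: "\<And>x k. front s x \<Longrightarrow> k < CARD('q) \<Longrightarrow> rows_at s k (narr s ''lo'' x) (narr s ''hi'' x) (pts x)"
    using T by (auto simp: tree_full_def)
  interpret phase crd n Z pts s u l r m0
    by unfold_locales (use TI u R[OF u(1)] in \<open>auto simp: l_def r_def m0_def rows_at_def\<close>)
  have drl: "d = r - l" and d0: "0 < d" using u_facts d by (auto simp: l_def r_def)
  define s1 where "s1 = eff (''l'' ::=\<^sub>n cell ''lo'' ''u'' ;; ''r'' ::=\<^sub>n cell ''hi'' ''u'' ;; ''sa'' ::=\<^sub>n NVar ''l'' ;;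
      ''cu'' ::=\<^sub>n NVar ''u'' ;; ''go'' ::=\<^sub>n NLit 1) s"
  have s1: "narr s1 = narr s" "rarr s1 = rarr s" "nvar s1 ''n'' = nvar s ''n''" "nvar s1 ''m'' = m0" "nvar s1 ''u'' = u" "nvar s1 ''l'' = l"
     "nvar s1 ''r'' = r" "nvar s1 ''sa'' = l" "nvar s1 ''cu'' = u" "nvar s1 ''go'' = 1"
    using u(3) by (simp_all add: s1_def l_def r_def m0_def)
  let ?f = "expand_cost * d"
  have sz: "CARD('q) < ?f" "(3 * CARD('q) + 8) * (CARD('q) * d + 1) < ?f" "CARD('q) * (r - l + 1) < ?f" "r - l < ?f"
  proof -
    obtain e where e: "d = Suc e" using d0 by (cases d) auto
    show "CARD('q) < ?f" "(3 * CARD('q) + 8) * (CARD('q) * d + 1) < ?f" "CARD('q) * (r - l + 1) < ?f" "r - l < ?f"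
      unfolding drl[symmetric] e expand_cost_def by (simp_all add: algebra_simps)
  qed
  have 1: "runs (For ''k'' (NLit 0) (NLit CARD('q)) (NPut ''a'' (NVar ''k'') (NVar ''l'') ;; NPut ''b'' (NVar ''k'') (NVar ''r''))) s1 ?f
    (\<lambda>t. \<forall>k<CARD('q). narr t ''a'' k = l \<and> narr t ''b'' k = r)"
    by (rule runs_For[where M = 0 and N = "CARD('q)" and g = "\<lambda>_. 1" and I = "\<lambda>k t. \<forall>j<k. narr t ''a'' j = l \<and> narr t ''b'' j = r"])
      (use s1 sz(1) in \<open>auto simp: same_def less_Suc_eq intro!: runs_line\<close>)
  show ?thesis unfolding expand_def
  proof (rule runs_Seq, rule runs_line, simp, use sz(1) in linarith, fold s1_def, rule runs_Seq, rule runs_mono[OF 1 order_refl])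
    fix t :: state
    assume ab: "\<forall>k<CARD('q). narr t ''a'' k = l \<and> narr t ''b'' k = r"
      and sm: "same (For ''k'' (NLit 0) (NLit CARD('q)) (NPut ''a'' (NVar ''k'') (NVar ''l'') ;; NPut ''b'' (NVar ''k'') (NVar ''r''))) s1 t"
    have e: "ctx t" "row t = row s" "nvar t ''m'' = m0" "nvar t ''u'' = u" "nvar t ''l'' = l"
     "nvar t ''r'' = r" "nvar t ''sa'' = l" "nvar t ''cu'' = u" "nvar t ''go'' = 1" "narr t ''lab'' = narr s ''lab''" "narr t ''st'' = narr s ''st''"
    "narr t ''rep'' = narr s ''rep''" "rarr t ''lmx'' = rarr s ''lmx''" "narr t ''ch'' = narr s ''ch''" "narr t ''par'' = narr s ''par''"
    "narr t ''lo'' = narr s ''lo''" "narr t ''hi'' = narr s ''hi''"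
      using sm s1 c by (auto simp: same_def ctx_def row_def fun_eq_iff)
    have vl: "vlab t = narr t ''lab''" using e(8) by (auto simp: vlab_def)
    have "tree_inv pts (vlab t) t" unfolding vl by (rule tree_inv_cong[OF TI]) (use e m0_def in auto)
    moreover have "spine_cur pts t"
    proof -
      have "front t u" using u(1) e by (simp add: front_def m0_def)
      moreover have "(narr t ''lab'' i = u) = (i \<in> pts u)" if "i < n" for i
        using tree_invD(10)[OF TI u(1)] that e by auto
      moreover have "pointers t l r (pts u)"
        unfolding pointers_def e(2) using ab rows u_facts(6) by auto
      ultimately show ?thesis unfolding spine_cur_def Let_def using e u(2) by (simp add: l_def r_def)
    qed
    moreover have "spine_old pts t"
      unfolding spine_old_def using e tree_invD(10)[OF TI u(1)] by auto
    moreover have "spine_new t" unfolding spine_new_def using e by simp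
    ultimately have I: "spine_inv pts t" by (simp add: spine_inv_def)
    have F: "fixd t" using e by (simp add: fixd_def)
    have "gap t = CARD('q) * d" unfolding gap_def drl using ab by simp
    then have p: "spine_pot t < ?f" using sz(2) e by (simp add: spine_pot_def)
    show "runs (While (NLess (NLit 0) (NVar ''go'')) (spine_step CARD('q)) ;; relabel ;; distribute CARD('q)) t ?f
      (\<lambda>s'. (\<exists>pts'. tree_full pts' s') \<and> narr s' ''st'' u \<noteq> 0 \<and> lab_pot s' + d \<le> lab_pot s \<and>
     nvar s ''m'' \<le> nvar s' ''m'' \<and> (\<forall>x<nvar s ''m''. x \<noteq> u \<longrightarrow> narr s' ''st'' x = narr s ''st'' x))"
    proof (rule runs_Seq, rule runs_mono[OF loop_runs[OF F I p] order_refl], elim conjE exE)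
      fix t' pts' assume a: "fixd t'" "nvar t' ''go'' = 0" "spine_inv pts' t'"
      show "runs (relabel ;; distribute CARD('q)) t' ?f (\<lambda>s'. (\<exists>pts'. tree_full pts' s') \<and> narr s' ''st'' u \<noteq> 0 \<and> lab_pot s' + d \<le> lab_pot s \<and>
         nvar s ''m'' \<le> nvar s' ''m'' \<and> (\<forall>x<nvar s ''m''. x \<noteq> u \<longrightarrow> narr s' ''st'' x = narr s ''st'' x))"
        by (rule runs_mono[OF finish_runs[OF a(1,3,2) sz(3,4) R] order_refl]) (auto simp: drl m0_def)
    qed
  qed
qed

definition built :: "(nat \<Rightarrow> nat set) \<Rightarrow> state \<Rightarrow> bool" where
  "built pts s \<longleftrightarrow> tree_full pts s \<and> (\<forall>x<nvar s ''m''. narr s ''st'' x \<noteq> 0)"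

text \<open>Every leaf is the label of some point, so there are at most \<open>n\<close>
  leaves.\<close>

lemma nodes_le: "tree_inv pts lab s \<Longrightarrow> nvar s ''m'' \<le> 2 * n"
proof -
  assume T: "tree_inv pts lab s"
  note I = tree_invD[OF T]
  have "{x. front s x} \<subseteq> lab ` {..<n}"
  proof
    fix x assume "x \<in> {x. front s x}"
    then have x: "front s x" by simp
    then have "pts x \<noteq> {}" using I(3)[of x] by (simp add: front_def)
    then show "x \<in> lab ` {..<n}" using I(10)[OF x] by auto
  qed
  then have "card {x. front s x} \<le> card (lab ` {..<n})" by (intro card_mono) auto
  also have "\<dots> \<le> n" using card_image_le[of "{..<n}" lab] by simp
  finally show ?thesis using I(12) by linarith
qed

text \<open>An expansion of \<open>d\<close> points costs \<open>expand_cost * d\<close> and lowers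
  \<open>lab_pot\<close> by at least \<open>d\<close>; the term \<open>2 * n - u\<close> pays for
  nodes that are merely passed over.\<close>

lemma grow_runs:
  assumes T: "tree_full pts s" and u: "nvar s ''u'' = 0" and f: "expand_cost * lab_pot s + 2 * n < f"
  shows "runs (While (NLess (NVar ''u'') (NVar ''m''))
       (Cond (NLess (NLit 0) (cell ''st'' ''u'')) Skip (expand CARD('q)) ;; inc ''u'')) s f (\<lambda>s'. \<exists>pts'. built pts' s')"
proof (rule runs_While[where I = "\<lambda>t. (\<exists>pts. tree_full pts t) \<and> nvar t ''u'' \<le> nvar t ''m'' \<and> (\<forall>x<nvar t ''u''. narr t ''st'' x \<noteq> 0)"
    and \<mu> = "\<lambda>t. expand_cost * lab_pot t + (2 * n - nvar t ''u'')"])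
  fix t assume I: "(\<exists>pts. tree_full pts t) \<and> nvar t ''u'' \<le> nvar t ''m'' \<and> (\<forall>x<nvar t ''u''. narr t ''st'' x \<noteq> 0)"
    and b: "\<not> bval (NLess (NVar ''u'') (NVar ''m'')) t"
  then have "nvar t ''u'' = nvar t ''m''" by simp
  then show "\<exists>pts'. built pts' t" using I by (auto simp: built_def)
next
  fix t assume I: "(\<exists>pts. tree_full pts t) \<and> nvar t ''u'' \<le> nvar t ''m'' \<and> (\<forall>x<nvar t ''u''. narr t ''st'' x \<noteq> 0)"
    and b: "bval (NLess (NVar ''u'') (NVar ''m'')) t"
  then obtain pts where T: "tree_full pts t" by blast
  let ?u = "nvar t ''u''"
  have um: "?u < nvar t ''m''" using b by simp
  have mn: "nvar t ''m'' \<le> 2 * n" using T nodes_le by (auto simp: tree_full_def)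
  let ?Q = "\<lambda>j t'. ((\<exists>pts. tree_full pts t') \<and> nvar t' ''u'' \<le> nvar t' ''m'' \<and> (\<forall>x<nvar t' ''u''. narr t' ''st'' x \<noteq> 0)) \<and>
        expand_cost * lab_pot t' + (2 * n - nvar t' ''u'') + j \<le> expand_cost * lab_pot t + (2 * n - ?u)"
  have incr: "runs (inc ''u'') t1 j (?Q j)"
    if a: "tree_full pts1 t1" "nvar t1 ''u'' = ?u" "?u < nvar t1 ''m''" "\<forall>x\<le>?u. narr t1 ''st'' x \<noteq> 0" "0 < j"
      "expand_cost * lab_pot t1 + j \<le> expand_cost * lab_pot t + 1" for t1 pts1 j
  proof (rule runs_line)
    let ?t = "eff (inc ''u'') t1"
    have fr: "front ?t = front t1" by (simp add: front_def fun_eq_iff)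
    have rw: "row ?t = row t1" by (rule row_eq) simp
    have "tree_full pts1 ?t"
      unfolding tree_full_def
    proof (intro conjI allI impI)
      show "ctx ?t" using a(1) by (simp add: tree_full_def ctx_def)
      show "tree_inv pts1 (narr ?t ''lab'') ?t"
        using a(1) tree_inv_cong[of pts1 "narr t1 ''lab''" t1 "narr ?t ''lab''" ?t] by (simp add: tree_full_def)
      show "rows_at ?t k (narr ?t ''lo'' x) (narr ?t ''hi'' x) (pts1 x)" if "front ?t x" "k < CARD('q)" for x k
        using a(1) that fr rw by (simp add: tree_full_def rows_at_def)
    qed
    moreover have "lab_pot ?t = lab_pot t1" by (simp add: lab_pot_def cong: if_cong)
    ultimately show "?Q j ?t"
      using a um mn by (auto simp: less_Suc_eq_le)
  qed (use a in simp_all)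
  show "\<exists>j. runs (Cond (NLess (NLit 0) (cell ''st'' ''u'')) Skip (expand CARD('q)) ;; inc ''u'') t j (?Q j)"
  proof (cases "narr t ''st'' ?u = 0")
    case False
    have "runs (inc ''u'') t 1 (?Q 1)"
      by (rule incr[OF T refl um]) (use I False in \<open>auto simp: le_less\<close>)
    then have "runs (Cond (NLess (NLit 0) (cell ''st'' ''u'')) Skip (expand CARD('q)) ;; inc ''u'') t 1 (?Q 1)"
      by (intro runs_Seq runs_Cond) (use False in \<open>auto intro: runs_line\<close>)
    then show ?thesis by blast
  next
    case True
    have fr: "front t ?u" using True um by (simp add: front_def)
    define d where "d = narr t ''hi'' ?u - narr t ''lo'' ?u"
    note E = expand_runs[OF T fr True refl d_def]
    let ?j = "expand_cost * d"
    have j0: "0 < ?j" by (rule runs_pos[OF E])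
    have "runs (Cond (NLess (NLit 0) (cell ''st'' ''u'')) Skip (expand CARD('q)) ;; inc ''u'') t ?j (?Q ?j)"
    proof (rule runs_Seq, rule runs_Cond)
      show "runs (expand CARD('q)) t ?j (\<lambda>s'. runs (inc ''u'') s' ?j (?Q ?j))"
      proof (rule runs_mono[OF E order_refl], elim conjE exE)
        fix t1 pts1
        assume h: "narr t1 ''st'' ?u \<noteq> 0" "lab_pot t1 + d \<le> lab_pot t" "nvar t ''m'' \<le> nvar t1 ''m''"
          "\<forall>x<nvar t ''m''. x \<noteq> ?u \<longrightarrow> narr t1 ''st'' x = narr t ''st'' x" "tree_full pts1 t1"
          and sm: "same (expand CARD('q)) t t1"
        have "nvar t1 ''u'' = ?u" using sm by (simp add: same_def expand_defs)
        moreover have "narr t1 ''st'' x \<noteq> 0" if "x \<le> ?u" for x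
          using h(1,4) I um that by (cases "x = ?u") auto
        moreover have "expand_cost * lab_pot t1 + ?j \<le> expand_cost * lab_pot t + 1"
          using mult_le_mono2[OF h(2), of expand_cost] by (simp add: distrib_left)
        ultimately show "runs (inc ''u'') t1 ?j (?Q ?j)"
          using h(3,5) um j0 by (intro incr[of pts1]) auto
      qed
    qed (use True in simp)
    then show ?thesis by blast
  qed
qed (use T u f in auto)

end

context sample
begin

lemma init_row_runs:
  fixes s :: state
  assumes c: "nvar s ''n'' = n" "rarr s ''Z'' = Zin" "nvar s ''k'' = k" "k < CARD('q)" "nvar s ''f'' = k * n"
    and f: "(n + 1) * (blen n + 1) \<le> f"
  shows "runs (for_each (RPut ''K'' (NVar ''i'') (zc CARD('q) (NVar ''i'') (NVar ''k''))) ;;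
        merge_sort ;;
        for_each (NPut ''ord'' (NAdd (NVar ''f'') (NVar ''i'')) (cell ''P'' ''i'')) ;;
        (NPut ''off'' (NVar ''k'') (NVar ''f'') ;; ''f'' ::=\<^sub>n NAdd (NVar ''f'') (NVar ''n''))) s f
    (\<lambda>t. rows_at t k 0 n {..<n} \<and> (\<forall>j<CARD('q). j \<noteq> k \<longrightarrow> (\<forall>p<n. row t j p = row s j p)) \<and>
       narr t ''off'' = (narr s ''off'')(k := k * n) \<and> nvar t ''f'' = Suc k * n)"
proof -
  have fn: "n < f" using f by auto
  have 1: "runs (for_each (RPut ''K'' (NVar ''i'') (zc CARD('q) (NVar ''i'') (NVar ''k'')))) s f (\<lambda>t. \<forall>i<n. rarr t ''K'' i = X k i)"
    unfolding for_each_For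
    by (rule runs_For[where M = 0 and N = n and g = "\<lambda>_. 1" and I = "\<lambda>m t. \<forall>i<m. rarr t ''K'' i = X k i"])
      (use c fn in \<open>auto simp: same_def less_Suc_eq intro!: runs_line\<close>)
  show ?thesis
  proof (rule runs_Seq, rule runs_mono[OF 1 order_refl])
    fix t1 :: state
    assume K: "\<forall>i<n. rarr t1 ''K'' i = X k i" and s1: "same (for_each (RPut ''K'' (NVar ''i'') (zc CARD('q) (NVar ''i'') (NVar ''k'')))) s t1"
    have e1: "nvar t1 ''n'' = n" "nvar t1 ''k'' = k" "nvar t1 ''f'' = k * n" "narr t1 = narr s"
      using s1 c by (auto simp: same_def for_each_For fun_eq_iff)
    show "runs (merge_sort ;; for_each (NPut ''ord'' (NAdd (NVar ''f'') (NVar ''i'')) (cell ''P'' ''i'')) ;;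
        (NPut ''off'' (NVar ''k'') (NVar ''f'') ;; ''f'' ::=\<^sub>n NAdd (NVar ''f'') (NVar ''n''))) t1 f
      (\<lambda>t. rows_at t k 0 n {..<n} \<and> (\<forall>j<CARD('q). j \<noteq> k \<longrightarrow> (\<forall>p<n. row t j p = row s j p)) \<and>
       narr t ''off'' = (narr s ''off'')(k := k * n) \<and> nvar t ''f'' = Suc k * n)"
    proof (rule runs_Seq, rule runs_mono[OF merge_sort_runs[OF e1(1) f] order_refl], elim conjE)
      fix t2 :: state
      assume P: "narr t2 ''P'' ` {..<n} = {..<n}"
        "\<forall>i j. i < j \<longrightarrow> j < n \<longrightarrow> lexl (rarr t1 ''K'') (narr t2 ''P'' i) (narr t2 ''P'' j)"
        and s2: "same merge_sort t1 t2"
      have e2: "nvar t2 ''n'' = n" "nvar t2 ''k'' = k" "nvar t2 ''f'' = k * n" "narr t2 ''off'' = narr s ''off''" "row t2 = row s"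
        using s2 e1 by (auto simp: same_def merge_sort_def merge_pass_def merge_step_def for_each_For row_def fun_eq_iff)
      have lx: "lexl (X k) (narr t2 ''P'' i) (narr t2 ''P'' j)" if "i < j" "j < n" for i j
      proof -
        have "narr t2 ''P'' i \<in> {..<n}" "narr t2 ''P'' j \<in> {..<n}" using P(1) that by auto
        then have "rarr t1 ''K'' (narr t2 ''P'' i) = X k (narr t2 ''P'' i)" "rarr t1 ''K'' (narr t2 ''P'' j) = X k (narr t2 ''P'' j)" using K by simp_all
        then show ?thesis using P(2)[rule_format, OF that] by (simp add: lexl_def)
      qed
      have 3: "runs (for_each (NPut ''ord'' (NAdd (NVar ''f'') (NVar ''i'')) (cell ''P'' ''i''))) t2 f
        (\<lambda>t. \<forall>j<CARD('q). \<forall>p<n. row t j p = (if j = k then narr t2 ''P'' p else row s j p))"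
        unfolding for_each_For
      proof (rule runs_For[where M = 0 and N = n and g = "\<lambda>_. 1" and
          I = "\<lambda>i t. \<forall>j<CARD('q). \<forall>p<n. row t j p = (if j = k \<and> p < i then narr t2 ''P'' p else row s j p)"], goal_cases)
        case (6 i t)
        have e: "nvar t ''f'' = k * n" "narr t ''P'' = narr t2 ''P''" using sameD[OF 6(5)] e2 by simp_all
        let ?t = "eff (NPut ''ord'' (NAdd (NVar ''f'') (NVar ''i'')) (cell ''P'' ''i'')) t"
        have "row ?t j p = (if j = k \<and> p = i then narr t2 ''P'' p else row t j p)" if "j < CARD('q)" "p < n" for j p
          using e 6(4) row_upd[OF that 6(2), of k] by (simp add: row_def)
        then show ?case
          by (intro runs_line) (use 6(3) in \<open>auto simp: less_Suc_eq\<close>)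
      qed (use e2 fn in \<open>auto simp: same_def\<close>)
      show "runs (for_each (NPut ''ord'' (NAdd (NVar ''f'') (NVar ''i'')) (cell ''P'' ''i'')) ;;
        (NPut ''off'' (NVar ''k'') (NVar ''f'') ;; ''f'' ::=\<^sub>n NAdd (NVar ''f'') (NVar ''n''))) t2 f
        (\<lambda>t. rows_at t k 0 n {..<n} \<and> (\<forall>j<CARD('q). j \<noteq> k \<longrightarrow> (\<forall>p<n. row t j p = row s j p)) \<and>
         narr t ''off'' = (narr s ''off'')(k := k * n) \<and> nvar t ''f'' = Suc k * n)"
      proof (rule runs_Seq, rule runs_mono[OF 3 order_refl])
        fix t3 :: state
        assume h: "\<forall>j<CARD('q). \<forall>p<n. row t3 j p = (if j = k then narr t2 ''P'' p else row s j p)"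
          and s3: "same (for_each (NPut ''ord'' (NAdd (NVar ''f'') (NVar ''i'')) (cell ''P'' ''i''))) t2 t3"
        have e3: "nvar t3 ''n'' = n" "nvar t3 ''k'' = k" "nvar t3 ''f'' = k * n" "narr t3 ''off'' = narr s ''off''"
          using s3 e2 by (auto simp: same_def for_each_For)
        let ?t = "eff (NPut ''off'' (NVar ''k'') (NVar ''f'') ;; ''f'' ::=\<^sub>n NAdd (NVar ''f'') (NVar ''n'')) t3"
        have rw: "row ?t = row t3" by (rule row_eq) simp
        have rk: "row t3 k p = narr t2 ''P'' p" if "p < n" for p using h c(4) that by simp
        have "row t3 k ` {0..<n} = narr t2 ''P'' ` {..<n}" using rk by (intro image_cong) auto
        then have "rows_at ?t k 0 n {..<n}" unfolding rows_at_def rw using P(1) lx rk by auto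
        moreover have "row ?t j p = row s j p" if "j < CARD('q)" "j \<noteq> k" "p < n" for j p
          unfolding rw using h that by simp
        ultimately show "runs (NPut ''off'' (NVar ''k'') (NVar ''f'') ;; ''f'' ::=\<^sub>n NAdd (NVar ''f'') (NVar ''n'')) t3 f
          (\<lambda>t. rows_at t k 0 n {..<n} \<and> (\<forall>j<CARD('q). j \<noteq> k \<longrightarrow> (\<forall>p<n. row t j p = row s j p)) \<and>
           narr t ''off'' = (narr s ''off'')(k := k * n) \<and> nvar t ''f'' = Suc k * n)"
          using fn e3 by (intro runs_line) auto
      qed
    qed
  qed
qed

text \<open>The program sets only \<open>hi\<close> and \<open>m\<close> for the root; its label,
  its start and its status are 0 in the initial memory, whence the assumption on
  \<open>narr s\<close>.\<close>

lemma init_rows_runs: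
  fixes s :: state
  assumes c: "nvar s ''n'' = n" "rarr s ''Z'' = Zin" "narr s = (\<lambda>_ _. 0)"
    and f: "CARD('q) * ((n + 1) * (blen n + 1)) < f"
  shows "runs (init_rows CARD('q)) s f (\<lambda>t. tree_full (\<lambda>_. {..<n}) t \<and> lab_pot t = n * blen n)"
proof -
  let ?s = "eff (''f'' ::=\<^sub>n NLit 0) s"
  let ?b = "for_each (RPut ''K'' (NVar ''i'') (zc CARD('q) (NVar ''i'') (NVar ''k''))) ;;
        merge_sort ;;
        for_each (NPut ''ord'' (NAdd (NVar ''f'') (NVar ''i'')) (cell ''P'' ''i'')) ;;
        (NPut ''off'' (NVar ''k'') (NVar ''f'') ;; ''f'' ::=\<^sub>n NAdd (NVar ''f'') (NVar ''n''))"
  have f0: "0 < f" using f by simp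
  have 1: "runs (For ''k'' (NLit 0) (NLit CARD('q)) ?b) ?s f (\<lambda>t. \<forall>j<CARD('q). rows_at t j 0 n {..<n} \<and> narr t ''off'' j = j * n)"
  proof (rule runs_For[where M = 0 and N = "CARD('q)" and g = "\<lambda>_. (n + 1) * (blen n + 1)" and
      I = "\<lambda>k t. nvar t ''f'' = k * n \<and> (\<forall>j<k. rows_at t j 0 n {..<n} \<and> narr t ''off'' j = j * n)"], goal_cases)
    case (6 k t)
    have e: "nvar t ''n'' = n" "rarr t ''Z'' = Zin" "nvar t ''f'' = k * n"
      using 6(5,3) c by (auto simp: same_def for_each_For merge_sort_def merge_pass_def merge_step_def)
    show ?case
    proof (rule runs_mono[OF init_row_runs[OF e(1,2) 6(4,2) e(3) order_refl] order_refl], elim conjE, intro conjI allI impI, goal_cases)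
      case (2 t' j)
      show ?case
      proof (cases "j = k")
        case False
        then have j: "j < k" "j < CARD('q)" using 2(6) 6(2) by auto
        then have "rows_at t j 0 n {..<n}" using 6(3) by simp
        then have "rows_at t' j 0 n {..<n}" by (rule rows_at_cong) (use 2(1-5) False j in \<open>auto simp del: row_nvar\<close>)
        then show ?thesis by (simp add: rows_at_def)
      qed (use 2(1-3) in \<open>auto simp add: rows_at_def\<close>)
    next
      case (3 t' j)
      then show ?case using 6(3) by (cases "j = k") auto
    qed simp
  qed (use c f in \<open>auto simp: for_each_For merge_sort_def merge_pass_def merge_step_def\<close>)
  show ?thesis unfolding init_rows_def
  proof (rule runs_Seq, rule runs_line, simp, rule f0, rule runs_Seq, rule runs_mono[OF 1 order_refl])
    fix t :: state
    assume h: "\<forall>j<CARD('q). rows_at t j 0 n {..<n} \<and> narr t ''off'' j = j * n" and sm: "same (For ''k'' (NLit 0) (NLit CARD('q)) ?b) ?s t"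
    have e: "nvar t ''n'' = n" "rarr t ''Z'' = Zin" "narr t ''st'' = (\<lambda>_. 0)" "narr t ''lab'' = (\<lambda>_. 0)" "narr t ''lo'' = (\<lambda>_. 0)" "narr t ''hi'' = (\<lambda>_. 0)"
      using sm c by (auto simp: same_def for_each_For merge_sort_def merge_pass_def merge_step_def)
    let ?t = "eff (NPut ''hi'' (NLit 0) (NVar ''n'') ;; ''m'' ::=\<^sub>n NLit 1) t"
    have et: "nvar ?t ''m'' = 1" "nvar ?t ''n'' = n" "rarr ?t ''Z'' = Zin" "narr ?t ''st'' = (\<lambda>_. 0)" "narr ?t ''lab'' = (\<lambda>_. 0)"
      "narr ?t ''lo'' = (\<lambda>_. 0)" "narr ?t ''hi'' = (\<lambda>_. 0)(0 := n)" "narr ?t ''off'' = narr t ''off''" "row ?t = row t"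
      using e by (simp_all add: row_def fun_eq_iff)
    have fr: "front ?t x \<longleftrightarrow> x = 0" for x using et by (simp add: front_def)
    have "ctx ?t" using h et by (simp add: ctx_def)
    moreover have "tree_inv (\<lambda>_. {..<n}) (narr ?t ''lab'') ?t"
      unfolding tree_inv_def Let_def fr et(1,4-7) using n0 by (auto simp: lessThan_empty_iff)
    moreover have "rows_at ?t k (narr ?t ''lo'' x) (narr ?t ''hi'' x) {..<n}" if "front ?t x" "k < CARD('q)" for x k
      using h that et(6,7,9) unfolding fr rows_at_def by simp
    ultimately have "tree_full (\<lambda>_. {..<n}) ?t" by (simp add: tree_full_def)
    \<comment> \<open>At the start each point lies in a leaf of size \<open>n\<close>. This is where
      the factor \<open>n * blen n\<close> of the construction originates.\<close>
    moreover have "lab_pot ?t = n * blen n" unfolding lab_pot_def et(4-7) by simp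
    ultimately show "runs (NPut ''hi'' (NLit 0) (NVar ''n'') ;; ''m'' ::=\<^sub>n NLit 1) t f (\<lambda>t. tree_full (\<lambda>_. {..<n}) t \<and> lab_pot t = n * blen n)"
      using f0 by (intro runs_line) simp_all
  qed
qed

definition build_cost :: nat where "build_cost = expand_cost + CARD('q) + 4"

lemma build_tree_runs:
  fixes s :: state
  assumes c: "nvar s ''n'' = n" "rarr s ''Z'' = Zin" "narr s = (\<lambda>_ _. 0)"
    and f: "build_cost * ((n + 1) * (blen n + 1)) \<le> f"
  shows "runs (build_tree CARD('q)) s f (\<lambda>t. \<exists>pts. built pts t)"
proof -
  let ?g = "(n + 1) * (blen n + 1)"
  have g: "n * blen n \<le> ?g" "n < ?g" by (simp_all add: algebra_simps)
  have "build_cost * ?g = expand_cost * ?g + CARD('q) * ?g + 4 * ?g" by (simp add: build_cost_def distrib_right)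
  then have f1: "CARD('q) * ?g < f" and f2: "expand_cost * (n * blen n) + 2 * n < f"
    using f g mult_le_mono2[OF g(1), of expand_cost] by linarith+
  show ?thesis unfolding build_tree_def
  proof (rule runs_Seq, rule runs_mono[OF init_rows_runs[OF c f1] order_refl], elim conjE)
    fix t :: state assume T: "tree_full (\<lambda>_. {..<n}) t" "lab_pot t = n * blen n"
    let ?t = "eff (''u'' ::=\<^sub>n NLit 0) t"
    have fr: "front ?t = front t" by (simp add: front_def fun_eq_iff)
    have T': "tree_full (\<lambda>_. {..<n}) ?t"
      unfolding tree_full_def
    proof (intro conjI allI impI)
      show "ctx ?t" using T(1) by (simp add: tree_full_def ctx_def)
      show "tree_inv (\<lambda>_. {..<n}) (narr ?t ''lab'') ?t"
        by (rule tree_inv_cong[of "\<lambda>_. {..<n}" "narr t ''lab''" t]) (use T(1) in \<open>simp_all add: tree_full_def\<close>)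
      show "rows_at ?t k (narr ?t ''lo'' x) (narr ?t ''hi'' x) {..<n}" if "front ?t x" "k < CARD('q)" for x k
        using T(1) that fr by (simp add: tree_full_def rows_at_def)
    qed
    have "lab_pot ?t = n * blen n" using T(2) by (simp add: lab_pot_def cong: if_cong)
    then have "expand_cost * lab_pot ?t + 2 * n < f" using f2 by simp
    then show "runs (''u'' ::=\<^sub>n NLit 0 ;; While (NLess (NVar ''u'') (NVar ''m''))
       (Cond (NLess (NLit 0) (cell ''st'' ''u'')) Skip (expand CARD('q)) ;; inc ''u'')) t f (\<lambda>t. \<exists>pts. built pts t)"
      using grow_runs[OF T', of f] f1 by (auto intro!: runs_Seq[OF runs_line])
  qed
qed

section \<open>The arrays of the finished tree\<close>

lemma built_split_tree:
  assumes "built pts s"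
  shows "split_tree Z n (nvar s ''m'') pts (narr s ''ch'') (narr s ''par'') (narr s ''rep'') (rarr s ''lmx'')"
proof -
  have T: "tree_inv pts (narr s ''lab'') s" and st: "\<And>x. x < nvar s ''m'' \<Longrightarrow> narr s ''st'' x \<noteq> 0"
    using assms by (auto simp: built_def tree_full_def)
  note I = tree_invD[OF T]
  have nd: "node_ok pts s x" if "x < nvar s ''m''" for x using I(7)[OF that st[OF that]] .
  show ?thesis
  proof
    show "pts 0 = {..<n}" "0 < nvar s ''m''" by (rule I)+
  next
    fix x assume x: "x < nvar s ''m''"
    note N = nd[OF x, unfolded node_ok_def Let_def]
    show "narr s ''rep'' x \<in> pts x" "0 \<le> rarr s ''lmx'' x" using N by blast+
    show "\<bar>Z i $ k - Z j $ k\<bar> \<le> rarr s ''lmx'' x" if "i \<in> pts x" "j \<in> pts x" for i j k using N that by blast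
    assume w: "0 < rarr s ''lmx'' x"
    show "x < narr s ''ch'' x \<and> narr s ''ch'' x + 1 < nvar s ''m'' \<and> narr s ''par'' (narr s ''ch'' x) = x \<and> narr s ''par'' (narr s ''ch'' x + 1) = x"
      using N w by blast
    show "\<exists>k c. (\<exists>i\<in>pts x. Z i $ k = c - rarr s ''lmx'' x / 2) \<and> (\<exists>i\<in>pts x. Z i $ k = c + rarr s ''lmx'' x / 2) \<and>
       (pts (narr s ''ch'' x) = {i \<in> pts x. Z i $ k \<le> c} \<and> pts (narr s ''ch'' x + 1) = {i \<in> pts x. c < Z i $ k} \<or>
        pts (narr s ''ch'' x) = {i \<in> pts x. c < Z i $ k} \<and> pts (narr s ''ch'' x + 1) = {i \<in> pts x. Z i $ k \<le> c})"
      using N w unfolding cut_ok_def by blast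
  next
    fix x assume "0 < x" "x < nvar s ''m''"
    then show "narr s ''par'' x < nvar s ''m'' \<and> 0 < rarr s ''lmx'' (narr s ''par'' x) \<and>
      (x = narr s ''ch'' (narr s ''par'' x) \<or> x = narr s ''ch'' (narr s ''par'' x) + 1)"
      using I(8) by blast
  qed
qed

text \<open>Row 0 begins at position 0 of \<open>ord\<close>, so \<open>ord\<close> itself lists the
  points of a leaf in its segment. For inner nodes the segments of the children are joined, from
  large node numbers to small ones.\<close>

lemma built_range:
  assumes B: "built pts s" and x: "x < nvar s ''m''"
  shows "narr s ''ord'' ` {narr s ''lo'' x..<narr s ''hi'' x} = pts x" "narr s ''hi'' x - narr s ''lo'' x = card (pts x)"
    "narr s ''lo'' x < narr s ''hi'' x" "narr s ''hi'' x \<le> n"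
proof -
  have T: "tree_inv pts (narr s ''lab'') s" and st: "\<And>x. x < nvar s ''m'' \<Longrightarrow> narr s ''st'' x \<noteq> 0"
    and R: "\<And>x k. front s x \<Longrightarrow> k < CARD('q) \<Longrightarrow> rows_at s k (narr s ''lo'' x) (narr s ''hi'' x) (pts x)"
    using B by (auto simp: built_def tree_full_def)
  note I = tree_invD[OF T]
  interpret tr: split_tree Z n "nvar s ''m''" pts "narr s ''ch''" "narr s ''par''" "narr s ''rep''" "rarr s ''lmx''"
    by (rule built_split_tree[OF B])
  have len: "narr s ''hi'' x - narr s ''lo'' x = card (pts x) \<and> narr s ''lo'' x < narr s ''hi'' x \<and> narr s ''hi'' x \<le> n" if x: "x < nvar s ''m''" for x
    using I(5,6)[OF x] tr.pts_nonempty[OF x] tr.finite_pts[OF x] card_gt_0_iff[of "pts x"] by auto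
  then show "narr s ''hi'' x - narr s ''lo'' x = card (pts x)" "narr s ''lo'' x < narr s ''hi'' x" "narr s ''hi'' x \<le> n"
    using x by auto
  show "narr s ''ord'' ` {narr s ''lo'' x..<narr s ''hi'' x} = pts x"
    using x
  proof (induction "nvar s ''m'' - x" arbitrary: x rule: less_induct)
    case less
    show ?case
    proof (cases "rarr s ''lmx'' x = 0")
      case True
      then have "front s x" using less.prems by (simp add: front_def)
      from R[OF this q0] show ?thesis by (simp add: rows_at_def row_def)
    next
      case False
      then have w: "0 < rarr s ''lmx'' x" using tr.lmx0[OF less.prems] by simp
      let ?y = "narr s ''ch'' x"
      have N: "x < ?y" "?y + 1 < nvar s ''m''" "narr s ''lo'' ?y = narr s ''lo'' x" "narr s ''hi'' ?y = narr s ''lo'' (?y + 1)" "narr s ''hi'' (?y + 1) = narr s ''hi'' x"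
        using I(7)[OF less.prems st[OF less.prems]] w unfolding node_ok_def Let_def by blast+
      have 1: "narr s ''ord'' ` {narr s ''lo'' ?y..<narr s ''hi'' ?y} = pts ?y" using N less.prems by (intro less.hyps) auto
      have 2: "narr s ''ord'' ` {narr s ''lo'' (?y + 1)..<narr s ''hi'' (?y + 1)} = pts (?y + 1)" using N less.prems by (intro less.hyps) auto
      have "{narr s ''lo'' x..<narr s ''hi'' x} = {narr s ''lo'' ?y..<narr s ''hi'' ?y} \<union> {narr s ''lo'' (?y + 1)..<narr s ''hi'' (?y + 1)}"
        using N len[of ?y] len[of "?y + 1"] by auto
      then show ?thesis using 1 2 tr.pts_children[OF less.prems w] by (simp add: image_Un)
    qed
  qed
qed

text \<open>The points of a leaf have equal coordinates, so the row is ordered by the tie-breaking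
  index. The first points of the segment are therefore the preferred neighbours among coinciding
  points.\<close>

lemma built_leaf_sorted:
  assumes B: "built pts s" and x: "x < nvar s ''m''" "rarr s ''lmx'' x = 0" and p: "narr s ''lo'' x \<le> p" "p < p'" "p' < narr s ''hi'' x"
  shows "narr s ''ord'' p < narr s ''ord'' p'"
proof -
  interpret tr: split_tree Z n "nvar s ''m''" pts "narr s ''ch''" "narr s ''par''" "narr s ''rep''" "rarr s ''lmx''"
    by (rule built_split_tree[OF B])
  have "front s x" using x by (simp add: front_def)
  then have "rows_at s 0 (narr s ''lo'' x) (narr s ''hi'' x) (pts x)" using B q0 by (simp add: built_def tree_full_def)
  then have 1: "lexl (X 0) (narr s ''ord'' p) (narr s ''ord'' p')" "narr s ''ord'' p \<in> pts x" "narr s ''ord'' p' \<in> pts x"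
    using p unfolding rows_at_def row_def by auto
  have "X 0 (narr s ''ord'' p) = X 0 (narr s ''ord'' p')"
    using tr.width[OF x(1) 1(2,3), of "crd 0"] x(2) by (simp add: X_def)
  then show ?thesis using 1(1) by (simp add: lexl_def)
qed

end

section \<open>Lists of candidates\<close>

text \<open>The sum over the coordinates is unfolded into the expression, so a squared distance has
  constant cost for fixed dimension.\<close>

primrec sqd_upto :: "nat \<Rightarrow> nat \<Rightarrow> nexp \<Rightarrow> nexp \<Rightarrow> rexp" where
  "sqd_upto 0 q i j = OfNat (NLit 0)"
| "sqd_upto (Suc k) q i j = RAdd (sqd_upto k q i j)
     (RMul (RSub (zc q i (NLit k)) (zc q j (NLit k))) (RSub (zc q i (NLit k)) (zc q j (NLit k))))"

definition sqd :: "nat \<Rightarrow> nexp \<Rightarrow> nexp \<Rightarrow> rexp" where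
  "sqd q i j = sqd_upto q q i j"

definition nearer :: "nat \<Rightarrow> nexp \<Rightarrow> nexp \<Rightarrow> nexp \<Rightarrow> bexp" where
  "nearer q a b c = lex_less (sqd q a b) (sqd q a c) b c"

text \<open>The value \<open>n\<close> marks an empty slot.\<close>

definition slot :: "nat \<Rightarrow> name \<Rightarrow> com" where
  "slot q N = Cond (Conj (neq (cell N ''ia'') (NVar ''n'')) (Neg (nearer q (NVar ''ia'') (NVar ''ib'') (cell N ''ia''))))
     Skip
     (''t'' ::=\<^sub>n cell N ''ia'' ;; NPut N (NVar ''ia'') (NVar ''ib'') ;; ''ib'' ::=\<^sub>n NVar ''t'')"

definition offer :: "nat \<Rightarrow> com" where
  "offer q = Cond (Conj (neq (NVar ''ib'') (cell ''N'' ''ia'')) (Conj (neq (NVar ''ib'') (cell ''N2'' ''ia'')) (neq (NVar ''ib'') (cell ''N3'' ''ia''))))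
     (slot q ''N'' ;; slot q ''N2'' ;; slot q ''N3'') Skip"

text \<open>The squared radius is \<open>q\<close> times the squared side length, so the only
  literal required is \<open>4 * q\<close>.\<close>

definition screen_test :: "nat \<Rightarrow> nexp \<Rightarrow> nexp \<Rightarrow> bexp" where
  "screen_test q a b = Conj (RLess (sqd q a b) (sqd q a (cell ''rep'' ''B'')))
     (RLess (RMul (OfNat (NLit (4 * q))) (RMul (RMul (RGet ''lmx'' (NVar ''B'')) (RGet ''lmx'' (NVar ''B''))) (sqd q a (cell ''rep'' ''B''))))
        (RMul (RSub (sqd q a (cell ''rep'' ''B'')) (sqd q a b)) (RSub (sqd q a (cell ''rep'' ''B'')) (sqd q a b))))"

definition find_pt :: com where
  "find_pt = ''fd'' ::=\<^sub>n NLit 0 ;;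
     For ''e'' (cell ''ls'' ''B'') (NVar ''lt'') (Cond (neq (cell ''lp'' ''e'') (NVar ''ia'')) Skip (''fd'' ::=\<^sub>n NLit 1))"

definition count_screens :: "nat \<Rightarrow> com" where
  "count_screens q = ''cn'' ::=\<^sub>n NLit 0 ;;
     For ''g'' (cell ''ls'' ''B'') (NVar ''lt'')
       (Cond (Conj (neq (cell ''lp'' ''g'') (cell ''lp'' ''e'')) (screen_test q (cell ''lp'' ''e'') (cell ''lp'' ''g''))) (inc ''cn'') Skip)"

definition find_removable :: "nat \<Rightarrow> com" where
  "find_removable q = ''rm'' ::=\<^sub>n NVar ''lt'' ;;
     For ''e'' (cell ''ls'' ''B'') (NVar ''lt'')
       (count_screens q ;; Cond (NLess (NLit 2) (NVar ''cn'')) (''rm'' ::=\<^sub>n NVar ''e'') Skip)"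

text \<open>The list of the current node is the top segment of the array \<open>lp\<close>; an entry
  is removed by overwriting it with the last one.\<close>

definition insert_pt :: "nat \<Rightarrow> com" where
  "insert_pt q = find_pt ;;
     Cond (NLess (NLit 0) (NVar ''fd'')) Skip
      ((NPut ''lp'' (NVar ''lt'') (NVar ''ia'') ;; inc ''lt'') ;;
       find_removable q ;;
       Cond (NLess (NVar ''rm'') (NVar ''lt''))
         (''lt'' ::=\<^sub>n NSub (NVar ''lt'') (NLit 1) ;; NPut ''lp'' (NVar ''rm'') (cell ''lp'' ''lt'')) Skip)"

lemmas insert_defs = insert_pt_def find_pt_def find_removable_def count_screens_def

section \<open>The three best candidates of a point\<close>

context sample
begin

lemma rval_sqd [simp]:
  assumes "rarr s ''Z'' = Zin" "nval i s < n" "nval j s < n"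
  shows "rval (sqd CARD('q) i j) s = (dist (Z (nval i s)) (Z (nval j s)))\<^sup>2"
proof -
  have "rval (sqd_upto k CARD('q) i j) s = (\<Sum>l<k. (X l (nval i s) - X l (nval j s))\<^sup>2)" if "k \<le> CARD('q)" for k
    using that assms by (induction k) (simp_all add: power2_eq_square)
  then have "rval (sqd CARD('q) i j) s = (\<Sum>l<CARD('q). (Z (nval i s) $ crd l - Z (nval j s) $ crd l)\<^sup>2)"
    by (simp add: sqd_def X_def)
  also have "\<dots> = (\<Sum>k\<in>UNIV. (Z (nval i s) $ k - Z (nval j s) $ k)\<^sup>2)"
    by (rule sum.reindex_bij_betw[OF crd, of "\<lambda>k. (Z (nval i s) $ k - Z (nval j s) $ k)\<^sup>2"])
  also have "\<dots> = (dist (Z (nval i s)) (Z (nval j s)))\<^sup>2"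
    by (simp add: dist_vec_def L2_set_def sum_nonneg dist_real_def)
  finally show ?thesis .
qed

lemma closer_lexl: "closer Z a b c = lexl (\<lambda>j. dist (Z a) (Z j)) b c"
  by (simp add: closer_def lexl_def)

lemma bval_nearer [simp]:
  assumes "rarr s ''Z'' = Zin" "nval a s < n" "nval b s < n" "nval c s < n"
  shows "bval (nearer CARD('q) a b c) s \<longleftrightarrow> closer Z (nval a s) (nval b s) (nval c s)"
proof -
  have "x\<^sup>2 < y\<^sup>2 \<longleftrightarrow> x < y" "x\<^sup>2 = y\<^sup>2 \<longleftrightarrow> x = y" if "0 \<le> x" "0 \<le> y" for x y :: real
    using that by (auto intro: power_strict_mono power_less_imp_less_base simp: power2_eq_iff_nonneg)
  then show ?thesis using assms by (simp add: nearer_def closer_def)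
qed

text \<open>The first element of \<open>S\<close> in the order of \<open>closer\<close>. Its default
  for the empty set is the marker of an empty slot.\<close>

definition lst :: "nat \<Rightarrow> nat set \<Rightarrow> nat" where
  "lst a S = (if S = {} then n else THE x. x \<in> S \<and> (\<forall>y\<in>S. y \<noteq> x \<longrightarrow> closer Z a x y))"

lemma closer_trans: "closer Z a x y \<Longrightarrow> closer Z a y z \<Longrightarrow> closer Z a x z"
  unfolding closer_lexl by (rule lexl_trans)

lemma closer_total: "x \<noteq> y \<Longrightarrow> closer Z a x y \<or> closer Z a y x"
  unfolding closer_lexl by (rule lexl_total)

lemma closer_irrefl: "\<not> closer Z a x x"
  unfolding closer_lexl by (rule lexl_irrefl)

lemma lst_eq: "x \<in> S \<Longrightarrow> (\<And>y. y \<in> S \<Longrightarrow> y \<noteq> x \<Longrightarrow> closer Z a x y) \<Longrightarrow> lst a S = x"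
proof -
  assume x: "x \<in> S" "\<And>y. y \<in> S \<Longrightarrow> y \<noteq> x \<Longrightarrow> closer Z a x y"
  have "(THE x. x \<in> S \<and> (\<forall>y\<in>S. y \<noteq> x \<longrightarrow> closer Z a x y)) = x"
  proof (rule the_equality)
    fix z assume z: "z \<in> S \<and> (\<forall>y\<in>S. y \<noteq> z \<longrightarrow> closer Z a z y)"
    show "z = x"
    proof (rule ccontr)
      assume "z \<noteq> x"
      then have "closer Z a z x" "closer Z a x z" using x z by auto
      then show False using closer_trans closer_irrefl by blast
    qed
  qed (use x in auto)
  then show ?thesis using x(1) by (auto simp: lst_def)
qed

lemma lst_props:
  assumes "finite S" "S \<noteq> {}"
  shows "lst a S \<in> S" "y \<in> S \<Longrightarrow> y \<noteq> lst a S \<Longrightarrow> closer Z a (lst a S) y"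
proof -
  have "\<exists>x. x \<in> S \<and> (\<forall>y\<in>S. y \<noteq> x \<longrightarrow> closer Z a x y)"
    using assms
  proof (induction rule: finite_ne_induct)
    case (insert b S)
    then obtain x where x: "x \<in> S" "\<forall>y\<in>S. y \<noteq> x \<longrightarrow> closer Z a x y" by blast
    show ?case
    proof (cases "closer Z a b x")
      case True
      then have "closer Z a b y" if "y \<in> S" for y using x(2) that closer_trans by (cases "y = x") auto
      then show ?thesis by (intro exI[of _ b]) auto
    next
      case False
      then have "closer Z a x b" using closer_total[of b x] insert x by auto
      then show ?thesis using x by (intro exI[of _ x]) auto
    qed
  qed simp
  then obtain x where x: "x \<in> S" "\<And>y. y \<in> S \<Longrightarrow> y \<noteq> x \<Longrightarrow> closer Z a x y" by blast
  have "lst a S = x" by (rule lst_eq[OF x])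
  then show "lst a S \<in> S" "y \<in> S \<Longrightarrow> y \<noteq> lst a S \<Longrightarrow> closer Z a (lst a S) y" using x by auto
qed

definition ins :: "nat \<Rightarrow> nat set \<Rightarrow> nat set" where "ins c T = (if c = n then T else insert c T)"
text \<open>What can be handed to a slot: a candidate that is not yet present, or the marker
  \<open>n\<close> once no candidates are left behind this slot.\<close>

definition fresh :: "nat \<Rightarrow> nat set \<Rightarrow> bool" where "fresh c T \<longleftrightarrow> (if c = n then T = {} else c < n \<and> c \<notin> T)"

text \<open>One stage of insertion into a sorted triple. The slot keeps the better of its entry and
  the arriving candidate, and the other one moves on to the next slot, where the same situation
  recurs with the old entry removed from \<open>T\<close>.\<close>

lemma slot_step:
  assumes T: "T \<subseteq> {..<n}" and ok: "fresh c T"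
  shows "if lst a T \<noteq> n \<and> \<not> closer Z a c (lst a T)
    then lst a (ins c T) = lst a T \<and> ins c T - {lst a T} = ins c (T - {lst a T}) \<and> fresh c (T - {lst a T})
    else lst a (ins c T) = c \<and> ins c T - {c} = ins (lst a T) (T - {lst a T}) \<and> fresh (lst a T) (T - {lst a T})"
proof (cases "T = {}")
  case True
  then have "lst a T = n" by (simp add: lst_def)
  moreover have "lst a (ins c T) = c" using True by (cases "c = n") (auto simp: ins_def lst_def)
  ultimately show ?thesis using True ok by (auto simp: ins_def fresh_def)
next
  case False
  have fin: "finite T" using T finite_subset by blast
  note P = lst_props[OF fin False, where a = a]
  have c: "c < n" "c \<notin> T" using ok False by (auto simp: fresh_def split: if_splits)
  have v: "lst a T < n" using P(1) T by blast
  have ic: "ins c T = insert c T" "ins c (T - {lst a T}) = insert c (T - {lst a T})" "ins (lst a T) (T - {lst a T}) = T"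
    using c v P(1) by (auto simp: ins_def)
  show ?thesis
  proof (cases "closer Z a c (lst a T)")
    case True
    have "lst a (insert c T) = c"
    proof (rule lst_eq)
      fix y assume "y \<in> insert c T" "y \<noteq> c"
      then show "closer Z a c y" using P(2)[of y] True closer_trans by (cases "y = lst a T") auto
    qed simp
    then show ?thesis using True ic c v by (auto simp: fresh_def)
  next
    case f: False
    then have "closer Z a (lst a T) c" using closer_total[of c "lst a T" a] P(1) c by auto
    then have "lst a (insert c T) = lst a T" using P by (intro lst_eq) auto
    then show ?thesis using f ic c v P(1) by (auto simp: fresh_def)
  qed
qed

text \<open>\<open>S a\<close> is the ghost set of all candidates offered to \<open>a\<close> so
  far; only its first three elements are stored.\<close>

definition best :: "state \<Rightarrow> (nat \<Rightarrow> nat set) \<Rightarrow> bool" where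
  "best s S \<longleftrightarrow> (\<forall>a<n. S a \<subseteq> {..<n} - {a} \<and> narr s ''N'' a = lst a (S a) \<and> narr s ''N2'' a = lst a (S a - {narr s ''N'' a}) \<and>
     narr s ''N3'' a = lst a (S a - {narr s ''N'' a} - {narr s ''N2'' a}))"

lemma slot_runs:
  assumes z: "rarr s ''Z'' = Zin" and nn: "nvar s ''n'' = n" and a: "nvar s ''ia'' = a" "a < n" and T: "T \<subseteq> {..<n}" and c: "fresh (nvar s ''ib'') T"
    and N: "narr s N a = lst a T" and f: "0 < f"
  shows "runs (slot CARD('q) N) s f (\<lambda>s'. narr s' = (narr s)(N := (narr s N)(a := lst a (ins (nvar s ''ib'') T))) \<and>
     ins (nvar s ''ib'') T - {lst a (ins (nvar s ''ib'') T)} = ins (nvar s' ''ib'') (T - {narr s N a}) \<and> fresh (nvar s' ''ib'') (T - {narr s N a}))"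
proof -
  let ?c = "nvar s ''ib''" and ?v = "lst a T"
  have b: "bval (Conj (neq (cell N ''ia'') (NVar ''n'')) (Neg (nearer CARD('q) (NVar ''ia'') (NVar ''ib'') (cell N ''ia'')))) s \<longleftrightarrow>
     ?v \<noteq> n \<and> \<not> closer Z a ?c ?v"
  proof (cases "?v = n")
    case False
    then have "T \<noteq> {}" by (auto simp: lst_def)
    then have "?v \<in> T" "?c < n" using lst_props(1)[of T a] T finite_subset[OF T] c by (auto simp: fresh_def split: if_splits)
    then show ?thesis using z a nn N T by auto
  qed (use a nn N in simp)
  note st = slot_step[OF T c, of a]
  show ?thesis unfolding slot_def
  proof (rule runs_Cond, goal_cases)
    case 1
    then have "?v \<noteq> n \<and> \<not> closer Z a ?c ?v" using b by blast
    then have "lst a (ins ?c T) = ?v \<and> ins ?c T - {?v} = ins ?c (T - {?v}) \<and> fresh ?c (T - {?v})" using st by simp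
    then show ?case using f N by (intro runs_line) (auto simp: fun_eq_iff)
  next
    case 2
    then have "\<not> (?v \<noteq> n \<and> \<not> closer Z a ?c ?v)" using b by blast
    then have "lst a (ins ?c T) = ?c \<and> ins ?c T - {?c} = ins ?v (T - {?v}) \<and> fresh ?v (T - {?v})" using st by (simp only: if_False)
    then show ?case using f N a by (intro runs_line) (auto simp: fun_eq_iff)
  qed
qed

lemma offer_runs:
  fixes s :: state
  assumes z: "rarr s ''Z'' = Zin" and nn: "nvar s ''n'' = n" and ab: "nvar s ''ia'' = a" "a < n" "nvar s ''ib'' = b" "b < n" "a \<noteq> b"
    and B: "best s S" and f: "0 < f"
  shows "runs (offer CARD('q)) s f (\<lambda>s'. best s' (S(a := insert b (S a))))"
proof -
  let ?N = "narr s ''N'' a" and ?N2 = "narr s ''N2'' a" and ?N3 = "narr s ''N3'' a"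
  have Sa: "S a \<subseteq> {..<n}" "?N = lst a (S a)" "?N2 = lst a (S a - {?N})" "?N3 = lst a (S a - {?N} - {?N2})"
    using B ab(2) unfolding best_def by auto
  have fin: "finite (S a)" using Sa(1) finite_subset by blast
  let ?S' = "S(a := insert b (S a))"
  have keep: "best s ?S'" if "insert b (S a) = S a"
    using B ab that unfolding best_def by auto
  show ?thesis unfolding offer_def
  proof (rule runs_Cond, goal_cases)
    case 2
    have "b \<in> S a"
    proof -
      have "lst a T \<in> T \<or> lst a T = n" if "finite T" for T using lst_props(1)[OF that] by (auto simp: lst_def)
      then have "?N \<in> S a \<or> ?N = n" "?N2 \<in> S a \<or> ?N2 = n" "?N3 \<in> S a \<or> ?N3 = n"
        using Sa fin by (metis finite_Diff Diff_iff)+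
      moreover have "b = ?N \<or> b = ?N2 \<or> b = ?N3" using 2 ab by auto
      ultimately show ?thesis using ab(4) by auto
    qed
    then show ?case using keep f by (intro runs_line) (auto simp: insert_absorb)
  next
    case 1
    then have ne: "b \<noteq> ?N" "b \<noteq> ?N2" "b \<noteq> ?N3" using ab by auto
    show ?case
    proof (cases "b \<in> S a")
      case True
      \<comment> \<open>The candidate was offered earlier but is in no slot. Then all slots hold
        closer candidates and the three stages change nothing.\<close>
      have T2: "b \<in> S a - {?N}" and T3: "b \<in> S a - {?N} - {?N2}" using True ne by auto
      have m: "lst a T < n \<and> closer Z a (lst a T) b" if "T \<subseteq> {..<n}" "b \<in> T" "b \<noteq> lst a T" for T
      proof -
        have "finite T" "T \<noteq> {}" using that finite_subset by auto
        from lst_props(1)[OF this, where a = a] lst_props(2)[OF this, where a = a and y = b] show ?thesis using that by auto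
      qed
      have 1: "?N < n" "closer Z a ?N b" using m[OF Sa(1) True] ne Sa by auto
      have 2: "?N2 < n" "closer Z a ?N2 b" using m[OF _ T2] ne Sa by auto
      have 3: "?N3 < n" "closer Z a ?N3 b" using m[OF _ T3] ne Sa by auto
      have lt: "?N < n" "?N2 < n" "?N3 < n" using 1 2 3 by auto
      have nc: "\<not> closer Z a b ?N" "\<not> closer Z a b ?N2" "\<not> closer Z a b ?N3"
        using 1 2 3 closer_trans closer_irrefl by blast+
      have "eff (slot CARD('q) ''N'' ;; slot CARD('q) ''N2'' ;; slot CARD('q) ''N3'') s = s"
        using lt nc ab z nn by (simp add: slot_def)
      then show ?thesis using keep True f by (intro runs_line) (auto simp: insert_absorb slot_def)
    next
      case False
      have fr: "fresh b (S a)" using False ab by (simp add: fresh_def)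
      have ib: "ins b (S a) = insert b (S a)" using ab by (simp add: ins_def)
      show ?thesis
      proof (rule runs_Seq, rule runs_mono[OF slot_runs[OF z nn ab(1,2) Sa(1) _ Sa(2) f] order_refl], simp add: ab fr, elim conjE)
        fix s1 :: state
        assume h1: "narr s1 = (narr s)(''N'' := (narr s ''N'')(a := lst a (ins (nvar s ''ib'') (S a))))"
          "ins (nvar s ''ib'') (S a) - {lst a (ins (nvar s ''ib'') (S a))} = ins (nvar s1 ''ib'') (S a - {?N})" "fresh (nvar s1 ''ib'') (S a - {?N})"
          and sm1: "same (slot CARD('q) ''N'') s s1"
        have e1: "rarr s1 ''Z'' = Zin" "nvar s1 ''n'' = n" "nvar s1 ''ia'' = a" "narr s1 ''N2'' a = lst a (S a - {?N})"
          using sameD[OF sm1] z nn ab h1(1) Sa(3) by (simp_all add: slot_def)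
        have sub1: "S a - {?N} \<subseteq> {..<n}" using Sa(1) by auto
        show "runs (slot CARD('q) ''N2'' ;; slot CARD('q) ''N3'') s1 f (\<lambda>s'. best s' ?S')"
        proof (rule runs_Seq, rule runs_mono[OF slot_runs[OF e1(1-3) ab(2) sub1 h1(3) e1(4) f] order_refl], elim conjE)
          fix s2 :: state
          assume h2: "narr s2 = (narr s1)(''N2'' := (narr s1 ''N2'')(a := lst a (ins (nvar s1 ''ib'') (S a - {?N}))))"
            "ins (nvar s1 ''ib'') (S a - {?N}) - {lst a (ins (nvar s1 ''ib'') (S a - {?N}))} = ins (nvar s2 ''ib'') (S a - {?N} - {narr s1 ''N2'' a})"
            "fresh (nvar s2 ''ib'') (S a - {?N} - {narr s1 ''N2'' a})"
            and sm2: "same (slot CARD('q) ''N2'') s1 s2"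
          have n2: "narr s1 ''N2'' a = ?N2" using h1(1) by simp
          have e2: "rarr s2 ''Z'' = Zin" "nvar s2 ''n'' = n" "nvar s2 ''ia'' = a" "narr s2 ''N3'' a = lst a (S a - {?N} - {?N2})"
            using sameD[OF sm2] e1 h1(1) h2(1) Sa(4) by (simp_all add: slot_def)
          have sub2: "S a - {?N} - {?N2} \<subseteq> {..<n}" using Sa(1) by auto
          show "runs (slot CARD('q) ''N3'') s2 f (\<lambda>s'. best s' ?S')"
          proof (rule runs_mono[OF slot_runs[OF e2(1-3) ab(2) sub2 h2(3)[unfolded n2] e2(4) f] order_refl], elim conjE)
            fix s3 :: state
            assume h3: "narr s3 = (narr s2)(''N3'' := (narr s2 ''N3'')(a := lst a (ins (nvar s2 ''ib'') (S a - {?N} - {?N2}))))"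
            have v1: "narr s3 ''N'' = (narr s ''N'')(a := lst a (insert b (S a)))" using h1(1) h2(1) h3 ib ab by simp
            have v2: "narr s3 ''N2'' = (narr s ''N2'')(a := lst a (insert b (S a) - {lst a (insert b (S a))}))"
              using h1 h2(1) h3 ib ab by simp
            have v3: "narr s3 ''N3'' = (narr s ''N3'')(a := lst a (insert b (S a) - {lst a (insert b (S a))} - {lst a (insert b (S a) - {lst a (insert b (S a))})}))"
              using h1 h2 h3 ib ab n2 by simp
            show "best s3 ?S'" unfolding best_def v1 v2 v3 using B ab unfolding best_def by auto
          qed
        qed
      qed
    qed
  qed
qed

end

section \<open>Candidate lists of bounded length\<close>

locale search = sample crd n Z + split_tree Z n m pts ch par rep lmx
  for crd :: "nat \<Rightarrow> 'q::finite" and n Z and m and pts :: "nat \<Rightarrow> nat set" and ch par rep lmx +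
  fixes ord lo hi :: "nat \<Rightarrow> nat"
  assumes range: "x < m \<Longrightarrow> ord ` {lo x..<hi x} = pts x" "x < m \<Longrightarrow> hi x - lo x = card (pts x)"
      "x < m \<Longrightarrow> lo x < hi x" "x < m \<Longrightarrow> hi x \<le> n"
    and leaf_sorted: "x < m \<Longrightarrow> lmx x = 0 \<Longrightarrow> lo x \<le> p \<Longrightarrow> p < p' \<Longrightarrow> p' < hi x \<Longrightarrow> ord p < ord p'"
    and m2: "m \<le> 2 * n"
begin

definition tstate :: "state \<Rightarrow> bool" where
  "tstate s \<longleftrightarrow> nvar s ''n'' = n \<and> nvar s ''m'' = m \<and> rarr s ''Z'' = Zin \<and> rarr s ''lmx'' = lmx \<and> narr s ''ch'' = ch \<and>
     narr s ''par'' = par \<and> narr s ''rep'' = rep \<and> narr s ''ord'' = ord \<and> narr s ''lo'' = lo \<and> narr s ''hi'' = hi"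

lemma tstate_frame:
  assumes "same c s s'" "tstate s" "''n'' \<notin> wn c" "''m'' \<notin> wn c" "''Z'' \<notin> wra c" "''lmx'' \<notin> wra c"
    "wna c \<inter> {''ch'', ''par'', ''rep'', ''ord'', ''lo'', ''hi''} = {}"
  shows "tstate s'"
  using assms by (auto simp: tstate_def same_def)

lemma tstateD:
  assumes "tstate s"
  shows "nvar s ''n'' = n" "nvar s ''m'' = m" "rarr s ''Z'' = Zin" "rarr s ''lmx'' = lmx" "narr s ''ch'' = ch"
    "narr s ''par'' = par" "narr s ''rep'' = rep" "narr s ''ord'' = ord" "narr s ''lo'' = lo" "narr s ''hi'' = hi"
  using assms by (auto simp: tstate_def)

lemma rep_n: "x < m \<Longrightarrow> rep x < n"
  using rep pts_root by blast

lemma bval_screen: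
  assumes t: "tstate s" and B: "nvar s ''B'' < m" and ab: "nval a s < n" "nval b s < n"
  shows "bval (screen_test CARD('q) a b) s \<longleftrightarrow> screens (nvar s ''B'') (nval a s) (nval b s)"
proof -
  let ?y = "nvar s ''B''"
  have r: "real (4 * CARD('q)) * (lmx ?y * lmx ?y * d) = 4 * (rad ?y)\<^sup>2 * d" for d
    unfolding rad_sq by (simp add: power2_eq_square)
  have e: "rval (sqd CARD('q) a b) s = (dist (Z (nval a s)) (Z (nval b s)))\<^sup>2"
    "rval (sqd CARD('q) a (cell ''rep'' ''B'')) s = (dist (Z (nval a s)) (Z (rep ?y)))\<^sup>2"
    using tstateD[OF t] rep_n[OF B] ab by simp_all
  have "bval (screen_test CARD('q) a b) s \<longleftrightarrow> rval (sqd CARD('q) a b) s < rval (sqd CARD('q) a (cell ''rep'' ''B'')) s \<and>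
     real (4 * CARD('q)) * (lmx ?y * lmx ?y * rval (sqd CARD('q) a (cell ''rep'' ''B'')) s) <
     (rval (sqd CARD('q) a (cell ''rep'' ''B'')) s - rval (sqd CARD('q) a b) s) * (rval (sqd CARD('q) a (cell ''rep'' ''B'')) s - rval (sqd CARD('q) a b) s)"
    using tstateD(4)[OF t] by (simp add: screen_test_def)
  then show ?thesis unfolding r e screens_def Let_def by (simp only: power2_eq_square[symmetric])
qed

text \<open>A certificate that \<open>a\<close> has none of its three nearest neighbours in
  \<open>y\<close>. The inequalities are strict, so it does not depend on the breaking of
  ties.\<close>

definition far :: "nat \<Rightarrow> nat \<Rightarrow> bool" where
  "far a y \<longleftrightarrow> (\<exists>C. C \<subseteq> {..<n} - {a} \<and> 3 \<le> card C \<and> (\<forall>c\<in>C. \<forall>j\<in>pts y. dist (Z a) (Z c) < dist (Z a) (Z j)))"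

definition listed :: "state \<Rightarrow> nat \<Rightarrow> nat set \<Rightarrow> bool" where
  "listed s y L \<longleftrightarrow> narr s ''ls'' y \<le> nvar s ''lt'' \<and> inj_on (narr s ''lp'') {narr s ''ls'' y..<nvar s ''lt''} \<and>
     narr s ''lp'' ` {narr s ''ls'' y..<nvar s ''lt''} = L"

text \<open>The factor 4 is the one that \<open>cone\<close> requires and that
  \<open>sep_dist\<close> provides.\<close>

definition remote :: "nat \<Rightarrow> nat \<Rightarrow> bool" where
  "remote a y \<longleftrightarrow> a < n \<and> (\<forall>j\<in>pts y. 4 * rad y < dist (Z a) (Z j))"

lemma screens_far:
  assumes y: "y < m" and L: "L \<subseteq> {..<n}" and c: "3 \<le> card {b \<in> L. b \<noteq> a \<and> screens y a b}"
  shows "far a y"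
  unfolding far_def by (intro exI[of _ "{b \<in> L. b \<noteq> a \<and> screens y a b}"]) (use c L screens_closer[OF y] in auto)

definition ins_cost :: nat where "ins_cost = (list_max + 2) * (list_max + 2)"

lemma find_pt_runs:
  fixes s :: state
  assumes y: "nvar s ''B'' = y" and a: "nvar s ''ia'' = a" and L: "listed s y L" and f: "nvar s ''lt'' - narr s ''ls'' y < f"
  shows "runs find_pt s f (\<lambda>s'. 0 < nvar s' ''fd'' \<longleftrightarrow> a \<in> L)"
  unfolding find_pt_def
proof (rule runs_Seq, rule runs_line, simp, use f in simp,
    rule runs_For[where M = "narr s ''ls'' y" and N = "nvar s ''lt''" and g = "\<lambda>_. 1" and
    I = "\<lambda>e t. 0 < nvar t ''fd'' \<longleftrightarrow> a \<in> narr s ''lp'' ` {narr s ''ls'' y..<e}"], goal_cases)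
  case (6 e t)
  have S: "{narr s ''ls'' y..<Suc e} = insert e {narr s ''ls'' y..<e}" using 6(1) by auto
  show ?case
    by (rule runs_line) (use 6(3-5) a in \<open>auto simp: S same_def\<close>)
qed (use y f L in \<open>auto simp: same_def listed_def\<close>)

lemma count_screens_runs:
  fixes s :: state
  assumes t: "tstate s" and y: "nvar s ''B'' = y" "y < m" and L: "listed s y L" "L \<subseteq> {..<n}"
    and e: "nvar s ''e'' = e" "narr s ''ls'' y \<le> e" "e < nvar s ''lt''" and f: "nvar s ''lt'' - narr s ''ls'' y < f"
  shows "runs (count_screens CARD('q)) s f (\<lambda>s'. nvar s' ''cn'' = card {b \<in> L. b \<noteq> narr s ''lp'' e \<and> screens y (narr s ''lp'' e) b})"
proof -
  let ?lp = "narr s ''lp''" and ?ls = "narr s ''ls'' y" and ?lt = "nvar s ''lt''"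
  let ?C = "\<lambda>g. {b \<in> ?lp ` {?ls..<g}. b \<noteq> ?lp e \<and> screens y (?lp e) b}"
  have lpn: "?lp g < n" if "?ls \<le> g" "g < ?lt" for g
  proof -
    have "?lp g \<in> ?lp ` {?ls..<?lt}" using that by simp
    then show ?thesis using L by (auto simp: listed_def)
  qed
  show ?thesis unfolding count_screens_def
  proof (rule runs_Seq, rule runs_line, simp, use f in simp,
      rule runs_For[where M = ?ls and N = ?lt and g = "\<lambda>_. 1" and I = "\<lambda>g t. nvar t ''cn'' = card (?C g)"], goal_cases)
    case (6 g t')
    have tt: "tstate t'"
      by (rule tstate_frame[OF 6(5)]) (use t in \<open>simp_all add: tstate_def\<close>)
    have v: "nvar t' ''B'' = y" "nvar t' ''e'' = e" "narr t' ''lp'' = ?lp" using 6(5) y e by (simp_all add: same_def)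
    have b: "bval (Conj (neq (cell ''lp'' ''g'') (cell ''lp'' ''e'')) (screen_test CARD('q) (cell ''lp'' ''e'') (cell ''lp'' ''g''))) t' \<longleftrightarrow>
      ?lp g \<noteq> ?lp e \<and> screens y (?lp e) (?lp g)"
      using bval_screen[OF tt, of "cell ''lp'' ''e''" "cell ''lp'' ''g''"] v 6(4) y(2) lpn[OF 6(1,2)] lpn[OF e(2,3)] by simp
    have S: "{?ls..<Suc g} = insert g {?ls..<g}" using 6(1) by auto
    have ng: "?lp g \<notin> ?lp ` {?ls..<g}"
    proof
      assume "?lp g \<in> ?lp ` {?ls..<g}"
      then obtain g' where g': "?ls \<le> g'" "g' < g" "?lp g = ?lp g'" by auto
      have "inj_on ?lp {?ls..<?lt}" using L by (simp add: listed_def)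
      from inj_onD[OF this g'(3)[symmetric]] have "g' = g" using g' 6(1,2) by simp
      then show False using g' by simp
    qed
    have CS: "?C (Suc g) = (if ?lp g \<noteq> ?lp e \<and> screens y (?lp e) (?lp g) then insert (?lp g) (?C g) else ?C g)"
      unfolding S by auto
    have "?lp g \<notin> ?C g" using ng by blast
    moreover have "finite (?C g)" by simp
    ultimately have "card (insert (?lp g) (?C g)) = Suc (card (?C g))" by (rule card_insert_disjoint[rotated])
    then have cS: "card (?C (Suc g)) = (if ?lp g \<noteq> ?lp e \<and> screens y (?lp e) (?lp g) then Suc (card (?C g)) else card (?C g))"
      using CS by presburger
    show ?case
    proof (rule runs_Cond, goal_cases)
      case 1
      then have "?lp g \<noteq> ?lp e \<and> screens y (?lp e) (?lp g)" using b by blast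
      then show ?case using 6(3) cS by (intro runs_line) simp_all
    next
      case 2
      then have "\<not> (?lp g \<noteq> ?lp e \<and> screens y (?lp e) (?lp g))" using b by blast
      then have "card (?C (Suc g)) = card (?C g)" using cS by (simp only: if_False)
      then show ?case using 6(3) by (intro runs_line) simp_all
    qed
  next
    case (7 t')
    then show ?case using L(1) by (simp add: listed_def)
  qed (use y f L in \<open>auto simp: same_def listed_def\<close>)
qed

text \<open>The value \<open>lt\<close>, one past the last entry, signals that no entry is screened
  by three others.\<close>

lemma find_removable_runs:
  fixes s :: state
  assumes t: "tstate s" and y: "nvar s ''B'' = y" "y < m" and L: "listed s y L" "L \<subseteq> {..<n}"
    and f: "(nvar s ''lt'' - narr s ''ls'' y) * (nvar s ''lt'' - narr s ''ls'' y + 1) < f"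
  shows "runs (find_removable CARD('q)) s f (\<lambda>s'. let C = (\<lambda>a. card {b \<in> L. b \<noteq> a \<and> screens y a b}) in
    if nvar s' ''rm'' < nvar s ''lt'' then narr s ''ls'' y \<le> nvar s' ''rm'' \<and> 3 \<le> C (narr s ''lp'' (nvar s' ''rm''))
    else \<forall>a\<in>L. C a < 3)"
proof -
  let ?lp = "narr s ''lp''" and ?ls = "narr s ''ls'' y" and ?lt = "nvar s ''lt''"
  let ?C = "\<lambda>a. card {b \<in> L. b \<noteq> a \<and> screens y a b}"
  show ?thesis unfolding find_removable_def Let_def
  proof (rule runs_Seq, rule runs_line, simp, use f in simp,
      rule runs_For[where M = ?ls and N = ?lt and g = "\<lambda>_. ?lt - ?ls + 1" and I = "\<lambda>e t. if nvar t ''rm'' < ?lt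
        then ?ls \<le> nvar t ''rm'' \<and> 3 \<le> ?C (?lp (nvar t ''rm'')) else \<forall>g. ?ls \<le> g \<and> g < e \<longrightarrow> ?C (?lp g) < 3"], goal_cases)
    case (6 e t')
    have tt: "tstate t'"
      by (rule tstate_frame[OF 6(5)]) (use t in \<open>simp_all add: tstate_def count_screens_def\<close>)
    have v: "nvar t' ''B'' = y" "narr t' ''lp'' = ?lp" "narr t' ''ls'' = narr s ''ls''" "nvar t' ''lt'' = ?lt"
      using 6(5) y by (simp_all add: same_def count_screens_def)
    have Lt: "listed t' y L" using L(1) v by (simp add: listed_def)
    show ?case
    proof (rule runs_Seq, rule runs_mono[OF count_screens_runs[OF tt v(1) y(2) Lt L(2) 6(4), where f = "?lt - ?ls + 1"] order_refl], goal_cases)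
      case (4 t'')
      have w: "nvar t'' ''cn'' = ?C (?lp e)" "nvar t'' ''e'' = e" "nvar t'' ''rm'' = nvar t' ''rm''"
        using 4(1) sameD[OF 4(2)] v 6(4) by (simp_all add: count_screens_def)
      show ?case
        by (rule runs_line) (use w 6(1-3) in \<open>auto simp: less_Suc_eq split: if_splits\<close>)
    qed (use 6(1,2) v in auto)
  next
    case (7 t')
    then show ?case using L(1) by (auto simp: listed_def split: if_splits)
  qed (use y f L in \<open>auto simp: same_def listed_def count_screens_def\<close>)
qed

text \<open>The new point may exceed the bound by one for a moment. In that case \<open>cone\<close>
  guarantees an entry with three screening points, and such an entry can be deleted since it is
  \<open>far\<close> from \<open>y\<close>.\<close>

lemma insert_pt_runs:
  fixes s :: state
  assumes t: "tstate s" and y: "nvar s ''B'' = y" "y < m" and a: "nvar s ''ia'' = a" "remote a y"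
    and L: "listed s y L" "\<And>x. x \<in> L \<Longrightarrow> remote x y" "card L \<le> list_max" and f: "ins_cost \<le> f"
  shows "runs (insert_pt CARD('q)) s f (\<lambda>s'. \<exists>L'. listed s' y L' \<and> L' \<subseteq> insert a L \<and> card L' \<le> list_max \<and> (\<forall>x\<in>insert a L - L'. far x y) \<and>
    (\<forall>p<narr s ''ls'' y. narr s' ''lp'' p = narr s ''lp'' p))"
proof -
  let ?lp = "narr s ''lp''" and ?ls = "narr s ''ls'' y" and ?lt = "nvar s ''lt''"
  have Ls: "?ls \<le> ?lt" "inj_on ?lp {?ls..<?lt}" "?lp ` {?ls..<?lt} = L" using L(1) by (auto simp: listed_def)
  have fin: "finite L" using Ls(3) by auto
  have cl: "card L = ?lt - ?ls" using Ls card_image[OF Ls(2)] by simp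
  have Ln: "insert a L \<subseteq> {..<n}" using L(2) a(2) by (auto simp: remote_def)
  have f1: "?lt - ?ls < f" "0 < f" "(list_max + 1) * (list_max + 2) < f"
    using f cl L(3) by (simp_all add: ins_cost_def)
  show ?thesis unfolding insert_pt_def
  proof (rule runs_Seq, rule runs_mono[OF find_pt_runs[OF y(1) a(1) L(1) f1(1)] order_refl])
    fix t1 :: state assume h1: "(0 < nvar t1 ''fd'') = (a \<in> L)" and s1: "same find_pt s t1"
    have e1: "tstate t1" "nvar t1 ''B'' = y" "nvar t1 ''ia'' = a" "nvar t1 ''lt'' = ?lt" "narr t1 = narr s"
      using tstate_frame[OF s1 t] sameD[OF s1] y a by (auto simp: find_pt_def fun_eq_iff)
    show "runs (Cond (NLess (NLit 0) (NVar ''fd'')) Skip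
      ((NPut ''lp'' (NVar ''lt'') (NVar ''ia'') ;; inc ''lt'') ;;
       find_removable CARD('q) ;;
       Cond (NLess (NVar ''rm'') (NVar ''lt''))
         (''lt'' ::=\<^sub>n NSub (NVar ''lt'') (NLit 1) ;; NPut ''lp'' (NVar ''rm'') (cell ''lp'' ''lt'')) Skip)) t1 f
       (\<lambda>s'. \<exists>L'. listed s' y L' \<and> L' \<subseteq> insert a L \<and> card L' \<le> list_max \<and> (\<forall>x\<in>insert a L - L'. far x y) \<and>
    (\<forall>p<narr s ''ls'' y. narr s' ''lp'' p = narr s ''lp'' p))"
    proof (rule runs_Cond, goal_cases)
      case 1
      then have "a \<in> L" using h1 by simp
      then have "listed t1 y L \<and> L \<subseteq> insert a L \<and> card L \<le> list_max \<and> (\<forall>x\<in>insert a L - L. far x y) \<and>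
         (\<forall>p<narr s ''ls'' y. narr t1 ''lp'' p = narr s ''lp'' p)" using L e1 by (auto simp: listed_def)
      then show ?case using f1(2) by (intro runs_line) auto
    next
      case 2
      then have aL: "a \<notin> L" using h1 by simp
      define t2 where "t2 = eff (NPut ''lp'' (NVar ''lt'') (NVar ''ia'') ;; inc ''lt'') t1"
      have e2: "tstate t2" "nvar t2 ''B'' = y" "nvar t2 ''lt'' = ?lt + 1" "narr t2 ''lp'' = ?lp(?lt := a)" "narr t2 ''ls'' = narr s ''ls''"
        using e1 by (simp_all add: t2_def tstate_def)
      have L2: "listed t2 y (insert a L)"
      proof -
        have S: "{?ls..<?lt + 1} = insert ?lt {?ls..<?lt}" using Ls(1) by auto
        have im: "(?lp(?lt := a)) ` {?ls..<?lt} = L" using Ls(3) by (auto simp: image_iff)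
        have "inj_on (?lp(?lt := a)) {?ls..<?lt}" using Ls(2) by (auto simp: inj_on_def)
        then have "inj_on (?lp(?lt := a)) {?ls..<?lt + 1}" unfolding S using im aL by (simp only: inj_on_insert) auto
        moreover have "(?lp(?lt := a)) ` {?ls..<?lt + 1} = insert a L" unfolding S using im by (simp only: image_insert fun_upd_same)
        ultimately show ?thesis using Ls(1) e2 by (simp add: listed_def)
      qed
      have f2: "(nvar t2 ''lt'' - narr t2 ''ls'' y) * (nvar t2 ''lt'' - narr t2 ''ls'' y + 1) < f"
      proof -
        have "?lt + 1 - ?ls \<le> list_max + 1" "?lt + 1 - ?ls + 1 \<le> list_max + 2" using cl L(3) Ls(1) by simp_all
        then have "(?lt + 1 - ?ls) * (?lt + 1 - ?ls + 1) \<le> (list_max + 1) * (list_max + 2)" by (rule mult_le_mono)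
        then show ?thesis using f1(3) e2 by simp
      qed
      let ?C = "\<lambda>a'. card {b \<in> insert a L. b \<noteq> a' \<and> screens y a' b}"
      show ?case
      proof (rule runs_Seq, rule runs_line, simp, rule f1(2), fold t2_def, rule runs_Seq,
          rule runs_mono[OF find_removable_runs[OF e2(1,2) y(2) L2 Ln f2] order_refl])
        fix t3 :: state
        assume h3: "let C = ?C in if nvar t3 ''rm'' < nvar t2 ''lt'' then narr t2 ''ls'' y \<le> nvar t3 ''rm'' \<and> 3 \<le> C (narr t2 ''lp'' (nvar t3 ''rm''))
            else \<forall>a\<in>insert a L. C a < 3" and s3: "same (find_removable CARD('q)) t2 t3"
        have e3: "nvar t3 ''lt'' = ?lt + 1" "narr t3 ''lp'' = ?lp(?lt := a)" "narr t3 ''ls'' = narr s ''ls''"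
          using s3 e2 by (auto simp: same_def find_removable_def count_screens_def)
        let ?rm = "nvar t3 ''rm''"
        show "runs (Cond (NLess (NVar ''rm'') (NVar ''lt''))
         (''lt'' ::=\<^sub>n NSub (NVar ''lt'') (NLit 1) ;; NPut ''lp'' (NVar ''rm'') (cell ''lp'' ''lt'')) Skip) t3 f
          (\<lambda>s'. \<exists>L'. listed s' y L' \<and> L' \<subseteq> insert a L \<and> card L' \<le> list_max \<and> (\<forall>x\<in>insert a L - L'. far x y) \<and>
            (\<forall>p<narr s ''ls'' y. narr s' ''lp'' p = narr s ''lp'' p))"
        proof (rule runs_Cond, goal_cases)
          case 1
          then have rm: "?ls \<le> ?rm" "?rm \<le> ?lt" "3 \<le> ?C ((?lp(?lt := a)) ?rm)" using h3 e2 e3 by (auto simp: Let_def)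
          define z where "z = (?lp(?lt := a)) ?rm"
          \<comment> \<open>The last entry is the newly appended \<open>a\<close>, so it is
            \<open>a\<close> that moves into the vacated position.\<close>
          define lp' where "lp' = (?lp(?lt := a))(?rm := a)"
          have zin: "z \<in> insert a L" using rm(1,2) Ls(3) by (auto simp: z_def)
          have fz: "far z y" by (rule screens_far[OF y(2) Ln]) (use rm(3) z_def in simp)
          have in1: "inj_on (?lp(?lt := a)) {?ls..<?lt + 1}" and im1: "(?lp(?lt := a)) ` {?ls..<?lt + 1} = insert a L"
            using L2 e2 by (simp_all add: listed_def)
          have im: "lp' ` {?ls..<?lt} = insert a L - {z}"
          proof (cases "?rm = ?lt")
            case True
            then have "z = a" by (simp add: z_def)
            moreover have "lp' ` {?ls..<?lt} = ?lp ` {?ls..<?lt}" using True by (intro image_cong) (auto simp: lp'_def)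
            ultimately show ?thesis using Ls(3) aL by simp
          next
            case False
            then have r: "?rm \<in> {?ls..<?lt}" using rm by simp
            have z: "z = ?lp ?rm" using False by (simp add: z_def)
            have "lp' ` {?ls..<?lt} = insert a (?lp ` ({?ls..<?lt} - {?rm}))"
              using r by (auto simp: lp'_def image_iff)
            also have "?lp ` ({?ls..<?lt} - {?rm}) = L - {z}"
              using inj_on_image_set_diff[OF Ls(2), of "{?ls..<?lt}" "{?rm}"] r Ls(3) z by auto
            finally show ?thesis using aL z r Ls(3) by auto
          qed
          have "card (insert a L - {z}) = card L" using zin fin aL by (simp add: card_Diff_singleton)
          then have inj: "inj_on lp' {?ls..<?lt}" using im cl by (intro eq_card_imp_inj_on) simp_all
          have LL: "listed (eff (''lt'' ::=\<^sub>n NSub (NVar ''lt'') (NLit 1) ;; NPut ''lp'' (NVar ''rm'') (cell ''lp'' ''lt'')) t3) y (insert a L - {z})"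
            using e3 Ls(1) inj im by (simp add: listed_def lp'_def)
          show ?case
          proof (rule runs_line, simp, rule f1(2), intro exI[of _ "insert a L - {z}"] conjI, rule LL)
            show "card (insert a L - {z}) \<le> list_max" using \<open>card (insert a L - {z}) = card L\<close> L(3) by simp
            show "\<forall>x\<in>insert a L - (insert a L - {z}). far x y" using fz by auto
            show "\<forall>p<narr s ''ls'' y. narr (eff (''lt'' ::=\<^sub>n NSub (NVar ''lt'') (NLit 1) ;; NPut ''lp'' (NVar ''rm'') (cell ''lp'' ''lt'')) t3) ''lp'' p = narr s ''lp'' p"
              using e3 rm(1) Ls(1) by auto
          qed auto
        next
          case 2
          then have c3: "?C x < 3" if "x \<in> insert a L" for x using h3 e2 e3 that by (auto simp: Let_def)
          have "card (insert a L) \<le> list_max"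
          proof (rule ccontr)
            assume "\<not> card (insert a L) \<le> list_max"
            then have "list_max < card (insert a L)" by simp
            moreover have "4 * rad y < dist (Z x) (Z (rep y))" if "x \<in> insert a L" for x
              using that L(2) a(2) rep[OF y(2)] by (auto simp: remote_def)
            ultimately obtain x where "x \<in> insert a L" "3 \<le> ?C x" using cone[OF y(2), of "insert a L"] fin by blast
            then show False using c3 by force
          qed
          moreover have "listed t3 y (insert a L)" using L2 e2 e3 by (simp add: listed_def)
          ultimately show ?case using f1(2) e3 Ls(1) by (intro runs_line) (auto intro!: exI[of _ "insert a L"])
        qed
      qed
    qed
  qed
qed

end

section \<open>Traversal of the tree\<close>

definition sep_test :: "nat \<Rightarrow> bexp" where
  "sep_test q = (let d = sqd q (cell ''rep'' ''A'') (cell ''rep'' ''B'');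
       w = (\<lambda>x. RMul (OfNat (NLit (36 * q))) (RMul (RGet ''lmx'' (NVar x)) (RGet ''lmx'' (NVar x)))) in
     Conj (RLess (w ''A'') d) (RLess (w ''B'') d))"

definition insert_range :: "nat \<Rightarrow> com" where
  "insert_range q = For ''p'' (cell ''lo'' ''A'') (cell ''hi'' ''A'') (''ia'' ::=\<^sub>n cell ''ord'' ''p'' ;; insert_pt q)"

text \<open>A separated node with four or more points is dropped because its points are each other's
  closer neighbours; with at most three points its insertion takes bounded time. An unseparated node
  is split if it precedes \<open>B\<close>, and is otherwise left to the descendants of
  \<open>B\<close>.\<close>

definition pair_step :: "nat \<Rightarrow> com" where
  "pair_step q = (''sp'' ::=\<^sub>n NSub (NVar ''sp'') (NLit 1) ;; ''A'' ::=\<^sub>n cell ''stk'' ''sp'') ;;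
     Cond (sep_test q)
       (Cond (NLess (NSub (cell ''hi'' ''A'') (cell ''lo'' ''A'')) (NLit 4)) (insert_range q) Skip)
       (Cond (lex_less (RGet ''lmx'' (NVar ''B'')) (RGet ''lmx'' (NVar ''A'')) (NVar ''A'') (NVar ''B''))
         (NPut ''stk'' (NVar ''sp'') (cell ''ch'' ''A'') ;;
          NPut ''stk'' (NAdd (NVar ''sp'') (NLit 1)) (NAdd (cell ''ch'' ''A'') (NLit 1)) ;;
          ''sp'' ::=\<^sub>n NAdd (NVar ''sp'') (NLit 2))
         (NPut ''pp'' (NVar ''pt'') (NVar ''A'') ;; inc ''pt''))"

definition copy :: "name \<Rightarrow> name \<Rightarrow> name \<Rightarrow> nexp \<Rightarrow> nexp \<Rightarrow> com" where
  "copy a b x e0 e1 = For ''p'' e0 e1 (NPut b (NVar x) (cell a ''p'') ;; inc x)"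

text \<open>Nodes are visited by number and not depth first, so the lists of a node must survive
  until both children have copied them. Hence every node appends a new segment to \<open>lp\<close>
  and \<open>pp\<close>, and no segment is reused.\<close>

definition start_lists :: com where
  "start_lists = (NPut ''ls'' (NVar ''B'') (NVar ''lt'') ;; NPut ''ps'' (NVar ''B'') (NVar ''pt'') ;; ''sp'' ::=\<^sub>n NLit 0) ;;
     Cond (NLess (NLit 0) (NVar ''B''))
       (copy ''lp'' ''lp'' ''lt'' (NGet ''ls'' (cell ''par'' ''B'')) (NGet ''le'' (cell ''par'' ''B'')) ;;
        copy ''pp'' ''stk'' ''sp'' (NGet ''ps'' (cell ''par'' ''B'')) (NGet ''pe'' (cell ''par'' ''B'')))
       (NPut ''stk'' (NVar ''sp'') (NLit 0) ;; inc ''sp'')"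

definition offer_pairs :: "nat \<Rightarrow> name \<Rightarrow> nexp \<Rightarrow> nexp \<Rightarrow> nexp \<Rightarrow> nexp \<Rightarrow> com" where
  "offer_pairs q a e0 e1 f0 f1 = For ''e'' e0 e1 (For ''g'' f0 f1
     ((''ia'' ::=\<^sub>n cell a ''e'' ;; ''ib'' ::=\<^sub>n cell ''ord'' ''g'') ;; Cond (neq (NVar ''ia'') (NVar ''ib'')) (offer q) Skip))"

text \<open>A leaf may contain many coinciding points, and trying all pairs would be quadratic. The
  four of smallest index suffice, since at most one of them is the point itself.\<close>

definition leaf_work :: "nat \<Rightarrow> com" where
  "leaf_work q = offer_pairs q ''lp'' (cell ''ls'' ''B'') (NVar ''lt'') (cell ''lo'' ''B'') (cell ''hi'' ''B'') ;;
     Cond (NLess (NAdd (cell ''lo'' ''B'') (NLit 4)) (cell ''hi'' ''B''))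
       (''h4'' ::=\<^sub>n NAdd (cell ''lo'' ''B'') (NLit 4)) (''h4'' ::=\<^sub>n cell ''hi'' ''B'') ;;
     offer_pairs q ''ord'' (cell ''lo'' ''B'') (cell ''hi'' ''B'') (cell ''lo'' ''B'') (NVar ''h4'')"

definition visit :: "nat \<Rightarrow> com" where
  "visit q = start_lists ;; While (NLess (NLit 0) (NVar ''sp'')) (pair_step q) ;;
     (NPut ''le'' (NVar ''B'') (NVar ''lt'') ;; NPut ''pe'' (NVar ''B'') (NVar ''pt'')) ;;
     Cond (RLess (OfNat (NLit 0)) (RGet ''lmx'' (NVar ''B''))) Skip (leaf_work q)"

definition search_nodes :: "nat \<Rightarrow> com" where
  "search_nodes q = For ''B'' (NLit 0) (NVar ''m'') (visit q)"

lemma map_copied: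
  assumes "M \<le> N"
  shows "map (\<lambda>i. if x \<le> i \<and> i < x + (N - M) then g (M + (i - x)) else h i) [x..<x + (N - M)] = map g [M..<N]"
proof -
  obtain d where N: "N = M + d" using assms le_Suc_ex by blast
  show ?thesis unfolding N by (rule nth_equalityI) simp_all
qed

text \<open>The arrays \<open>a\<close> and \<open>b\<close> may be the same; then the source has to
  end before the place where the copy begins.\<close>

lemma copy_runs:
  fixes s :: state
  assumes N: "\<And>s'. same (copy a b x e0 e1) s s' \<Longrightarrow> nval e1 s' = N" and M: "nval e0 s = M" "M \<le> N"
    and x: "x \<noteq> ''p''" and ab: "a = b \<Longrightarrow> N \<le> nvar s x" and f: "N - M < f"
  shows "runs (copy a b x e0 e1) s f (\<lambda>t. nvar t x = nvar s x + (N - M) \<and>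
    narr t = (narr s)(b := \<lambda>i. if nvar s x \<le> i \<and> i < nvar s x + (N - M) then narr s a (M + (i - nvar s x)) else narr s b i))"
  unfolding copy_def
proof (rule runs_For[where M = M and N = N and g = "\<lambda>_. 1" and I = "\<lambda>k t. nvar t x = nvar s x + (k - M) \<and>
    narr t = (narr s)(b := \<lambda>i. if nvar s x \<le> i \<and> i < nvar s x + (k - M) then narr s a (M + (i - nvar s x)) else narr s b i)"], goal_cases)
  case (2 s')
  then show ?case using N unfolding copy_def by blast
next
  case (6 k t)
  have "narr t a k = narr s a k" using 6(1-3) ab by (auto simp: fun_upd_def)
  moreover have "(if nvar s x \<le> i \<and> i < nvar s x + (Suc k - M) then narr s a (M + (i - nvar s x)) else narr s b i) =
      ((\<lambda>i. if nvar s x \<le> i \<and> i < nvar s x + (k - M) then narr s a (M + (i - nvar s x)) else narr s b i)(nvar s x + (k - M) := narr s a k)) i" for i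
    using 6(1) by (auto simp: fun_upd_def)
  ultimately show ?case using 6(1-4) x by (intro runs_line) (auto simp: fun_eq_iff)
qed (use M x f in \<open>auto simp: fun_eq_iff\<close>)

section \<open>The invariant of the traversal\<close>

context search
begin

lemma far_mono: "far a x \<Longrightarrow> pts y \<subseteq> pts x \<Longrightarrow> far a y"
  unfolding far_def by blast

lemma rad_par: "0 < y \<Longrightarrow> y < m \<Longrightarrow> rad y \<le> rad (par y)"
  using lmx_par by (simp add: rad_def mult_left_mono)

lemma remote_par: "0 < y \<Longrightarrow> y < m \<Longrightarrow> remote a (par y) \<Longrightarrow> remote a y"
  using rad_par[of y] pts_par[of y] by (fastforce simp: remote_def)

text \<open>The nodes \<open>xs\<close> are still to be compared with \<open>y\<close>, the nodes \<open>ps\<close> are passed on to the children of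
  \<open>y\<close>, and \<open>L\<close> is the list of candidate points.\<close>

definition frontier :: "nat \<Rightarrow> nat list \<Rightarrow> nat list \<Rightarrow> nat set \<Rightarrow> bool" where
  "frontier y xs ps L \<longleftrightarrow> sorted_wrt (\<lambda>x x'. pts x \<inter> pts x' = {}) (xs @ rev ps) \<and>
     (\<forall>x\<in>set xs. x < m \<and> (y = 0 \<longrightarrow> x = 0) \<and> (0 < y \<longrightarrow> (x = 0 \<or> prec (par x) y) \<and> (par y = x \<or> prec (par y) x))) \<and>
     (\<forall>x\<in>set ps. pend_ok x y) \<and> (\<forall>x\<in>L. remote x y) \<and> card L \<le> list_max \<and>
     (\<forall>a<n. a \<in> L \<or> far a y \<or> (\<exists>x\<in>set xs \<union> set ps. a \<in> pts x))"

text \<open>An entry below which \<open>k\<close> splits are possible gives rise to at most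
  \<open>2 * k + 1\<close> nodes to be handled, as in a full binary tree with \<open>k\<close> inner
  nodes.\<close>

definition wt :: "nat \<Rightarrow> nat list \<Rightarrow> nat" where
  "wt y xs = (\<Sum>x\<leftarrow>xs. 2 * card {z \<in> split_by y. pts z \<subseteq> pts x} + 1)"

lemma finite_split: "finite (split_by y)"
  by (rule finite_subset[of _ "{..<m}"]) (auto simp: split_by_def)

lemma frontier_keep:
  assumes "frontier y (xs @ [A]) ps L" "y < m" "\<not> sep A y" "\<not> prec A y"
  shows "frontier y xs (ps @ [A]) L"
proof -
  have "pend_ok A y" using assms prec_total[of A y] by (auto simp: frontier_def pend_ok_def)
  then show ?thesis using assms(1) by (auto simp: frontier_def)
qed

text \<open>Each point of \<open>A\<close> has three others within \<open>rad A\<close>, and by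
  separation all of them are closer than any point of \<open>y\<close>.\<close>

lemma frontier_drop:
  assumes "frontier y (xs @ [A]) ps L" "y < m" "sep A y" "4 \<le> card (pts A)"
  shows "frontier y xs ps L"
proof -
  have A: "A < m" using assms(1) by (auto simp: frontier_def)
  have "far a y" if "a \<in> pts A" for a unfolding far_def
  proof (intro exI[of _ "pts A - {a}"] conjI ballI)
    show "pts A - {a} \<subseteq> {..<n} - {a}" using pts_root[OF A] by auto
    show "3 \<le> card (pts A - {a})" using assms(4) that by (simp add: card_Diff_singleton)
  next
    fix c j assume c: "c \<in> pts A - {a}" "j \<in> pts y"
    have "dist (Z a) (Z c) \<le> rad A" using dist_pts[OF A that] c by auto
    then show "dist (Z a) (Z c) < dist (Z a) (Z j)"
      using sep_dist(1)[OF A assms(2,3) that c(2)] rad0[OF A] by linarith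
  qed
  then show ?thesis using assms(1) by (auto simp: frontier_def sorted_wrt_append)
qed

lemma frontier_few:
  assumes "frontier y (xs @ [A]) ps L" "y < m" "sep A y" "L' \<subseteq> L \<union> pts A" "card L' \<le> list_max" "\<And>x. x \<in> L \<union> pts A - L' \<Longrightarrow> far x y"
  shows "frontier y xs ps L'"
proof -
  have A: "A < m" using assms(1) by (auto simp: frontier_def)
  have "remote x y" if "x \<in> pts A" for x
    using pts_root[OF A] that sep_dist(2)[OF A assms(2,3) that] by (auto simp: remote_def)
  then have "\<forall>x\<in>L'. remote x y" using assms(1,4) unfolding frontier_def by blast
  moreover have "\<forall>a<n. a \<in> L' \<or> far a y \<or> (\<exists>x\<in>set xs \<union> set ps. a \<in> pts x)"
  proof (intro allI impI)
    fix a assume a: "a < n"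
    have "a \<in> L \<or> far a y \<or> (\<exists>x\<in>set (xs @ [A]) \<union> set ps. a \<in> pts x)" using assms(1) a unfolding frontier_def by blast
    then show "a \<in> L' \<or> far a y \<or> (\<exists>x\<in>set xs \<union> set ps. a \<in> pts x)" using assms(6)[of a] by auto
  qed
  ultimately show ?thesis using assms(1,5) by (simp add: frontier_def sorted_wrt_append)
qed

lemma frontier_split:
  assumes "frontier y (xs @ [A]) ps L" "y < m" "\<not> sep A y" "prec A y"
  shows "frontier y (xs @ [ch A, ch A + 1]) ps L" "wt y (xs @ [ch A, ch A + 1]) < wt y (xs @ [A])"
proof -
  have A: "A < m" "y = 0 \<longrightarrow> A = 0" "0 < y \<longrightarrow> (A = 0 \<or> prec (par A) y) \<and> (par y = A \<or> prec (par y) A)"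
    using assms(1) by (auto simp: frontier_def)
  \<comment> \<open>At the root the only entry is the root itself, and no node precedes
    itself.\<close>
  have y: "0 < y" using A(2) assms(4) prec_irrefl[of 0] by (cases "y = 0") auto
  then have Ay: "A \<in> split_by y" using A assms by (auto simp: split_by_def)
  then have l: "0 < lmx A" by (rule split_pos)
  note c = children[OF A(1) l] and d = pts_children[OF A(1) l]
  have ok: "prec (par x) y \<and> prec (par y) x \<and> x < m" if "x = ch A \<or> x = ch A + 1" for x
  proof -
    have x: "par x = A" "x < m" "0 < x" using c that by auto
    have "prec A x" using prec_par[OF x(3,2)] x(1) by simp
    moreover have "par y = A \<or> prec (par y) A" using A(3) y by simp
    ultimately have "prec (par y) x" using prec_trans[of "par y" A x] by auto
    then show ?thesis using x assms(4) by simp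
  qed
  have sub: "pts (ch A) \<subseteq> pts A" "pts (ch A + 1) \<subseteq> pts A" "pts (ch A) \<inter> pts (ch A + 1) = {}" using d by auto
  have F: "sorted_wrt (\<lambda>x x'. pts x \<inter> pts x' = {}) ((xs @ [A]) @ rev ps)"
    "\<forall>x\<in>set xs. x < m \<and> (x = 0 \<or> prec (par x) y) \<and> (par y = x \<or> prec (par y) x)"
    "\<forall>a<n. a \<in> L \<or> far a y \<or> (\<exists>x\<in>set (xs @ [A]) \<union> set ps. a \<in> pts x)"
    using assms(1) y by (simp_all add: frontier_def)
  have S: "sorted_wrt (\<lambda>x x'. pts x \<inter> pts x' = {}) xs" "\<And>x. x \<in> set xs \<Longrightarrow> pts x \<inter> pts A = {}" "sorted_wrt (\<lambda>x x'. pts x \<inter> pts x' = {}) (rev ps)"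
    "\<And>x p. x \<in> set xs \<Longrightarrow> p \<in> set ps \<Longrightarrow> pts x \<inter> pts p = {}" "\<And>p. p \<in> set ps \<Longrightarrow> pts A \<inter> pts p = {}"
    using F(1) by (simp_all add: sorted_wrt_append)
  have S': "pts x \<inter> pts (ch A) = {} \<and> pts x \<inter> pts (ch A + 1) = {}" if "x \<in> set xs" for x using S(2)[OF that] sub by blast
  have S'': "pts (ch A) \<inter> pts p = {} \<and> pts (ch A + 1) \<inter> pts p = {}" if "p \<in> set ps" for p using S(5)[OF that] sub by blast
  show "frontier y (xs @ [ch A, ch A + 1]) ps L" unfolding frontier_def
  proof (intro conjI)
    show "sorted_wrt (\<lambda>x x'. pts x \<inter> pts x' = {}) ((xs @ [ch A, ch A + 1]) @ rev ps)"
      using S(1,3,4) S' S'' sub(3) by (simp add: sorted_wrt_append)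
    show "\<forall>x\<in>set (xs @ [ch A, ch A + 1]). x < m \<and> (y = 0 \<longrightarrow> x = 0) \<and> (0 < y \<longrightarrow> (x = 0 \<or> prec (par x) y) \<and> (par y = x \<or> prec (par y) x))"
      using F(2) ok[of "ch A"] ok[of "ch A + 1"] y by simp
    show "\<forall>a<n. a \<in> L \<or> far a y \<or> (\<exists>x\<in>set (xs @ [ch A, ch A + 1]) \<union> set ps. a \<in> pts x)"
    proof (intro allI impI)
      fix a assume "a < n"
      then have "a \<in> L \<or> far a y \<or> (\<exists>x\<in>set xs \<union> set ps. a \<in> pts x) \<or> a \<in> pts A" using F(3) by auto
      then show "a \<in> L \<or> far a y \<or> (\<exists>x\<in>set (xs @ [ch A, ch A + 1]) \<union> set ps. a \<in> pts x)" using d by auto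
    qed
  qed (use assms(1) in \<open>simp_all add: frontier_def\<close>)
  let ?C = "\<lambda>x. {z \<in> split_by y. pts z \<subseteq> pts x}"
  have ne: "pts z \<noteq> {}" if "z \<in> split_by y" for z using that pts_nonempty by (auto simp: split_by_def)
  have ne': "pts (ch A) \<noteq> {}" "pts (ch A + 1) \<noteq> {}" using pts_nonempty c by auto
  \<comment> \<open>The weight drops because \<open>A\<close> is counted for its own entry but for
    neither child: its point set is not contained in one of theirs.\<close>
  have "A \<notin> ?C (ch A) \<union> ?C (ch A + 1)" using d ne' by blast
  moreover have "?C (ch A) \<inter> ?C (ch A + 1) = {}" using d ne by blast
  moreover have fin: "finite (?C x)" for x using finite_split by simp
  ultimately have "card (insert A (?C (ch A) \<union> ?C (ch A + 1))) = Suc (card (?C (ch A)) + card (?C (ch A + 1)))"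
    by (simp add: card_Un_disjoint)
  moreover have "card (insert A (?C (ch A) \<union> ?C (ch A + 1))) \<le> card (?C A)"
    by (rule card_mono[OF fin]) (use Ay d in auto)
  ultimately show "wt y (xs @ [ch A, ch A + 1]) < wt y (xs @ [A])" by (simp add: wt_def)
qed

text \<open>What was left pending at the parent is the list of nodes to compare with the child. The
  inequalities carry over because the parent precedes the child.\<close>

lemma frontier_start:
  assumes "frontier (par y) [] ps L" "0 < y" "y < m"
  shows "frontier y ps [] L"
proof -
  have p: "prec (par y) y" by (rule prec_par[OF assms(2,3)])
  have "x < m \<and> (x = 0 \<or> prec (par x) y) \<and> (par y = x \<or> prec (par y) x)" if "x \<in> set ps" for x
    using assms(1) that prec_trans[OF _ p] by (auto simp: frontier_def pend_ok_def)
  moreover have "remote x y" if "x \<in> L" for x using assms remote_par that by (auto simp: frontier_def)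
  moreover have "far a y" if "far a (par y)" for a using far_mono[OF that pts_par[OF assms(2,3)]] .
  moreover have "sorted_wrt (\<lambda>x x'. pts x \<inter> pts x' = {}) ps"
    using assms(1) by (simp add: frontier_def sorted_wrt_rev Int_commute)
  ultimately show ?thesis using assms(1,2) unfolding frontier_def by auto
qed

lemma frontier_root: "frontier 0 [0] [] {}"
  using root by (auto simp: frontier_def)

text \<open>The entries have disjoint point sets, so a node that is to be split lies within at most
  one of them.\<close>

lemma wt_le:
  assumes "sorted_wrt (\<lambda>x x'. pts x \<inter> pts x' = {}) xs"
  shows "wt y xs \<le> 2 * card (split_by y) + length xs"
proof -
  let ?C = "\<lambda>x. {z \<in> split_by y. pts z \<subseteq> pts x}"
  have ne: "pts z \<noteq> {}" if "z \<in> split_by y" for z using that pts_nonempty by (auto simp: split_by_def)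
  have "(\<Sum>x\<leftarrow>xs. card (?C x)) \<le> card (\<Union>x\<in>set xs. ?C x)"
    using assms
  proof (induction xs)
    case (Cons x xs)
    have "?C x \<inter> (\<Union>x\<in>set xs. ?C x) = {}" using Cons.prems ne by fastforce
    then have "card (?C x \<union> (\<Union>x\<in>set xs. ?C x)) = card (?C x) + card (\<Union>x\<in>set xs. ?C x)"
      using finite_split by (intro card_Un_disjoint) auto
    then show ?case using Cons by simp
  qed simp
  also have "\<dots> \<le> card (split_by y)" by (rule card_mono[OF finite_split]) auto
  finally have "2 * (\<Sum>x\<leftarrow>xs. card (?C x)) + length xs \<le> 2 * card (split_by y) + length xs" by simp
  moreover have "wt y xs = 2 * (\<Sum>x\<leftarrow>xs. card (?C x)) + length xs" by (induction xs) (simp_all add: wt_def)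
  ultimately show ?thesis by simp
qed

lemma length_pend:
  assumes "frontier y [] ps L" "0 < lmx y"
  shows "length ps \<le> pend_max + 1"
proof -
  have "pend_ok x y" if "x \<in> set ps" for x using assms that by (simp add: frontier_def)
  moreover from this have "distinct ps"
  proof -
    have "sorted_wrt (\<lambda>x x'. pts x \<inter> pts x' = {}) (rev ps)" using assms(1) by (simp add: frontier_def)
    then have "sorted_wrt (\<noteq>) (rev ps)"
      by (rule sorted_wrt_mono_rel[rotated]) (use calculation pts_nonempty in \<open>force simp: pend_ok_def\<close>)
    moreover have "sorted_wrt (\<noteq>) zs \<Longrightarrow> distinct zs" for zs :: "nat list" by (induction zs) auto
    ultimately show ?thesis by (metis distinct_rev)
  qed
  ultimately show ?thesis using card_pend[OF assms(2), of "set ps"] distinct_card[of ps] by simp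
qed

text \<open>A pending node is no larger than the leaf \<open>y\<close>, hence a leaf, and distinct
  leaves are separated.\<close>

lemma frontier_leaf:
  assumes "frontier y [] ps L" "y < m" "lmx y = 0" "x \<in> set ps"
  shows "x = y"
proof -
  have x: "x < m" "\<not> sep x y" "x = y \<or> prec y x" using assms by (auto simp: frontier_def pend_ok_def)
  then have "lmx x = 0" using assms(3) lmx0[OF x(1)] by (auto simp: prec_def)
  then show ?thesis using leaf_sep[of x y] x assms by auto
qed

definition stacked :: "state \<Rightarrow> nat list \<Rightarrow> bool" where
  "stacked s xs \<longleftrightarrow> xs = map (narr s ''stk'') [0..<nvar s ''sp'']"

definition pended :: "state \<Rightarrow> nat \<Rightarrow> nat list \<Rightarrow> bool" where
  "pended s y ps \<longleftrightarrow> narr s ''ps'' y \<le> nvar s ''pt'' \<and> ps = map (narr s ''pp'') [narr s ''ps'' y..<nvar s ''pt'']"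

definition visiting :: "state \<Rightarrow> nat \<Rightarrow> nat list \<Rightarrow> nat list \<Rightarrow> nat set \<Rightarrow> bool" where
  "visiting s y xs ps L \<longleftrightarrow> tstate s \<and> nvar s ''B'' = y \<and> y < m \<and> stacked s xs \<and> pended s y ps \<and> listed s y L \<and> frontier y xs ps L"

definition kept :: "state \<Rightarrow> nat \<Rightarrow> state \<Rightarrow> bool" where
  "kept s y t \<longleftrightarrow> (\<forall>i<narr s ''ls'' y. narr t ''lp'' i = narr s ''lp'' i) \<and> (\<forall>i<narr s ''ps'' y. narr t ''pp'' i = narr s ''pp'' i)"

lemma bval_sep_test:
  assumes t: "tstate s" and A: "nvar s ''A'' = A" "A < m" and B: "nvar s ''B'' = y" "y < m"
  shows "bval (sep_test CARD('q)) s \<longleftrightarrow> sep A y"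
  using tstateD[OF t] A B rep_n[OF A(2)] rep_n[OF B(2)]
  by (simp add: sep_test_def Let_def sep_def rad_sq) (simp add: power2_eq_square mult.assoc)

text \<open>At most three insertions per step, and one more share to make the bound of the loop
  strict.\<close>

definition step_cost :: nat where "step_cost = 4 * ins_cost"

lemma ins_cost0: "0 < ins_cost" by (simp add: ins_cost_def)

lemma insert_range_runs:
  fixes s :: state
  assumes t: "tstate s" and y: "nvar s ''B'' = y" "y < m" and A: "nvar s ''A'' = A" "A < m" "sep A y" "card (pts A) < 4"
    and L: "listed s y L" "\<And>x. x \<in> L \<Longrightarrow> remote x y" "card L \<le> list_max"
  shows "runs (insert_range CARD('q)) s step_cost (\<lambda>s'. \<exists>L'. listed s' y L' \<and> L' \<subseteq> L \<union> pts A \<and> card L' \<le> list_max \<and>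
    (\<forall>x\<in>L \<union> pts A - L'. far x y) \<and> (\<forall>i<narr s ''ls'' y. narr s' ''lp'' i = narr s ''lp'' i))"
  unfolding insert_range_def
proof (rule runs_For[where M = "lo A" and N = "hi A" and g = "\<lambda>_. ins_cost" and I = "\<lambda>p t. \<exists>L'. listed t y L' \<and> L' \<subseteq> L \<union> ord ` {lo A..<p} \<and>
    card L' \<le> list_max \<and> (\<forall>x\<in>L \<union> ord ` {lo A..<p} - L'. far x y) \<and> (\<forall>i<narr s ''ls'' y. narr t ''lp'' i = narr s ''lp'' i)"], goal_cases)
  case (6 p t')
  have tt: "tstate t'"
    by (rule tstate_frame[OF 6(5)]) (use t in \<open>simp_all add: insert_defs\<close>)
  have v: "nvar t' ''B'' = y" "narr t' ''ls'' = narr s ''ls''" using 6(5) y by (simp_all add: same_def insert_defs)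
  obtain L' where L': "listed t' y L'" "L' \<subseteq> L \<union> ord ` {lo A..<p}" "card L' \<le> list_max" "\<And>x. x \<in> L \<union> ord ` {lo A..<p} - L' \<Longrightarrow> far x y"
    "\<And>i. i < narr s ''ls'' y \<Longrightarrow> narr t' ''lp'' i = narr s ''lp'' i" using 6(3) by blast
  have rA: "remote x y" if "x \<in> pts A" for x
    using pts_root[OF A(2)] that sep_dist(2)[OF A(2) y(2) A(3) that] by (auto simp: remote_def)
  have op: "ord ` {lo A..<p} \<subseteq> pts A" "ord p \<in> pts A" using range(1)[OF A(2)] 6(1,2) by auto
  have S: "{lo A..<Suc p} = insert p {lo A..<p}" using 6(1) by auto
  have Lr: "remote x y" if "x \<in> L'" for x using that L'(2) L(2) rA op(1) by blast
  let ?t = "eff (''ia'' ::=\<^sub>n cell ''ord'' ''p'') t'"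
  have tt2: "tstate ?t" "nvar ?t ''B'' = y" "nvar ?t ''ia'' = ord p" "listed ?t y L'" using tt v L'(1) 6(4) tstateD[OF tt] by (simp_all add: tstate_def listed_def)
  show ?case
  proof (rule runs_Seq, rule runs_line, simp, rule ins_cost0, rule runs_mono[OF insert_pt_runs[OF tt2(1,2) y(2) tt2(3) rA[OF op(2)] tt2(4) Lr L'(3) order_refl] order_refl], goal_cases)
    case (2 u)
    then obtain L'' where L'': "listed u y L''" "L'' \<subseteq> insert (ord p) L'" "card L'' \<le> list_max" "\<And>x. x \<in> insert (ord p) L' - L'' \<Longrightarrow> far x y"
      "\<And>i. i < narr s ''ls'' y \<Longrightarrow> narr u ''lp'' i = narr t' ''lp'' i" using v(2) by auto
    have "far x y" if "x \<in> L \<union> ord ` {lo A..<Suc p} - L''" for x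
      using that L'(4)[of x] L''(4)[of x] by (auto simp: S)
    moreover have "L'' \<subseteq> L \<union> ord ` {lo A..<Suc p}" using L'(2) L''(2) by (auto simp: S)
    moreover have "listed (u\<lparr>nvar := (nvar u)(''p'' := Suc p)\<rparr>) y L''" using L''(1) by (simp add: listed_def)
    ultimately show ?case using L''(3,5) L'(5) by (intro exI[of _ L'']) simp
  qed
next
  case (8)
  have "hi A - lo A \<le> 3" using A(4) range(2)[OF A(2)] by simp
  then have "(hi A - lo A) * ins_cost \<le> 3 * ins_cost" by (rule mult_le_mono1)
  then show ?case using ins_cost0 by (simp add: step_cost_def)
next
  case (7 t')
  then show ?case using range(1)[OF A(2)] by simp
qed (use t y A L range(3)[OF A(2)] in \<open>auto simp: same_def insert_defs tstate_def listed_def\<close>)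

lemma pair_step_runs:
  fixes s :: state
  assumes v: "visiting s y (xs @ [A]) ps L"
  shows "runs (pair_step CARD('q)) s step_cost (\<lambda>t. \<exists>xs' ps' L'. visiting t y xs' ps' L' \<and> wt y xs' < wt y (xs @ [A]) \<and> kept s y t)"
proof -
  have t: "tstate s" "nvar s ''B'' = y" "y < m" and stk: "stacked s (xs @ [A])" and pnd: "pended s y ps" and lst: "listed s y L"
    and F: "frontier y (xs @ [A]) ps L" using v by (auto simp: visiting_def)
  obtain k where k: "nvar s ''sp'' = Suc k" using stk by (cases "nvar s ''sp''") (auto simp: stacked_def)
  have xs: "xs = map (narr s ''stk'') [0..<k]" "A = narr s ''stk'' k" using stk k by (auto simp: stacked_def)
  have A: "A < m" using F by (auto simp: frontier_def)
  let ?e = "eff (''sp'' ::=\<^sub>n NSub (NVar ''sp'') (NLit 1) ;; ''A'' ::=\<^sub>n cell ''stk'' ''sp'') s"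
  have e: "tstate ?e" "nvar ?e ''B'' = y" "nvar ?e ''A'' = A" "stacked ?e xs" "pended ?e y ps" "listed ?e y L" "narr ?e = narr s" "nvar ?e ''sp'' = k"
    "nvar ?e ''pt'' = nvar s ''pt''"
    using t k xs pnd lst by (simp_all add: tstate_def stacked_def pended_def listed_def)
  have c0: "0 < step_cost" using ins_cost0 by (simp add: step_cost_def)
  have wl: "wt y xs < wt y (xs @ [A])" by (simp add: wt_def)
  note td = tstateD[OF e(1)]
  show ?thesis unfolding pair_step_def
  proof (rule runs_Seq, rule runs_line, simp, rule c0, rule runs_Cond, goal_cases)
    case 1
    then have sp: "sep A y" using bval_sep_test[OF e(1) e(3) A e(2) t(3)] by simp
    show ?case
    proof (rule runs_Cond, goal_cases)
      case 1
      then have "card (pts A) < 4" using range(2)[OF A] e(3) td by simp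
      note R = insert_range_runs[OF e(1,2) t(3) e(3) A sp this e(6)]
      show ?case
      proof (rule runs_mono[OF R order_refl], goal_cases)
        case (3 u)
        then obtain L' where L': "listed u y L'" "L' \<subseteq> L \<union> pts A" "card L' \<le> list_max" "\<And>x. x \<in> L \<union> pts A - L' \<Longrightarrow> far x y"
          "\<And>i. i < narr ?e ''ls'' y \<Longrightarrow> narr u ''lp'' i = narr ?e ''lp'' i" by blast
        have fr: "frontier y xs ps L'" by (rule frontier_few[OF F t(3) sp L'(2-4)])
        have sm: "tstate u" by (rule tstate_frame[OF 3(2) e(1)]) (simp_all add: insert_range_def insert_defs)
        have "nvar u ''B'' = y" "narr u ''stk'' = narr ?e ''stk''" "nvar u ''sp'' = nvar ?e ''sp''" "narr u ''ps'' = narr ?e ''ps''"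
          "nvar u ''pt'' = nvar ?e ''pt''" "narr u ''pp'' = narr ?e ''pp''"
          using sameD[OF 3(2)] e(2) unfolding insert_range_def insert_defs by simp_all
        then have "visiting u y xs ps L'" "kept s y u" using e fr sm t(3) L' unfolding visiting_def stacked_def pended_def kept_def by simp_all
        then show ?case using wl by blast
      qed (use F in \<open>auto simp: frontier_def\<close>)
    next
      case 2
      then have "4 \<le> card (pts A)" using range(2)[OF A] e(3) td by simp
      then have "frontier y xs ps L" by (rule frontier_drop[OF F t(3) sp])
      then have "visiting ?e y xs ps L" "kept s y ?e" using e t(3) unfolding visiting_def kept_def by simp_all
      then show ?case using wl c0 by (intro runs_line) auto
    qed
  next
    case 2
    then have sp: "\<not> sep A y" using bval_sep_test[OF e(1) e(3) A e(2) t(3)] by simp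
    have bp: "bval (lex_less (RGet ''lmx'' (NVar ''B'')) (RGet ''lmx'' (NVar ''A'')) (NVar ''A'') (NVar ''B'')) ?e \<longleftrightarrow> prec A y"
      using e(2,3) td(4) by (auto simp: prec_def simp del: eff.simps)
    show ?case
    proof (rule runs_Cond, goal_cases)
      case 1
      then have p: "prec A y" using bp by blast
      let ?c = "NPut ''stk'' (NVar ''sp'') (cell ''ch'' ''A'') ;; NPut ''stk'' (NAdd (NVar ''sp'') (NLit 1)) (NAdd (cell ''ch'' ''A'') (NLit 1)) ;;
          ''sp'' ::=\<^sub>n NAdd (NVar ''sp'') (NLit 2)"
      define e' where "e' = ?e"
      have "visiting (eff ?c e') y (xs @ [ch A, ch A + 1]) ps L" "kept s y (eff ?c e')"
        using e[folded e'_def] td[folded e'_def] t(3) frontier_split(1)[OF F t(3) sp p] xs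
        by (auto simp: visiting_def kept_def tstate_def stacked_def pended_def listed_def)
      then show ?case using c0 frontier_split(2)[OF F t(3) sp p] unfolding e'_def by (intro runs_line) (simp, simp, blast)
    next
      case 2
      then have p: "\<not> prec A y" using bp by blast
      let ?c = "NPut ''pp'' (NVar ''pt'') (NVar ''A'') ;; inc ''pt''"
      define e' where "e' = ?e"
      have "visiting (eff ?c e') y xs (ps @ [A]) L" "kept s y (eff ?c e')"
        using e[folded e'_def] td[folded e'_def] t(3) frontier_keep[OF F t(3) sp p] pnd
        by (auto simp: visiting_def kept_def tstate_def stacked_def pended_def listed_def)
      then show ?case using c0 wl unfolding e'_def by (intro runs_line) (simp, simp, blast)
    qed
  qed
qed


text \<open>If three points come before \<open>b\<close> as seen from \<open>a\<close>, then
  \<open>b\<close> is not among the three nearest neighbours and the pair may be omitted.\<close>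

definition crowd :: "nat \<Rightarrow> nat \<Rightarrow> bool" where
  "crowd a b \<longleftrightarrow> 3 \<le> card {c. c < n \<and> c \<noteq> a \<and> closer Z a c b}"

definition offered :: "state \<Rightarrow> (nat \<times> nat) set \<Rightarrow> bool" where
  "offered s Q \<longleftrightarrow> (\<exists>S. best s S \<and> (\<forall>(a, b)\<in>Q. b \<in> S a \<or> crowd a b))"

lemma offered_frame:
  "offered s Q \<Longrightarrow> narr t ''N'' = narr s ''N'' \<Longrightarrow> narr t ''N2'' = narr s ''N2'' \<Longrightarrow> narr t ''N3'' = narr s ''N3'' \<Longrightarrow> offered t Q"
  unfolding offered_def best_def by simp

lemma offered_mono:
  assumes "offered s Q" "\<And>a b. (a, b) \<in> Q' \<Longrightarrow> (a, b) \<in> Q \<or> crowd a b"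
  shows "offered s Q'"
  using assms unfolding offered_def by fast

lemma crowdI: "C \<subseteq> {..<n} - {a} \<Longrightarrow> 3 \<le> card C \<Longrightarrow> (\<And>c. c \<in> C \<Longrightarrow> closer Z a c b) \<Longrightarrow> crowd a b"
proof -
  assume C: "C \<subseteq> {..<n} - {a}" "3 \<le> card C" "\<And>c. c \<in> C \<Longrightarrow> closer Z a c b"
  have "card C \<le> card {c. c < n \<and> c \<noteq> a \<and> closer Z a c b}" by (rule card_mono) (use C in auto)
  then show ?thesis using C(2) by (simp add: crowd_def)
qed

lemma far_crowd: "far a y \<Longrightarrow> b \<in> pts y \<Longrightarrow> crowd a b"
proof -
  assume h: "far a y" "b \<in> pts y"
  then obtain C where "C \<subseteq> {..<n} - {a}" "3 \<le> card C" "\<forall>c\<in>C. \<forall>j\<in>pts y. dist (Z a) (Z c) < dist (Z a) (Z j)"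
    unfolding far_def by blast
  then show "crowd a b" using h(2) by (intro crowdI[of C]) (auto simp: closer_def)
qed

lemma offer_pairs_runs:
  fixes s :: state
  assumes z: "rarr s ''Z'' = Zin" "nvar s ''n'' = n" and a: "a \<notin> {''N'', ''N2'', ''N3''}"
    and c: "\<And>s'. same (offer_pairs CARD('q) a e0 e1 f0 f1) s s' \<Longrightarrow> nval e1 s' = N \<and> nval f0 s' = M' \<and> nval f1 s' = N'"
    and M: "nval e0 s = M" "M \<le> N" "M' \<le> N'"
    and r: "\<And>i. M \<le> i \<Longrightarrow> i < N \<Longrightarrow> narr s a i < n" "\<And>i. M' \<le> i \<Longrightarrow> i < N' \<Longrightarrow> narr s ''ord'' i < n"
    and Q: "offered s Q" and f: "(N - M) * (N' - M' + 1) < f"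
  shows "runs (offer_pairs CARD('q) a e0 e1 f0 f1) s f (\<lambda>t. offered t (Q \<union> {(x, b). x \<noteq> b \<and> x \<in> narr s a ` {M..<N} \<and> b \<in> narr s ''ord'' ` {M'..<N'}}))"
    (is "runs _ _ _ (\<lambda>t. offered t (Q \<union> ?R N))")
  unfolding offer_pairs_def
proof (rule runs_For[where M = M and N = N and g = "\<lambda>_. N' - M' + 1" and I = "\<lambda>k t. offered t (Q \<union> ?R k)"], goal_cases)
  case (2 s')
  then show ?case using c unfolding offer_pairs_def by blast
next
  case (6 i t)
  have c': "nval f0 t = M'" using c[unfolded offer_pairs_def, OF 6(5)] by blast
  let ?R' = "\<lambda>j. {(x, b). x \<noteq> b \<and> x = narr s a i \<and> b \<in> narr s ''ord'' ` {M'..<j}}"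
  have S: "?R (Suc i) = ?R i \<union> ?R' N'" using 6(1) by (auto simp: atLeastLessThanSuc)
  show ?case
  proof (rule runs_For[where M = M' and N = N' and g = "\<lambda>_. 1" and I = "\<lambda>j t. offered t (Q \<union> ?R i \<union> ?R' j)"], goal_cases)
    case (2 s')
    then have "same (offer_pairs CARD('q) a e0 e1 f0 f1) s s'" using 6(5) unfolding same_def offer_pairs_def by simp
    then show ?case using c by blast
  next
    case (6 j u)
    let ?c = "''ia'' ::=\<^sub>n cell a ''e'' ;; ''ib'' ::=\<^sub>n cell ''ord'' ''g''"
    have smA: "rarr u ''Z'' = Zin" "nvar u ''n'' = n" "narr u a = narr s a" "narr u ''ord'' = narr s ''ord''" "nvar u ''e'' = i"
      using 6(5) \<open>same _ s t\<close> z \<open>nvar t ''e'' = i\<close> a unfolding same_def by (simp_all add: offer_def slot_def)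
    have e: "rarr (eff ?c u) ''Z'' = Zin" "nvar (eff ?c u) ''n'' = n" "nvar (eff ?c u) ''ia'' = narr s a i" "nvar (eff ?c u) ''ib'' = narr s ''ord'' j"
      using smA 6(4) by auto
    have lt: "narr s a i < n" "narr s ''ord'' j < n" using r 6(1,2) \<open>M \<le> i\<close> \<open>i < N\<close> by auto
    have oe: "offered (eff ?c u) (Q \<union> ?R i \<union> ?R' j)" by (rule offered_frame[OF 6(3)]) simp_all
    have S: "?R' (Suc j) = (if narr s a i = narr s ''ord'' j then {} else {(narr s a i, narr s ''ord'' j)}) \<union> ?R' j"
      using 6(1) by (auto simp: atLeastLessThanSuc)
    show ?case
    proof (rule runs_Seq, rule runs_line, simp, simp, rule runs_Cond, goal_cases)
      case 1
      then have ne: "narr s a i \<noteq> narr s ''ord'' j" using e by simp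
      from oe obtain S' where S': "best (eff ?c u) S'" "\<forall>(a, b)\<in>Q \<union> ?R i \<union> ?R' j. b \<in> S' a \<or> crowd a b" unfolding offered_def by blast
      show ?case
      proof (rule runs_mono[OF offer_runs[OF e(1-3) lt(1) e(4) lt(2) ne S'(1)] order_refl], goal_cases)
        case (2 w)
        let ?S = "S'(narr s a i := insert (narr s ''ord'' j) (S' (narr s a i)))"
        have "best (w\<lparr>nvar := (nvar w)(''g'' := Suc j)\<rparr>) ?S" using 2(1) unfolding best_def by simp
        moreover have "case p of (x, b) \<Rightarrow> b \<in> ?S x \<or> crowd x b" if "p \<in> Q \<union> ?R i \<union> ?R' (Suc j)" for p
        proof -
          have "p \<in> Q \<union> ?R i \<union> ?R' j \<or> p = (narr s a i, narr s ''ord'' j)" using that unfolding S by (auto split: if_splits)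
          then show ?thesis
          proof
            assume "p \<in> Q \<union> ?R i \<union> ?R' j"
            from bspec[OF S'(2) this] show ?thesis by (cases p) auto
          qed simp
        qed
        ultimately show ?case unfolding offered_def by blast
      qed simp
    next
      case 2
      then have "?R' (Suc j) = ?R' j" using e unfolding S by simp
      then have "offered (u\<lparr>nvar := (nvar u)(''g'' := k)\<rparr>) (Q \<union> ?R i \<union> ?R' (Suc j))" for k using 6(3) by (simp add: offered_def best_def)
      then show ?case by (intro runs_line) (simp_all add: offered_def best_def)
    qed
  next
    case (7 u)
    then show ?case by (auto simp: S Un_assoc offered_def best_def)
  next
    case 5
    then show ?case using \<open>offered t _\<close> by (auto simp: offered_def best_def)
  qed (use M c' in \<open>auto simp: offer_def slot_def\<close>)
qed (use M a Q f in \<open>auto simp: offer_def slot_def offered_def best_def\<close>)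


text \<open>What the children of \<open>y\<close> rely on: the stored segments satisfy the invariant
  with nothing left to compare.\<close>

definition finished :: "state \<Rightarrow> nat \<Rightarrow> bool" where
  "finished s y \<longleftrightarrow> narr s ''ls'' y \<le> narr s ''le'' y \<and> narr s ''le'' y \<le> nvar s ''lt'' \<and> narr s ''ps'' y \<le> narr s ''pe'' y \<and> narr s ''pe'' y \<le> nvar s ''pt'' \<and>
     distinct (map (narr s ''lp'') [narr s ''ls'' y..<narr s ''le'' y]) \<and>
     frontier y [] (map (narr s ''pp'') [narr s ''ps'' y..<narr s ''pe'' y]) (set (map (narr s ''lp'') [narr s ''ls'' y..<narr s ''le'' y]))"

lemma listed_iff: "listed s y L \<longleftrightarrow> narr s ''ls'' y \<le> nvar s ''lt'' \<and> distinct (map (narr s ''lp'') [narr s ''ls'' y..<nvar s ''lt'']) \<and>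
    set (map (narr s ''lp'') [narr s ''ls'' y..<nvar s ''lt'']) = L"
  by (auto simp: listed_def distinct_map)

definition extends :: "state \<Rightarrow> state \<Rightarrow> nat \<Rightarrow> bool" where
  "extends s t y \<longleftrightarrow> nvar s ''lt'' \<le> nvar t ''lt'' \<and> nvar s ''pt'' \<le> nvar t ''pt'' \<and> (\<forall>i<nvar s ''lt''. narr t ''lp'' i = narr s ''lp'' i) \<and>
     (\<forall>i<nvar s ''pt''. narr t ''pp'' i = narr s ''pp'' i) \<and> (\<forall>a\<in>{''ls'', ''le'', ''ps'', ''pe''}. \<forall>x. x \<noteq> y \<longrightarrow> narr t a x = narr s a x)"

lemma finished_extends:
  assumes "finished s x" "extends s t y" "x \<noteq> y"
  shows "finished t x"
proof -
  have e: "narr t ''ls'' x = narr s ''ls'' x" "narr t ''le'' x = narr s ''le'' x" "narr t ''ps'' x = narr s ''ps'' x" "narr t ''pe'' x = narr s ''pe'' x"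
    using assms(2,3) by (auto simp: extends_def)
  have mm: "map (narr t ''lp'') [narr s ''ls'' x..<narr s ''le'' x] = map (narr s ''lp'') [narr s ''ls'' x..<narr s ''le'' x]"
    "map (narr t ''pp'') [narr s ''ps'' x..<narr s ''pe'' x] = map (narr s ''pp'') [narr s ''ps'' x..<narr s ''pe'' x]"
    using assms(1,2) by (auto simp: finished_def extends_def)
  show ?thesis unfolding finished_def e mm using assms(1,2)[unfolded finished_def extends_def] by auto
qed

lemma start_lists_runs:
  fixes s :: state
  assumes t: "tstate s" and y: "nvar s ''B'' = y" "y < m" and p: "0 < y \<Longrightarrow> finished s (par y)"
    and f: "list_max + pend_max + 3 < f"
  shows "runs start_lists s f (\<lambda>t. \<exists>xs L. visiting t y xs [] L \<and> length xs \<le> pend_max + 1 \<and> sorted_wrt (\<lambda>x x'. pts x \<inter> pts x' = {}) xs \<and>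
     extends s t y \<and> narr t ''ls'' y = nvar s ''lt'' \<and> narr t ''ps'' y = nvar s ''pt'')"
  unfolding start_lists_def
proof (rule runs_Seq, rule runs_line, simp, use f in simp)
  let ?c = "NPut ''ls'' (NVar ''B'') (NVar ''lt'') ;; NPut ''ps'' (NVar ''B'') (NVar ''pt'') ;; ''sp'' ::=\<^sub>n NLit 0"
  define e where "e = eff ?c s"
  have e: "tstate e" "nvar e ''B'' = y" "nvar e ''sp'' = 0" "nvar e ''lt'' = nvar s ''lt''" "nvar e ''pt'' = nvar s ''pt''"
    "narr e ''ls'' = (narr s ''ls'')(y := nvar s ''lt'')" "narr e ''ps'' = (narr s ''ps'')(y := nvar s ''pt'')"
    "narr e ''le'' = narr s ''le''" "narr e ''pe'' = narr s ''pe''" "narr e ''lp'' = narr s ''lp''" "narr e ''pp'' = narr s ''pp''" "narr e ''par'' = par"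
    using t y tstateD[OF t] by (simp_all add: e_def tstate_def)
  show "runs (Cond (NLess (NLit 0) (NVar ''B''))
       (copy ''lp'' ''lp'' ''lt'' (NGet ''ls'' (cell ''par'' ''B'')) (NGet ''le'' (cell ''par'' ''B'')) ;;
        copy ''pp'' ''stk'' ''sp'' (NGet ''ps'' (cell ''par'' ''B'')) (NGet ''pe'' (cell ''par'' ''B'')))
       (NPut ''stk'' (NVar ''sp'') (NLit 0) ;; inc ''sp'')) (eff ?c s) f (\<lambda>t. \<exists>xs L. visiting t y xs [] L \<and> length xs \<le> pend_max + 1 \<and> sorted_wrt (\<lambda>x x'. pts x \<inter> pts x' = {}) xs \<and>
     extends s t y \<and> narr t ''ls'' y = nvar s ''lt'' \<and> narr t ''ps'' y = nvar s ''pt'')"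
    unfolding e_def[symmetric]
  proof (rule runs_Cond, goal_cases)
    case 2
    then have y0: "y = 0" using e by simp
    let ?d = "NPut ''stk'' (NVar ''sp'') (NLit 0) ;; inc ''sp''"
    have "visiting (eff ?d e) y [0] [] {}" using e y y0 frontier_root
      by (auto simp: visiting_def tstate_def stacked_def pended_def listed_def)
    moreover have "extends s (eff ?d e) y" "narr (eff ?d e) ''ls'' y = nvar s ''lt''" "narr (eff ?d e) ''ps'' y = nvar s ''pt''"
      using e by (auto simp: extends_def)
    ultimately show ?case using f by (intro runs_line) (auto simp del: eff.simps)
  next
    case 1
    then have y0: "0 < y" using e by simp
    let ?p = "par y"
    have py: "?p < y" "?p \<noteq> y" "?p < m" using par_less[OF y0 y(2)] y by auto
    have F: "finished s ?p" by (rule p[OF y0])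
    let ?M = "narr s ''ls'' ?p" and ?N = "narr s ''le'' ?p" and ?M' = "narr s ''ps'' ?p" and ?N' = "narr s ''pe'' ?p"
    let ?ps = "map (narr s ''pp'') [?M'..<?N']" and ?l = "map (narr s ''lp'') [?M..<?N]"
    have FF: "?M \<le> ?N" "?N \<le> nvar s ''lt''" "?M' \<le> ?N'" "?N' \<le> nvar s ''pt''" "distinct ?l" "frontier ?p [] ?ps (set ?l)"
      using F by (auto simp: finished_def)
    have c1: "?N - ?M \<le> list_max" using FF(5,6) distinct_card[OF FF(5)] by (simp add: frontier_def)
    \<comment> \<open>A parent is not a leaf, so its list of pending nodes is bounded by
      \<open>length_pend\<close>.\<close>
    have "0 < lmx ?p" using parent[OF y0 y(2)] by auto
    then have c2: "?N' - ?M' \<le> pend_max + 1" using length_pend[OF FF(6)] by simp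
    have fr: "frontier y ?ps [] (set ?l)" by (rule frontier_start[OF FF(6) y0 y(2)])
    show ?case
    proof (rule runs_Seq, rule runs_mono[OF copy_runs[where N = ?N and M = ?M and f = f] order_refl], goal_cases)
      case (7 t1)
      have e1: "tstate t1" by (rule tstate_frame[OF 7(2) e(1)]) (simp_all add: copy_def)
      have v1: "nvar t1 ''B'' = y" "nvar t1 ''sp'' = 0" "nvar t1 ''pt'' = nvar s ''pt''" "nvar t1 ''lt'' = nvar s ''lt'' + (?N - ?M)"
        "narr t1 ''ls'' = (narr s ''ls'')(y := nvar s ''lt'')" "narr t1 ''ps'' = (narr s ''ps'')(y := nvar s ''pt'')"
        "narr t1 ''le'' = narr s ''le''" "narr t1 ''pe'' = narr s ''pe''" "narr t1 ''pp'' = narr s ''pp''" "narr t1 ''par'' = par"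
        "narr t1 ''lp'' = (\<lambda>i. if nvar s ''lt'' \<le> i \<and> i < nvar s ''lt'' + (?N - ?M) then narr s ''lp'' (?M + (i - nvar s ''lt'')) else narr s ''lp'' i)"
        using 7(1) sameD[OF 7(2)] e by (simp_all add: copy_def cong: if_cong)
      show ?case
      proof (rule runs_mono[OF copy_runs[where N = ?N' and M = ?M' and f = f] order_refl], goal_cases)
        case (7 t2)
        have e2: "tstate t2" by (rule tstate_frame[OF 7(2) e1]) (simp_all add: copy_def)
        have v2: "nvar t2 ''B'' = y" "nvar t2 ''sp'' = ?N' - ?M'" "nvar t2 ''pt'' = nvar s ''pt''" "nvar t2 ''lt'' = nvar s ''lt'' + (?N - ?M)"
          "narr t2 ''ls'' = (narr s ''ls'')(y := nvar s ''lt'')" "narr t2 ''ps'' = (narr s ''ps'')(y := nvar s ''pt'')"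
          "narr t2 ''le'' = narr s ''le''" "narr t2 ''pe'' = narr s ''pe''" "narr t2 ''pp'' = narr s ''pp''"
          "narr t2 ''stk'' = (\<lambda>i. if i < ?N' - ?M' then narr s ''pp'' (?M' + i) else narr t1 ''stk'' i)"
          "narr t2 ''lp'' = narr t1 ''lp''"
          using 7(1) sameD[OF 7(2)] v1 by (simp_all add: copy_def cong: if_cong)
        have "map (narr t2 ''stk'') [0..<?N' - ?M'] = ?ps" by (rule nth_equalityI) (simp_all add: v2)
        then have 1: "stacked t2 ?ps" by (simp add: stacked_def v2)
        have "map (narr t2 ''lp'') [nvar s ''lt''..<nvar s ''lt'' + (?N - ?M)] = ?l" unfolding v2 v1 by (rule map_copied[OF FF(1)])
        then have 2: "listed t2 y (set ?l)" using FF(5) unfolding listed_iff v2 by simp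
        have 3: "pended t2 y []" by (simp add: pended_def v2)
        have "visiting t2 y ?ps [] (set ?l)" using e2 v2(1) y(2) fr 1 2 3 by (simp add: visiting_def)
        moreover have "extends s t2 y" using v2 v1 FF by (auto simp: extends_def)
        moreover have "length ?ps \<le> pend_max + 1" using c2 by simp
        moreover have "sorted_wrt (\<lambda>x x'. pts x \<inter> pts x' = {}) ?ps" using fr by (simp add: frontier_def)
        moreover have "narr t2 ''ls'' y = nvar s ''lt''" "narr t2 ''ps'' y = nvar s ''pt''" using v2 by simp_all
        ultimately show ?case by blast
      qed (use v1 py FF f c2 in \<open>auto simp: same_def copy_def\<close>)
    qed (use e py FF f c1 in \<open>auto simp: same_def copy_def\<close>)
  qed
qed


lemma pair_loop_runs:
  fixes s :: state
  assumes v: "visiting s y xs ps L" and f: "step_cost * wt y xs < f"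
  shows "runs (While (NLess (NLit 0) (NVar ''sp'')) (pair_step CARD('q))) s f (\<lambda>t. \<exists>ps L. visiting t y [] ps L \<and> kept s y t)"
\<comment> \<open>The measure must be a function of the state, so the ghost list \<open>xs\<close>
  is read back from the stack.\<close>
proof (rule runs_While[where I = "\<lambda>t. \<exists>xs ps L. visiting t y xs ps L \<and> kept s y t" and
    \<mu> = "\<lambda>t. step_cost * wt y (map (narr t ''stk'') [0..<nvar t ''sp''])"], goal_cases)
  case 1
  then show ?case using v by (auto simp: kept_def)
next
  case (2 t)
  then obtain xs ps L where h: "visiting t y xs ps L" "kept s y t" by blast
  have xs: "map (narr t ''stk'') [0..<nvar t ''sp''] = xs" if "visiting t y xs ps L" for t xs ps L
    using that by (simp add: visiting_def stacked_def)
  have "xs \<noteq> []" using xs[OF h(1)] 2(3) by auto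
  then obtain zs A where zs: "xs = zs @ [A]" by (metis rev_exhaust)
  have sm: "narr t ''ls'' = narr s ''ls''" "narr t ''ps'' = narr s ''ps''"
    using sameD(3)[OF 2(2)] by (simp_all add: pair_step_def insert_range_def insert_defs)
  show ?case
  proof (rule exI[of _ step_cost], rule runs_mono[OF pair_step_runs[OF h(1)[unfolded zs]] order_refl], goal_cases)
    case (1 u)
    then obtain xs' ps' L' where u: "visiting u y xs' ps' L'" "wt y xs' < wt y xs" "kept t y u" using zs by blast
    have "step_cost * Suc (wt y xs') \<le> step_cost * wt y xs" using u(2) by (intro mult_le_mono2) simp
    moreover have "kept s y u" using u(3) h(2) sm by (simp add: kept_def)
    ultimately show ?case using u(1) xs[OF u(1)] xs[OF h(1)] by auto
  qed
next
  case (3 t)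
  then obtain xs ps L where h: "visiting t y xs ps L" "kept s y t" by blast
  moreover have "xs = []" using h(1) 3(3) by (simp add: visiting_def stacked_def)
  ultimately show ?case by blast
next
  case 4
  then show ?case using v f by (simp add: visiting_def stacked_def)
qed

text \<open>The pairs that must be settled before node \<open>y\<close> is visited, grouped by the
  leaf that contains the prospective neighbour \<open>b\<close>.\<close>

definition targets :: "nat \<Rightarrow> (nat \<times> nat) set" where
  "targets y = {(a, b). a < n \<and> a \<noteq> b \<and> (\<exists>x<y. lmx x = 0 \<and> b \<in> pts x)}"

lemma leaf_work_runs:
  fixes s :: state
  assumes v: "visiting s y [] ps L" and y: "lmx y = 0" and Q: "offered s (targets y)" and f: "(list_max + 5) * (card (pts y) + 1) < f"
  shows "runs (leaf_work CARD('q)) s f (\<lambda>t. offered t (targets (Suc y)))"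
proof -
  have t: "tstate s" "nvar s ''B'' = y" "y < m" and lst: "listed s y L" and F: "frontier y [] ps L"
    using v by (auto simp: visiting_def)
  note td = tstateD[OF t(1)]
  let ?k = "card (pts y)" and ?ls = "narr s ''ls'' y" and ?lt = "nvar s ''lt''"
  note r = range[OF t(3)]
  have L: "narr s ''lp'' ` {?ls..<?lt} = L" "inj_on (narr s ''lp'') {?ls..<?lt}" "?ls \<le> ?lt" using lst by (auto simp: listed_def)
  then have cL: "?lt - ?ls \<le> list_max" using F card_image[OF L(2)] by (simp add: frontier_def)
  have Ln: "a < n \<and> a \<notin> pts y" if "a \<in> L" for a
  proof -
    have "remote a y" using F that by (simp add: frontier_def)
    then show ?thesis using rad0[OF t(3)] unfolding remote_def by force
  qed
  have bn: "b < n" if "b \<in> pts y" for b using pts_root[OF t(3)] that by auto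
  have on: "ord i < n" if "lo y \<le> i" "i < hi y" for i
    using bn[of "ord i"] that unfolding r(1)[symmetric] by simp
  let ?h = "min (lo y + 4) (hi y)"
  have f1: "(?lt - ?ls) * (?k + 1) < f" "?k * (?h - lo y + 1) < f" "0 < f"
  proof -
    have "(?lt - ?ls) * (?k + 1) \<le> (list_max + 5) * (?k + 1)" using cL by (intro mult_le_mono1) simp
    moreover have "?k * (?h - lo y + 1) \<le> ?k * 5" by (intro mult_le_mono2) simp
    ultimately show "(?lt - ?ls) * (?k + 1) < f" "?k * (?h - lo y + 1) < f" "0 < f" using f by (simp_all add: algebra_simps)
  qed
  let ?P = "targets y \<union> {(x, b). x \<noteq> b \<and> x \<in> narr s ''lp'' ` {?ls..<?lt} \<and> b \<in> narr s ''ord'' ` {lo y..<hi y}}"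
  let ?P' = "?P \<union> {(x, b). x \<noteq> b \<and> x \<in> ord ` {lo y..<hi y} \<and> b \<in> ord ` {lo y..<?h}}"
  have fin: "offered u (targets (Suc y))" if "offered u ?P'" for u
  proof (rule offered_mono[OF that])
    fix a b assume ab: "(a, b) \<in> targets (Suc y)"
    show "(a, b) \<in> ?P' \<or> crowd a b"
    proof (cases "(a, b) \<in> targets y")
      case False
      then have h: "a < n" "a \<noteq> b" "b \<in> pts y" using ab by (auto simp: targets_def less_Suc_eq)
      have "a \<in> L \<or> far a y \<or> (\<exists>x\<in>set ps. a \<in> pts x)" using F h(1) by (simp add: frontier_def)
      \<comment> \<open>At a leaf the only possible pending node is the leaf itself. So
        \<open>a\<close> is a listed candidate, certified to be irrelevant, or a point of the same
        leaf.\<close>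
      then consider "a \<in> L" | "far a y" | "a \<in> pts y" using frontier_leaf[OF F t(3) y] by blast
      then show ?thesis
      proof cases
        case 1
        then show ?thesis using h L(1) r(1) td(8) by simp
      next
        case 2
        then show ?thesis using far_crowd h(3) by blast
      next
        case 3
        from h(3)[folded r(1)] obtain j where j: "lo y \<le> j" "j < hi y" "b = ord j" by auto
        show ?thesis
        proof (cases "j < ?h")
          case True
          then have "b \<in> ord ` {lo y..<?h}" using j by auto
          then show ?thesis using 3 h r(1) by auto
        next
          case False
          then have j4: "lo y + 4 \<le> j" using j by auto
          \<comment> \<open>The first four points of the leaf are at distance 0 from
            \<open>a\<close>, like \<open>b\<close>, and win by their index. At least three of them
            differ from \<open>a\<close>, so \<open>b\<close> is crowded out.\<close>
          have so: "ord i < b" if "i \<in> {lo y..<lo y + 4}" for i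
            using leaf_sorted[OF t(3) y, of i j] that j j4 by auto
          have inj: "inj_on ord {lo y..<lo y + 4}"
          proof (rule linorder_inj_onI')
            fix i i' assume "i \<in> {lo y..<lo y + 4}" "i' \<in> {lo y..<lo y + 4}" "i < i'"
            then show "ord i \<noteq> ord i'" using leaf_sorted[OF t(3) y, of i i'] j4 j by auto
          qed
          have z: "dist (Z a) (Z i) = 0" if "i \<in> pts y" for i
            using dist_pts[OF t(3) 3 that] y by (simp add: rad_def)
          have sub: "ord ` {lo y..<lo y + 4} \<subseteq> pts y" using r(1) j j4 by auto
          show ?thesis
          proof (intro disjI2 crowdI[where C = "ord ` {lo y..<lo y + 4} - {a}"])
            show "ord ` {lo y..<lo y + 4} - {a} \<subseteq> {..<n} - {a}" using sub bn by auto
            have "card (ord ` {lo y..<lo y + 4}) = 4" using card_image[OF inj] by simp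
            then show "3 \<le> card (ord ` {lo y..<lo y + 4} - {a})" by (simp add: card_Diff_singleton_if)
            fix c assume c: "c \<in> ord ` {lo y..<lo y + 4} - {a}"
            then have "c \<in> pts y" "c < b" using sub so by auto
            then show "closer Z a c b" using z h(3) by (simp add: closer_def)
          qed
        qed
      qed
    qed simp
  qed
  show ?thesis unfolding leaf_work_def
  proof (rule runs_Seq, rule runs_mono[OF offer_pairs_runs[where N = ?lt and M = ?ls and M' = "lo y" and N' = "hi y" and Q = "targets y" and f = f] order_refl], goal_cases)
    case (12 s1)
    have t1: "tstate s1" by (rule tstate_frame[OF 12(2) t(1)]) (simp_all add: offer_pairs_def offer_def slot_def)
    note td1 = tstateD[OF t1]
    have B1: "nvar s1 ''B'' = y" using sameD[OF 12(2)] t(2) by (simp add: offer_pairs_def offer_def slot_def)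
    show ?case
    proof (rule runs_Seq, rule runs_line, simp, rule f1(3))
      let ?c = "Cond (NLess (NAdd (cell ''lo'' ''B'') (NLit 4)) (cell ''hi'' ''B''))
       (''h4'' ::=\<^sub>n NAdd (cell ''lo'' ''B'') (NLit 4)) (''h4'' ::=\<^sub>n cell ''hi'' ''B'')"
      define e where "e = eff ?c s1"
      have e: "tstate e" "nvar e ''B'' = y" "nvar e ''h4'' = ?h" "offered e ?P"
        using t1 B1 td1 12(1) by (auto simp: e_def tstate_def offered_def best_def)
      note tde = tstateD[OF e(1)]
      show "runs (offer_pairs CARD('q) ''ord'' (cell ''lo'' ''B'') (cell ''hi'' ''B'') (cell ''lo'' ''B'') (NVar ''h4'')) (eff ?c s1) f (\<lambda>t. offered t (targets (Suc y)))"
        unfolding e_def[symmetric]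
      proof (rule runs_mono[OF offer_pairs_runs[where N = "hi y" and M = "lo y" and M' = "lo y" and N' = ?h and Q = ?P and f = f] order_refl], goal_cases)
        case (12 u)
        then show ?case using fin tde(8) by simp
      next
        case (9 i)
        then show ?case using on[of i] tde(8) by auto
      next
        case (8 i)
        then show ?case using on[of i] tde(8) by auto
      next
        case 11
        then show ?case using f1(2) r(2) by simp
      qed (use e tde r in \<open>auto simp: same_def offer_pairs_def offer_def slot_def\<close>)
    qed
  next
    case (9 i)
    then show ?case using on[of i] td(8) by auto
  next
    case (8 i)
    then show ?case using L(1) Ln by auto
  next
    case 11
    then show ?case using f1(1) r(2) by simp
  qed (use t td L r Q in \<open>auto simp: same_def offer_pairs_def offer_def slot_def\<close>)
qed


section \<open>Total cost of the traversal\<close>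

definition visit_cost :: "nat \<Rightarrow> nat" where
  "visit_cost y = step_cost * (2 * card (split_by y) + pend_max + 2) + list_max + pend_max + 4 +
     (if lmx y = 0 then (list_max + 5) * (card (pts y) + 1) else 0)"

lemma visit_runs:
  fixes s :: state
  assumes t: "tstate s" and y: "nvar s ''B'' = y" "y < m" and p: "\<And>x. x < y \<Longrightarrow> finished s x" and Q: "offered s (targets y)"
  shows "runs (visit CARD('q)) s (visit_cost y) (\<lambda>t. tstate t \<and> (\<forall>x<Suc y. finished t x) \<and> offered t (targets (Suc y)))"
proof -
  have f1: "list_max + pend_max + 3 < visit_cost y" by (simp add: visit_cost_def)
  have pp: "finished s (par y)" if "0 < y" using p[OF par_less[OF that y(2)]] .
  have tv: "tstate t'" if "same (visit CARD('q)) s t'" for t'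
    by (rule tstate_frame[OF that t]) (simp_all add: visit_def start_lists_def copy_def pair_step_def insert_range_def insert_defs leaf_work_def offer_pairs_def offer_def slot_def)
  have "runs (visit CARD('q)) s (visit_cost y) (\<lambda>t. (\<forall>x<Suc y. finished t x) \<and> offered t (targets (Suc y)))" unfolding visit_def
  proof (rule runs_Seq, rule runs_mono[OF start_lists_runs[OF t y pp f1] order_refl], assumption, elim exE conjE)
    fix s1 :: state and xs L
    assume v1: "visiting s1 y xs [] L" and len: "length xs \<le> pend_max + 1" and so: "sorted_wrt (\<lambda>x x'. pts x \<inter> pts x' = {}) xs"
      and x1: "extends s s1 y" and l1: "narr s1 ''ls'' y = nvar s ''lt''" "narr s1 ''ps'' y = nvar s ''pt''" and sm1: "same start_lists s s1"
    have Q1: "offered s1 (targets y)" by (rule offered_frame[OF Q]) (use sm1 in \<open>simp_all add: same_def start_lists_def copy_def\<close>)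
    have "wt y xs \<le> 2 * card (split_by y) + pend_max + 1" using wt_le[OF so, of y] len by linarith
    then have "step_cost * wt y xs \<le> step_cost * (2 * card (split_by y) + pend_max + 1)" by (rule mult_le_mono2)
    then have f2: "step_cost * wt y xs < visit_cost y" by (simp add: visit_cost_def)
    show "runs (While (NLess (NLit 0) (NVar ''sp'')) (pair_step CARD('q)) ;; (NPut ''le'' (NVar ''B'') (NVar ''lt'') ;; NPut ''pe'' (NVar ''B'') (NVar ''pt'')) ;;
       Cond (RLess (OfNat (NLit 0)) (RGet ''lmx'' (NVar ''B''))) Skip (leaf_work CARD('q))) s1 (visit_cost y)
       (\<lambda>t. (\<forall>x<Suc y. finished t x) \<and> offered t (targets (Suc y)))"
    proof (rule runs_Seq, rule runs_mono[OF pair_loop_runs[OF v1 f2] order_refl], elim exE conjE, rule runs_Seq, rule runs_line, simp, use f1 in simp)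
      fix s2 :: state and ps L
      assume v2: "visiting s2 y [] ps L" and k2: "kept s1 y s2" and sm2: "same (While (NLess (NLit 0) (NVar ''sp'')) (pair_step CARD('q))) s1 s2"
      have Q2: "offered s2 (targets y)"
        by (rule offered_frame[OF Q1]) (use sm2 in \<open>simp_all add: same_def pair_step_def insert_range_def insert_defs\<close>)
      have ar: "narr s2 ''ls'' = narr s1 ''ls''" "narr s2 ''le'' = narr s1 ''le''" "narr s2 ''ps'' = narr s1 ''ps''" "narr s2 ''pe'' = narr s1 ''pe''"
        using sm2 by (simp_all add: same_def pair_step_def insert_range_def insert_defs)
      let ?c = "NPut ''le'' (NVar ''B'') (NVar ''lt'') ;; NPut ''pe'' (NVar ''B'') (NVar ''pt'')"
      define e where "e = eff ?c s2"
      have B2: "nvar s2 ''B'' = y" "tstate s2" using v2 by (simp_all add: visiting_def)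
      have ea: "narr e = (narr s2)(''le'' := (narr s2 ''le'')(y := nvar s2 ''lt''), ''pe'' := (narr s2 ''pe'')(y := nvar s2 ''pt''))" "nvar e = nvar s2" "rarr e = rarr s2"
        using B2 by (simp_all add: e_def)
      have ve: "visiting e y [] ps L" using v2 ea by (auto simp: visiting_def tstate_def stacked_def pended_def listed_def)
      have Qe: "offered e (targets y)" by (rule offered_frame[OF Q2]) (simp_all add: ea)
      have lp: "narr s2 ''ls'' y \<le> nvar s2 ''lt''" "narr s2 ''ps'' y \<le> nvar s2 ''pt''" using v2 by (auto simp: visiting_def listed_def pended_def)
      have xe: "extends s e y" using x1 k2 l1 lp by (auto simp: extends_def kept_def ea ar)
      have fe: "finished e x" if "x < Suc y" for x
      proof (cases "x = y")
        case True
        have ls: "distinct (map (narr s2 ''lp'') [narr s2 ''ls'' y..<nvar s2 ''lt''])" "set (map (narr s2 ''lp'') [narr s2 ''ls'' y..<nvar s2 ''lt'']) = L"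
          using v2 unfolding visiting_def listed_iff by blast+
        have "ps = map (narr s2 ''pp'') [narr s2 ''ps'' y..<nvar s2 ''pt'']" "frontier y [] ps L" using v2 by (auto simp: visiting_def pended_def)
        then show ?thesis unfolding True finished_def ea using ls lp by simp
      next
        case False
        then show ?thesis using finished_extends[OF p xe] that by simp
      qed
      show "runs (Cond (RLess (OfNat (NLit 0)) (RGet ''lmx'' (NVar ''B''))) Skip (leaf_work CARD('q))) (eff ?c s2) (visit_cost y)
         (\<lambda>t. (\<forall>x<Suc y. finished t x) \<and> offered t (targets (Suc y)))"
        unfolding e_def[symmetric]
      proof (rule runs_Cond, goal_cases)
        case 1
        then have "lmx y \<noteq> 0" using ve tstateD(4)[of e] by (simp add: visiting_def)
        then have "targets (Suc y) = targets y" by (auto simp: targets_def less_Suc_eq)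
        then show ?case using f1 fe Qe by (intro runs_line) auto
      next
        case 2
        then have l0: "lmx y = 0" using ve tstateD(4)[of e] lmx0[OF y(2)] by (simp add: visiting_def)
        have f3: "(list_max + 5) * (card (pts y) + 1) < visit_cost y" using l0 by (simp add: visit_cost_def)
        show ?case
        proof (rule runs_mono[OF leaf_work_runs[OF ve l0 Qe f3] order_refl], intro conjI)
          fix u :: state assume "same (leaf_work CARD('q)) e u"
          then have "extends e u y" "narr u ''lp'' = narr e ''lp''" "narr u ''pp'' = narr e ''pp''" "nvar u ''lt'' = nvar e ''lt''" "nvar u ''pt'' = nvar e ''pt''"
              "\<forall>a\<in>{''ls'', ''le'', ''ps'', ''pe''}. narr u a = narr e a"
            by (simp_all add: same_def extends_def leaf_work_def offer_pairs_def offer_def slot_def)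
          then have "finished e x \<Longrightarrow> finished u x" for x unfolding finished_def by simp
          then show "\<forall>x<Suc y. finished u x" using fe by blast
        qed
      qed
    qed
  qed
  then show ?thesis by (rule runs_mono) (use tv in auto)
qed

text \<open>Distinct leaves have disjoint point sets by \<open>laminar\<close> and
  \<open>leaf_anc\<close>.\<close>

lemma card_leaves: "(\<Sum>y<m. if lmx y = 0 then card (pts y) else 0) \<le> n"
proof -
  let ?F = "{y. y < m \<and> lmx y = 0}"
  have "(\<Sum>y<m. if lmx y = 0 then card (pts y) else 0) = (\<Sum>y\<in>?F. card (pts y))"
    by (rule sum.mono_neutral_cong_right) auto
  also have "\<dots> = card (\<Union>y\<in>?F. pts y)"
    by (rule card_UN_disjoint[symmetric]) (use finite_pts laminar leaf_anc in \<open>auto, blast\<close>)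
  also have "\<dots> \<le> card {..<n}" by (rule card_mono) (use pts_root in auto)
  finally show ?thesis by simp
qed

text \<open>Splits are bounded for each split node by \<open>card_split\<close>, not for each
  visited node; exchanging the sums turns one count into the other.\<close>

lemma sum_card_split: "(\<Sum>y<m. card (split_by y)) \<le> m * pend_max"
proof -
  have sw: "(\<Sum>y<m. \<Sum>x<m. of_bool (x \<in> split_by y)) = (\<Sum>x<m. \<Sum>y<m. (of_bool (x \<in> split_by y) :: nat))" by (rule sum.swap)
  have "card (split_by y) = (\<Sum>x<m. of_bool (x \<in> split_by y))" for y
  proof -
    have "{x. x < m \<and> x \<in> split_by y} = split_by y" by (auto simp: split_by_def)
    then show ?thesis by (simp add: lessThan_def Int_def)
  qed
  moreover have "(\<Sum>y<m. of_bool (x \<in> split_by y)) = card {y. x \<in> split_by y}" for x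
  proof -
    have "{y. y < m \<and> x \<in> split_by y} = {y. x \<in> split_by y}" by (auto simp: split_by_def)
    then show ?thesis by (simp add: lessThan_def Int_def)
  qed
  ultimately have "(\<Sum>y<m. card (split_by y)) = (\<Sum>x<m. card {y. x \<in> split_by y})" using sw by simp
  also have "\<dots> \<le> (\<Sum>x<m. pend_max)" by (rule sum_mono) (use card_split in auto)
  finally show ?thesis by simp
qed

definition search_cost :: nat where
  "search_cost = 2 * (step_cost * (3 * pend_max + 2) + list_max + pend_max + 4) + 3 * (list_max + 5)"

lemma sum_visit_cost: "(\<Sum>y<m. visit_cost y) \<le> search_cost * n"
proof -
  let ?K = "step_cost * (pend_max + 2) + list_max + pend_max + 4"
  have "visit_cost y \<le> ?K + 2 * step_cost * card (split_by y) + (list_max + 5) * (1 + (if lmx y = 0 then card (pts y) else 0))" for y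
    by (simp add: visit_cost_def algebra_simps)
  then have "(\<Sum>y<m. visit_cost y) \<le> (\<Sum>y<m. ?K + 2 * step_cost * card (split_by y) + (list_max + 5) * (1 + (if lmx y = 0 then card (pts y) else 0)))"
    by (intro sum_mono)
  also have "\<dots> = m * ?K + 2 * step_cost * (\<Sum>y<m. card (split_by y)) + (list_max + 5) * (m + (\<Sum>y<m. if lmx y = 0 then card (pts y) else 0))"
    by (simp only: sum.distrib sum_distrib_left[symmetric] sum_constant card_lessThan mult_1_right of_nat_id) (simp add: algebra_simps)
  also have "\<dots> \<le> m * ?K + 2 * step_cost * (m * pend_max) + (list_max + 5) * (m + n)"
    by (intro add_mono mult_le_mono2 order_refl sum_card_split card_leaves)
  also have "\<dots> = m * (?K + 2 * step_cost * pend_max) + (list_max + 5) * (m + n)" by (simp add: algebra_simps)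
  also have "\<dots> \<le> 2 * n * (?K + 2 * step_cost * pend_max) + (list_max + 5) * (2 * n + n)"
    by (intro add_mono mult_le_mono) (use m2 in auto)
  also have "\<dots> = search_cost * n" by (simp add: search_cost_def algebra_simps)
  finally show ?thesis .
qed

lemma leaf_exists: "x < m \<Longrightarrow> b \<in> pts x \<Longrightarrow> \<exists>y<m. lmx y = 0 \<and> b \<in> pts y"
proof (induction "m - x" arbitrary: x rule: less_induct)
  case less
  show ?case
  proof (cases "0 < lmx x")
    case True
    note c = children[OF less(2) True]
    have "b \<in> pts (ch x) \<or> b \<in> pts (ch x + 1)" using pts_children[OF less(2) True] less(3) by auto
    then show ?thesis using less(1)[of "ch x"] less(1)[of "ch x + 1"] c by auto
  next
    case False
    then show ?thesis using less(2,3) lmx0[OF less(2)] by (intro exI[of _ x]) auto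
  qed
qed

lemma search_nodes_runs:
  fixes s :: state
  assumes t: "tstate s" and Q: "offered s {}" and f: "search_cost * (n + 1) < f"
  shows "runs (search_nodes CARD('q)) s f (\<lambda>t. offered t {(a, b). a < n \<and> b < n \<and> a \<noteq> b})"
  unfolding search_nodes_def
proof (rule runs_For[where M = 0 and N = m and g = visit_cost and
    I = "\<lambda>y t. tstate t \<and> (\<forall>x<y. finished t x) \<and> offered t (targets y)"], goal_cases)
  case (6 y t')
  then have h: "tstate t'" "\<And>x. x < y \<Longrightarrow> finished t' x" "offered t' (targets y)" by auto
  show ?case
  proof (rule runs_mono[OF visit_runs[OF h(1) 6(4,2) h(2,3)] order_refl], assumption, elim conjE, intro conjI)
    fix u :: state assume u: "tstate u" "\<forall>x<Suc y. finished u x" "offered u (targets (Suc y))"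
    show "tstate (u\<lparr>nvar := (nvar u)(''B'' := Suc y)\<rparr>)" using u(1) by (simp add: tstate_def)
    show "\<forall>x<Suc y. finished (u\<lparr>nvar := (nvar u)(''B'' := Suc y)\<rparr>) x" using u(2) by (simp add: finished_def)
    show "offered (u\<lparr>nvar := (nvar u)(''B'' := Suc y)\<rparr>) (targets (Suc y))" by (rule offered_frame[OF u(3)]) simp_all
  qed
next
  case (7 t')
  then have o: "offered t' (targets m)" by auto
  show ?case
  proof (rule offered_mono[OF o])
    fix a b assume "(a, b) \<in> {(a, b). a < n \<and> b < n \<and> a \<noteq> b}"
    then show "(a, b) \<in> targets m \<or> crowd a b" using leaf_exists[of 0 b] root by (auto simp: targets_def)
  qed
next
  case 8
  then show ?case using sum_visit_cost f by (simp add: lessThan_atLeast0)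
next
  case 5
  have "targets 0 = {}" by (auto simp: targets_def)
  then have "offered (s\<lparr>nvar := (nvar s)(''B'' := 0)\<rparr>) (targets 0)" using offered_frame[OF Q, of "s\<lparr>nvar := (nvar s)(''B'' := 0)\<rparr>"] by simp
  then show ?case using t by (simp add: tstate_def)
qed (use t in \<open>auto simp: same_def tstate_def visit_def start_lists_def copy_def pair_step_def insert_range_def insert_defs leaf_work_def offer_pairs_def offer_def slot_def\<close>)

end

section \<open>The estimator in time \<open>O(n log n)\<close>\<close>

context sample
begin

text \<open>The guards reflect that a \<open>k\<close>-th neighbour exists only among more than
  \<open>k\<close> points.\<close>

definition neighbours :: "state \<Rightarrow> bool" where
  "neighbours s \<longleftrightarrow> (\<forall>a<n. (2 \<le> n \<longrightarrow> narr s ''N'' a = nbr n Z 1 a \<and> nbr n Z 1 a < n) \<and> (3 \<le> n \<longrightarrow> narr s ''N2'' a = nbr n Z 2 a \<and> nbr n Z 2 a < n) \<and>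
     (4 \<le> n \<longrightarrow> narr s ''N3'' a = nbr n Z 3 a \<and> nbr n Z 3 a < n))"

end

context search
begin

text \<open>The number of closer points increases strictly along \<open>closer\<close>, so at most
  one point has a given position.\<close>

lemma nbr_eq:
  assumes b: "b < n" "b \<noteq> a" and k: "Suc (card {c. c < n \<and> c \<noteq> a \<and> closer Z a c b}) = k"
  shows "nbr n Z k a = b"
  unfolding nbr_def
proof (rule the_equality)
  show "b < n \<and> b \<noteq> a \<and> Suc (card {c. c < n \<and> c \<noteq> a \<and> closer Z a c b}) = k" using assms by simp
next
  have less: "card {c. c < n \<and> c \<noteq> a \<and> closer Z a c x} < card {c. c < n \<and> c \<noteq> a \<and> closer Z a c y}"
    if "x < n" "x \<noteq> a" "closer Z a x y" for x y
  proof (rule psubset_card_mono)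
    show "{c. c < n \<and> c \<noteq> a \<and> closer Z a c x} \<subset> {c. c < n \<and> c \<noteq> a \<and> closer Z a c y}"
      using that closer_trans closer_irrefl by blast
  qed simp
  fix j assume j: "j < n \<and> j \<noteq> a \<and> Suc (card {c. c < n \<and> c \<noteq> a \<and> closer Z a c j}) = k"
  show "j = b"
  proof (rule ccontr)
    assume "j \<noteq> b"
    then have "closer Z a j b \<or> closer Z a b j" by (rule closer_total)
    then show False using less[of j b] less[of b j] j assms by auto
  qed
qed

lemma lst_subset:
  assumes "finite V" "T \<subseteq> V" "lst a V \<in> T"
  shows "lst a T = lst a V"
proof (rule lst_eq[OF assms(3)])
  fix y assume "y \<in> T" "y \<noteq> lst a V"
  then show "closer Z a (lst a V) y" using lst_props(2)[OF assms(1)] assms(2) by blast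
qed

lemma offered_neighbours:
  assumes "offered s {(a, b). a < n \<and> b < n \<and> a \<noteq> b}"
  shows "neighbours s"
  unfolding neighbours_def
proof (intro allI impI)
  fix a assume a: "a < n"
  obtain S where S: "best s S" "\<forall>(a, b)\<in>{(a, b). a < n \<and> b < n \<and> a \<noteq> b}. b \<in> S a \<or> crowd a b"
    using assms unfolding offered_def by blast
  let ?U = "{..<n} - {a}"
  define b1 where "b1 = lst a ?U"
  define b2 where "b2 = lst a (?U - {b1})"
  define b3 where "b3 = lst a (?U - {b1} - {b2})"
  let ?C = "\<lambda>b. {c. c < n \<and> c \<noteq> a \<and> closer Z a c b}"
  \<comment> \<open>The three nearest neighbours have fewer than three points before them, so none
    of them is crowded out and all were offered.\<close>
  have inS: "b \<in> S a" if "b \<in> ?U" "card (?C b) < 3" for b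
    using bspec[OF S(2), of "(a, b)"] a that by (auto simp: crowd_def)
  have SU: "S a \<subseteq> ?U" and N: "narr s ''N'' a = lst a (S a)" "narr s ''N2'' a = lst a (S a - {narr s ''N'' a})"
     "narr s ''N3'' a = lst a (S a - {narr s ''N'' a} - {narr s ''N2'' a})" using S(1) a unfolding best_def by blast+
  have asym: "\<not> closer Z a x y" if "closer Z a y x" for x y using that closer_trans closer_irrefl by blast
  have 1: "narr s ''N'' a = b1" "nbr n Z 1 a = b1" "b1 \<in> ?U" "\<And>y. y \<in> ?U \<Longrightarrow> y \<noteq> b1 \<Longrightarrow> closer Z a b1 y" if n: "2 \<le> n"
  proof -
    have cU: "card ?U = n - 1" using a by simp
    have ne: "?U \<noteq> {}"
    proof
      assume "?U = {}"
      then have "card ?U = 0" by (simp only: card.empty)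
      then show False using cU n by simp
    qed
    show b: "b1 \<in> ?U" unfolding b1_def by (rule lst_props(1)[OF _ ne]) simp
    show cl: "closer Z a b1 y" if "y \<in> ?U" "y \<noteq> b1" for y using lst_props(2)[OF _ ne that(1), where a = a] that(2) unfolding b1_def by simp
    have "?C b1 = {}" using cl asym closer_irrefl by blast
    then have c: "card (?C b1) = 0" by simp
    have s: "b1 \<in> S a" by (rule inS[OF b]) (use c in linarith)
    show "narr s ''N'' a = b1" unfolding N(1) b1_def
      by (rule lst_subset[OF _ SU]) (use s in \<open>simp_all add: b1_def[symmetric]\<close>)
    show "nbr n Z 1 a = b1" by (rule nbr_eq) (use b c in auto)
  qed
  have 2: "narr s ''N2'' a = b2" "nbr n Z 2 a = b2" "b2 \<in> ?U - {b1}" "\<And>y. y \<in> ?U - {b1} \<Longrightarrow> y \<noteq> b2 \<Longrightarrow> closer Z a b2 y" if n: "3 \<le> n"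
  proof -
    note h1 = 1[OF order_trans[OF _ n]]
    have h: "narr s ''N'' a = b1" "b1 \<in> ?U" "\<And>y. y \<in> ?U \<Longrightarrow> y \<noteq> b1 \<Longrightarrow> closer Z a b1 y" using h1 by simp_all
    have cU: "card (?U - {b1}) = n - 2" using a h(2) by simp
    have ne: "?U - {b1} \<noteq> {}"
    proof
      assume "?U - {b1} = {}"
      then have "card (?U - {b1}) = 0" by (simp only: card.empty)
      then show False using cU n by simp
    qed
    show b: "b2 \<in> ?U - {b1}" unfolding b2_def by (rule lst_props(1)[OF _ ne]) simp
    show cl: "closer Z a b2 y" if "y \<in> ?U - {b1}" "y \<noteq> b2" for y using lst_props(2)[OF _ ne that(1), where a = a] that(2) unfolding b2_def by simp
    have "?C b2 = {b1}" using cl asym closer_irrefl b h by blast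
    then have c: "card (?C b2) = 1" by simp
    have s: "b2 \<in> S a" by (rule inS[OF DiffD1[OF b]]) (use c in linarith)
    show "narr s ''N2'' a = b2" unfolding N(2) b2_def h(1)
      by (rule lst_subset) (use SU s b in \<open>auto simp: b2_def[symmetric]\<close>)
    show "nbr n Z 2 a = b2" by (rule nbr_eq) (use b c in auto)
  qed
  have 3: "narr s ''N3'' a = b3" "nbr n Z 3 a = b3" "b3 < n" if n: "4 \<le> n"
  proof -
    note h1 = 1[OF order_trans[OF _ n]] and h2 = 2[OF order_trans[OF _ n]]
    have h: "narr s ''N'' a = b1" "b1 \<in> ?U" "\<And>y. y \<in> ?U \<Longrightarrow> y \<noteq> b1 \<Longrightarrow> closer Z a b1 y" using h1 by simp_all
    have g: "narr s ''N2'' a = b2" "b2 \<in> ?U - {b1}" "\<And>y. y \<in> ?U - {b1} \<Longrightarrow> y \<noteq> b2 \<Longrightarrow> closer Z a b2 y" using h2 by simp_all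
    have cU: "card (?U - {b1} - {b2}) = n - 3" using a h(2) g(2) by simp
    have ne: "?U - {b1} - {b2} \<noteq> {}"
    proof
      assume "?U - {b1} - {b2} = {}"
      then have "card (?U - {b1} - {b2}) = 0" by (simp only: card.empty)
      then show False using cU n by simp
    qed
    have b: "b3 \<in> ?U - {b1} - {b2}" unfolding b3_def by (rule lst_props(1)[OF _ ne]) simp
    have cl: "closer Z a b3 y" if "y \<in> ?U - {b1} - {b2}" "y \<noteq> b3" for y using lst_props(2)[OF _ ne that(1), where a = a] that(2) unfolding b3_def by simp
    have "?C b3 = {b1, b2}" using cl asym closer_irrefl b h g by blast
    then have c: "card (?C b3) = 2" using g(2) by simp
    have s: "b3 \<in> S a" by (rule inS[OF DiffD1[OF DiffD1[OF b]]]) (use c in linarith)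
    show "narr s ''N3'' a = b3" unfolding N(3) b3_def h(1) g(1)
      by (rule lst_subset) (use SU s b in \<open>auto simp: b3_def[symmetric]\<close>)
    show "nbr n Z 3 a = b3" by (rule nbr_eq) (use b c in auto)
    show "b3 < n" using b by simp
  qed
  show "(2 \<le> n \<longrightarrow> narr s ''N'' a = nbr n Z 1 a \<and> nbr n Z 1 a < n) \<and> (3 \<le> n \<longrightarrow> narr s ''N2'' a = nbr n Z 2 a \<and> nbr n Z 2 a < n) \<and> (4 \<le> n \<longrightarrow> narr s ''N3'' a = nbr n Z 3 a \<and> nbr n Z 3 a < n)"
    using 1(1-3) 2(1-3) 3 by simp
qed

end

definition init_best :: com where
  "init_best = ''lt'' ::=\<^sub>n NLit 0 ;; ''pt'' ::=\<^sub>n NLit 0 ;;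
     for_each (NPut ''N'' (NVar ''i'') (NVar ''n'') ;; NPut ''N2'' (NVar ''i'') (NVar ''n'') ;; NPut ''N3'' (NVar ''i'') (NVar ''n''))"

definition neighbour_search :: "nat \<Rightarrow> com" where
  "neighbour_search q = build_tree q ;; init_best ;; search_nodes q"

lemma init_best_runs:
  fixes s :: state
  assumes n: "nvar s ''n'' = n" and f: "n < f"
  shows "runs init_best s f (\<lambda>t. \<forall>i<n. narr t ''N'' i = n \<and> narr t ''N2'' i = n \<and> narr t ''N3'' i = n)"
  unfolding init_best_def for_each_For
  by (rule runs_Seq, rule runs_line, simp, use f in simp, rule runs_Seq, rule runs_line, simp, use f in simp,
      rule runs_For[where M = 0 and N = n and g = "\<lambda>_. 1" and I = "\<lambda>k t. \<forall>i<k. narr t ''N'' i = n \<and> narr t ''N2'' i = n \<and> narr t ''N3'' i = n"])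
    (use n f in \<open>auto simp: same_def less_Suc_eq intro!: runs_line\<close>)

context sample
begin

lemma search_from_built:
  assumes B: "built pts s"
  shows "search crd n Z (nvar s ''m'') pts (narr s ''ch'') (narr s ''par'') (narr s ''rep'') (rarr s ''lmx'') (narr s ''ord'') (narr s ''lo'') (narr s ''hi'')"
proof -
  interpret tr: split_tree Z n "nvar s ''m''" pts "narr s ''ch''" "narr s ''par''" "narr s ''rep''" "rarr s ''lmx''"
    by (rule built_split_tree[OF B])
  have "tree_inv pts (narr s ''lab'') s" using B by (simp add: built_def tree_full_def)
  then have "nvar s ''m'' \<le> 2 * n" by (rule nodes_le)
  then show ?thesis using built_range[OF B] built_leaf_sorted[OF B] by unfold_locales auto
qed

text \<open>Depends on the dimension only, not on \<open>n\<close> or on the sample; one time bound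
  can therefore serve all inputs.\<close>

definition nn_cost :: nat where
  "nn_cost = build_cost + search.search_cost TYPE('q) + 2"

lemma neighbour_search_runs:
  fixes s :: state
  assumes c: "nvar s ''n'' = n" "rarr s ''Z'' = Zin" "narr s = (\<lambda>_ _. 0)" and f: "nn_cost * ((n + 1) * (blen n + 1)) \<le> f"
  shows "runs (neighbour_search CARD('q)) s f neighbours"
proof -
  let ?g = "(n + 1) * (blen n + 1)"
  have "n + 1 \<le> ?g" by simp
  then have sc: "search.search_cost TYPE('q) * (n + 1) \<le> search.search_cost TYPE('q) * ?g" by (rule mult_le_mono2)
  have "nn_cost * ?g = build_cost * ?g + search.search_cost TYPE('q) * ?g + 2 * ?g" by (simp only: nn_cost_def distrib_right)
  then have fb: "build_cost * ?g \<le> f" "n < f" "search.search_cost TYPE('q) * (n + 1) < f" using f sc \<open>n + 1 \<le> ?g\<close> by linarith+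
  show ?thesis unfolding neighbour_search_def
  proof (rule runs_Seq, rule runs_mono[OF build_tree_runs[OF c fb(1)] order_refl], elim exE)
    fix s1 :: state and pts assume B: "built pts s1"
    interpret sr: search crd n Z "nvar s1 ''m''" pts "narr s1 ''ch''" "narr s1 ''par''" "narr s1 ''rep''" "rarr s1 ''lmx''" "narr s1 ''ord''" "narr s1 ''lo''" "narr s1 ''hi''"
      by (rule search_from_built[OF B])
    have cx: "nvar s1 ''n'' = n" "rarr s1 ''Z'' = Zin" using B by (simp_all add: built_def tree_full_def ctx_def)
    show "runs (init_best ;; search_nodes CARD('q)) s1 f neighbours"
    proof (rule runs_Seq, rule runs_mono[OF init_best_runs[OF cx(1) fb(2)] order_refl])
      fix s2 :: state assume I: "\<forall>i<n. narr s2 ''N'' i = n \<and> narr s2 ''N2'' i = n \<and> narr s2 ''N3'' i = n" and sm: "same init_best s1 s2"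
      have "sr.tstate s1" using cx by (simp add: sr.tstate_def)
      then have t2: "sr.tstate s2" by (rule sr.tstate_frame[OF sm]) (simp_all add: init_best_def for_each_For)
      have "best s2 (\<lambda>_. {})" using I by (simp add: best_def lst_def)
      then have o2: "sr.offered s2 {}" by (auto simp: sr.offered_def)
      show "runs (search_nodes CARD('q)) s2 f neighbours"
        by (rule runs_mono[OF sr.search_nodes_runs[OF t2 o2 fb(3)] order_refl]) (rule sr.offered_neighbours)
    qed
  qed
qed

lemma neighbour_search_frame:
  assumes "same (neighbour_search CARD('q)) s t"
  shows "nvar t ''n'' = nvar s ''n''" "rvar t ''q'' = rvar s ''q''" "rvar t ''o'' = rvar s ''o''" "rarr t ''Y'' = rarr s ''Y''"
proof -
  have "''q'' \<notin> wr (neighbour_search CARD('q))" "''o'' \<notin> wr (neighbour_search CARD('q))" "''n'' \<notin> wn (neighbour_search CARD('q))" "''Y'' \<notin> wra (neighbour_search CARD('q))"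
    by (simp_all add: neighbour_search_def build_tree_def init_rows_def expand_defs for_each_For merge_sort_def merge_pass_def merge_step_def
      init_best_def search_nodes_def visit_def start_lists_def copy_def pair_step_def insert_range_def insert_defs leaf_work_def offer_pairs_def offer_def slot_def)
  then show "nvar t ''n'' = nvar s ''n''" "rvar t ''q'' = rvar s ''q''" "rvar t ''o'' = rvar s ''o''" "rarr t ''Y'' = rarr s ''Y''" using sameD[OF assms] by simp_all
qed

end

section \<open>Ranks, sorting and counting by bisection\<close>

definition bisect :: "bexp \<Rightarrow> name \<Rightarrow> com" where
  "bisect b a =
     ''lo'' ::=\<^sub>n NLit 0 ;;
     ''hi'' ::=\<^sub>n NVar ''n'' ;;
     While (NLess (NVar ''lo'') (NVar ''hi''))
       (''mid'' ::=\<^sub>n NHalf (NAdd (NVar ''lo'') (NVar ''hi'')) ;;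
        Cond b (''lo'' ::=\<^sub>n NAdd (NVar ''mid'') (NLit 1)) (''hi'' ::=\<^sub>n NVar ''mid'')) ;;
     NPut a (NVar ''i'') (NVar ''lo'')"

lemma binary_search_bisect: "binary_search a key = bisect (NLess (NGet ''S'' (NVar ''mid'')) key) a"
  by (simp add: binary_search_def bisect_def)

text \<open>The positions that satisfy \<open>p\<close> form an initial segment, so their number is
  the boundary that the search finds. The interval at least halves in each round, and its binary
  length is the measure.\<close>

lemma bisect_runs:
  fixes s :: state
  assumes b: "\<And>s'. same (bisect b a) s s' \<Longrightarrow> nvar s' ''mid'' < n \<Longrightarrow> bval b s' \<longleftrightarrow> p (nvar s' ''mid'')"
    and n: "nvar s ''n'' = n" and mono: "\<And>j k. j \<le> k \<Longrightarrow> k < n \<Longrightarrow> p k \<Longrightarrow> p j" and f: "blen n < f"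
  shows "runs (bisect b a) s f (\<lambda>t. narr t = (narr s)(a := (narr s a)(nvar s ''i'' := card {j. j < n \<and> p j})))"
proof -
  let ?c = "''mid'' ::=\<^sub>n NHalf (NAdd (NVar ''lo'') (NVar ''hi'')) ;; Cond b (''lo'' ::=\<^sub>n NAdd (NVar ''mid'') (NLit 1)) (''hi'' ::=\<^sub>n NVar ''mid'')"
  let ?e = "eff (''hi'' ::=\<^sub>n NVar ''n'') (eff (''lo'' ::=\<^sub>n NLit 0) s)"
  show ?thesis unfolding bisect_def
  proof (rule runs_Seq, rule runs_line, simp, use f in simp, rule runs_Seq, rule runs_line, simp, use f in simp, rule runs_Seq,
      rule runs_While[where I = "\<lambda>t. nvar t ''lo'' \<le> nvar t ''hi'' \<and> nvar t ''hi'' \<le> n \<and> (\<forall>j<nvar t ''lo''. p j) \<and> (\<forall>j. nvar t ''hi'' \<le> j \<longrightarrow> j < n \<longrightarrow> \<not> p j)"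
        and \<mu> = "\<lambda>t. blen (nvar t ''hi'' - nvar t ''lo'')"], goal_cases)
    case (2 t)
    let ?lo = "nvar t ''lo''" and ?hi = "nvar t ''hi''"
    let ?m = "(?lo + ?hi) div 2"
    have lh: "?lo < ?hi" "?hi \<le> n" using 2 by auto
    have m: "?lo \<le> ?m" "?m < ?hi" using lh by auto
    let ?t = "eff (''mid'' ::=\<^sub>n NHalf (NAdd (NVar ''lo'') (NVar ''hi''))) t"
    have "same (bisect b a) s ?t" using 2(2) by (auto simp: same_def bisect_def)
    then have bt: "bval b ?t \<longleftrightarrow> p ?m" using b[of ?t] m lh by simp
    have B: "blen (?hi - Suc ?m) < blen (?hi - ?lo)" "blen (?m - ?lo) < blen (?hi - ?lo)"
      using lh by (auto intro!: blen_half)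
    show ?case
    proof (rule exI[of _ 1], rule runs_Seq, rule runs_line, simp, simp, rule runs_Cond, goal_cases)
      case 1
      then have "p ?m" using bt by blast
      then have "p j" if "j < Suc ?m" for j using mono[of j ?m] that m lh by simp
      then show ?case using 2(1) m B(1) by (intro runs_line) auto
    next
      case 2
      then have "\<not> p ?m" using bt by blast
      then have "\<not> p j" if "?m \<le> j" "j < n" for j using mono[OF that] by blast
      then show ?case using \<open>_ \<and> _\<close> m lh B(2) by (intro runs_line) auto
    qed
  next
    case (3 t)
    then have h: "nvar t ''hi'' = nvar t ''lo''" "nvar t ''lo'' \<le> n" "\<And>j. j < nvar t ''lo'' \<Longrightarrow> p j" "\<And>j. nvar t ''lo'' \<le> j \<Longrightarrow> j < n \<Longrightarrow> \<not> p j" by auto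
    have "x < nvar t ''lo''" if "x < n" "p x" for x using h(4)[of x] that by (cases "x < nvar t ''lo''") auto
    then have "{j. j < n \<and> p j} = {..<nvar t ''lo''}" using h(2,3) by auto
    moreover have "narr t = narr s" "nvar t ''i'' = nvar s ''i''" using 3(2) by (auto simp: same_def fun_eq_iff)
    ultimately show ?case using f by (intro runs_line) (simp_all add: fun_eq_iff)
  qed (use n f in auto)
qed

text \<open>The rank is searched for among the sorted keys and not read off the sorted position,
  because tied values must all receive the maximal rank.\<close>

definition ranking :: com where
  "ranking = for_each (RPut ''K'' (NVar ''i'') (RGet ''Y'' (NVar ''i''))) ;;
     merge_sort ;;
     for_each (bisect (Neg (RLess (RGet ''K'' (NVar ''i'')) (RGet ''K'' (NGet ''P'' (NVar ''mid''))))) ''R'') ;;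
     for_each (NPut ''RN'' (NVar ''i'') (NGet ''R'' (at_i ''N'')) ;; NPut ''RN2'' (NVar ''i'') (NGet ''R'' (at_i ''N2'')) ;; NPut ''RN3'' (NVar ''i'') (NGet ''R'' (at_i ''N3'')))"

text \<open>The naturals \<open>U i\<close> are embedded into the reals to reuse the sorting routine
  for real keys.\<close>

definition sorting :: com where
  "sorting = for_each (RPut ''K'' (NVar ''i'') (OfNat (at_i ''U''))) ;;
     merge_sort ;;
     for_each (NPut ''S'' (NVar ''i'') (NGet ''U'' (at_i ''P'')))"

lemmas sort_defs = for_each_For merge_sort_def merge_pass_def merge_step_def

lemma perm_inj: "P ` {..<n} = {..<n::nat} \<Longrightarrow> inj_on P {..<n}"
  by (rule eq_card_imp_inj_on) simp_all

text \<open>Stated for whatever the neighbour arrays contain, so that it also applies to three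
  points, where a third neighbour does not exist.\<close>

lemma ranking_runs:
  fixes s :: state
  assumes n: "nvar s ''n'' = n" and f: "(n + 1) * (blen n + 1) \<le> f"
  shows "runs ranking s f (\<lambda>t. \<forall>i<n. narr t ''R'' i = sample_rank n (rarr s ''Y'') i \<and> narr t ''RN'' i = narr t ''R'' (narr s ''N'' i) \<and>
    narr t ''RN2'' i = narr t ''R'' (narr s ''N2'' i) \<and> narr t ''RN3'' i = narr t ''R'' (narr s ''N3'' i))"
proof -
  let ?Y = "rarr s ''Y''"
  have f1: "n < f" "n * (blen n + 1) < f" using f by simp_all
  show ?thesis unfolding ranking_def
  proof (rule runs_Seq, unfold for_each_For, rule runs_For[where M = 0 and N = n and g = "\<lambda>_. 1" and I = "\<lambda>k t. \<forall>i<k. rarr t ''K'' i = ?Y i"], goal_cases)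
    case (7 s1)
    have n1: "nvar s1 ''n'' = n" using 7(3) n by (simp add: same_def)
    show ?case
    proof (rule runs_Seq, rule runs_mono[OF merge_sort_runs[OF n1 f] order_refl], elim conjE)
      fix s2 :: state assume P: "narr s2 ''P'' ` {..<n} = {..<n}" and so: "\<forall>i j. i < j \<longrightarrow> j < n \<longrightarrow> lexl (rarr s1 ''K'') (narr s2 ''P'' i) (narr s2 ''P'' j)"
        and sm: "same merge_sort s1 s2"
      let ?P = "narr s2 ''P''" and ?K = "rarr s1 ''K''"
      have e2: "nvar s2 ''n'' = n" "rarr s2 = rarr s1" "narr s2 ''N'' = narr s ''N''" "narr s2 ''N2'' = narr s ''N2''" "narr s2 ''N3'' = narr s ''N3''"
        using sm 7(3) n1 by (auto simp: same_def sort_defs fun_eq_iff)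
      have Pn: "?P j < n" if "j < n" for j using P that by (metis imageI lessThan_iff)
      have K: "?K i = ?Y i" if "i < n" for i using 7(1) that by simp
      have le: "?K (?P j) \<le> ?K (?P k)" if "j \<le> k" "k < n" for j k
      proof (cases "j = k")
        case False
        then show ?thesis using so that unfolding lexl_def by (metis le_neq_implies_less less_eq_real_def order_refl)
      qed simp
      have cd: "card {j. j < n \<and> ?K (?P j) \<le> ?K i} = sample_rank n ?Y i" if "i < n" for i
      proof -
        have "?P ` {j. j < n \<and> ?K (?P j) \<le> ?K i} = {j. j < n \<and> ?Y j \<le> ?Y i}"
        proof (intro equalityI subsetI)
          fix x assume "x \<in> {j. j < n \<and> ?Y j \<le> ?Y i}"
          then have x: "x < n" "?Y x \<le> ?Y i" by auto
          then obtain j where "j < n" "x = ?P j" using P by (metis imageE lessThan_iff)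
          then show "x \<in> ?P ` {j. j < n \<and> ?K (?P j) \<le> ?K i}" using x K that by auto
        qed (use Pn K that in auto)
        moreover have "card (?P ` {j. j < n \<and> ?K (?P j) \<le> ?K i}) = card {j. j < n \<and> ?K (?P j) \<le> ?K i}"
          by (rule card_image, rule inj_on_subset[OF perm_inj[OF P]]) auto
        ultimately show ?thesis by (simp add: sample_rank_def)
      qed
      show "runs (For ''i'' (NLit 0) (NVar ''n'') (bisect (Neg (RLess (RGet ''K'' (NVar ''i'')) (RGet ''K'' (NGet ''P'' (NVar ''mid''))))) ''R'') ;;
         For ''i'' (NLit 0) (NVar ''n'') (NPut ''RN'' (NVar ''i'') (NGet ''R'' (at_i ''N'')) ;; NPut ''RN2'' (NVar ''i'') (NGet ''R'' (at_i ''N2'')) ;; NPut ''RN3'' (NVar ''i'') (NGet ''R'' (at_i ''N3'')))) s2 f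
        (\<lambda>t. \<forall>i<n. narr t ''R'' i = sample_rank n (rarr s ''Y'') i \<and> narr t ''RN'' i = narr t ''R'' (narr s ''N'' i) \<and>
          narr t ''RN2'' i = narr t ''R'' (narr s ''N2'' i) \<and> narr t ''RN3'' i = narr t ''R'' (narr s ''N3'' i))"
      proof (rule runs_Seq, rule runs_For[where M = 0 and N = n and g = "\<lambda>_. blen n + 1" and I = "\<lambda>k t. \<forall>i<k. narr t ''R'' i = sample_rank n ?Y i"], goal_cases)
        case (6 k u)
        have u: "nvar u ''n'' = n" "rarr u = rarr s1" "narr u ''P'' = ?P" using 6(5) e2 by (auto simp: same_def bisect_def fun_eq_iff)
        show ?case
        proof (rule runs_mono[OF bisect_runs[where p = "\<lambda>j. ?K (?P j) \<le> ?K k" and n = n] order_refl], goal_cases)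
          case (1 v)
          then have "rarr v = rarr s1" "narr v ''P'' = ?P" "nvar v ''i'' = k" using u 6(4) by (auto simp: same_def bisect_def fun_eq_iff)
          then show ?case by (simp add: not_less)
        next
          case (3 i j)
          then show ?case using le[of i j] by linarith
        next
          case (5 v)
          then show ?case using cd[OF 6(2)] 6(3,4) by (auto simp: less_Suc_eq)
        qed (use u in auto)
      next
        case (7 u)
        have u: "nvar u ''n'' = n" "narr u ''N'' = narr s ''N''" "narr u ''N2'' = narr s ''N2''" "narr u ''N3'' = narr s ''N3''"
          using 7(3) e2 by (auto simp: same_def bisect_def)
        show ?case
        proof (rule runs_For[where M = 0 and N = n and g = "\<lambda>_. 1" and I = "\<lambda>k t. \<forall>i<k. narr t ''RN'' i = narr u ''R'' (narr s ''N'' i) \<and>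
            narr t ''RN2'' i = narr u ''R'' (narr s ''N2'' i) \<and> narr t ''RN3'' i = narr u ''R'' (narr s ''N3'' i)"], goal_cases)
          case (6 k v)
          have "narr v ''R'' = narr u ''R''" "narr v ''N'' = narr s ''N''" "narr v ''N2'' = narr s ''N2''" "narr v ''N3'' = narr s ''N3''"
            using 6(5) u by (auto simp: same_def)
          then show ?case using 6(3,4) by (intro runs_line) (auto simp: less_Suc_eq)
        next
          case (7 v)
          then have "narr v ''R'' = narr u ''R''" by (simp add: same_def)
          then show ?case using 7(1) \<open>\<forall>i<n. narr u ''R'' i = sample_rank n ?Y i\<close> by simp
        qed (use u f1 in \<open>auto simp: same_def\<close>)
      qed (use e2 f1 in \<open>auto simp: same_def bisect_def\<close>)
    qed
  qed (use n f1 in \<open>auto simp: same_def less_Suc_eq intro!: runs_line\<close>)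
qed

lemma sorting_runs:
  fixes s :: state
  assumes n: "nvar s ''n'' = n" and f: "(n + 1) * (blen n + 1) \<le> f"
  shows "runs sorting s f (\<lambda>t. sorted (entries t n ''S'') \<and> mset (entries t n ''S'') = mset (entries s n ''U''))"
proof -
  let ?U = "narr s ''U''"
  have f1: "n < f" using f by simp
  show ?thesis unfolding sorting_def
  proof (rule runs_Seq, unfold for_each_For, rule runs_For[where M = 0 and N = n and g = "\<lambda>_. 1" and I = "\<lambda>k t. \<forall>i<k. rarr t ''K'' i = real (?U i)"], goal_cases)
    case (6 k t)
    have "narr t ''U'' = ?U" using 6(5) by (simp add: same_def)
    then show ?case using 6(3,4) by (intro runs_line) (auto simp: less_Suc_eq)
  next
    case (7 s1)
    have n1: "nvar s1 ''n'' = n" using 7(3) n by (simp add: same_def)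
    show ?case
    proof (rule runs_Seq, rule runs_mono[OF merge_sort_runs[OF n1 f] order_refl], elim conjE)
      fix s2 :: state assume P: "narr s2 ''P'' ` {..<n} = {..<n}" and so: "\<forall>i j. i < j \<longrightarrow> j < n \<longrightarrow> lexl (rarr s1 ''K'') (narr s2 ''P'' i) (narr s2 ''P'' j)"
        and sm: "same merge_sort s1 s2"
      let ?P = "narr s2 ''P''" and ?K = "rarr s1 ''K''"
      have e2: "nvar s2 ''n'' = n" "narr s2 ''U'' = ?U" using sm 7(3) n1 by (auto simp: same_def sort_defs)
      have Pn: "?P j < n" if "j < n" for j using P that by (metis imageI lessThan_iff)
      have le: "?U (?P j) \<le> ?U (?P k)" if "j \<le> k" "k < n" for j k
      proof (cases "j = k")
        case False
        then have "lexl ?K (?P j) (?P k)" using so that by simp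
        then show ?thesis using 7(1) Pn[of j] Pn[of k] that by (auto simp: lexl_def)
      qed simp
      show "runs (For ''i'' (NLit 0) (NVar ''n'') (NPut ''S'' (NVar ''i'') (NGet ''U'' (at_i ''P'')))) s2 f
        (\<lambda>t. sorted (entries t n ''S'') \<and> mset (entries t n ''S'') = mset (entries s n ''U''))"
      proof (rule runs_For[where M = 0 and N = n and g = "\<lambda>_. 1" and I = "\<lambda>k t. \<forall>i<k. narr t ''S'' i = ?U (?P i)"], goal_cases)
        case (6 k u)
        have "narr u ''U'' = ?U" "narr u ''P'' = ?P" using 6(5) e2 by (simp_all add: same_def)
        then show ?case using 6(3,4) by (intro runs_line) (auto simp: less_Suc_eq)
      next
        case (7 u)
        have e: "entries u n ''S'' = map (\<lambda>i. ?U (?P i)) [0..<n]" using 7(1) by (simp add: entries_def)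
        have "image_mset ?P (mset_set {..<n}) = mset_set {..<n}" using image_mset_mset_set[OF perm_inj[OF P]] P by simp
        then have "image_mset ?U (image_mset ?P (mset_set {..<n})) = image_mset ?U (mset_set {..<n})" by simp
        then have "mset (entries u n ''S'') = mset (entries s n ''U'')"
          unfolding e by (simp add: entries_def[of s] mset_upt image_mset.compositionality comp_def lessThan_atLeast0)
        moreover have "sorted (entries u n ''S'')" unfolding e by (auto simp: sorted_iff_nth_mono intro: le)
        ultimately show ?case by simp
      qed (use e2 f1 in \<open>auto simp: same_def\<close>)
    qed
  qed (use n f1 in \<open>auto simp: same_def\<close>)
qed

lemma compute_UV_runs:
  fixes s :: state
  assumes n: "nvar s ''n'' = n" and f: "n < f"
  shows "runs compute_UV s f (\<lambda>t. \<forall>i<n. narr t ''U'' i = min (narr s ''R'' i) (narr s ''RN'' i) \<and> narr t ''V'' i = min (narr s ''RN'' i) (narr s ''RN2'' i))"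
  unfolding compute_UV_def for_each_For put_min_def
proof (rule runs_For[where M = 0 and N = n and g = "\<lambda>_. 1" and I = "\<lambda>k t. \<forall>i<k. narr t ''U'' i = min (narr s ''R'' i) (narr s ''RN'' i) \<and> narr t ''V'' i = min (narr s ''RN'' i) (narr s ''RN2'' i)"], goal_cases)
  case (6 k t)
  have "narr t ''R'' = narr s ''R''" "narr t ''RN'' = narr s ''RN''" "narr t ''RN2'' = narr s ''RN2''" using 6(5) by (simp_all add: same_def)
  then show ?case using 6(3,4) by (intro runs_line) (auto simp: less_Suc_eq)
qed (use n f in \<open>auto simp: same_def\<close>)

text \<open>Counting entries below a key depends only on the multiset, so the sorted copy may be
  searched in place of \<open>U\<close>.\<close>

lemma card_entries:
  assumes "mset (entries s n a) = mset (map U [0..<n])"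
  shows "card {j. j < n \<and> narr s a j < k} = card {j. j < n \<and> U j < k}"
proof -
  have c: "size {#x \<in># mset (map f [0..<n]). x < k#} = card {j. j < n \<and> f j < k}" for f :: "nat \<Rightarrow> nat"
  proof -
    have "size {#x \<in># mset (map f [0..<n]). x < k#} = length (filter (\<lambda>x. x < k) (map f [0..<n]))" by (metis mset_filter size_mset)
    also have "\<dots> = card {j. j < n \<and> f j < k}" unfolding length_filter_conv_card by (rule arg_cong[of _ _ card]) auto
    finally show ?thesis .
  qed
  show ?thesis using c[of "narr s a"] c[of U] assms by (simp add: entries_def)
qed

lemma count_ranks_runs:
  fixes s :: state
  assumes n: "nvar s ''n'' = n" and S: "sorted (entries s n ''S'')" "mset (entries s n ''S'') = mset (map U [0..<n])"
    and UR: "\<And>i. i < n \<Longrightarrow> narr s ''U'' i = U i" "\<And>i. i < n \<Longrightarrow> narr s ''R'' i = R i" and f: "(n + 1) * (blen n + 1) \<le> f"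
  shows "runs count_ranks s f (\<lambda>t. \<forall>i<n. narr t ''Rstar'' i = card {j. j < n \<and> R i > U j} \<and> narr t ''Rsharp'' i = card {j. j < n \<and> U i > U j} \<and>
    narr t ''Rflat'' i = card {j. j < n \<and> U i \<ge> U j})"
proof -
  let ?S = "narr s ''S''"
  have f1: "n * (blen n + 1) < f" using f by simp
  have mono: "?S j < k" if "j \<le> l" "l < n" "?S l < k" for j l k
    using S(1) that sorted_nth_mono[of "entries s n ''S''" j l] by (simp add: entries_def)
  note cd = card_entries[OF S(2)]
  have bs: "runs (binary_search a key) u (blen n + 1) (\<lambda>t. narr t = (narr u)(a := (narr u a)(nvar u ''i'' := card {j. j < n \<and> U j < k})))"
    if "nvar u ''n'' = n" "narr u ''S'' = ?S" "a \<noteq> ''S''" "\<And>v. same (bisect (NLess (NGet ''S'' (NVar ''mid'')) key) a) u v \<Longrightarrow> nval key v = k" for a key u k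
    unfolding binary_search_bisect cd[symmetric]
  proof (rule bisect_runs, goal_cases)
    case (1 v)
    have "narr v ''S'' = ?S" using 1(1) that(2,3) by (simp add: same_def bisect_def)
    then show ?case using that(4)[OF 1(1)] by simp
  next
    case (3 j l)
    then show ?case by (rule mono)
  qed (use that in auto)
  show ?thesis unfolding count_ranks_def for_each_For
  proof (rule runs_For[where M = 0 and N = n and g = "\<lambda>_. blen n + 1" and I = "\<lambda>k t. \<forall>i<k. narr t ''Rstar'' i = card {j. j < n \<and> R i > U j} \<and> narr t ''Rsharp'' i = card {j. j < n \<and> U i > U j} \<and>
    narr t ''Rflat'' i = card {j. j < n \<and> U i \<ge> U j}"], goal_cases)
    case (6 k t)
    have t: "nvar t ''n'' = n" "narr t ''S'' = ?S" "narr t ''U'' k = U k" "narr t ''R'' k = R k" "nvar t ''i'' = k"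
      using 6(2,4,5) n UR by (simp_all add: same_def binary_search_def)
    show ?case
    proof (rule runs_Seq, rule runs_mono[OF bs[where k = "R k"] order_refl], goal_cases)
      case (5 t1)
      have t1: "nvar t1 ''n'' = n" "narr t1 ''S'' = ?S" "narr t1 ''U'' k = U k" "nvar t1 ''i'' = k"
        using 5 t by (simp_all add: same_def binary_search_def)
      show ?case
      proof (rule runs_Seq, rule runs_mono[OF bs[where k = "U k"] order_refl], goal_cases)
        case (5 t2)
        have t2: "nvar t2 ''n'' = n" "narr t2 ''S'' = ?S" "narr t2 ''U'' k = U k" "nvar t2 ''i'' = k"
          using 5 t1 by (simp_all add: same_def binary_search_def)
        show ?case
        \<comment> \<open>For natural numbers, being less than \<open>U k + 1\<close> means being at
          most \<open>U k\<close>, so a search with the strict test yields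
          \<open>Rflat\<close>.\<close>
        proof (rule runs_mono[OF bs[where k = "U k + 1"] order_refl], goal_cases)
          case (5 t3)
          have "narr t3 ''Rstar'' = (narr t ''Rstar'')(k := card {j. j < n \<and> R k > U j})"
            "narr t3 ''Rsharp'' = (narr t ''Rsharp'')(k := card {j. j < n \<and> U k > U j})"
            "narr t3 ''Rflat'' = (narr t ''Rflat'')(k := card {j. j < n \<and> U k \<ge> U j})"
            using 5(1) \<open>narr t2 = _\<close> \<open>narr t1 = _\<close> t t1 t2 by (simp_all add: less_Suc_eq_le)
          then show ?case using 6(3) by (auto simp: less_Suc_eq)
        qed (use t2 in \<open>auto simp: same_def bisect_def\<close>)
      qed (use t1 in \<open>auto simp: same_def bisect_def\<close>)
    qed (use t in \<open>auto simp: same_def bisect_def\<close>)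
  qed (use n f1 in \<open>auto simp: same_def binary_search_def\<close>)
qed

section \<open>Sums over pairs reduced to counts\<close>

definition excess :: "nat \<Rightarrow> (nat \<Rightarrow> nat) \<Rightarrow> (nat \<Rightarrow> nat) \<Rightarrow> nat \<Rightarrow> real" where
  "excess n R U i = real n - real (card {j. j < n \<and> R i > U j}) - (if U i < R i then 0 else 1)"

definition ties :: "nat \<Rightarrow> (nat \<Rightarrow> nat) \<Rightarrow> nat \<Rightarrow> real" where
  "ties n U i = (real n - real (card {j. j < n \<and> U i > U j}) - 1) + (real n - real (card {j. j < n \<and> U i \<ge> U j}))"

lemma card_complement: "real (card {j. j < n \<and> P j}) = real n - real (card {j. j < n \<and> \<not> P j})" for n :: nat
proof -
  have "card ({j. j < n \<and> P j} \<union> {j. j < n \<and> \<not> P j}) = card {j. j < n \<and> P j} + card {j. j < n \<and> \<not> P j}"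
    by (rule card_Un_disjoint) auto
  moreover have "{j. j < n \<and> P j} \<union> {j. j < n \<and> \<not> P j} = {..<n}" by auto
  ultimately show ?thesis by simp
qed

text \<open>Subtracting from \<open>n\<close> counts the complement, and the last term of
  \<open>excess\<close> removes the index \<open>j = i\<close>.\<close>

lemma excess_eq:
  assumes "i < n"
  shows "excess n R U i = (\<Sum>j\<in>{..<n} - {i}. of_bool (R i \<le> U j))"
proof -
  have "(\<Sum>j<n. of_bool (R i \<le> U j) :: real) = real (card {j. j < n \<and> R i \<le> U j})" by (simp add: lessThan_def Int_def)
  also have "\<dots> = real n - real (card {j. j < n \<and> R i > U j})" by (subst card_complement) (simp add: not_le)
  finally have "(\<Sum>j<n. of_bool (R i \<le> U j) :: real) = real n - real (card {j. j < n \<and> R i > U j})" .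
  moreover have "(\<Sum>j<n. of_bool (R i \<le> U j) :: real) = of_bool (R i \<le> U i) + (\<Sum>j\<in>{..<n} - {i}. of_bool (R i \<le> U j))"
    by (rule sum.remove) (use assms in auto)
  ultimately show ?thesis by (auto simp: excess_def)
qed

text \<open>A pair with \<open>U i \<le> U j\<close> contributes \<open>U i\<close>, any other pair \<open>U j\<close>.\<close>

lemma sum_ties: "(\<Sum>i<n. real (U i) * ties n U i) = (\<Sum>i<n. \<Sum>j\<in>{..<n} - {i}. real (min (U i) (U j)))"
proof -
  let ?D = "\<lambda>i. {..<n} - {i}"
  have a: "(\<Sum>j\<in>?D i. of_bool (U i \<le> U j)) = real n - real (card {j. j < n \<and> U i > U j}) - 1" if "i < n" for i
    using excess_eq[OF that, of U U] by (simp add: excess_def)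
  have b: "(\<Sum>j\<in>?D i. of_bool (U i < U j)) = real n - real (card {j. j < n \<and> U i \<ge> U j})" if "i < n" for i
  proof -
    have "(\<Sum>j<n. of_bool (U i < U j) :: real) = real (card {j. j < n \<and> U i < U j})" by (simp add: lessThan_def Int_def)
    also have "\<dots> = real n - real (card {j. j < n \<and> U i \<ge> U j})" by (subst card_complement) (simp add: not_less)
    finally show ?thesis using sum.remove[of "{..<n}" i "\<lambda>j. of_bool (U i < U j) :: real"] that by simp
  qed
  have pt: "real (min x y) = real x * of_bool (x \<le> y) + real y * of_bool (y < x)" for x y :: nat
    by (auto simp: min_def)
  have "(\<Sum>i<n. \<Sum>j\<in>?D i. real (min (U i) (U j))) = (\<Sum>i<n. \<Sum>j\<in>?D i. real (U i) * of_bool (U i \<le> U j)) + (\<Sum>i<n. \<Sum>j\<in>?D i. real (U j) * of_bool (U j < U i))"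
    by (simp add: pt sum.distrib)
  also have "(\<Sum>i<n. \<Sum>j\<in>?D i. real (U j) * of_bool (U j < U i)) = (\<Sum>j<n. \<Sum>i\<in>?D j. real (U j) * of_bool (U j < U i))"
  proof -
    \<comment> \<open>The diagonal contributes zero because the inequality is strict; adding it
      makes the range rectangular, so the sums can be exchanged.\<close>
    have "(\<Sum>i<n. \<Sum>j\<in>?D i. real (U j) * of_bool (U j < U i)) = (\<Sum>i<n. \<Sum>j<n. real (U j) * of_bool (U j < U i))"
      by (intro sum.cong refl sum.mono_neutral_left) auto
    also have "\<dots> = (\<Sum>j<n. \<Sum>i<n. real (U j) * of_bool (U j < U i))" by (rule sum.swap)
    also have "\<dots> = (\<Sum>j<n. \<Sum>i\<in>?D j. real (U j) * of_bool (U j < U i))"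
      by (intro sum.cong refl sum.mono_neutral_right) auto
    finally show ?thesis .
  qed
  also have "(\<Sum>i<n. \<Sum>j\<in>?D i. real (U i) * of_bool (U i \<le> U j)) + (\<Sum>j<n. \<Sum>i\<in>?D j. real (U j) * of_bool (U j < U i)) = (\<Sum>i<n. real (U i) * ties n U i)"
    unfolding sum_distrib_left[symmetric] sum.distrib[symmetric]
    by (rule sum.cong[OF refl]) (simp only: a b ties_def distrib_left lessThan_iff)
  finally show ?thesis ..
qed

lemma compute_T456_runs:
  fixes s :: state
  assumes n: "nvar s ''n'' = n" and s: "\<And>i. i < n \<Longrightarrow> narr s ''U'' i = U i" "\<And>i. i < n \<Longrightarrow> narr s ''V'' i = V i" "\<And>i. i < n \<Longrightarrow> narr s ''R'' i = R i"
      "\<And>i. i < n \<Longrightarrow> narr s ''Rstar'' i = card {j. j < n \<and> R i > U j}" "\<And>i. i < n \<Longrightarrow> narr s ''Rsharp'' i = card {j. j < n \<and> U i > U j}"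
      "\<And>i. i < n \<Longrightarrow> narr s ''Rflat'' i = card {j. j < n \<and> U i \<ge> U j}" and f: "n < f"
  shows "runs compute_T456 s f (\<lambda>t. rvar t ''T4'' = (\<Sum>i<n. real (U i) * excess n R U i) / real n ^ 3 \<and>
    rvar t ''T5'' = (\<Sum>i<n. real (V i) * excess n R U i) / real n ^ 3 \<and> rvar t ''T6'' = (\<Sum>i<n. real (U i) * ties n U i) / real n ^ 3)"
  unfolding compute_T456_def for_each_For
proof (rule runs_Seq, rule runs_line, simp, use f in simp, rule runs_Seq, rule runs_line, simp, use f in simp, rule runs_Seq, rule runs_line, simp, use f in simp, rule runs_Seq,
    rule runs_For[where M = 0 and N = n and g = "\<lambda>_. 1" and I = "\<lambda>k t. rvar t ''T4'' = (\<Sum>i<k. real (U i) * excess n R U i) \<and>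
    rvar t ''T5'' = (\<Sum>i<k. real (V i) * excess n R U i) \<and> rvar t ''T6'' = (\<Sum>i<k. real (U i) * ties n U i)"], goal_cases)
  case (6 k t)
  have "nvar t ''n'' = n" "narr t = narr s" using 6(5) n by (auto simp: same_def fun_eq_iff)
  then show ?case using 6(2-4) s by (intro runs_line) (auto simp: excess_def ties_def)
next
  case (7 t)
  have "nvar t ''n'' = n" using 7(3) n by (simp add: same_def)
  then show ?case using 7(1) f by (intro runs_line) (simp_all add: power3_eq_cube mult.assoc)
qed (use n f in \<open>auto simp: same_def\<close>)

section \<open>Assembly of the estimator\<close>

definition combine :: com where
  "combine =
     (''T1'' ::=\<^sub>r OfNat (NLit 0) ;; ''T2'' ::=\<^sub>r OfNat (NLit 0) ;; ''T3'' ::=\<^sub>r OfNat (NLit 0) ;; ''T7'' ::=\<^sub>r OfNat (NLit 0)) ;;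
     for_each
       (put_min ''W2'' (at_i ''R'') (at_i ''RN2'') ;; put_min ''W3'' (at_i ''RN2'') (at_i ''RN3'') ;;
        ''T1'' ::=\<^sub>r RAdd (RVar ''T1'') (RMul (OfNat (at_i ''U'')) (OfNat (at_i ''U''))) ;;
        ''T2'' ::=\<^sub>r RAdd (RVar ''T2'') (RMul (OfNat (at_i ''U'')) (OfNat (at_i ''W2''))) ;;
        ''T3'' ::=\<^sub>r RAdd (RVar ''T3'') (RMul (OfNat (at_i ''U'')) (OfNat (at_i ''W3''))) ;;
        ''T7'' ::=\<^sub>r RAdd (RVar ''T7'') (OfNat (at_i ''U''))) ;;
     (''c'' ::=\<^sub>r RMul (OfNat (NVar ''n'')) (RMul (OfNat (NVar ''n'')) (OfNat (NVar ''n''))) ;;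
      ''T7'' ::=\<^sub>r RDiv (RVar ''T7'') (RMul (OfNat (NVar ''n'')) (OfNat (NVar ''n''))) ;;
      ''sigma2'' ::=\<^sub>r RMul (OfNat (NLit 36)) (RSub (RAdd (RSub (RAdd (RSub (RAdd
         (RMul (RAdd (OfNat (NLit 1)) (RVar ''q'')) (RDiv (RVar ''T1'') (RVar ''c'')))
         (RMul (RAdd (RSub (OfNat (NLit 2)) (RMul (OfNat (NLit 2)) (RVar ''q''))) (RVar ''o'')) (RDiv (RVar ''T2'') (RVar ''c''))))
         (RMul (RAdd (RSub (OfNat (NLit 2)) (RVar ''q'')) (RVar ''o'')) (RDiv (RVar ''T3'') (RVar ''c''))))
         (RMul (OfNat (NLit 4)) (RVar ''T4''))) (RMul (OfNat (NLit 2)) (RVar ''T5''))) (RVar ''T6''))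
         (RMul (OfNat (NLit 4)) (RMul (RVar ''T7'') (RVar ''T7'')))))"

lemma combine_runs:
  fixes s :: state
  assumes n: "nvar s ''n'' = n" and s: "\<And>i. i < n \<Longrightarrow> narr s ''U'' i = U i" and f: "n < f"
  defines "R \<equiv> narr s ''R''" and "A \<equiv> narr s ''RN2''" and "B \<equiv> narr s ''RN3''" and "q \<equiv> rvar s ''q''" and "w \<equiv> rvar s ''o''"
  shows "runs combine s f (\<lambda>t. rvar t ''sigma2'' = 36 * ((1 + q) * ((\<Sum>i<n. real (U i) * real (U i)) / real n ^ 3) +
      (2 - 2 * q + w) * ((\<Sum>i<n. real (U i) * real (min (R i) (A i))) / real n ^ 3)
      - (2 - q + w) * ((\<Sum>i<n. real (U i) * real (min (A i) (B i))) / real n ^ 3) + 4 * rvar s ''T4'' - 2 * rvar s ''T5'' + rvar s ''T6''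
      - 4 * ((\<Sum>i<n. real (U i)) / real n ^ 2)\<^sup>2))"
  unfolding combine_def for_each_For put_min_def
proof (rule runs_Seq, rule runs_line, simp, use f in simp, rule runs_Seq,
    rule runs_For[where M = 0 and N = n and g = "\<lambda>_. 1" and I = "\<lambda>k t. rvar t ''T1'' = (\<Sum>i<k. real (U i) * real (U i)) \<and>
    rvar t ''T2'' = (\<Sum>i<k. real (U i) * real (min (R i) (A i))) \<and> rvar t ''T3'' = (\<Sum>i<k. real (U i) * real (min (A i) (B i))) \<and>
    rvar t ''T7'' = (\<Sum>i<k. real (U i))"], goal_cases)
  case (6 k t)
  have "narr t ''U'' = narr s ''U''" "narr t ''R'' = R" "narr t ''RN2'' = A" "narr t ''RN3'' = B" using 6(5) by (simp_all add: same_def R_def A_def B_def)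
  then show ?case using 6(2-4) s by (intro runs_line) (auto simp: min_def)
next
  case (7 t)
  have "nvar t ''n'' = n" "rvar t ''T4'' = rvar s ''T4''" "rvar t ''T5'' = rvar s ''T5''" "rvar t ''T6'' = rvar s ''T6''" "rvar t ''q'' = q" "rvar t ''o'' = w"
    using 7(3) n by (simp_all add: same_def q_def w_def)
  then show ?case using 7(1) f by (intro runs_line) (simp_all add: power3_eq_cube power2_eq_square mult.assoc)
qed (use n f in \<open>auto simp: same_def\<close>)

lemma T456_hat_eq:
  assumes R: "R = sample_rank n Y" and U: "U = (\<lambda>i. min (R i) (R (nbr n Z 1 i)))" and V: "V = (\<lambda>i. min (R (nbr n Z 1 i)) (R (nbr n Z 2 i)))"
  shows "T4_hat n Y Z = (\<Sum>i<n. real (U i) * excess n R U i) / real n ^ 3"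
    "T5_hat n Y Z = (\<Sum>i<n. real (V i) * excess n R U i) / real n ^ 3"
    "T6_hat n Y Z = (\<Sum>i<n. real (U i) * ties n U i) / real n ^ 3"
proof -
  have e: "(\<Sum>i<n. \<Sum>j\<in>{..<n} - {i}. of_bool (real (R i) \<le> real (U j)) * real (W i)) = (\<Sum>i<n. real (W i) * excess n R U i)" for W
    by (rule sum.cong[OF refl]) (simp only: excess_eq sum_distrib_left lessThan_iff of_nat_le_iff mult.commute[of "of_bool _"])
  have m: "min (real (R i)) (real (R (nbr n Z 1 i))) = real (U i)" "min (real (R (nbr n Z 1 i))) (real (R (nbr n Z 2 i))) = real (V i)" for i
    by (simp_all add: U V of_nat_min)
  show "T4_hat n Y Z = (\<Sum>i<n. real (U i) * excess n R U i) / real n ^ 3"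
    "T5_hat n Y Z = (\<Sum>i<n. real (V i) * excess n R U i) / real n ^ 3"
    "T6_hat n Y Z = (\<Sum>i<n. real (U i) * ties n U i) / real n ^ 3"
    unfolding T4_hat_def T5_hat_def T6_hat_def Let_def R[symmetric] m e sum_ties by (simp_all add: of_nat_min)
qed

lemma runs_exec: "runs c s f Q \<Longrightarrow> \<exists>t s'. exec c s t s' \<and> t \<le> kc c * f \<and> Q s' \<and> same c s s'"
  using runs_same[of c s f Q] by (simp add: runs_def)

definition algorithm1 :: "nat \<Rightarrow> com" where
  "algorithm1 q = neighbour_search q ;; ranking ;; compute_UV ;; sorting ;; count_ranks ;; compute_T456"

context sample
begin

lemma nn_cost_ge: "(n + 1) * (blen n + 1) \<le> nn_cost * ((n + 1) * (blen n + 1))" "n < nn_cost * ((n + 1) * (blen n + 1))"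
proof -
  show *: "(n + 1) * (blen n + 1) \<le> nn_cost * ((n + 1) * (blen n + 1))" unfolding nn_cost_def by simp
  have "n < (n + 1) * (blen n + 1)" by simp
  then show "n < nn_cost * ((n + 1) * (blen n + 1))" using * by (rule less_le_trans)
qed

text \<open>A single execution serves both claims: it is exhibited as a run of the algorithm with
  all intermediate results, and its final state supplies what \<open>combine\<close> needs. The
  third neighbour is covered only from four points on.\<close>

lemma algorithm1_exec:
  fixes Y :: "nat \<Rightarrow> real"
  assumes n: "3 \<le> n"
  defines "F \<equiv> nn_cost * ((n + 1) * (blen n + 1))" and R_def: "R \<equiv> sample_rank n Y"
  shows "\<exists>t s. exec (algorithm1 CARD('q)) (input crd n Y Z) t s \<and> algorithm1_runs (neighbour_search CARD('q)) ranking sorting crd n Y Z t \<and>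
    t \<le> kc (algorithm1 CARD('q)) * F \<and> nvar s ''n'' = n \<and> rvar s ''q'' = q_const CARD('q) \<and> rvar s ''o'' = o_const TYPE('q) \<and>
    rvar s ''T4'' = T4_hat n Y Z \<and> rvar s ''T5'' = T5_hat n Y Z \<and> rvar s ''T6'' = T6_hat n Y Z \<and>
    (\<forall>i<n. narr s ''U'' i = min (R i) (R (nbr n Z 1 i)) \<and> narr s ''R'' i = R i \<and> narr s ''RN2'' i = R (nbr n Z 2 i) \<and> (4 \<le> n \<longrightarrow> narr s ''RN3'' i = R (nbr n Z 3 i)))"
proof -
  let ?s0 = "input crd n Y Z" and ?N = "nbr n Z 1" and ?N2 = "nbr n Z 2" and ?N3 = "nbr n Z 3"
  define U where "U i = min (R i) (R (?N i))" for i
  define V where "V i = min (R (?N i)) (R (?N2 i))" for i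
  note F = nn_cost_ge[folded F_def]
  have i0: "nvar ?s0 ''n'' = n" "rarr ?s0 ''Z'' = Zin" "narr ?s0 = (\<lambda>_ _. 0)" "rvar ?s0 ''q'' = q_const CARD('q)" "rvar ?s0 ''o'' = o_const TYPE('q)"
    "\<And>i. i < n \<Longrightarrow> rarr ?s0 ''Y'' i = Y i" by (simp_all add: input_def Zin_def)
  have rk: "sample_rank n (rarr ?s0 ''Y'') i = R i" if "i < n" for i
    unfolding R_def sample_rank_def using i0(6) that by (intro arg_cong[of _ _ card]) auto
  obtain t1 s1 where x1: "exec (neighbour_search CARD('q)) ?s0 t1 s1" "t1 \<le> kc (neighbour_search CARD('q)) * F" "neighbours s1" "same (neighbour_search CARD('q)) ?s0 s1"
    using runs_exec[OF neighbour_search_runs[OF i0(1-3), of F]] F_def by auto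
  note fr1 = neighbour_search_frame[OF x1(4)]
  have N: "narr s1 ''N'' i = ?N i" "narr s1 ''N2'' i = ?N2 i" "4 \<le> n \<Longrightarrow> narr s1 ''N3'' i = ?N3 i" "?N i < n" "?N2 i < n" "4 \<le> n \<Longrightarrow> ?N3 i < n" if "i < n" for i
    using x1(3) n that by (auto simp: neighbours_def)
  have n1: "nvar s1 ''n'' = n" using fr1 i0 by simp
  obtain t2 s2 where x2: "exec ranking s1 t2 s2" "t2 \<le> kc ranking * F" "same ranking s1 s2" and
    r2: "\<And>i. i < n \<Longrightarrow> narr s2 ''R'' i = sample_rank n (rarr s1 ''Y'') i \<and> narr s2 ''RN'' i = narr s2 ''R'' (narr s1 ''N'' i) \<and>
      narr s2 ''RN2'' i = narr s2 ''R'' (narr s1 ''N2'' i) \<and> narr s2 ''RN3'' i = narr s2 ''R'' (narr s1 ''N3'' i)"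
    using runs_exec[OF ranking_runs[OF n1 F(1)]] by blast
  have R2: "narr s2 ''R'' i = R i" if "i < n" for i using r2[OF that] rk[OF that] fr1(4) by simp
  have RN: "narr s2 ''RN'' i = R (?N i)" "narr s2 ''RN2'' i = R (?N2 i)" "4 \<le> n \<Longrightarrow> narr s2 ''RN3'' i = R (?N3 i)" if "i < n" for i
    using r2[OF that] N[OF that] R2 by simp_all
  have v2: "nvar s2 ''n'' = n" "rvar s2 ''q'' = q_const CARD('q)" "rvar s2 ''o'' = o_const TYPE('q)"
    using x2(3) n1 fr1 i0 by (simp_all add: same_def ranking_def bisect_def sort_defs)
  obtain t3 s3 where x3: "exec compute_UV s2 t3 s3" "t3 \<le> kc compute_UV * F" "same compute_UV s2 s3" and
    r3: "\<And>i. i < n \<Longrightarrow> narr s3 ''U'' i = min (narr s2 ''R'' i) (narr s2 ''RN'' i) \<and> narr s3 ''V'' i = min (narr s2 ''RN'' i) (narr s2 ''RN2'' i)"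
    using runs_exec[OF compute_UV_runs[OF v2(1) F(2)]] by blast
  have UV: "narr s3 ''U'' i = U i" "narr s3 ''V'' i = V i" if "i < n" for i using r3[OF that] R2[OF that] RN[OF that] by (simp_all add: U_def V_def)
  have v3: "nvar s3 ''n'' = n" "rvar s3 ''q'' = q_const CARD('q)" "rvar s3 ''o'' = o_const TYPE('q)"
    "narr s3 ''R'' = narr s2 ''R''" "narr s3 ''RN2'' = narr s2 ''RN2''" "narr s3 ''RN3'' = narr s2 ''RN3''"
    using x3(3) v2 by (simp_all add: same_def compute_UV_def put_min_def sort_defs)
  obtain t4 s4 where x4: "exec sorting s3 t4 s4" "t4 \<le> kc sorting * F" "same sorting s3 s4" and
    r4: "sorted (entries s4 n ''S'')" "mset (entries s4 n ''S'') = mset (entries s3 n ''U'')"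
    using runs_exec[OF sorting_runs[OF v3(1) F(1)]] by blast
  have eU: "entries s3 n ''U'' = map U [0..<n]" using UV(1) by (simp add: entries_def)
  have v4: "nvar s4 ''n'' = n" "rvar s4 ''q'' = q_const CARD('q)" "rvar s4 ''o'' = o_const TYPE('q)"
    "narr s4 ''R'' = narr s2 ''R''" "narr s4 ''RN2'' = narr s2 ''RN2''" "narr s4 ''RN3'' = narr s2 ''RN3''" "narr s4 ''U'' = narr s3 ''U''" "narr s4 ''V'' = narr s3 ''V''"
    using x4(3) v3 by (simp_all add: same_def sorting_def sort_defs)
  have c4: "\<And>i. i < n \<Longrightarrow> narr s4 ''U'' i = U i" "\<And>i. i < n \<Longrightarrow> narr s4 ''R'' i = R i" using v4 UV R2 by simp_all
  obtain t5 s5 where x5: "exec count_ranks s4 t5 s5" "t5 \<le> kc count_ranks * F" "same count_ranks s4 s5" and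
    r5: "\<And>i. i < n \<Longrightarrow> narr s5 ''Rstar'' i = card {j. j < n \<and> R i > U j} \<and> narr s5 ''Rsharp'' i = card {j. j < n \<and> U i > U j} \<and>
    narr s5 ''Rflat'' i = card {j. j < n \<and> U i \<ge> U j}"
    using runs_exec[OF count_ranks_runs[OF v4(1) r4(1) r4(2)[unfolded eU] c4 F(1)]] by blast
  have v5: "nvar s5 ''n'' = n" "rvar s5 ''q'' = q_const CARD('q)" "rvar s5 ''o'' = o_const TYPE('q)"
    "narr s5 ''R'' = narr s2 ''R''" "narr s5 ''RN2'' = narr s2 ''RN2''" "narr s5 ''RN3'' = narr s2 ''RN3''" "narr s5 ''U'' = narr s3 ''U''" "narr s5 ''V'' = narr s3 ''V''"
    using x5(3) v4 by (simp_all add: same_def count_ranks_def binary_search_def sort_defs)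
  have c5: "\<And>i. i < n \<Longrightarrow> narr s5 ''U'' i = U i" "\<And>i. i < n \<Longrightarrow> narr s5 ''V'' i = V i" "\<And>i. i < n \<Longrightarrow> narr s5 ''R'' i = R i"
    "\<And>i. i < n \<Longrightarrow> narr s5 ''Rstar'' i = card {j. j < n \<and> R i > U j}" "\<And>i. i < n \<Longrightarrow> narr s5 ''Rsharp'' i = card {j. j < n \<and> U i > U j}"
    "\<And>i. i < n \<Longrightarrow> narr s5 ''Rflat'' i = card {j. j < n \<and> U i \<ge> U j}" using v5 UV R2 r5 by simp_all
  obtain t6 s6 where x6: "exec compute_T456 s5 t6 s6" "t6 \<le> kc compute_T456 * F" "same compute_T456 s5 s6" and
    r6: "rvar s6 ''T4'' = (\<Sum>i<n. real (U i) * excess n R U i) / real n ^ 3 \<and>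
      rvar s6 ''T5'' = (\<Sum>i<n. real (V i) * excess n R U i) / real n ^ 3 \<and> rvar s6 ''T6'' = (\<Sum>i<n. real (U i) * ties n U i) / real n ^ 3"
    using runs_exec[OF compute_T456_runs[OF v5(1) c5 F(2)]] by blast
  have UVl: "U = (\<lambda>i. min (R i) (R (?N i)))" "V = (\<lambda>i. min (R (?N i)) (R (?N2 i)))" by (simp_all add: U_def V_def fun_eq_iff)
  have T: "rvar s6 ''T4'' = T4_hat n Y Z" "rvar s6 ''T5'' = T5_hat n Y Z" "rvar s6 ''T6'' = T6_hat n Y Z"
    using r6 T456_hat_eq[OF meta_eq_to_obj_eq[OF R_def] UVl] by simp_all
  have v6: "nvar s6 ''n'' = n" "rvar s6 ''q'' = q_const CARD('q)" "rvar s6 ''o'' = o_const TYPE('q)"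
    "narr s6 ''R'' = narr s2 ''R''" "narr s6 ''RN2'' = narr s2 ''RN2''" "narr s6 ''RN3'' = narr s2 ''RN3''" "narr s6 ''U'' = narr s3 ''U''"
    using x6(3) v5 by (simp_all add: same_def compute_T456_def sort_defs)
  let ?t = "t1 + (t2 + (t3 + (t4 + (t5 + t6))))"
  have "exec (algorithm1 CARD('q)) ?s0 ?t s6" unfolding algorithm1_def
    by (rule exec.Seq[OF x1(1) exec.Seq[OF x2(1) exec.Seq[OF x3(1) exec.Seq[OF x4(1) exec.Seq[OF x5(1) x6(1)]]]]])
  moreover have "?t \<le> kc (algorithm1 CARD('q)) * F"
    using x1(2) x2(2) x3(2) x4(2) x5(2) x6(2) by (simp add: algorithm1_def distrib_right)
  moreover have "algorithm1_runs (neighbour_search CARD('q)) ranking sorting crd n Y Z ?t"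
    unfolding algorithm1_runs_def Let_def R_def[symmetric]
    by (intro exI conjI, rule x1(1), use N in \<open>simp add: holds_array_def\<close>, use N in \<open>simp add: holds_array_def\<close>, rule x2(1),
      use R2 in \<open>simp add: holds_array_def\<close>, use RN in \<open>simp add: holds_array_def\<close>, use RN in \<open>simp add: holds_array_def\<close>, rule x3(1),
      use UV in \<open>simp add: holds_array_def U_def V_def\<close>, use UV in \<open>simp add: holds_array_def U_def V_def\<close>, rule x4(1), rule r4(1), simp only: r4(2) eU UVl(1), rule x5(1),
      use c5 in \<open>simp add: holds_array_def U_def\<close>, use c5 in \<open>simp add: holds_array_def U_def\<close>, use c5 in \<open>simp add: holds_array_def U_def\<close>, rule x6(1), rule T(1), rule T(2), rule T(3)) simp
  ultimately show ?thesis using v6 T UV(1) R2 RN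
    by (intro exI[of _ ?t] exI[of _ s6]) (simp add: U_def)
qed

lemma estimator_exec:
  fixes Y :: "nat \<Rightarrow> real"
  assumes n: "4 \<le> n"
  shows "\<exists>t s. exec (algorithm1 CARD('q) ;; combine) (input crd n Y Z) t s \<and>
    t \<le> kc (algorithm1 CARD('q) ;; combine) * (nn_cost * ((n + 1) * (blen n + 1))) \<and> rvar s ''sigma2'' = sigma2_hat n Y Z"
proof -
  let ?F = "nn_cost * ((n + 1) * (blen n + 1))"
  define R where "R = sample_rank n Y"
  obtain t s where x: "exec (algorithm1 CARD('q)) (input crd n Y Z) t s" "t \<le> kc (algorithm1 CARD('q)) * ?F" "nvar s ''n'' = n"
    "rvar s ''q'' = q_const CARD('q)" "rvar s ''o'' = o_const TYPE('q)" "rvar s ''T4'' = T4_hat n Y Z" "rvar s ''T5'' = T5_hat n Y Z" "rvar s ''T6'' = T6_hat n Y Z"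
    and a: "\<And>i. i < n \<Longrightarrow> narr s ''U'' i = min (R i) (R (nbr n Z 1 i))" "\<And>i. i < n \<Longrightarrow> narr s ''R'' i = R i"
      "\<And>i. i < n \<Longrightarrow> narr s ''RN2'' i = R (nbr n Z 2 i)" "\<And>i. i < n \<Longrightarrow> narr s ''RN3'' i = R (nbr n Z 3 i)"
    using algorithm1_exec[of Y] n unfolding R_def by auto
  obtain u s' where y: "exec combine s u s'" "u \<le> kc combine * ?F" and
    e: "rvar s' ''sigma2'' = 36 * ((1 + rvar s ''q'') * ((\<Sum>i<n. real (min (R i) (R (nbr n Z 1 i))) * real (min (R i) (R (nbr n Z 1 i)))) / real n ^ 3) +
      (2 - 2 * rvar s ''q'' + rvar s ''o'') * ((\<Sum>i<n. real (min (R i) (R (nbr n Z 1 i))) * real (min (narr s ''R'' i) (narr s ''RN2'' i))) / real n ^ 3)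
      - (2 - rvar s ''q'' + rvar s ''o'') * ((\<Sum>i<n. real (min (R i) (R (nbr n Z 1 i))) * real (min (narr s ''RN2'' i) (narr s ''RN3'' i))) / real n ^ 3) +
      4 * rvar s ''T4'' - 2 * rvar s ''T5'' + rvar s ''T6'' - 4 * ((\<Sum>i<n. real (min (R i) (R (nbr n Z 1 i)))) / real n ^ 2)\<^sup>2)"
    using runs_exec[OF combine_runs[OF x(3) a(1) nn_cost_ge(2)]] by blast
  have T: "T1_hat n Y Z = (\<Sum>i<n. real (min (R i) (R (nbr n Z 1 i))) * real (min (R i) (R (nbr n Z 1 i)))) / real n ^ 3"
    "T2_hat n Y Z = (\<Sum>i<n. real (min (R i) (R (nbr n Z 1 i))) * real (min (narr s ''R'' i) (narr s ''RN2'' i))) / real n ^ 3"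
    "T3_hat n Y Z = (\<Sum>i<n. real (min (R i) (R (nbr n Z 1 i))) * real (min (narr s ''RN2'' i) (narr s ''RN3'' i))) / real n ^ 3"
    "T7_hat n Y Z = ((\<Sum>i<n. real (min (R i) (R (nbr n Z 1 i)))) / real n ^ 2)\<^sup>2"
    using a(2-4) by (simp_all add: T1_hat_def T2_hat_def T3_hat_def T7_hat_def Let_def R_def[symmetric] of_nat_min power2_eq_square)
  have "rvar s' ''sigma2'' = sigma2_hat n Y Z" unfolding e T[symmetric] x(4-8) sigma2_hat_def Let_def ..
  moreover have "t + u \<le> kc (algorithm1 CARD('q) ;; combine) * ?F" using x(2) y(2) by (simp add: distrib_right)
  ultimately show ?thesis using exec.Seq[OF x(1) y(1)] by blast
qed

end

text \<open>The programs depend on the dimension but are chosen before \<open>n\<close> and the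
  sample. The estimator involves third neighbours and so needs four points, while three points
  suffice for the algorithm, which uses only first and second neighbours.\<close>

theorem proposition2p3:
  fixes crd :: "nat \<Rightarrow> 'q::finite"
  assumes "bij_betw crd {..<CARD('q)} UNIV"
  shows
    "(\<exists>(prog :: com) (T :: nat \<Rightarrow> nat).
        (\<lambda>n. real (T n)) \<in> O(\<lambda>n. real n * ln (real n)) \<and>
        (\<forall>n\<ge>4. \<forall>(Y :: nat \<Rightarrow> real) (Z :: nat \<Rightarrow> real ^ 'q).
           \<exists>t s. exec prog (input crd n Y Z) t s \<and> t \<le> T n \<and>
             rvar s ''sigma2'' = sigma2_hat n Y Z)) \<and>
     (\<exists>(search :: com) (ranking :: com) (sorting :: com) (T :: nat \<Rightarrow> nat).
        (\<lambda>n. real (T n)) \<in> O(\<lambda>n. real n * ln (real n)) \<and>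
        (\<forall>n\<ge>3. \<forall>(Y :: nat \<Rightarrow> real) (Z :: nat \<Rightarrow> real ^ 'q).
           \<exists>t\<le>T n. algorithm1_runs search ranking sorting crd n Y Z t))"
proof -
  \<comment> \<open>Both factors in front are constants for fixed program and dimension, so
    \<open>blen_bigo\<close> applies.\<close>
  define T where "T c n = kc c * sample.nn_cost TYPE('q) * ((n + 1) * (blen n + 1))" for c n
  have O: "(\<lambda>n. real (T c n)) \<in> O(\<lambda>n. real n * ln (real n))" for c unfolding T_def by (rule blen_bigo)
  have sm: "sample crd n" if "3 \<le> n" for n using assms that by unfold_locales auto
  show ?thesis
  proof
    show "\<exists>(prog :: com) (T :: nat \<Rightarrow> nat). (\<lambda>n. real (T n)) \<in> O(\<lambda>n. real n * ln (real n)) \<and>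
        (\<forall>n\<ge>4. \<forall>(Y :: nat \<Rightarrow> real) (Z :: nat \<Rightarrow> real ^ 'q). \<exists>t s. exec prog (input crd n Y Z) t s \<and> t \<le> T n \<and> rvar s ''sigma2'' = sigma2_hat n Y Z)"
    proof (rule exI[of _ "algorithm1 CARD('q) ;; combine"], rule exI[of _ "T (algorithm1 CARD('q) ;; combine)"], intro conjI O allI impI)
      fix n :: nat and Y and Z :: "nat \<Rightarrow> real ^ 'q" assume n: "4 \<le> n"
      interpret sample crd n Z by (rule sm) (use n in simp)
      show "\<exists>t s. exec (algorithm1 CARD('q) ;; combine) (input crd n Y Z) t s \<and> t \<le> T (algorithm1 CARD('q) ;; combine) n \<and> rvar s ''sigma2'' = sigma2_hat n Y Z"
        using estimator_exec[OF n] by (simp only: T_def mult.assoc)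
    qed
    show "\<exists>(search :: com) (ranking :: com) (sorting :: com) (T :: nat \<Rightarrow> nat). (\<lambda>n. real (T n)) \<in> O(\<lambda>n. real n * ln (real n)) \<and>
        (\<forall>n\<ge>3. \<forall>(Y :: nat \<Rightarrow> real) (Z :: nat \<Rightarrow> real ^ 'q). \<exists>t\<le>T n. algorithm1_runs search ranking sorting crd n Y Z t)"
    proof (rule exI[of _ "neighbour_search CARD('q)"], rule exI[of _ ranking], rule exI[of _ sorting], rule exI[of _ "T (algorithm1 CARD('q))"], intro conjI O allI impI)
      fix n :: nat and Y and Z :: "nat \<Rightarrow> real ^ 'q" assume n: "3 \<le> n"
      interpret sample crd n Z by (rule sm) (use n in simp)
      show "\<exists>t\<le>T (algorithm1 CARD('q)) n. algorithm1_runs (neighbour_search CARD('q)) ranking sorting crd n Y Z t"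
        using algorithm1_exec[OF n, of Y] unfolding T_def mult.assoc by blast
    qed
  qed
qed

end
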